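(* Let $\pi$ be a set of primes, let $G$ be a finite $\pi$-separable group, let $c\in H^2G$, and let $V$ be an irreducible $c$-module of $G$. Then there exist a subgroup $J\le G$, an irreducible $c_\pi$-module $V_\pi$ of $J$ and an irreducible $c_{\pi'}$-module $V_{\pi'}$ of $J$ such that $V$ is isomorphic to the $c$-module of $G$ induced from the $c$-module $V_\pi\otimes V_{\pi'}$ of $J$. Moreover, if $H$ and $H'$ are a Hall $\pi$-subgroup and a Hall $\pi'$-subgroup of $J$, then the restrictions $V_\pi|_H$ and $V_{\pi'}|_{H'}$ are irreducible, whereas $V_{\pi'}|_H$ and $V_\pi|_{H'}$ are ordinary modules.
   Context: All groups are finite and all modules are finite-dimensional over $\mathbb{C}$. $H^2G=Z^2G/B^2G$ is the Schur multiplier $H^2(G,\mathbb{C}^\times)$ (trivial action), a finite abelian group whose elements are called coclasses. For $c=[\alpha]\in H^2G$, a $c$-module is a nonzero space $V$ with a map $\varphi:G\to \mathrm{GL}(V)$ satisfying $\varphi(x)\varphi(y)=\alpha(x,y)\varphi(xy)$; equivalently, a module over the twisted group algebra $\mathbb{C}^cG$ with basis $\{g\sigma : g\in G\}$ and product $g\sigma\, h\sigma=\alpha(g,h)\,(gh)\sigma$ (the choice of representing cocycle is immaterial). For $J\le G$, a $c$-module of $J$ means a module for the restricted coclass $c|_J$ (and likewise for $c_\pi$, $c_{\pi'}$); the $c$-module of $G$ induced from a $c$-module $U$ of $J$ is $U\otimes_{\mathbb{C}^cJ}\mathbb{C}^cG$. A module for a trivial coclass is an ordinary module (a linear representation, after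 rescaling the maps $\varphi(x)$ so that the cocycle becomes $1$); saying that a restriction is an ordinary module means that the restricted coclass is trivial. If $A$ is an $a$-module and $B$ a $b$-module then $A\otimes B$, with diagonal action, is an $ab$-module (the cocycles being multiplied; representing cocycles are chosen compatibly). $\pi'$ is the complement of $\pi$ in the set of all primes. Each coclass decomposes uniquely as $c=c_\pi c_{\pi'}$ with $c_\pi,c_{\pi'}\in H^2G$ of order a $\pi$-number (all prime divisors in $\pi$) and a $\pi'$-number (no prime divisor in $\pi$) respectively. $G$ is $\pi$-separable if it has a series $1=N_0\le\dots\le N_l=G$ of normal subgroups such that each $|N_i/N_{i-1}|$ is a $\pi$-number or a $\pi'$-number. A Hall $\pi$-subgroup is a subgroup whose order is a $\pi$-number and whose index is a $\pi'$-number. *)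

theory Defs
  imports "HOL-Algebra.Multiplicative_Group" "Jordan_Normal_Form.VS_Connect"
begin

definition primes_compl :: "nat set \<Rightarrow> nat set" where
  "primes_compl \<pi> = {p. Factorial_Ring.prime p} - \<pi>"

definition pi_number :: "nat set \<Rightarrow> nat \<Rightarrow> bool" where
  "pi_number \<pi> n \<longleftrightarrow> 0 < n \<and> prime_factors n \<subseteq> \<pi>"

definition pi_separable :: "nat set \<Rightarrow> ('g, 'm) monoid_scheme \<Rightarrow> bool" where
  "pi_separable \<pi> G \<longleftrightarrow>
    (\<exists>(l::nat) N. N 0 = {\<one>\<^bsub>G\<^esub>} \<and> N l = carrier G \<and> (\<forall>i\<le>l. N i \<lhd> G) \<and>
      (\<forall>i<l. N i \<subseteq> N (Suc i) \<and>
        (let f = Coset.order (G\<lparr>carrier := N (Suc i)\<rparr> Mod N i)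
         in pi_number \<pi> f \<or> pi_number (primes_compl \<pi>) f)))"

definition hall_subgroup :: "nat set \<Rightarrow> ('g, 'm) monoid_scheme \<Rightarrow> 'g set \<Rightarrow> bool" where
  "hall_subgroup \<pi> G H \<longleftrightarrow> subgroup H G \<and> pi_number \<pi> (card H) \<and>
     pi_number (primes_compl \<pi>) (card (rcosets\<^bsub>G\<^esub> H))"

text \<open>Cocycles are extensional functions on pairs of group elements, so that equality in
  \<open>Z2 G\<close> is equality of functions; coclasses are cosets of \<open>B2 G\<close>, i.e. sets of cocycles.\<close>

definition Z2 :: "('g, 'm) monoid_scheme \<Rightarrow> ('g \<times> 'g \<Rightarrow> complex) monoid" where
  "Z2 G = \<lparr>carrier = {\<alpha> \<in> carrier G \<times> carrier G \<rightarrow>\<^sub>E UNIV - {0}.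
              \<forall>x\<in>carrier G. \<forall>y\<in>carrier G. \<forall>z\<in>carrier G.
                \<alpha> (x, y) * \<alpha> (x \<otimes>\<^bsub>G\<^esub> y, z) = \<alpha> (x, y \<otimes>\<^bsub>G\<^esub> z) * \<alpha> (y, z)},
           mult = (\<lambda>\<alpha> \<beta>. \<lambda>p\<in>carrier G \<times> carrier G. \<alpha> p * \<beta> p),
           one = (\<lambda>p\<in>carrier G \<times> carrier G. 1)\<rparr>"

definition B2 :: "('g, 'm) monoid_scheme \<Rightarrow> ('g \<times> 'g \<Rightarrow> complex) set" where
  "B2 G = {\<lambda>(x, y)\<in>carrier G \<times> carrier G. \<mu> x * \<mu> y / \<mu> (x \<otimes>\<^bsub>G\<^esub> y) | \<mu>.
             \<mu> \<in> carrier G \<rightarrow> UNIV - {0}}"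

definition H2 :: "('g, 'm) monoid_scheme \<Rightarrow> ('g \<times> 'g \<Rightarrow> complex) set monoid" where
  "H2 G = Z2 G Mod B2 G"

definition coclass :: "('g, 'm) monoid_scheme \<Rightarrow> ('g \<times> 'g \<Rightarrow> complex) \<Rightarrow> ('g \<times> 'g \<Rightarrow> complex) set"
  where "coclass G \<alpha> = B2 G #>\<^bsub>Z2 G\<^esub> \<alpha>"

definition res_cocycle :: "'g set \<Rightarrow> ('g \<times> 'g \<Rightarrow> complex) \<Rightarrow> ('g \<times> 'g \<Rightarrow> complex)" where
  "res_cocycle J \<alpha> = restrict \<alpha> (J \<times> J)"

text \<open>The factor \<open>d\<close> of the unique decomposition \<open>c = d e\<close> into elements whose orders are
  a \<open>\<pi>\<close>-number and a \<open>\<pi>'\<close>-number; meaningful for elements of finite order in an abelian group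
  (\<open>group.ord\<close> is 0, hence no \<open>\<pi>\<close>-number, otherwise).\<close>

definition pi_part :: "nat set \<Rightarrow> ('a, 'm) monoid_scheme \<Rightarrow> 'a \<Rightarrow> 'a" where
  "pi_part \<pi> A c = (THE d. d \<in> carrier A \<and> pi_number \<pi> (group.ord A d) \<and>
     (\<exists>e\<in>carrier A. pi_number (primes_compl \<pi>) (group.ord A e) \<and> c = d \<otimes>\<^bsub>A\<^esub> e))"

text \<open>Modules are right modules, maps being written on the right: \<open>\<phi> x v\<close> stands for
  \<open>v\<cdot>\<phi>(x)\<close>, and the product \<open>\<phi>(x)\<phi>(y)\<close> applies \<open>\<phi>(x)\<close> first. This is the side on which
  \<open>U \<otimes> \<complex>\<^sup>cG\<close> over \<open>\<complex>\<^sup>cJ\<close> makes sense.\<close>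

definition cmodule :: "('g, 'm) monoid_scheme \<Rightarrow> ('g \<times> 'g \<Rightarrow> complex) \<Rightarrow>
    (complex, 'v, 'n) module_scheme \<Rightarrow> ('g \<Rightarrow> 'v \<Rightarrow> 'v) \<Rightarrow> bool" where
  "cmodule G \<alpha> V \<phi> \<longleftrightarrow>
     vectorspace class_ring V \<and> vectorspace.fin_dim class_ring V \<and> carrier V \<noteq> {\<zero>\<^bsub>V\<^esub>} \<and>
     (\<forall>x\<in>carrier G. \<phi> x \<in> module_hom class_ring V V \<and> bij_betw (\<phi> x) (carrier V) (carrier V)) \<and>
     (\<forall>x\<in>carrier G. \<forall>y\<in>carrier G. \<forall>v\<in>carrier V.
        \<phi> y (\<phi> x v) = \<alpha> (x, y) \<odot>\<^bsub>V\<^esub> \<phi> (x \<otimes>\<^bsub>G\<^esub> y) v)"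

definition irreducible_cmodule :: "('g, 'm) monoid_scheme \<Rightarrow> ('g \<times> 'g \<Rightarrow> complex) \<Rightarrow>
    (complex, 'v, 'n) module_scheme \<Rightarrow> ('g \<Rightarrow> 'v \<Rightarrow> 'v) \<Rightarrow> bool" where
  "irreducible_cmodule G \<alpha> V \<phi> \<longleftrightarrow> cmodule G \<alpha> V \<phi> \<and>
     (\<forall>W. subspace class_ring W V \<and> (\<forall>x\<in>carrier G. \<phi> x ` W \<subseteq> W) \<longrightarrow>
        W = {\<zero>\<^bsub>V\<^esub>} \<or> W = carrier V)"

definition ordinary_cmodule :: "('g, 'm) monoid_scheme \<Rightarrow> ('g \<times> 'g \<Rightarrow> complex) \<Rightarrow>
    (complex, 'v, 'n) module_scheme \<Rightarrow> ('g \<Rightarrow> 'v \<Rightarrow> 'v) \<Rightarrow> bool" where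
  "ordinary_cmodule G \<alpha> V \<phi> \<longleftrightarrow> cmodule G \<alpha> V \<phi> \<and> coclass G \<alpha> = \<one>\<^bsub>H2 G\<^esub>"

definition cmodule_isomorphic :: "('g, 'm) monoid_scheme \<Rightarrow>
    (complex, 'v, 'n) module_scheme \<Rightarrow> ('g \<Rightarrow> 'v \<Rightarrow> 'v) \<Rightarrow>
    (complex, 'w, 'k) module_scheme \<Rightarrow> ('g \<Rightarrow> 'w \<Rightarrow> 'w) \<Rightarrow> bool" where
  "cmodule_isomorphic G V \<phi> W \<psi> \<longleftrightarrow>
     (\<exists>T\<in>module_hom class_ring V W. bij_betw T (carrier V) (carrier W) \<and>
        (\<forall>x\<in>carrier G. \<forall>v\<in>carrier V. T (\<phi> x v) = \<psi> x (T v)))"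

definition quotient_space :: "('k, 'v, 'm) module_scheme \<Rightarrow> 'v set \<Rightarrow> ('k, 'v set) module" where
  "quotient_space V W = \<lparr>carrier = a_rcosets\<^bsub>V\<^esub> W, mult = undefined, one = undefined,
     zero = W, add = (<+>\<^bsub>V\<^esub>), smult = (\<lambda>k X. \<Union>x\<in>X. W +>\<^bsub>V\<^esub> (k \<odot>\<^bsub>V\<^esub> x))\<rparr>"

definition free_space :: "'s set \<Rightarrow> (complex, 's \<Rightarrow> complex) module" where
  "free_space S = \<lparr>carrier = {f. finite {s. f s \<noteq> 0} \<and> {s. f s \<noteq> 0} \<subseteq> S},
     mult = undefined, one = undefined, zero = (\<lambda>s. 0), add = (\<lambda>f g s. f s + g s),
     smult = (\<lambda>k f s. k * f s)\<rparr>"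

definition point :: "'s \<Rightarrow> 's \<Rightarrow> complex" where
  "point s = (\<lambda>t. if t = s then 1 else 0)"

text \<open>The linear map of free spaces extending a map of the bases.\<close>

definition pushforward :: "('s \<Rightarrow> 't) \<Rightarrow> ('s \<Rightarrow> complex) \<Rightarrow> 't \<Rightarrow> complex" where
  "pushforward h f = (\<lambda>t. \<Sum>s | f s \<noteq> 0 \<and> h s = t. f s)"

definition bilinear_relations :: "(complex, 'u, 'm) module_scheme \<Rightarrow> (complex, 'w, 'n) module_scheme
    \<Rightarrow> ('u \<times> 'w \<Rightarrow> complex) set" where
  "bilinear_relations U W =
     {\<lambda>p. point (u \<oplus>\<^bsub>U\<^esub> u', w) p - point (u, w) p - point (u', w) p | u u' w.
        u \<in> carrier U \<and> u' \<in> carrier U \<and> w \<in> carrier W} \<union>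
     {\<lambda>p. point (u, w \<oplus>\<^bsub>W\<^esub> w') p - point (u, w) p - point (u, w') p | u w w'.
        u \<in> carrier U \<and> w \<in> carrier W \<and> w' \<in> carrier W} \<union>
     {\<lambda>p. point (k \<odot>\<^bsub>U\<^esub> u, w) p - k * point (u, w) p | k u w.
        u \<in> carrier U \<and> w \<in> carrier W} \<union>
     {\<lambda>p. point (u, k \<odot>\<^bsub>W\<^esub> w) p - k * point (u, w) p | k u w.
        u \<in> carrier U \<and> w \<in> carrier W}"

text \<open>The free space on \<open>U \<times> W\<close> modulo the bilinear relations and further relations \<open>E\<close>:
  for \<open>E = {}\<close> the tensor product over the complex numbers, for \<open>E\<close> the relations
  \<open>(u a, w) = (u, a w)\<close> the tensor product over an algebra.\<close>

definition tensor_kernel :: "(complex, 'u, 'm) module_scheme \<Rightarrow> (complex, 'w, 'n) module_scheme \<Rightarrow>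
    ('u \<times> 'w \<Rightarrow> complex) set \<Rightarrow> ('u \<times> 'w \<Rightarrow> complex) set" where
  "tensor_kernel U W E =
     module.span class_ring (free_space (carrier U \<times> carrier W)) (bilinear_relations U W \<union> E)"

definition tensor_space :: "(complex, 'u, 'm) module_scheme \<Rightarrow> (complex, 'w, 'n) module_scheme \<Rightarrow>
    ('u \<times> 'w \<Rightarrow> complex) set \<Rightarrow> (complex, ('u \<times> 'w \<Rightarrow> complex) set) module" where
  "tensor_space U W E =
     quotient_space (free_space (carrier U \<times> carrier W)) (tensor_kernel U W E)"

text \<open>The map \<open>u \<otimes> w \<mapsto> S u \<otimes> T w\<close>; well defined if \<open>S\<close>, \<open>T\<close> are linear and
  respect \<open>E\<close>.\<close>

definition tensor_map :: "(complex, 'u, 'm) module_scheme \<Rightarrow> (complex, 'w, 'n) module_scheme \<Rightarrow>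
    ('u \<times> 'w \<Rightarrow> complex) set \<Rightarrow> ('u \<Rightarrow> 'u) \<Rightarrow> ('w \<Rightarrow> 'w) \<Rightarrow>
    ('u \<times> 'w \<Rightarrow> complex) set \<Rightarrow> ('u \<times> 'w \<Rightarrow> complex) set" where
  "tensor_map U W E S T X =
     (\<Union>f\<in>X. tensor_kernel U W E +>\<^bsub>free_space (carrier U \<times> carrier W)\<^esub>
        pushforward (map_prod S T) f)"

abbreviation tensor :: "(complex, 'u, 'm) module_scheme \<Rightarrow> (complex, 'w, 'n) module_scheme \<Rightarrow>
    (complex, ('u \<times> 'w \<Rightarrow> complex) set) module" where
  "tensor U W \<equiv> tensor_space U W {}"

definition tensor_action :: "(complex, 'u, 'm) module_scheme \<Rightarrow> (complex, 'w, 'n) module_scheme \<Rightarrow>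
    ('g \<Rightarrow> 'u \<Rightarrow> 'u) \<Rightarrow> ('g \<Rightarrow> 'w \<Rightarrow> 'w) \<Rightarrow>
    'g \<Rightarrow> ('u \<times> 'w \<Rightarrow> complex) set \<Rightarrow> ('u \<times> 'w \<Rightarrow> complex) set" where
  "tensor_action U W \<phi> \<psi> g = tensor_map U W {} (\<phi> g) (\<psi> g)"

text \<open>The basis element \<open>g\<sigma>\<close> is \<open>point g\<close>. The unit is a multiple of \<open>1\<sigma>\<close> since
  cocycles are not assumed to be normalised.\<close>

definition twisted_algebra :: "('g, 'm) monoid_scheme \<Rightarrow> ('g \<times> 'g \<Rightarrow> complex) \<Rightarrow>
    (complex, 'g \<Rightarrow> complex) module" where
  "twisted_algebra G \<alpha> = \<lparr>carrier = {a. \<forall>g. g \<notin> carrier G \<longrightarrow> a g = 0},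
     mult = (\<lambda>a b x. \<Sum>(g, h) | g \<in> carrier G \<and> h \<in> carrier G \<and> g \<otimes>\<^bsub>G\<^esub> h = x. \<alpha> (g, h) * a g * b h),
     one = (\<lambda>x. point \<one>\<^bsub>G\<^esub> x / \<alpha> (\<one>\<^bsub>G\<^esub>, \<one>\<^bsub>G\<^esub>)),
     zero = (\<lambda>x. 0), add = (\<lambda>a b x. a x + b x), smult = (\<lambda>k a x. k * a x)\<rparr>"

definition algebra_action :: "('g, 'm) monoid_scheme \<Rightarrow> (complex, 'v, 'n) module_scheme \<Rightarrow>
    ('g \<Rightarrow> 'v \<Rightarrow> 'v) \<Rightarrow> 'v \<Rightarrow> ('g \<Rightarrow> complex) \<Rightarrow> 'v" where
  "algebra_action G V \<phi> v a = (\<Oplus>\<^bsub>V\<^esub>g\<in>carrier G. a g \<odot>\<^bsub>V\<^esub> \<phi> g v)"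

text \<open>The twisted group algebra of \<open>J\<close> consists of the elements of that of \<open>G\<close> which are
  supported on \<open>J\<close>, so it acts on the latter by multiplication.\<close>

definition balanced_relations :: "('g, 'm) monoid_scheme \<Rightarrow> ('g \<times> 'g \<Rightarrow> complex) \<Rightarrow> 'g set \<Rightarrow>
    (complex, 'u, 'n) module_scheme \<Rightarrow> ('g \<Rightarrow> 'u \<Rightarrow> 'u) \<Rightarrow> ('u \<times> ('g \<Rightarrow> complex) \<Rightarrow> complex) set" where
  "balanced_relations G \<alpha> J U \<phi> =
     {\<lambda>p. point (algebra_action (G\<lparr>carrier := J\<rparr>) U \<phi> u a, b) p
          - point (u, a \<otimes>\<^bsub>twisted_algebra G \<alpha>\<^esub> b) p | u a b.
        u \<in> carrier U \<and> a \<in> carrier (twisted_algebra (G\<lparr>carrier := J\<rparr>) (res_cocycle J \<alpha>)) \<and>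
        b \<in> carrier (twisted_algebra G \<alpha>)}"

definition induced :: "('g, 'm) monoid_scheme \<Rightarrow> ('g \<times> 'g \<Rightarrow> complex) \<Rightarrow> 'g set \<Rightarrow>
    (complex, 'u, 'n) module_scheme \<Rightarrow> ('g \<Rightarrow> 'u \<Rightarrow> 'u) \<Rightarrow>
    (complex, ('u \<times> ('g \<Rightarrow> complex) \<Rightarrow> complex) set) module" where
  "induced G \<alpha> J U \<phi> = tensor_space U (twisted_algebra G \<alpha>) (balanced_relations G \<alpha> J U \<phi>)"

definition induced_action :: "('g, 'm) monoid_scheme \<Rightarrow> ('g \<times> 'g \<Rightarrow> complex) \<Rightarrow> 'g set \<Rightarrow>
    (complex, 'u, 'n) module_scheme \<Rightarrow> ('g \<Rightarrow> 'u \<Rightarrow> 'u) \<Rightarrow>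
    'g \<Rightarrow> ('u \<times> ('g \<Rightarrow> complex) \<Rightarrow> complex) set \<Rightarrow> ('u \<times> ('g \<Rightarrow> complex) \<Rightarrow> complex) set" where
  "induced_action G \<alpha> J U \<phi> g =
     tensor_map U (twisted_algebra G \<alpha>) (balanced_relations G \<alpha> J U \<phi>)
       id (\<lambda>b. b \<otimes>\<^bsub>twisted_algebra G \<alpha>\<^esub> point g)"

end

theory Submission
  imports Defs "Jordan_Normal_Form.Char_Poly"
begin

text \<open>
  The module is a family of matrices \<open>\<rho> g\<close>. The factorization is proved for a projective
  representation \<open>\<rho>\<close> of a subgroup \<open>L\<close> that is scalar on a normal subgroup \<open>N\<close> of \<open>L\<close>, by induction
  on \<open>|L| - |N|\<close>; the theorem is the case \<open>L = G\<close>, \<open>N = 1\<close>.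

  If \<open>N \<noteq> L\<close>, separability gives a normal subgroup \<open>M\<close> of \<open>L\<close> above \<open>N\<close> such that \<open>M/N\<close> is a
  \<open>\<pi>\<close>-group or a \<open>\<pi>'\<close>-group, say a \<open>\<pi>\<close>-group, as the two sets of primes enter symmetrically. Let
  \<open>\<sigma>\<close> be an irreducible constituent of the restriction of \<open>\<rho>\<close> to \<open>M\<close> (locale \<open>clifford\<close>).
  If the restriction is not homogeneous, \<open>\<rho>\<close> is induced from the stabiliser of a homogeneous
  component (\<open>inhomogeneous\<close>), the induction hypothesis applies to this smaller subgroup, and induction
  of modules is transitive (\<open>factorizable_induced\<close>).

  If the restriction is homogeneous, \<open>\<rho>\<close> is a tensor product \<open>T \<otimes> W\<close> of projective representations
  of \<open>L\<close>, where \<open>T\<close> extends \<open>\<sigma>\<close> up to scalars and \<open>W\<close> is scalar on \<open>M\<close> (\<open>homogeneous\<close>).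
  The point is to control the cocycle \<open>\<delta>\<close> of \<open>T\<close>. With \<open>T\<close> normalised to have determinant one, the
  values of \<open>\<delta>\<close> are \<open>m\<close>-th roots of unity, \<open>m\<close> being the degree of \<open>T\<close>; and \<open>m\<close> divides \<open>|M/N|\<close>,
  because \<open>T\<close> is irreducible on \<open>M\<close> and scalar on \<open>N\<close> (\<open>degree_dvd_index\<close>). So \<open>m\<close> is a \<open>\<pi>\<close>-number,
  and if \<open>\<alpha> = \<beta> \<gamma>\<close> is the cocycle of \<open>\<rho>\<close>, that of \<open>W\<close> decomposes as \<open>(\<beta> / \<delta>) \<gamma>\<close>. The induction
  hypothesis, for \<open>M\<close> instead of \<open>N\<close>, factorizes \<open>W\<close>, and \<open>T\<close> is absorbed by the
  \<open>\<pi>\<close>-factor (\<open>factorizable_tensor\<close>). A Hall \<open>\<pi>\<close>-subgroup \<open>H\<close> covers \<open>M/N\<close>, so that \<open>T\<close> is irreducible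
  already on \<open>H \<inter> M\<close>, where the old \<open>\<pi>\<close>-factor is scalar; hence their tensor product is irreducible
  on \<open>H\<close>. If \<open>N = L\<close>, the degree is one, \<open>\<alpha>\<close> is a coboundary, and so are \<open>\<beta>\<close> and \<open>\<gamma>\<close>.

  That \<open>V\<^sub>\<pi>\<^sub>'\<close> is ordinary on \<open>H\<close> is a matter of orders: \<open>|H|\<close> annihilates the cohomology of \<open>H\<close>, and
  the coclass has order prime to it.

  The induction produces matrices and a bilinear map into the space of \<open>\<rho>\<close>, and these have to be
  compared with tensor products and induced modules, which are quotients of enormous free spaces.
  A bilinear map that respects the relations extends linearly to the free space, and the
  quotient consists of the fibres of the extension as soon as the relations reduce every
  generator to finitely many whose values are linearly independent (\<open>ev_kernel_eq\<close>). For the induced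
  module these are \<open>e\<^sub>i \<otimes> e\<^sub>j \<otimes> t\<close> with \<open>t\<close> in a transversal of \<open>J\<close>; their values span because \<open>\<rho>\<close> is
  irreducible, and they are independent because their number is the degree of \<open>\<rho>\<close>.
\<close>

section \<open>Complex matrices and vectors\<close>

lemma mat_assoc:
  fixes A B C :: "complex mat"
  shows "dim_col A = dim_row B \<Longrightarrow> dim_col B = dim_row C \<Longrightarrow> A * B * C = A * (B * C)"
  by (rule assoc_mult_mat[of A "dim_row A" "dim_col A" B "dim_col B" C "dim_col C"]) auto

lemma mat_smult_left:
  fixes A B :: "complex mat"
  shows "dim_col A = dim_row B \<Longrightarrow> (c \<cdot>\<^sub>m A) * B = c \<cdot>\<^sub>m (A * B)"
  by (rule mult_smult_assoc_mat[of A "dim_row A" "dim_col A" B "dim_col B"]) auto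

lemma mat_smult_right:
  fixes A B :: "complex mat"
  shows "dim_col A = dim_row B \<Longrightarrow> A * (c \<cdot>\<^sub>m B) = c \<cdot>\<^sub>m (A * B)"
  by (rule mult_smult_distrib[of A "dim_row A" "dim_col A" B "dim_col B"]) auto

lemma mat_smult_smult:
  fixes A :: "complex mat"
  shows "c \<cdot>\<^sub>m (d \<cdot>\<^sub>m A) = (c * d) \<cdot>\<^sub>m A"
  by (rule eq_matI) auto

lemma mat_smult_one: "(1 :: complex) \<cdot>\<^sub>m A = A"
  by (rule eq_matI) auto

lemma mat_vec_assoc:
  fixes A B :: "complex mat"
  shows "dim_col A = dim_row B \<Longrightarrow> dim_col B = dim_vec v \<Longrightarrow> A * B *\<^sub>v v = A *\<^sub>v (B *\<^sub>v v)"
  by (rule assoc_mult_mat_vec[OF carrier_matI carrier_matI carrier_vecI]) simp_all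

lemma smult_mat_mult_vec:
  fixes A :: "complex mat"
  shows "dim_col A = dim_vec v \<Longrightarrow> (c \<cdot>\<^sub>m A) *\<^sub>v v = c \<cdot>\<^sub>v (A *\<^sub>v v)"
  by (rule eq_vecI) (auto simp: scalar_prod_def sum_distrib_left mult.assoc)

lemma mat_mult_smult_vec:
  fixes A :: "complex mat"
  shows "dim_col A = dim_vec v \<Longrightarrow> A *\<^sub>v (c \<cdot>\<^sub>v v) = c \<cdot>\<^sub>v (A *\<^sub>v v)"
  by (rule eq_vecI) (auto simp: scalar_prod_def sum_distrib_left mult_ac)

lemma mat_one_mult: "dim_row (A :: complex mat) = n \<Longrightarrow> 1\<^sub>m n * A = A"
  by (rule left_mult_one_mat[of A n "dim_col A"]) auto

lemma mat_mult_one: "dim_col (A :: complex mat) = n \<Longrightarrow> A * 1\<^sub>m n = A"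
  by (rule right_mult_one_mat[of A "dim_row A" n]) auto

lemmas mat_algebra = mat_assoc mat_smult_left mat_smult_right mat_smult_smult mat_smult_one
  mat_one_mult mat_mult_one mat_vec_assoc smult_mat_mult_vec mat_mult_smult_vec

lemma smult_mat_cancel:
  assumes "c \<noteq> 0" "c \<cdot>\<^sub>m A = c \<cdot>\<^sub>m (B :: complex mat)" shows "A = B"
proof -
  have "(1 / c) \<cdot>\<^sub>m (c \<cdot>\<^sub>m A) = (1 / c) \<cdot>\<^sub>m (c \<cdot>\<^sub>m B)" using assms by simp
  then show ?thesis using assms(1) by (simp add: mat_smult_smult mat_smult_one)
qed

definition vec_subspace :: "nat \<Rightarrow> complex vec set \<Rightarrow> bool" where
  "vec_subspace n W \<longleftrightarrow> W \<subseteq> carrier_vec n \<and> 0\<^sub>v n \<in> W \<and>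
     (\<forall>v\<in>W. \<forall>w\<in>W. v + w \<in> W) \<and> (\<forall>c. \<forall>v\<in>W. c \<cdot>\<^sub>v v \<in> W)"

definition inj_mat :: "complex mat \<Rightarrow> bool" where
  "inj_mat A \<longleftrightarrow> (\<forall>v\<in>carrier_vec (dim_col A). A *\<^sub>v v = 0\<^sub>v (dim_row A) \<longrightarrow> v = 0\<^sub>v (dim_col A))"

lemma inj_matD:
  assumes "inj_mat A" "A \<in> carrier_mat n k" "v \<in> carrier_vec k" "w \<in> carrier_vec k" "A *\<^sub>v v = A *\<^sub>v w"
  shows "v = w"
proof -
  have "A *\<^sub>v (v - w) = 0\<^sub>v n"
    using assms by (subst mult_minus_distrib_mat_vec[of _ n k]) auto
  then have "v - w = 0\<^sub>v k"
    using assms unfolding inj_mat_def by auto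
  then show ?thesis using assms(3,4)
    by (auto simp: vec_eq_iff)
qed

lemma inj_mat_dim:
  assumes "inj_mat A" "A \<in> carrier_mat n k"
  shows "k \<le> n"
proof (rule ccontr)
  assume "\<not> k \<le> n"
  then have nk: "n < k" by simp
  define B where "B = mat k k (\<lambda>(i,j). if i < n then A $$ (i,j) else 0)"
  have B: "B \<in> carrier_mat k k" unfolding B_def by simp
  have "row B n = 0\<^sub>v k" using nk unfolding B_def by auto
  then have "det B = 0" using laplace_expansion_row[OF B nk] nk B
    by (auto intro!: sum.neutral simp: B_def)
  then obtain v where v: "v \<in> carrier_vec k" "v \<noteq> 0\<^sub>v k" "B *\<^sub>v v = 0\<^sub>v k"
    using det_0_iff_vec_prod_zero_field[OF B] by auto
  have "A *\<^sub>v v = 0\<^sub>v n"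
  proof (rule eq_vecI)
    fix i assume i: "i < dim_vec (0\<^sub>v n :: complex vec)"
    then have "(A *\<^sub>v v) $ i = (B *\<^sub>v v) $ i"
      using assms(2) v(1) nk B unfolding B_def
      by (auto simp: scalar_prod_def intro!: sum.cong)
    then show "(A *\<^sub>v v) $ i = 0\<^sub>v n $ i" using v(3) i nk by simp
  qed (use assms in auto)
  then show False using assms v unfolding inj_mat_def by auto
qed

lemma square_inj_inverse:
  fixes A :: "complex mat"
  assumes "inj_mat A" "A \<in> carrier_mat n n"
  obtains B where "B \<in> carrier_mat n n" "A * B = 1\<^sub>m n" "B * A = 1\<^sub>m n"
proof -
  have "det A \<noteq> 0" using det_0_iff_vec_prod_zero_field[OF assms(2)] assms
    unfolding inj_mat_def by auto
  then show ?thesis using det_non_zero_imp_unit[OF assms(2)] that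
    unfolding Units_def by (auto simp: ring_mat_simps)
qed

text \<open>An injective matrix with range in \<open>W\<close> and the largest possible number of columns has range \<open>W\<close>.\<close>

lemma subspace_basis_matrix:
  assumes W: "vec_subspace n W"
  obtains k A where "A \<in> carrier_mat n k" "inj_mat A" "W = {A *\<^sub>v v | v. v \<in> carrier_vec k}"
    "k \<le> n" "k = n \<Longrightarrow> W = carrier_vec n" "k = 0 \<Longrightarrow> W = {0\<^sub>v n}"
proof -
  define P where "P k \<longleftrightarrow> (\<exists>A. A \<in> carrier_mat n k \<and> inj_mat A \<and> (\<forall>v\<in>carrier_vec k. A *\<^sub>v v \<in> W))" for k
  have "mat n 0 (\<lambda>_. 0) *\<^sub>v v = 0\<^sub>v n" if "v \<in> carrier_vec 0" for v :: "complex vec"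
    by (rule eq_vecI) (use that in \<open>auto simp: scalar_prod_def\<close>)
  then have "P 0" unfolding P_def
    by (intro exI[of _ "mat n 0 (\<lambda>_. 0)"]) (use W in \<open>auto simp: inj_mat_def vec_subspace_def\<close>)
  moreover have bound: "P k \<Longrightarrow> k \<le> n" for k unfolding P_def using inj_mat_dim by blast
  ultimately obtain k where k: "P k" "\<And>j. P j \<Longrightarrow> j \<le> k"
    using Greatest_le_nat[of P _ n] GreatestI_nat[of P 0 n] by blast
  then obtain A where A: "A \<in> carrier_mat n k" "inj_mat A" "\<forall>v\<in>carrier_vec k. A *\<^sub>v v \<in> W"
    unfolding P_def by blast
  have im: "W = {A *\<^sub>v v | v. v \<in> carrier_vec k}"
  proof (rule ccontr)
    assume "W \<noteq> {A *\<^sub>v v | v. v \<in> carrier_vec k}"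
    then obtain w where w: "w \<in> W" "w \<notin> {A *\<^sub>v v | v. v \<in> carrier_vec k}" using A(3) by blast
    have wc: "w \<in> carrier_vec n" using W w unfolding vec_subspace_def by blast
    define B where "B = mat n (Suc k) (\<lambda>(i,j). if j < k then A $$ (i,j) else w $ i)"
    have B: "B \<in> carrier_mat n (Suc k)" unfolding B_def by simp
    have Bv: "B *\<^sub>v v = A *\<^sub>v vec k (\<lambda>i. v $ i) + v $ k \<cdot>\<^sub>v w" if v: "v \<in> carrier_vec (Suc k)" for v
      by (rule eq_vecI) (use A(1) wc v in \<open>auto simp: B_def scalar_prod_def\<close>)
    have "inj_mat B" unfolding inj_mat_def
    proof (intro ballI impI)
      fix v assume "v \<in> carrier_vec (dim_col B)" "B *\<^sub>v v = 0\<^sub>v (dim_row B)"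
      then have v: "v \<in> carrier_vec (Suc k)" and Z: "B *\<^sub>v v = 0\<^sub>v n" using B by auto
      let ?u = "vec k (\<lambda>i. v $ i)"
      have Z': "A *\<^sub>v ?u + v $ k \<cdot>\<^sub>v w = 0\<^sub>v n" using Z Bv[OF v] by simp
      have vk: "v $ k = 0"
      proof (rule ccontr)
        assume c: "v $ k \<noteq> 0"
        have "w = A *\<^sub>v ((- 1 / v $ k) \<cdot>\<^sub>v ?u)"
        proof (rule eq_vecI)
          fix i assume "i < dim_vec (A *\<^sub>v ((- 1 / v $ k) \<cdot>\<^sub>v ?u))"
          then have i: "i < n" using A(1) by simp
          have "(A *\<^sub>v ?u) $ i + v $ k * w $ i = 0"
            using arg_cong[OF Z', of "\<lambda>x. x $ i"] i A(1) wc by auto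
          then have "w $ i = (- 1 / v $ k) * (A *\<^sub>v ?u) $ i" using c
            by (simp add: field_simps add_eq_0_iff del: index_mult_mat_vec)
          moreover have "A *\<^sub>v ((- 1 / v $ k) \<cdot>\<^sub>v ?u) = (- 1 / v $ k) \<cdot>\<^sub>v (A *\<^sub>v ?u)"
            using A(1) by (subst mult_mat_vec[of A n k]) auto
          ultimately show "w $ i = (A *\<^sub>v ((- 1 / v $ k) \<cdot>\<^sub>v ?u)) $ i" using i A(1) by (simp del: index_mult_mat_vec)
        qed (use A(1) wc in auto)
        moreover have "(- 1 / v $ k) \<cdot>\<^sub>v ?u \<in> carrier_vec k" by simp
        ultimately show False using w(2) by blast
      qed
      have "0 \<cdot>\<^sub>v w = 0\<^sub>v n" using wc by auto
      then have "A *\<^sub>v ?u = 0\<^sub>v n" using Z' vk A(1) by simp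
      then have "?u = 0\<^sub>v k" using A(1,2) unfolding inj_mat_def by auto
      then have "?u $ i = 0\<^sub>v k $ i" for i by simp
      then have "v $ i = 0" if "i < k" for i using that by (metis index_vec index_zero_vec(1))
      then show "v = 0\<^sub>v (dim_col B)" using v vk B
        by (intro eq_vecI) (auto simp: less_Suc_eq)
    qed
    moreover have "\<forall>v\<in>carrier_vec (Suc k). B *\<^sub>v v \<in> W"
      using Bv A(3) W w(1) unfolding vec_subspace_def by auto
    ultimately have "P (Suc k)" unfolding P_def using B by blast
    then show False using k(2) by fastforce
  qed
  show ?thesis
  proof (rule that[OF A(1,2) im bound[OF k(1)]])
    assume kn: "k = n"
    obtain B where B: "B \<in> carrier_mat n n" "A * B = 1\<^sub>m n" using square_inj_inverse[of A n] A kn by auto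
    have "v \<in> W" if v: "v \<in> carrier_vec n" for v
    proof -
      have "A *\<^sub>v (B *\<^sub>v v) = v" using A B kn v by (subst assoc_mult_mat_vec[symmetric, of _ n n _ n]) auto
      then show ?thesis using A(3) B kn v by (metis mult_mat_vec_carrier)
    qed
    then show "W = carrier_vec n" using W unfolding vec_subspace_def by auto
  next
    assume "k = 0"
    then show "W = {0\<^sub>v n}" using im A(1)
      by (auto simp: scalar_prod_def intro!: eq_vecI exI[of _ "0\<^sub>v 0"])
  qed
qed

section \<open>Spans of matrices and irreducibility\<close>

text \<open>Generated inductively, so that properties of the span follow by rule induction.\<close>

inductive_set mat_span :: "nat \<Rightarrow> complex mat set \<Rightarrow> complex mat set" for n S where
  mat_span_zero: "0\<^sub>m n n \<in> mat_span n S"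
| mat_span_add_smult: "X \<in> mat_span n S \<Longrightarrow> A \<in> S \<Longrightarrow> X + c \<cdot>\<^sub>m A \<in> mat_span n S"

lemma mat_span_carrier:
  assumes "S \<subseteq> carrier_mat n n" "X \<in> mat_span n S" shows "X \<in> carrier_mat n n"
  using assms(2,1) by induction auto

lemma mat_span_base:
  assumes "S \<subseteq> carrier_mat n n" "A \<in> S" shows "A \<in> mat_span n S"
proof -
  have "0\<^sub>m n n + 1 \<cdot>\<^sub>m A \<in> mat_span n S" by (intro mat_span.intros assms)
  moreover have "0\<^sub>m n n + 1 \<cdot>\<^sub>m A = A" using assms by (intro eq_matI) auto
  ultimately show ?thesis by simp
qed

lemma mat_span_add:
  assumes "S \<subseteq> carrier_mat n n" "X \<in> mat_span n S" "Y \<in> mat_span n S" shows "X + Y \<in> mat_span n S"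
  using assms(3)
proof induction
  case mat_span_zero
  then show ?case using assms mat_span_carrier[OF assms(1,2)] by simp
next
  case (mat_span_add_smult Y A c)
  have "X + (Y + c \<cdot>\<^sub>m A) = (X + Y) + c \<cdot>\<^sub>m A"
    using mat_span_carrier[OF assms(1,2)] mat_span_carrier[OF assms(1) mat_span_add_smult(1)]
      mat_span_add_smult(2) assms(1) by (subst assoc_add_mat) auto
  then show ?case using mat_span_add_smult mat_span.mat_span_add_smult by metis
qed

lemma mat_span_smult:
  assumes "S \<subseteq> carrier_mat n n" "X \<in> mat_span n S" shows "d \<cdot>\<^sub>m X \<in> mat_span n S"
  using assms(2)
proof induction
  case mat_span_zero
  show ?case by (simp add: mat_span.intros)
next
  case (mat_span_add_smult Y A c)
  have "d \<cdot>\<^sub>m (Y + c \<cdot>\<^sub>m A) = d \<cdot>\<^sub>m Y + (d * c) \<cdot>\<^sub>m A"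
    using mat_span_carrier[OF assms(1) mat_span_add_smult(1)] mat_span_add_smult(2) assms(1)
    by (intro eq_matI) (auto simp: algebra_simps)
  then show ?case using mat_span_add_smult mat_span.mat_span_add_smult by metis
qed

lemma mat_span_sum:
  assumes "S \<subseteq> carrier_mat n n" "finite I" "\<And>i. i \<in> I \<Longrightarrow> F i \<in> mat_span n S"
  shows "mat n n (\<lambda>p. \<Sum>i\<in>I. F i $$ p) \<in> mat_span n S"
  using assms(2,3)
proof (induction I)
  case empty
  have "mat n n (\<lambda>p. \<Sum>i\<in>{}. F i $$ p) = 0\<^sub>m n n" by auto
  then show ?case by (simp add: mat_span.intros del: sum.empty)
next
  case (insert i I)
  have "mat n n (\<lambda>p. \<Sum>i\<in>insert i I. F i $$ p) = F i + mat n n (\<lambda>p. \<Sum>i\<in>I. F i $$ p)"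
    using insert mat_span_carrier[OF assms(1) insert(4)[of i]] by (intro eq_matI) auto
  then show ?case using insert mat_span_add[OF assms(1)] by simp
qed

lemma mat_span_mult:
  assumes S: "S \<subseteq> carrier_mat n n" and cl: "\<And>A B. A \<in> S \<Longrightarrow> B \<in> S \<Longrightarrow> A * B \<in> mat_span n S"
    and X: "X \<in> mat_span n S" and Y: "Y \<in> mat_span n S"
  shows "X * Y \<in> mat_span n S"
proof -
  have 1: "X * A \<in> mat_span n S" if "A \<in> S" for A
    using X
  proof induction
    case mat_span_zero
    have "0\<^sub>m n n * A = 0\<^sub>m n n" using that S by auto
    then show ?case by (simp add: mat_span.intros)
  next
    case (mat_span_add_smult X B c)
    have "(X + c \<cdot>\<^sub>m B) * A = X * A + c \<cdot>\<^sub>m (B * A)"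
      using mat_span_carrier[OF S mat_span_add_smult(1)] subsetD[OF S mat_span_add_smult(2)] subsetD[OF S that]
      by (subst add_mult_distrib_mat[of _ n n]) (auto simp: mat_smult_left)
    then show ?case using mat_span_add_smult cl that mat_span_add[OF S] mat_span_smult[OF S] by metis
  qed
  show ?thesis using Y
  proof induction
    case mat_span_zero
    then show ?case using mat_span_carrier[OF S X] by (simp add: mat_span.intros)
  next
    case (mat_span_add_smult Y B c)
    have "X * (Y + c \<cdot>\<^sub>m B) = X * Y + c \<cdot>\<^sub>m (X * B)"
      using mat_span_carrier[OF S mat_span_add_smult(1)] mat_span_carrier[OF S X] subsetD[OF S mat_span_add_smult(2)]
      by (subst mult_add_distrib_mat[of _ n n]) (auto simp: mat_smult_right)
    then show ?case using mat_span_add_smult 1 mat_span_add[OF S] mat_span_smult[OF S] by metis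
  qed
qed

lemma subspace_mat_span_invariant:
  assumes W: "vec_subspace n W" and S: "S \<subseteq> carrier_mat n n"
    and inv: "\<And>A w. A \<in> S \<Longrightarrow> w \<in> W \<Longrightarrow> A *\<^sub>v w \<in> W"
    and "X \<in> mat_span n S" "w \<in> W"
  shows "X *\<^sub>v w \<in> W"
  using assms(4)
proof induction
  case mat_span_zero
  have "w \<in> carrier_vec n" using W assms(5) unfolding vec_subspace_def by auto
  then have "0\<^sub>m n n *\<^sub>v w = 0\<^sub>v n" by auto
  then show ?case using W unfolding vec_subspace_def by simp
next
  case (mat_span_add_smult X A c)
  have w: "w \<in> carrier_vec n" using W assms(5) unfolding vec_subspace_def by auto
  have "(X + c \<cdot>\<^sub>m A) *\<^sub>v w = X *\<^sub>v w + c \<cdot>\<^sub>v (A *\<^sub>v w)"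
    using mat_span_carrier[OF S mat_span_add_smult(1)] subsetD[OF S mat_span_add_smult(2)] w
    by (subst add_mult_distrib_mat_vec[of _ n n]) (auto simp: smult_mat_mult_vec)
  then show ?case using mat_span_add_smult inv assms(5) W unfolding vec_subspace_def by auto
qed

text \<open>By Burnside's theorem this is irreducibility. In this form it passes to compressions and to tensor
  products by linear algebra alone.\<close>

definition full :: "nat \<Rightarrow> ('g \<Rightarrow> complex mat) \<Rightarrow> 'g set \<Rightarrow> bool" where
  "full n \<rho> H \<longleftrightarrow> carrier_mat n n \<subseteq> mat_span n (\<rho> ` H)"

definition irreducible_on :: "nat \<Rightarrow> ('g \<Rightarrow> complex mat) \<Rightarrow> 'g set \<Rightarrow> bool" where
  "irreducible_on n \<rho> H \<longleftrightarrow> (\<forall>W. vec_subspace n W \<and> (\<forall>x\<in>H. \<forall>w\<in>W. \<rho> x *\<^sub>v w \<in> W) \<longrightarrow>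
      W = {0\<^sub>v n} \<or> W = carrier_vec n)"

lemma exists_matrix_mapping:
  assumes "v \<in> carrier_vec n" "v \<noteq> 0\<^sub>v n" "w \<in> carrier_vec k"
  obtains X :: "complex mat" where "X \<in> carrier_mat k n" "X *\<^sub>v v = w"
proof -
  obtain i where i: "i < n" "v $ i \<noteq> 0" using assms(1,2) by (auto simp: vec_eq_iff)
  define X where "X = mat k n (\<lambda>(r,j). if j = i then w $ r / v $ i else 0)"
  have "X *\<^sub>v v = w" unfolding X_def using assms i
    by (intro eq_vecI) (auto simp: scalar_prod_def if_distrib[of "\<lambda>x. x * _"] cong: if_cong)
  then show ?thesis using that[of X] unfolding X_def by simp
qed

text \<open>Some matrix maps a given nonzero vector to any other vector.\<close>

lemma full_imp_irreducible:
  assumes "full n \<rho> H" "\<And>x. x \<in> H \<Longrightarrow> \<rho> x \<in> carrier_mat n n"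
  shows "irreducible_on n \<rho> H"
  unfolding irreducible_on_def
proof (intro allI impI, elim conjE)
  fix W assume W: "vec_subspace n W" and inv: "\<forall>x\<in>H. \<forall>w\<in>W. \<rho> x *\<^sub>v w \<in> W"
  have S: "\<rho> ` H \<subseteq> carrier_mat n n" using assms(2) by auto
  show "W = {0\<^sub>v n} \<or> W = carrier_vec n"
  proof (cases "W = {0\<^sub>v n}")
    case False
    then obtain w where w: "w \<in> W" "w \<noteq> 0\<^sub>v n" using W unfolding vec_subspace_def by auto
    then have wc: "w \<in> carrier_vec n" using W unfolding vec_subspace_def by auto
    have "u \<in> W" if u: "u \<in> carrier_vec n" for u
    proof -
      obtain X where X: "X \<in> carrier_mat n n" "X *\<^sub>v w = u"
        using exists_matrix_mapping[OF wc w(2) u] by blast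
      then have "X \<in> mat_span n (\<rho> ` H)" using assms(1) unfolding full_def by auto
      from subspace_mat_span_invariant[OF W S _ this w(1)] inv show ?thesis unfolding X(2) by auto
    qed
    then show ?thesis using W unfolding vec_subspace_def by auto
  qed auto
qed

lemma mat_has_eigenvector:
  assumes A: "(A :: complex mat) \<in> carrier_mat n n" and n: "0 < n"
  obtains e v where "v \<in> carrier_vec n" "v \<noteq> 0\<^sub>v n" "A *\<^sub>v v = e \<cdot>\<^sub>v v"
proof -
  have "degree (char_poly A) = n" using degree_monic_char_poly[OF A] by simp
  then have "\<not> constant (poly (char_poly A))" using n constant_degree[of "char_poly A"] by simp
  then obtain e where "poly (char_poly A) e = 0" using fundamental_theorem_of_algebra by blast
  then have "eigenvalue A e" using eigenvalue_root_char_poly[OF A] by simp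
  then show ?thesis using that A unfolding eigenvalue_def eigenvector_def by auto
qed

text \<open>Schur's lemma: an eigenspace of \<open>X\<close> is invariant.\<close>

lemma schur_scalar:
  assumes irr: "irreducible_on n \<rho> H" and \<rho>: "\<And>x. x \<in> H \<Longrightarrow> \<rho> x \<in> carrier_mat n n" and n: "0 < n"
    and X: "X \<in> carrier_mat n n" and com: "\<And>x. x \<in> H \<Longrightarrow> X * \<rho> x = \<rho> x * X"
  obtains e where "X = e \<cdot>\<^sub>m 1\<^sub>m n"
proof -
  obtain e v where v: "v \<in> carrier_vec n" "v \<noteq> 0\<^sub>v n" "X *\<^sub>v v = e \<cdot>\<^sub>v v"
    using mat_has_eigenvector[OF X n] by blast
  define W where "W = {w \<in> carrier_vec n. X *\<^sub>v w = e \<cdot>\<^sub>v w}"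
  have "vec_subspace n W" unfolding vec_subspace_def W_def using X
    by (auto simp: mult_add_distrib_mat_vec[of _ n n] smult_add_distrib_vec[of _ n] mult_mat_vec[of _ n n]
        smult_smult_assoc mult.commute)
  moreover have "\<rho> x *\<^sub>v w \<in> W" if x: "x \<in> H" and w: "w \<in> W" for x w
  proof -
    have "X *\<^sub>v (\<rho> x *\<^sub>v w) = \<rho> x *\<^sub>v (X *\<^sub>v w)" using com[OF x] X \<rho>[OF x] w unfolding W_def
      by (metis (no_types, lifting) assoc_mult_mat_vec mem_Collect_eq)
    then show ?thesis using w \<rho>[OF x] unfolding W_def by (auto simp: mult_mat_vec[of _ n n])
  qed
  ultimately have "W = {0\<^sub>v n} \<or> W = carrier_vec n" using irr unfolding irreducible_on_def by blast
  then have W: "W = carrier_vec n" using v unfolding W_def by blast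
  have "X = e \<cdot>\<^sub>m 1\<^sub>m n"
  proof (rule eq_matI)
    fix i j assume "i < dim_row (e \<cdot>\<^sub>m 1\<^sub>m n)" "j < dim_col (e \<cdot>\<^sub>m 1\<^sub>m n)"
    then have ij: "i < n" "j < n" by auto
    have "unit_vec n j \<in> W" using W by simp
    then have "X *\<^sub>v unit_vec n j = e \<cdot>\<^sub>v unit_vec n j" unfolding W_def by simp
    then have "(X *\<^sub>v unit_vec n j) $ i = (e \<cdot>\<^sub>v unit_vec n j) $ i" by simp
    then show "X $$ (i,j) = (e \<cdot>\<^sub>m 1\<^sub>m n) $$ (i,j)" using ij X by auto
  qed (use X in auto)
  then show ?thesis using that by blast
qed

section \<open>Projective representations and their degrees\<close>

text \<open>The number \<open>e\<close> is a root of the characteristic polynomial of the integer matrix \<open>a\<close>.\<close>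

lemma eigenvalue_of_integer_family:
  fixes f :: "'s \<Rightarrow> complex" and a :: "'s \<Rightarrow> 's \<Rightarrow> int"
  assumes S: "finite S" and ev: "\<And>s. s \<in> S \<Longrightarrow> e * f s = (\<Sum>t\<in>S. of_int (a s t) * f t)"
    and nz: "s0 \<in> S" "f s0 \<noteq> 0"
  shows "algebraic_int e"
proof -
  obtain h where h: "bij_betw h {0..<card S} S" using ex_bij_betw_nat_finite[OF S] by blast
  define N where "N = card S"
  define A where "A = mat N N (\<lambda>(i,j). a (h i) (h j))"
  define C :: "complex mat" where "C = map_mat of_int A"
  define v where "v = vec N (\<lambda>i. f (h i))"
  have A: "A \<in> carrier_mat N N" and C: "C \<in> carrier_mat N N" unfolding A_def C_def by auto
  have hS: "h i \<in> S" if "i < N" for i using h that unfolding bij_betw_def N_def by auto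
  have "C *\<^sub>v v = e \<cdot>\<^sub>v v"
  proof (rule eq_vecI)
    fix i assume "i < dim_vec (e \<cdot>\<^sub>v v)"
    then have i: "i < N" by (simp add: v_def)
    have "(C *\<^sub>v v) $ i = (\<Sum>j\<in>{0..<N}. of_int (a (h i) (h j)) * f (h j))"
      using i by (auto simp: C_def A_def v_def scalar_prod_def)
    also have "\<dots> = (\<Sum>t\<in>S. of_int (a (h i) t) * f t)"
      using sum.reindex_bij_betw[OF h, of "\<lambda>t. of_int (a (h i) t) * f t"] by (simp add: N_def)
    also have "\<dots> = (e \<cdot>\<^sub>v v) $ i" using ev[OF hS[OF i]] i by (simp add: v_def)
    finally show "(C *\<^sub>v v) $ i = (e \<cdot>\<^sub>v v) $ i" .
  qed (use C in \<open>auto simp: v_def\<close>)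
  moreover have "v \<noteq> 0\<^sub>v N"
  proof
    assume v0: "v = 0\<^sub>v N"
    obtain i where i: "i < N" "h i = s0" using h nz(1) unfolding bij_betw_def N_def
      by (metis (no_types, lifting) atLeastLessThan_iff imageE)
    then have "v $ i = f s0" by (simp add: v_def)
    then show False using v0 i nz(2) by simp
  qed
  ultimately have "eigenvalue C e" using C unfolding eigenvalue_def eigenvector_def
    by (intro exI[of _ v]) (auto simp: v_def)
  then have "poly (char_poly C) e = 0" using eigenvalue_root_char_poly[OF C] by simp
  moreover have "char_poly C = map_poly of_int (char_poly A)"
    unfolding C_def by (rule of_int_hom.char_poly_hom[OF A])
  moreover have "lead_coeff (char_poly C) = 1" using degree_monic_char_poly[OF C] by simp
  ultimately show ?thesis
    by (intro algebraic_int.intros[of "char_poly C"]) auto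
qed

definition msum :: "nat \<Rightarrow> nat \<Rightarrow> ('i \<Rightarrow> complex mat) \<Rightarrow> 'i set \<Rightarrow> complex mat" where
  "msum n k f S = mat n k (\<lambda>p. \<Sum>x\<in>S. f x $$ p)"

lemma msum_dim [simp]: "dim_row (msum n k f S) = n" "dim_col (msum n k f S) = k"
  "msum n k f S \<in> carrier_mat n k"
  by (auto simp: msum_def)

lemma msum_index [simp]: "i < n \<Longrightarrow> j < k \<Longrightarrow> msum n k f S $$ (i,j) = (\<Sum>x\<in>S. f x $$ (i,j))"
  by (auto simp: msum_def)

lemma msum_cong: "(\<And>x. x \<in> S \<Longrightarrow> f x = g x) \<Longrightarrow> msum n k f S = msum n k g S"
  by (auto simp: msum_def)

lemma msum_reindex: "bij_betw h S T \<Longrightarrow> msum n k f T = msum n k (\<lambda>x. f (h x)) S"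
  unfolding msum_def by (intro eq_matI) (auto simp: sum.reindex_bij_betw[symmetric, of h S T])

lemma mult_msum:
  assumes "A \<in> carrier_mat r n" "\<And>x. x \<in> S \<Longrightarrow> f x \<in> carrier_mat n k"
  shows "A * msum n k f S = msum r k (\<lambda>x. A * f x) S"
proof (rule eq_matI)
  fix i j assume "i < dim_row (msum r k (\<lambda>x. A * f x) S)" "j < dim_col (msum r k (\<lambda>x. A * f x) S)"
  then have ij: "i < r" "j < k" by auto
  have "(A * msum n k f S) $$ (i,j) = (\<Sum>l<n. \<Sum>x\<in>S. A $$ (i,l) * f x $$ (l,j))"
    using ij assms(1) by (auto simp: scalar_prod_def sum_distrib_left atLeast0LessThan)
  also have "\<dots> = (\<Sum>x\<in>S. \<Sum>l<n. A $$ (i,l) * f x $$ (l,j))" by (rule sum.swap)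
  also have "\<dots> = (\<Sum>x\<in>S. (A * f x) $$ (i,j))"
    using ij assms(1) carrier_matD[OF assms(2)]
    by (intro sum.cong) (auto simp: scalar_prod_def atLeast0LessThan)
  finally show "(A * msum n k f S) $$ (i,j) = msum r k (\<lambda>x. A * f x) S $$ (i,j)" using ij by simp
qed (use assms in auto)

lemma msum_mult:
  assumes "A \<in> carrier_mat k r" "\<And>x. x \<in> S \<Longrightarrow> f x \<in> carrier_mat n k"
  shows "msum n k f S * A = msum n r (\<lambda>x. f x * A) S"
proof (rule eq_matI)
  fix i j assume "i < dim_row (msum n r (\<lambda>x. f x * A) S)" "j < dim_col (msum n r (\<lambda>x. f x * A) S)"
  then have ij: "i < n" "j < r" by auto
  have "(msum n k f S * A) $$ (i,j) = (\<Sum>l<k. \<Sum>x\<in>S. f x $$ (i,l) * A $$ (l,j))"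
    using ij assms(1) by (auto simp: scalar_prod_def sum_distrib_right atLeast0LessThan)
  also have "\<dots> = (\<Sum>x\<in>S. \<Sum>l<k. f x $$ (i,l) * A $$ (l,j))" by (rule sum.swap)
  also have "\<dots> = (\<Sum>x\<in>S. (f x * A) $$ (i,j))"
    using ij assms(1) carrier_matD[OF assms(2)]
    by (intro sum.cong) (auto simp: scalar_prod_def atLeast0LessThan)
  finally show "(msum n k f S * A) $$ (i,j) = msum n r (\<lambda>x. f x * A) S $$ (i,j)" using ij by simp
qed (use assms in auto)

lemma smult_msum:
  assumes "\<And>x. x \<in> S \<Longrightarrow> f x \<in> carrier_mat n k"
  shows "c \<cdot>\<^sub>m msum n k f S = msum n k (\<lambda>x. c \<cdot>\<^sub>m f x) S"
  using carrier_matD[OF assms] by (intro eq_matI) (auto simp: sum_distrib_left intro!: sum.cong)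

lemma msum_in_span:
  assumes "finite S" "\<And>x. x \<in> S \<Longrightarrow> f x \<in> mat_span n T" "T \<subseteq> carrier_mat n n"
  shows "msum n n f S \<in> mat_span n T"
  unfolding msum_def by (rule mat_span_sum) (use assms in auto)

text \<open>Modules are right modules, whereas matrices act on columns from the left; hence the order of
  the factors in \<open>\<rho> y * \<rho> x\<close>. Cocycles are not normalised, so that \<open>\<rho> \<one>\<close> is only a multiple of the
  identity.\<close>

definition proj_rep ::
  "('g, 'm) monoid_scheme \<Rightarrow> 'g set \<Rightarrow> nat \<Rightarrow> ('g \<times> 'g \<Rightarrow> complex) \<Rightarrow> ('g \<Rightarrow> complex mat) \<Rightarrow> bool" where
  "proj_rep G L n \<alpha> \<rho> \<longleftrightarrow> 0 < n \<and> (\<forall>x\<in>L. \<rho> x \<in> carrier_mat n n) \<and>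
     (\<forall>x\<in>L. \<forall>y\<in>L. \<alpha> (x, y) \<noteq> 0 \<and> \<rho> y * \<rho> x = \<alpha> (x, y) \<cdot>\<^sub>m \<rho> (x \<otimes>\<^bsub>G\<^esub> y)) \<and>
     \<rho> \<one>\<^bsub>G\<^esub> = \<alpha> (\<one>\<^bsub>G\<^esub>, \<one>\<^bsub>G\<^esub>) \<cdot>\<^sub>m 1\<^sub>m n"

text \<open>The inverse of \<open>\<rho> x\<close>.\<close>

definition rep_inv ::
  "('g, 'm) monoid_scheme \<Rightarrow> ('g \<times> 'g \<Rightarrow> complex) \<Rightarrow> ('g \<Rightarrow> complex mat) \<Rightarrow> 'g \<Rightarrow> complex mat" where
  "rep_inv G \<alpha> \<rho> x = (1 / (\<alpha> (x, inv\<^bsub>G\<^esub> x) * \<alpha> (\<one>\<^bsub>G\<^esub>, \<one>\<^bsub>G\<^esub>))) \<cdot>\<^sub>m \<rho> (inv\<^bsub>G\<^esub> x)"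

definition scalar_mat :: "nat \<Rightarrow> complex mat \<Rightarrow> bool" where
  "scalar_mat n A \<longleftrightarrow> (\<exists>c. A = c \<cdot>\<^sub>m 1\<^sub>m n)"

lemma proj_repD:
  assumes "proj_rep G L n \<alpha> \<rho>"
  shows "0 < n" "x \<in> L \<Longrightarrow> \<rho> x \<in> carrier_mat n n" "x \<in> L \<Longrightarrow> dim_row (\<rho> x) = n"
    "x \<in> L \<Longrightarrow> dim_col (\<rho> x) = n"
    "x \<in> L \<Longrightarrow> y \<in> L \<Longrightarrow> \<alpha> (x, y) \<noteq> 0"
    "x \<in> L \<Longrightarrow> y \<in> L \<Longrightarrow> \<rho> y * \<rho> x = \<alpha> (x, y) \<cdot>\<^sub>m \<rho> (x \<otimes>\<^bsub>G\<^esub> y)"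
    "\<rho> \<one>\<^bsub>G\<^esub> = \<alpha> (\<one>\<^bsub>G\<^esub>, \<one>\<^bsub>G\<^esub>) \<cdot>\<^sub>m 1\<^sub>m n"
  using assms unfolding proj_rep_def by auto

lemma proj_rep_mono: "proj_rep G L n \<alpha> \<rho> \<Longrightarrow> M \<subseteq> L \<Longrightarrow> proj_rep G M n \<alpha> \<rho>"
  unfolding proj_rep_def by auto

lemma smult_one_cancel:
  assumes "0 < n" "c \<cdot>\<^sub>m 1\<^sub>m n = (d :: complex) \<cdot>\<^sub>m 1\<^sub>m n" shows "c = d"
proof -
  have "(c \<cdot>\<^sub>m 1\<^sub>m n) $$ (0,0) = (d \<cdot>\<^sub>m 1\<^sub>m n) $$ (0,0)" using assms by simp
  then show ?thesis using assms(1) by simp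
qed

context group
begin

lemma rep_inv:
  assumes L: "subgroup L G" and rep: "proj_rep G L n \<alpha> \<rho>" and x: "x \<in> L"
  shows "rep_inv G \<alpha> \<rho> x \<in> carrier_mat n n" "rep_inv G \<alpha> \<rho> x * \<rho> x = 1\<^sub>m n"
    "\<rho> x * rep_inv G \<alpha> \<rho> x = 1\<^sub>m n"
proof -
  note D = proj_repD[OF rep]
  have i: "inv x \<in> L" "\<one> \<in> L" and xG: "x \<in> carrier G"
    using subgroup.m_inv_closed[OF L x] subgroup.one_closed[OF L] subgroup.mem_carrier[OF L x] by auto
  show c: "rep_inv G \<alpha> \<rho> x \<in> carrier_mat n n" unfolding rep_inv_def using D(2)[OF i(1)] by simp
  show l: "rep_inv G \<alpha> \<rho> x * \<rho> x = 1\<^sub>m n"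
    unfolding rep_inv_def using D(3,4) x i D(5)[OF x i(1)] D(5)[OF i(2) i(2)] D(6)[OF x i(1)] D(7) xG
    by (simp add: mat_algebra)
  show "\<rho> x * rep_inv G \<alpha> \<rho> x = 1\<^sub>m n"
    using mat_mult_left_right_inverse[OF c D(2)[OF x] l] .
qed

lemma rep_inv_unique:
  assumes L: "subgroup L G" and rep: "proj_rep G L n \<alpha> \<rho>" and x: "x \<in> L"
    and Y: "Y \<in> carrier_mat n n" "Y * \<rho> x = 1\<^sub>m n"
  shows "rep_inv G \<alpha> \<rho> x = Y"
proof -
  note R = rep_inv[OF L rep x]
  have "Y = Y * (\<rho> x * rep_inv G \<alpha> \<rho> x)" using R Y by simp
  also have "\<dots> = rep_inv G \<alpha> \<rho> x" using R Y proj_repD(3,4)[OF rep x]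
    by (subst mat_assoc[symmetric]) auto
  finally show ?thesis by simp
qed

lemma rep_inv_mult:
  assumes L: "subgroup L G" and rep: "proj_rep G L n \<alpha> \<rho>" and x: "x \<in> L" and y: "y \<in> L"
  shows "rep_inv G \<alpha> \<rho> (x \<otimes> y) = \<alpha> (x, y) \<cdot>\<^sub>m (rep_inv G \<alpha> \<rho> x * rep_inv G \<alpha> \<rho> y)"
proof (rule rep_inv_unique[OF L rep])
  note R = rep_inv[OF L rep x] rep_inv[OF L rep y] and D = proj_repD[OF rep]
  show xy: "x \<otimes> y \<in> L" using subgroup.m_closed[OF L x y] .
  show "\<alpha> (x, y) \<cdot>\<^sub>m (rep_inv G \<alpha> \<rho> x * rep_inv G \<alpha> \<rho> y) \<in> carrier_mat n n" using R by simp
  have "\<alpha> (x, y) \<cdot>\<^sub>m (rep_inv G \<alpha> \<rho> x * rep_inv G \<alpha> \<rho> y) * \<rho> (x \<otimes> y)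
      = rep_inv G \<alpha> \<rho> x * rep_inv G \<alpha> \<rho> y * (\<alpha> (x, y) \<cdot>\<^sub>m \<rho> (x \<otimes> y))"
    using carrier_matD[OF R(1)] carrier_matD[OF R(4)] D(3,4)[OF xy] by (simp add: mat_algebra)
  also have "\<dots> = rep_inv G \<alpha> \<rho> x * ((rep_inv G \<alpha> \<rho> y * \<rho> y) * \<rho> x)"
    using carrier_matD[OF R(1)] carrier_matD[OF R(4)] D(3,4)[OF x] D(3,4)[OF y] D(6)[OF x y, symmetric]
    by (simp add: mat_algebra)
  also have "\<dots> = 1\<^sub>m n" using R D(3)[OF x] by (simp add: mat_algebra)
  finally show "\<alpha> (x, y) \<cdot>\<^sub>m (rep_inv G \<alpha> \<rho> x * rep_inv G \<alpha> \<rho> y) * \<rho> (x \<otimes> y) = 1\<^sub>m n" .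
qed

text \<open>Multiplication by \<open>y\<close> permutes the summands: the factors that the cocycle contributes to \<open>\<sigma>\<close> and to its
  inverse cancel.\<close>

lemma average_commutes:
  assumes M: "subgroup M G" and rep: "proj_rep G M m \<alpha> \<sigma>" and Y: "Y \<in> carrier_mat m m" and y: "y \<in> M"
  defines "Z \<equiv> msum m m (\<lambda>x. \<sigma> x * Y * rep_inv G \<alpha> \<sigma> x) M"
  shows "Z * \<sigma> y = \<sigma> y * Z"
proof -
  note D = proj_repD[OF rep]
  define \<tau> where "\<tau> = rep_inv G \<alpha> \<sigma>"
  have R: "\<tau> x \<in> carrier_mat m m" "\<tau> x * \<sigma> x = 1\<^sub>m m" "\<sigma> x * \<tau> x = 1\<^sub>m m"
    "dim_row (\<tau> x) = m" "dim_col (\<tau> x) = m" if "x \<in> M" for x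
    using rep_inv[OF M rep that] unfolding \<tau>_def by auto
  have Y: "Y \<in> carrier_mat m m" "dim_row Y = m" "dim_col Y = m" using Y by auto
  have Zd: "Z = msum m m (\<lambda>x. \<sigma> x * Y * \<tau> x) M" unfolding Z_def \<tau>_def ..
  have trm: "\<sigma> x * Y * \<tau> x \<in> carrier_mat m m" if "x \<in> M" for x using D(2)[OF that] Y R[OF that] by auto
  have bij: "bij_betw (\<lambda>x. x \<otimes> y) M M"
  proof (rule bij_betwI[where g = "\<lambda>x. x \<otimes> inv y"])
    show "(\<lambda>x. x \<otimes> y) \<in> M \<rightarrow> M" "(\<lambda>x. x \<otimes> inv y) \<in> M \<rightarrow> M"
      using M y subgroup.m_closed subgroup.m_inv_closed by fastforce+
    show "x \<otimes> y \<otimes> inv y = x" "x \<otimes> inv y \<otimes> y = x" if "x \<in> M" for x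
      using that y subgroup.mem_carrier[OF M] by (auto simp: m_assoc)
  qed
  have tr: "\<sigma> y * (\<sigma> x * Y * \<tau> x) = (\<sigma> (x \<otimes> y) * Y * \<tau> (x \<otimes> y)) * \<sigma> y" if x: "x \<in> M" for x
  proof -
    have xy: "x \<otimes> y \<in> M" using subgroup.m_closed[OF M x y] .
    have "(\<sigma> (x \<otimes> y) * Y * \<tau> (x \<otimes> y)) * \<sigma> y
        = (\<alpha> (x,y) \<cdot>\<^sub>m \<sigma> (x \<otimes> y)) * (Y * (\<tau> x * (\<tau> y * \<sigma> y)))"
      unfolding \<tau>_def rep_inv_mult[OF M rep x y] unfolding \<tau>_def[symmetric]
      using D(3,4)[OF xy] D(3,4)[OF y] Y R[OF x] R[OF y] by (simp add: mat_algebra)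
    also have "\<dots> = \<sigma> y * (\<sigma> x * Y * \<tau> x)"
      unfolding D(6)[OF x y, symmetric] using D(3,4)[OF y] D(3,4)[OF x] Y R[OF x] R[OF y]
      by (simp add: mat_algebra)
    finally show ?thesis by simp
  qed
  have "\<sigma> y * Z = msum m m (\<lambda>x. \<sigma> y * (\<sigma> x * Y * \<tau> x)) M"
    unfolding Zd by (rule mult_msum[OF D(2)[OF y]]) (use trm in auto)
  also have "\<dots> = msum m m (\<lambda>x. (\<sigma> (x \<otimes> y) * Y * \<tau> (x \<otimes> y)) * \<sigma> y) M"
    by (rule msum_cong) (rule tr)
  also have "\<dots> = msum m m (\<lambda>x. (\<sigma> x * Y * \<tau> x) * \<sigma> y) M"
    by (rule msum_reindex[OF bij, symmetric])
  also have "\<dots> = Z * \<sigma> y"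
    unfolding Zd by (rule msum_mult[OF D(2)[OF y], symmetric]) (use trm in auto)
  finally show ?thesis by simp
qed

text \<open>The average of a matrix unit commutes with \<open>\<sigma>\<close>. By Schur's lemma it is a scalar, which its
  trace determines.\<close>

lemma schur_orthogonality:
  assumes M: "subgroup M G" "finite M" and rep: "proj_rep G M m \<alpha> \<sigma>" and irr: "irreducible_on m \<sigma> M"
    and ijkl: "i < m" "j < m" "k < m" "l < m"
  shows "(\<Sum>x\<in>M. \<sigma> x $$ (i,j) * rep_inv G \<alpha> \<sigma> x $$ (k,l)) = (if j = k \<and> i = l then of_nat (card M) / of_nat m else 0)"
proof -
  note D = proj_repD[OF rep]
  define \<tau> where "\<tau> = rep_inv G \<alpha> \<sigma>"
  have R: "\<tau> x \<in> carrier_mat m m" "\<tau> x * \<sigma> x = 1\<^sub>m m" "\<sigma> x * \<tau> x = 1\<^sub>m m"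
    "dim_row (\<tau> x) = m" "dim_col (\<tau> x) = m" if "x \<in> M" for x
    using rep_inv[OF M(1) rep that] unfolding \<tau>_def by auto
  define Y :: "complex mat" where "Y = mat m m (\<lambda>(a,b). if a = j \<and> b = k then 1 else 0)"
  have Y: "Y \<in> carrier_mat m m" "dim_row Y = m" "dim_col Y = m" unfolding Y_def by auto
  have entry: "(\<sigma> x * Y * \<tau> x) $$ (a,b) = \<sigma> x $$ (a,j) * \<tau> x $$ (k,b)"
    if x: "x \<in> M" and ab: "a < m" "b < m" for x a b
  proof -
    have YT: "Y * \<tau> x = mat m m (\<lambda>(r,s). if r = j then \<tau> x $$ (k,s) else 0)"
      unfolding Y_def using R[OF x] ijkl
      by (intro eq_matI) (auto simp: scalar_prod_def if_distrib[of "\<lambda>t. t * _"] cong: if_cong)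
    show ?thesis using D(3,4)[OF x] Y R(4,5)[OF x] ab ijkl
      by (simp add: mat_assoc YT) (auto simp: scalar_prod_def if_distrib[of "\<lambda>t. _ * t"] cong: if_cong)
  qed
  define Z where "Z = msum m m (\<lambda>x. \<sigma> x * Y * \<tau> x) M"
  have trm: "\<sigma> x * Y * \<tau> x \<in> carrier_mat m m" if "x \<in> M" for x using D(2)[OF that] Y R[OF that] by auto
  have Z: "Z \<in> carrier_mat m m" unfolding Z_def by simp
  have "Z * \<sigma> y = \<sigma> y * Z" if "y \<in> M" for y
    unfolding Z_def \<tau>_def by (rule average_commutes[OF M(1) rep Y(1) that])
  then obtain e where e: "Z = e \<cdot>\<^sub>m 1\<^sub>m m"
    using schur_scalar[OF irr D(2) D(1) Z] by metis
  have "(\<Sum>a<m. Z $$ (a,a)) = (\<Sum>x\<in>M. \<Sum>a<m. \<tau> x $$ (k,a) * \<sigma> x $$ (a,j))"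
    unfolding Z_def by (subst sum.swap) (auto simp: entry mult.commute)
  also have "\<dots> = (\<Sum>x\<in>M. (\<tau> x * \<sigma> x) $$ (k,j))"
    using D(3,4) R(4,5) ijkl by (intro sum.cong) (auto simp: scalar_prod_def atLeast0LessThan)
  also have "\<dots> = (if j = k then of_nat (card M) else 0)" using R(2) ijkl by simp
  finally have "of_nat m * e = (if j = k then of_nat (card M) else 0)" unfolding e by simp
  then have em: "e = (if j = k then of_nat (card M) / of_nat m else 0)" using D(1)
    by (auto simp: field_simps split: if_splits)
  have "(\<Sum>x\<in>M. \<sigma> x $$ (i,j) * \<tau> x $$ (k,l)) = Z $$ (i,l)"
    unfolding Z_def using ijkl by (simp add: entry)
  also have "\<dots> = (if j = k \<and> i = l then of_nat (card M) / of_nat m else 0)" unfolding e using ijkl em by simp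
  finally show ?thesis unfolding \<tau>_def .
qed

text \<open>The number \<open>m / |M|\<close> times the trace of \<open>\<sigma>(x)\<^sup>-\<^sup>1 X\<close>. By orthogonality these are coefficients
  that express \<open>X\<close> by the values of \<open>\<sigma>\<close>.\<close>

definition schur_coeff ::
  "('g, 'b) monoid_scheme \<Rightarrow> 'g set \<Rightarrow> nat \<Rightarrow> ('g \<times> 'g \<Rightarrow> complex) \<Rightarrow> ('g \<Rightarrow> complex mat) \<Rightarrow> 'g \<Rightarrow> complex mat \<Rightarrow> complex" where
  "schur_coeff H M m \<alpha> \<sigma> x X =
     of_nat m / of_nat (card M) * (\<Sum>k<m. \<Sum>l<m. rep_inv H \<alpha> \<sigma> x $$ (k,l) * X $$ (l,k))"

lemma schur_expansion:
  assumes M: "subgroup M G" "finite M" and rep: "proj_rep G M m \<alpha> \<sigma>" and irr: "irreducible_on m \<sigma> M"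
    and X: "X \<in> carrier_mat m m"
  shows "msum m m (\<lambda>x. schur_coeff G M m \<alpha> \<sigma> x X \<cdot>\<^sub>m \<sigma> x) M = X"
proof (rule eq_matI)
  note D = proj_repD[OF rep]
  have cM: "card M \<noteq> 0" using M subgroup.one_closed by (metis card_0_eq empty_iff)
  fix i j assume "i < dim_row X" "j < dim_col X"
  then have ij: "i < m" "j < m" using X by auto
  have "msum m m (\<lambda>x. schur_coeff G M m \<alpha> \<sigma> x X \<cdot>\<^sub>m \<sigma> x) M $$ (i,j)
      = (\<Sum>x\<in>M. \<Sum>k<m. \<Sum>l<m. of_nat m / of_nat (card M) * (X $$ (l,k) * (\<sigma> x $$ (i,j) * rep_inv G \<alpha> \<sigma> x $$ (k,l))))"
    using ij D(3,4) by (auto simp: schur_coeff_def sum_distrib_left sum_distrib_right mult_ac intro!: sum.cong)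
  also have "\<dots> = (\<Sum>k<m. \<Sum>l<m. of_nat m / of_nat (card M) * (X $$ (l,k) *
      (\<Sum>x\<in>M. \<sigma> x $$ (i,j) * rep_inv G \<alpha> \<sigma> x $$ (k,l))))"
    unfolding sum_distrib_left by (subst sum.swap, rule sum.cong[OF refl], rule sum.swap)
  also have "\<dots> = (\<Sum>k<m. \<Sum>l<m. of_nat m / of_nat (card M) * (X $$ (l,k) *
      (if j = k \<and> i = l then of_nat (card M) / of_nat m else 0)))"
    by (intro sum.cong refl arg_cong2[of _ _ _ _ "(*)"] schur_orthogonality[OF M rep irr ij]) auto
  also have "\<dots> = (\<Sum>k<m. \<Sum>l<m. if j = k \<and> i = l then X $$ (i,j) else 0)"
    using cM D(1) by (intro sum.cong refl) auto
  also have "\<dots> = (\<Sum>k<m. if j = k then X $$ (i,j) else 0)"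
    using ij by (intro sum.cong refl) (auto simp: if_distrib)
  also have "\<dots> = X $$ (i,j)" using ij by simp
  finally show "msum m m (\<lambda>x. schur_coeff G M m \<alpha> \<sigma> x X \<cdot>\<^sub>m \<sigma> x) M $$ (i,j) = X $$ (i,j)" .
qed (use X in auto)

text \<open>Burnside's theorem, with explicit coefficients.\<close>

lemma irreducible_imp_full:
  assumes M: "subgroup M G" "finite M" and rep: "proj_rep G M m \<alpha> \<sigma>" and irr: "irreducible_on m \<sigma> M"
  shows "full m \<sigma> M"
  unfolding full_def
proof
  fix X :: "complex mat" assume X: "X \<in> carrier_mat m m"
  have S: "\<sigma> ` M \<subseteq> carrier_mat m m" using proj_repD(2)[OF rep] by auto
  show "X \<in> mat_span m (\<sigma> ` M)"
    by (subst schur_expansion[OF M rep irr X, symmetric])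
      (intro msum_in_span M mat_span_smult mat_span_base S imageI)
qed

lemma commuting_imp_scalar:
  assumes "full n \<rho> H" "\<And>x. x \<in> H \<Longrightarrow> \<rho> x \<in> carrier_mat n n" "0 < n"
    and "X \<in> carrier_mat n n" "\<And>x. x \<in> H \<Longrightarrow> X * \<rho> x = \<rho> x * X"
  shows "scalar_mat n X"
  using schur_scalar[OF full_imp_irreducible[OF assms(1,2)] assms(2-5)] unfolding scalar_mat_def by metis

lemma mat_span_closed_mult:
  assumes "subgroup L G" "proj_rep G L n \<alpha> \<rho>" "X \<in> mat_span n (\<rho> ` L)" "Y \<in> mat_span n (\<rho> ` L)"
  shows "X * Y \<in> mat_span n (\<rho> ` L)"
proof (rule mat_span_mult[OF _ _ assms(3,4)])
  note D = proj_repD[OF assms(2)]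
  show S: "\<rho> ` L \<subseteq> carrier_mat n n" using D(2) by auto
  fix A B assume "A \<in> \<rho> ` L" "B \<in> \<rho> ` L"
  then obtain x y where xy: "x \<in> L" "y \<in> L" "A = \<rho> y" "B = \<rho> x" by auto
  have "x \<otimes> y \<in> L" using subgroup.m_closed[OF assms(1) xy(1,2)] .
  then show "A * B \<in> mat_span n (\<rho> ` L)" unfolding xy D(6)[OF xy(1,2)]
    by (intro mat_span_smult[OF S] mat_span_base[OF S] imageI)
qed

text \<open>The claim is that the rational number \<open>|M| / (m |N|)\<close> is an algebraic integer. The determinant condition
  makes the cocycle values \<open>m\<close>-th roots of unity, so that finitely many matrices \<open>\<zeta> T(y)\<close> with
  \<open>\<zeta>\<^sup>m = 1\<close> form a set closed under multiplication by the \<open>T x\<close> and their inverses. On functions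
  on pairs of such matrices there is the operator with nonnegative integer entries which
  sums over the translates of a pair by \<open>(T x, T(x)\<^sup>-\<^sup>1)\<close>, with \<open>x\<close> in a transversal of \<open>N\<close> in \<open>M\<close>.
  By the orthogonality relations, the product of the upper left entries is an eigenvector, and
  \<open>|M| / (m |N|)\<close> its eigenvalue. Elements of \<open>N\<close> act as scalars, which cancel in a pair; this is
  why a transversal suffices.\<close>

lemma degree_dvd_index:
  assumes M: "subgroup M G" "finite M" and N: "subgroup N G" "N \<subseteq> M"
    and rep: "proj_rep G M m \<delta> T" and irr: "irreducible_on m T M"
    and det: "\<And>x. x \<in> M \<Longrightarrow> det (T x) = 1" and sc: "\<And>x. x \<in> N \<Longrightarrow> scalar_mat m (T x)"
  shows "m * card N dvd card M"
proof -
  note D = proj_repD[OF rep]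
  define \<tau> where "\<tau> = rep_inv G \<delta> T"
  have R: "\<tau> x \<in> carrier_mat m m" "\<tau> x * T x = 1\<^sub>m m" "T x * \<tau> x = 1\<^sub>m m"
    "dim_row (\<tau> x) = m" "dim_col (\<tau> x) = m" if "x \<in> M" for x
    using rep_inv[OF M(1) rep that] unfolding \<tau>_def by auto
  have Mm: "x \<otimes> y \<in> M" if "x \<in> M" "y \<in> M" for x y using subgroup.m_closed[OF M(1)] that by auto
  have Mi: "inv x \<in> M" if "x \<in> M" for x using subgroup.m_inv_closed[OF M(1)] that by auto
  have root: "\<delta> (x,y) ^ m = 1" if "x \<in> M" "y \<in> M" for x y
  proof -
    have "det (T y * T x) = det (T y) * det (T x)" by (rule det_mult) (use D(2) that in auto)
    then show ?thesis unfolding D(6)[OF that] using det that Mm D(4) by simp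
  qed
  define K where "K = {\<zeta> \<cdot>\<^sub>m T x | \<zeta> x. \<zeta> ^ m = 1 \<and> x \<in> M}"
  have finK: "finite K"
  proof -
    have "finite {\<zeta> :: complex. \<zeta> ^ m = 1}" using finite_roots_unity[of m] D(1) by simp
    then have "finite ((\<lambda>(\<zeta>, x). \<zeta> \<cdot>\<^sub>m T x) ` ({\<zeta>. \<zeta> ^ m = 1} \<times> M))" using M(2) by simp
    moreover have "K = (\<lambda>(\<zeta>, x). \<zeta> \<cdot>\<^sub>m T x) ` ({\<zeta>. \<zeta> ^ m = 1} \<times> M)" unfolding K_def by auto
    ultimately show ?thesis by simp
  qed
  have Kc: "A \<in> carrier_mat m m" if "A \<in> K" for A using that D(2) unfolding K_def by auto
  have KT: "T x * A \<in> K" if xM: "x \<in> M" and AK: "A \<in> K" for x A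
  proof -
    obtain \<zeta> y where A: "A = \<zeta> \<cdot>\<^sub>m T y" "\<zeta> ^ m = 1" "y \<in> M" using AK unfolding K_def by auto
    have "T x * A = (\<zeta> * \<delta> (y,x)) \<cdot>\<^sub>m T (y \<otimes> x)" using D(6)[OF A(3) xM] D(3,4) A xM
      by (simp add: mat_algebra)
    then show ?thesis using root[OF A(3) xM] A Mm xM unfolding K_def
      by (auto intro!: exI[of _ "\<zeta> * \<delta> (y,x)"] simp: power_mult_distrib)
  qed
  have one: "\<one> \<in> M" using subgroup.one_closed[OF M(1)] .
  have KR: "\<tau> x * A \<in> K" if xM: "x \<in> M" and AK: "A \<in> K" for x A
  proof -
    define c where "c = 1 / (\<delta> (x, inv x) * \<delta> (\<one>, \<one>))"
    have c: "c ^ m = 1" unfolding c_def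
      using root[OF xM Mi[OF xM]] root[OF one one] by (simp add: power_divide power_mult_distrib)
    obtain \<zeta> y where A: "T (inv x) * A = \<zeta> \<cdot>\<^sub>m T y" "\<zeta> ^ m = 1" "y \<in> M"
      using KT[OF Mi[OF xM] AK] unfolding K_def by auto
    have "\<tau> x * A = c \<cdot>\<^sub>m (T (inv x) * A)" unfolding \<tau>_def rep_inv_def c_def
      using D(4)[OF Mi[OF xM]] Kc[OF AK] by (simp add: mat_smult_left)
    also have "\<dots> = (c * \<zeta>) \<cdot>\<^sub>m T y" unfolding A(1) by (simp add: mat_smult_smult)
    finally show ?thesis using c A(2,3) unfolding K_def
      by (auto intro!: exI[of _ "c * \<zeta>"] simp: power_mult_distrib)
  qed
  have oneK: "1\<^sub>m m \<in> K"
  proof -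
    have "1\<^sub>m m = (1 / \<delta> (\<one>, \<one>)) \<cdot>\<^sub>m T \<one>" using D(5)[OF one one] D(7) by (simp add: mat_algebra)
    then show ?thesis using root[OF one one] one unfolding K_def
      by (auto intro!: exI[of _ "1 / \<delta> (\<one>, \<one>)"] simp: power_divide)
  qed
  define f where "f = (\<lambda>(A :: complex mat, B :: complex mat). A $$ (0,0) * B $$ (0,0))"
  define h where "h = (\<lambda>A B x. f (T x * A, \<tau> x * B))"
  have orth: "(\<Sum>x\<in>M. h A B x) = of_nat (card M) / of_nat m * f (A, B)"
    if AB: "A \<in> carrier_mat m m" "B \<in> carrier_mat m m" for A B
  proof -
    have "(\<Sum>x\<in>M. h A B x) = (\<Sum>x\<in>M. \<Sum>a<m. \<Sum>b<m. A $$ (a,0) * B $$ (b,0) * (T x $$ (0,a) * \<tau> x $$ (0,b)))"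
      using AB D(1,3,4) R(4,5) unfolding h_def f_def
      by (auto simp: scalar_prod_def atLeast0LessThan sum_product mult_ac intro!: sum.cong)
    also have "\<dots> = (\<Sum>a<m. \<Sum>b<m. A $$ (a,0) * B $$ (b,0) * (\<Sum>x\<in>M. T x $$ (0,a) * \<tau> x $$ (0,b)))"
      unfolding sum_distrib_left by (subst sum.swap, rule sum.cong[OF refl], rule sum.swap)
    also have "\<dots> = (\<Sum>a<m. \<Sum>b<m. A $$ (a,0) * B $$ (b,0) *
        (if a = 0 \<and> 0 = b then of_nat (card M) / of_nat m else 0))"
      unfolding \<tau>_def by (intro sum.cong refl arg_cong2[of _ _ _ _ "(*)"] schur_orthogonality[OF M rep irr]) (use D(1) in auto)
    also have "\<dots> = (\<Sum>a<m. \<Sum>b<m. if b = 0 then (if a = 0 then of_nat (card M) / of_nat m * f (A, B) else 0) else 0)"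
      by (intro sum.cong refl) (auto simp: f_def)
    also have "\<dots> = of_nat (card M) / of_nat m * f (A, B)" using D(1) by simp
    finally show ?thesis .
  qed
  have hN: "h A B (n \<otimes> x) = h A B x" if n: "n \<in> N" and x: "x \<in> M" and AB: "A \<in> carrier_mat m m" "B \<in> carrier_mat m m"
    for n x A B
  proof -
    have nM: "n \<in> M" using n N by auto
    obtain c where c: "T n = c \<cdot>\<^sub>m 1\<^sub>m m" using sc[OF n] unfolding scalar_mat_def by auto
    have "c \<noteq> 0"
    proof
      assume "c = 0"
      then have "det (T n) = 0" using c D(1) by simp
      then show False using det[OF nM] by simp
    qed
    note d = D(5)[OF nM x]
    have nx: "T (n \<otimes> x) = (c / \<delta> (n,x)) \<cdot>\<^sub>m T x"
    proof (rule smult_mat_cancel[OF d])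
      show "\<delta> (n,x) \<cdot>\<^sub>m T (n \<otimes> x) = \<delta> (n,x) \<cdot>\<^sub>m ((c / \<delta> (n,x)) \<cdot>\<^sub>m T x)"
        using D(6)[OF nM x] c D(3,4)[OF x] d by (simp add: mat_algebra)
    qed
    have nr: "\<tau> (n \<otimes> x) = (\<delta> (n,x) / c) \<cdot>\<^sub>m \<tau> x" unfolding \<tau>_def
      by (rule rep_inv_unique[OF M(1) rep Mm[OF nM x]], unfold nx \<tau>_def[symmetric])
        (use R[OF x] D(3,4)[OF x] \<open>c \<noteq> 0\<close> d in \<open>auto simp: mat_algebra\<close>)
    show ?thesis unfolding h_def f_def nx nr using AB R[OF x] D(3,4)[OF x] D(1) \<open>c \<noteq> 0\<close> d
      by (simp add: mat_smult_left)
  qed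
  define Q where "Q = (\<lambda>x. N #> x) ` M"
  have finQ: "finite Q" unfolding Q_def using M(2) by simp
  define r where "r C = (SOME x. x \<in> M \<and> N #> x = C)" for C
  have r: "r C \<in> M" "N #> r C = C" if "C \<in> Q" for C
    using that someI_ex[of "\<lambda>x. x \<in> M \<and> N #> x = C"] unfolding Q_def r_def by auto
  have NG: "N \<subseteq> carrier G" using subgroup.subset[OF N(1)] .
  have MG: "x \<in> carrier G" if "x \<in> M" for x using subgroup.mem_carrier[OF M(1) that] .
  have cosets: "{x \<in> M. N #> x = C} = N #> r C" "card {x \<in> M. N #> x = C} = card N" if C: "C \<in> Q" for C
  proof -
    show 1: "{x \<in> M. N #> x = C} = N #> r C"
    proof (intro equalityI subsetI)
      fix x assume "x \<in> {x \<in> M. N #> x = C}"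
      then show "x \<in> N #> r C" using rcos_self[OF MG N(1)] r(2)[OF C] by auto
    next
      fix x assume x: "x \<in> N #> r C"
      then have "x \<in> M" using N(2) r(1)[OF C] Mm unfolding r_coset_def by auto
      then show "x \<in> {x \<in> M. N #> x = C}"
        using repr_independence[OF x MG[OF r(1)[OF C]] N(1)] r(2)[OF C] by auto
    qed
    have "N #> r C \<in> rcosets N" unfolding RCOSETS_def using MG[OF r(1)[OF C]] by auto
    then show "card {x \<in> M. N #> x = C} = card N" unfolding 1 using card_rcosets_equal[OF _ NG] by simp
  qed
  have sumQ: "(\<Sum>x\<in>M. h A B x) = of_nat (card N) * (\<Sum>C\<in>Q. h A B (r C))"
    if AB: "A \<in> carrier_mat m m" "B \<in> carrier_mat m m" for A B
  proof -
    have "(\<Sum>x\<in>M. h A B x) = (\<Sum>C\<in>Q. \<Sum>x | x \<in> M \<and> N #> x = C. h A B x)"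
      unfolding Q_def by (rule sum.image_gen[OF M(2)])
    also have "\<dots> = (\<Sum>C\<in>Q. of_nat (card N) * h A B (r C))"
    proof (rule sum.cong[OF refl])
      fix C assume C: "C \<in> Q"
      have "(\<Sum>x | x \<in> M \<and> N #> x = C. h A B x) = (\<Sum>x | x \<in> M \<and> N #> x = C. h A B (r C))"
      proof (rule sum.cong[OF refl])
        fix x assume "x \<in> {x. x \<in> M \<and> N #> x = C}"
        then obtain n where "n \<in> N" "x = n \<otimes> r C" using cosets(1)[OF C] unfolding r_coset_def by auto
        then show "h A B x = h A B (r C)" using hN r(1)[OF C] AB by auto
      qed
      then show "(\<Sum>x | x \<in> M \<and> N #> x = C. h A B x) = of_nat (card N) * h A B (r C)"
        using cosets(2)[OF C] by simp
    qed
    finally show ?thesis by (simp add: sum_distrib_left)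
  qed
  have cN: "card N \<noteq> 0" using N M(2) subgroup.one_closed[OF N(1)] by (metis card_0_eq empty_iff finite_subset)
  define e :: complex where "e = of_nat (card M) / of_nat (m * card N)"
  have "algebraic_int e"
  proof (rule eigenvalue_of_integer_family)
    show "finite (K \<times> K)" using finK by simp
    show "(1\<^sub>m m, 1\<^sub>m m) \<in> K \<times> K" using oneK by simp
    show "f (1\<^sub>m m, 1\<^sub>m m) \<noteq> 0" using D(1) unfolding f_def by simp
    fix s assume "s \<in> K \<times> K"
    then obtain A B where s: "s = (A, B)" "A \<in> K" "B \<in> K" by auto
    have "e * f s = (\<Sum>C\<in>Q. h A B (r C))"
      using orth[of A B] sumQ[of A B] Kc s cN D(1) unfolding e_def by (simp add: field_simps)
    also have "\<dots> = (\<Sum>C\<in>Q. f ((\<lambda>C. (T (r C) * A, \<tau> (r C) * B)) C))" unfolding h_def by simp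
    also have "\<dots> = (\<Sum>t\<in>K \<times> K. of_nat (card {C \<in> Q. (T (r C) * A, \<tau> (r C) * B) = t}) * f t)"
      by (rule sum_fun_comp) (use finQ finK KT KR r s in auto)
    finally show "e * f s = (\<Sum>t\<in>K \<times> K. of_int ((\<lambda>s t. int (card {C \<in> Q. (T (r C) * fst s, \<tau> (r C) * snd s) = t})) s t) * f t)"
      using s by simp
  qed
  moreover have "e \<in> \<rat>" unfolding e_def by (intro Rats_divide Rats_of_nat)
  ultimately have "e \<in> \<int>" by (rule rational_algebraic_int_is_int)
  then obtain k :: int where k: "e = of_int k" by (auto elim: Ints_cases)
  have "of_nat (card M) = (of_int (k * int (m * card N)) :: complex)"
    using k cN D(1) unfolding e_def by (simp add: field_simps)
  then have "int (card M) = k * int (m * card N)"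
    by (metis of_int_eq_iff of_int_of_nat_eq)
  then have "int (m * card N) dvd int (card M)" by simp
  then show ?thesis by (simp only: of_nat_dvd_iff)
qed

end

section \<open>Irreducible constituents and homogeneous components\<close>

lemma mult_carrier_iff [simp]: "A * B \<in> carrier_mat n k \<longleftrightarrow> dim_row A = n \<and> dim_col B = k"
  unfolding carrier_mat_def by simp

lemma mat_add_mult:
  fixes A B C :: "complex mat"
  shows "dim_row A = dim_row B \<Longrightarrow> dim_col A = dim_col B \<Longrightarrow> dim_col B = dim_row C \<Longrightarrow> (A + B) * C = A * C + B * C"
  by (rule add_mult_distrib_mat[of A "dim_row A" "dim_col A" B C "dim_col C"]) auto

lemma mat_mult_add:
  fixes A B C :: "complex mat"
  shows "dim_row B = dim_row C \<Longrightarrow> dim_col B = dim_col C \<Longrightarrow> dim_col A = dim_row B \<Longrightarrow> A * (B + C) = A * B + A * C"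
  by (rule mult_add_distrib_mat[of A "dim_row A" "dim_col A" B "dim_col B" C]) auto

lemma mat_mult_vec_eq_imp_eq:
  fixes X Y :: "complex mat"
  assumes "X \<in> carrier_mat n m" "Y \<in> carrier_mat n m" "\<And>v. v \<in> carrier_vec m \<Longrightarrow> X *\<^sub>v v = Y *\<^sub>v v"
  shows "X = Y"
proof (rule eq_matI)
  fix i j assume ij: "i < dim_row Y" "j < dim_col Y"
  have "(X *\<^sub>v unit_vec m j) $ i = (Y *\<^sub>v unit_vec m j) $ i" using assms(3)[of "unit_vec m j"] by simp
  then show "X $$ (i,j) = Y $$ (i,j)" using ij assms(1,2) by auto
qed (use assms in auto)

lemma zero_smult_mat: "A \<in> carrier_mat n k \<Longrightarrow> (0 :: complex) \<cdot>\<^sub>m A = 0\<^sub>m n k"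
  by (intro eq_matI) auto

lemma factor_through:
  fixes X B :: "complex mat"
  assumes X: "X \<in> carrier_mat n m" and B: "B \<in> carrier_mat n k"
    and im: "\<And>v. v \<in> carrier_vec m \<Longrightarrow> \<exists>u\<in>carrier_vec k. X *\<^sub>v v = B *\<^sub>v u"
  obtains Y where "Y \<in> carrier_mat k m" "X = B * Y"
proof -
  have "\<forall>j. \<exists>u. j < m \<longrightarrow> u \<in> carrier_vec k \<and> X *\<^sub>v unit_vec m j = B *\<^sub>v u" using im[OF unit_vec_carrier] by blast
  then obtain u where u: "\<And>j. j < m \<Longrightarrow> u j \<in> carrier_vec k \<and> X *\<^sub>v unit_vec m j = B *\<^sub>v u j" by metis
  define Y where "Y = mat k m (\<lambda>(i,j). u j $ i)"
  have "X = B * Y"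
  proof (rule eq_matI)
    fix i j assume "i < dim_row (B * Y)" "j < dim_col (B * Y)"
    then have ij: "i < n" "j < m" using B by (auto simp: Y_def)
    have "col Y j = u j" using u[OF ij(2)] ij unfolding Y_def by auto
    then have "(B * Y) $$ (i,j) = (B *\<^sub>v u j) $ i" using ij B by (simp add: Y_def)
    also have "\<dots> = (X *\<^sub>v unit_vec m j) $ i" using u[OF ij(2)] by simp
    also have "\<dots> = X $$ (i,j)" using ij X by auto
    finally show "X $$ (i,j) = (B * Y) $$ (i,j)" by simp
  qed (use X B in \<open>auto simp: Y_def\<close>)
  then show ?thesis using that[of Y] by (simp add: Y_def)
qed

lemma inj_mat_cancel:
  assumes "inj_mat B" "B \<in> carrier_mat n m" "X \<in> carrier_mat m k" "Y \<in> carrier_mat m k" "B * X = B * Y"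
  shows "X = Y"
proof (rule mat_mult_vec_eq_imp_eq[OF assms(3,4)])
  fix v :: "complex vec" assume v: "v \<in> carrier_vec k"
  have "B *\<^sub>v (X *\<^sub>v v) = B *\<^sub>v (Y *\<^sub>v v)"
    using assms v by (metis assoc_mult_mat_vec)
  then show "X *\<^sub>v v = Y *\<^sub>v v"
    using inj_matD[OF assms(1,2)] assms(3,4) v by (metis mult_mat_vec_carrier)
qed

lemma inj_mat_mult:
  assumes "inj_mat A" "A \<in> carrier_mat n m" "inj_mat B" "B \<in> carrier_mat m k"
  shows "inj_mat (A * B)"
  unfolding inj_mat_def
proof (intro ballI impI)
  fix v assume "v \<in> carrier_vec (dim_col (A * B))" "A * B *\<^sub>v v = 0\<^sub>v (dim_row (A * B))"
  then have v: "v \<in> carrier_vec k" and "A *\<^sub>v (B *\<^sub>v v) = 0\<^sub>v n" using assms by (auto simp: mat_vec_assoc)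
  then have "B *\<^sub>v v = 0\<^sub>v m" using assms unfolding inj_mat_def by (metis carrier_matD mult_mat_vec_carrier)
  then show "v = 0\<^sub>v (dim_col (A * B))" using assms v unfolding inj_mat_def by auto
qed

definition tr :: "complex mat \<Rightarrow> complex" where
  "tr A = (\<Sum>i<dim_row A. A $$ (i,i))"

lemma tr_mult_commute:
  assumes "A \<in> carrier_mat n k" "B \<in> carrier_mat k n"
  shows "tr (A * B) = tr (B * A)"
proof -
  have "tr (A * B) = (\<Sum>i<n. \<Sum>j<k. A $$ (i,j) * B $$ (j,i))"
    using assms by (auto simp: tr_def scalar_prod_def atLeast0LessThan)
  also have "\<dots> = (\<Sum>j<k. \<Sum>i<n. B $$ (j,i) * A $$ (i,j))" by (subst sum.swap) (simp add: mult.commute)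
  also have "\<dots> = tr (B * A)" using assms by (auto simp: tr_def scalar_prod_def atLeast0LessThan)
  finally show ?thesis .
qed

lemma tr_one [simp]: "tr (1\<^sub>m n) = of_nat n"
  by (simp add: tr_def)

lemma tr_smult [simp]: "tr (c \<cdot>\<^sub>m A) = c * tr A" if "A \<in> carrier_mat n n"
  using that by (simp add: tr_def sum_distrib_left)

lemma tr_msum:
  "tr (msum n n f S) = (\<Sum>x\<in>S. tr (f x))" if "\<And>x. x \<in> S \<Longrightarrow> f x \<in> carrier_mat n n"
proof -
  have "(\<Sum>x\<in>S. tr (f x)) = (\<Sum>x\<in>S. \<Sum>i<n. f x $$ (i,i))"
    using carrier_matD[OF that] by (intro sum.cong) (auto simp: tr_def)
  then show ?thesis by (simp add: tr_def) (rule sum.swap)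
qed

text \<open>The columns of \<open>A\<close> are a basis of the range of \<open>P\<close>, and \<open>C\<close> sends \<open>v\<close> to the coordinates of \<open>P v\<close>.\<close>

lemma idempotent_factorization:
  assumes P: "P \<in> carrier_mat n n" "P * P = P"
  obtains k A C where "A \<in> carrier_mat n k" "C \<in> carrier_mat k n" "A * C = P" "C * A = 1\<^sub>m k" "inj_mat A"
proof -
  define W where "W = {P *\<^sub>v v | v. v \<in> carrier_vec n}"
  have "vec_subspace n W" unfolding vec_subspace_def
  proof (intro conjI ballI allI)
    show "W \<subseteq> carrier_vec n" unfolding W_def using P by auto
    have "P *\<^sub>v 0\<^sub>v n = 0\<^sub>v n" using P by auto
    then show "0\<^sub>v n \<in> W" unfolding W_def by (metis (mono_tags, lifting) mem_Collect_eq zero_carrier_vec)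
  next
    fix v w assume "v \<in> W" "w \<in> W"
    then obtain v' w' where v: "v' \<in> carrier_vec n" "v = P *\<^sub>v v'" and w: "w' \<in> carrier_vec n" "w = P *\<^sub>v w'"
      unfolding W_def by auto
    have "v + w = P *\<^sub>v (v' + w')" using v w mult_add_distrib_mat_vec[OF P(1)] by simp
    then show "v + w \<in> W" unfolding W_def using v w by auto
  next
    fix c v assume "v \<in> W"
    then obtain v' where v: "v' \<in> carrier_vec n" "v = P *\<^sub>v v'" unfolding W_def by auto
    have "c \<cdot>\<^sub>v v = P *\<^sub>v (c \<cdot>\<^sub>v v')" using v mult_mat_vec[OF P(1)] by simp
    then show "c \<cdot>\<^sub>v v \<in> W" unfolding W_def using v by auto
  qed
  then obtain k A where A: "A \<in> carrier_mat n k" "inj_mat A" "W = {A *\<^sub>v v | v. v \<in> carrier_vec k}"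
    by (rule subspace_basis_matrix)
  have "\<exists>u\<in>carrier_vec k. P *\<^sub>v v = A *\<^sub>v u" if "v \<in> carrier_vec n" for v
  proof -
    have "P *\<^sub>v v \<in> W" using that unfolding W_def by auto
    then show ?thesis unfolding A(3) by auto
  qed
  then obtain C where C: "C \<in> carrier_mat k n" "P = A * C" using factor_through[OF P(1) A(1)] by metis
  have PA: "P * A = A"
  proof (rule mat_mult_vec_eq_imp_eq[of _ n k])
    fix v :: "complex vec" assume v: "v \<in> carrier_vec k"
    have "A *\<^sub>v v \<in> W" unfolding A(3) using v by auto
    then obtain w where w: "w \<in> carrier_vec n" "A *\<^sub>v v = P *\<^sub>v w" unfolding W_def by auto
    have "P * A *\<^sub>v v = P *\<^sub>v (P *\<^sub>v w)" using P A(1) v w by (simp add: mat_vec_assoc)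
    also have "\<dots> = P * P *\<^sub>v w" using P(1) w by (simp add: mat_vec_assoc)
    finally show "P * A *\<^sub>v v = A *\<^sub>v v" using P(2) w by simp
  qed (use P A in auto)
  have "A * (C * A) = A * 1\<^sub>m k" using PA C A(1) by (simp add: mat_algebra)
  then have "C * A = 1\<^sub>m k" using inj_mat_cancel[OF A(2,1), of "C * A" k "1\<^sub>m k"] C A(1) by simp
  then show ?thesis using that A C by metis
qed

context group
begin

text \<open>The columns of \<open>B\<close> are a basis of an invariant subspace of the least possible positive dimension.\<close>

lemma minimal_submodule:
  assumes M: "subgroup M G" and rep: "proj_rep G M n \<alpha> \<rho>"
  obtains m B \<sigma> where "B \<in> carrier_mat n m" "inj_mat B" "proj_rep G M m \<alpha> \<sigma>" "irreducible_on m \<sigma> M"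
    "\<And>x. x \<in> M \<Longrightarrow> \<rho> x * B = B * \<sigma> x"
proof -
  note D = proj_repD[OF rep]
  define Q where "Q m B \<longleftrightarrow> 0 < m \<and> B \<in> carrier_mat n m \<and> inj_mat B \<and>
    (\<forall>x\<in>M. \<forall>v\<in>carrier_vec m. \<exists>u\<in>carrier_vec m. \<rho> x *\<^sub>v (B *\<^sub>v v) = B *\<^sub>v u)" for m B
  have "Q n (1\<^sub>m n)" unfolding Q_def using D by (auto simp: inj_mat_def intro!: mult_mat_vec_carrier)
  then have ex: "\<exists>m. \<exists>B. Q m B" by blast
  define m where "m = (LEAST m. \<exists>B. Q m B)"
  obtain B where "Q m B" using LeastI_ex[OF ex] unfolding m_def by blast
  then have m: "0 < m" and B: "B \<in> carrier_mat n m" "inj_mat B"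
    and inv: "\<And>x v. x \<in> M \<Longrightarrow> v \<in> carrier_vec m \<Longrightarrow> \<exists>u\<in>carrier_vec m. \<rho> x *\<^sub>v (B *\<^sub>v v) = B *\<^sub>v u"
    unfolding Q_def by auto
  have least: "m \<le> k" if "Q k A" for k A unfolding m_def using that by (blast intro: Least_le)
  have "\<exists>Y. Y \<in> carrier_mat m m \<and> \<rho> x * B = B * Y" if x: "x \<in> M" for x
  proof -
    have "\<exists>u\<in>carrier_vec m. \<rho> x * B *\<^sub>v v = B *\<^sub>v u" if "v \<in> carrier_vec m" for v
      using inv[OF x that] D(4)[OF x] B that by (simp add: mat_vec_assoc)
    then show ?thesis using factor_through[of "\<rho> x * B" n m B m] D(2)[OF x] B by (metis mult_carrier_mat)
  qed
  then obtain \<sigma> where \<sigma>: "\<And>x. x \<in> M \<Longrightarrow> \<sigma> x \<in> carrier_mat m m" "\<And>x. x \<in> M \<Longrightarrow> \<rho> x * B = B * \<sigma> x"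
    by metis
  have one: "\<one> \<in> M" using subgroup.one_closed[OF M] .
  have "proj_rep G M m \<alpha> \<sigma>" unfolding proj_rep_def
  proof (intro conjI ballI)
    fix x y assume x: "x \<in> M" and y: "y \<in> M"
    have xy: "x \<otimes> y \<in> M" using subgroup.m_closed[OF M x y] .
    show "\<alpha> (x,y) \<noteq> 0" using D(5)[OF x y] .
    show "\<sigma> y * \<sigma> x = \<alpha> (x,y) \<cdot>\<^sub>m \<sigma> (x \<otimes> y)"
    proof (rule inj_mat_cancel[OF B(2,1), where k = m])
      have "B * (\<sigma> y * \<sigma> x) = B * \<sigma> y * \<sigma> x" using \<sigma>[OF x] \<sigma>[OF y] B by (simp add: mat_assoc)
      also have "\<dots> = \<rho> y * B * \<sigma> x" using \<sigma>(2)[OF y] by simp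
      also have "\<dots> = \<rho> y * \<rho> x * B" using \<sigma>(1)[OF x] \<sigma>(2)[OF x, symmetric] B D(3,4)[OF x] D(3,4)[OF y]
        by (simp add: mat_assoc)
      also have "\<dots> = B * (\<alpha> (x,y) \<cdot>\<^sub>m \<sigma> (x \<otimes> y))" unfolding D(6)[OF x y]
        using \<sigma>[OF xy] B D(3,4)[OF xy] by (simp add: mat_algebra)
      finally show "B * (\<sigma> y * \<sigma> x) = B * (\<alpha> (x,y) \<cdot>\<^sub>m \<sigma> (x \<otimes> y))" .
    qed (use \<sigma>(1)[OF x] \<sigma>(1)[OF y] \<sigma>(1)[OF xy] in auto)
  next
    show "\<sigma> \<one> = \<alpha> (\<one>,\<one>) \<cdot>\<^sub>m 1\<^sub>m m"
      by (rule inj_mat_cancel[OF B(2,1), where k = m]) (use \<sigma>[OF one] B D(7) in \<open>auto simp: mat_algebra\<close>)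
  qed (use m \<sigma> in auto)
  moreover have "irreducible_on m \<sigma> M" unfolding irreducible_on_def
  proof (intro allI impI, elim conjE)
    fix W assume W: "vec_subspace m W" and iW: "\<forall>x\<in>M. \<forall>w\<in>W. \<sigma> x *\<^sub>v w \<in> W"
    obtain k A where A: "A \<in> carrier_mat m k" "inj_mat A" "W = {A *\<^sub>v v | v. v \<in> carrier_vec k}"
      "k \<le> m" "k = m \<Longrightarrow> W = carrier_vec m" "k = 0 \<Longrightarrow> W = {0\<^sub>v m}"
      by (rule subspace_basis_matrix[OF W]) blast
    have "Q k (B * A)" if "0 < k" unfolding Q_def
    proof (intro conjI ballI)
      fix x and v :: "complex vec" assume x: "x \<in> M" and v: "v \<in> carrier_vec k"
      have "A *\<^sub>v v \<in> W" using A(3) v by auto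
      then have "\<sigma> x *\<^sub>v (A *\<^sub>v v) \<in> W" using iW x by auto
      then obtain u where u: "u \<in> carrier_vec k" "\<sigma> x *\<^sub>v (A *\<^sub>v v) = A *\<^sub>v u" using A(3) by auto
      have "\<rho> x *\<^sub>v (B * A *\<^sub>v v) = \<rho> x * B *\<^sub>v (A *\<^sub>v v)"
        using D(3,4)[OF x] B A(1) v by (simp add: mat_vec_assoc)
      also have "\<dots> = B * A *\<^sub>v u" using \<sigma>[OF x] B A(1) v u by (simp add: mat_vec_assoc)
      finally show "\<exists>u\<in>carrier_vec k. \<rho> x *\<^sub>v (B * A *\<^sub>v v) = B * A *\<^sub>v u" using u by blast
    qed (use that A B inj_mat_mult in auto)
    then have "k = 0 \<or> k = m" using least A(4) by fastforce
    then show "W = {0\<^sub>v m} \<or> W = carrier_vec m" using A(5,6) by blast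
  qed
  ultimately show ?thesis using that[OF B _ _ \<sigma>(2)] by blast
qed

end

text \<open>A representation of \<open>L\<close>, a normal subgroup \<open>M\<close> of \<open>L\<close> and an irreducible constituent
  \<open>\<sigma>\<close> of the restriction to \<open>M\<close>, which \<open>B\<close> embeds.\<close>

locale clifford = group G for G (structure) +
  fixes L M :: "'a set" and n m :: nat and \<alpha> :: "'a \<times> 'a \<Rightarrow> complex" and \<rho> \<sigma> :: "'a \<Rightarrow> complex mat"
    and B :: "complex mat"
  assumes L: "subgroup L G" "finite L" and M: "subgroup M G" "M \<subseteq> L"
    and normal: "\<And>g x. g \<in> L \<Longrightarrow> x \<in> M \<Longrightarrow> inv g \<otimes> x \<otimes> g \<in> M"
    and rep: "proj_rep G L n \<alpha> \<rho>" and full: "full n \<rho> L"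
    and sub: "B \<in> carrier_mat n m" "inj_mat B" "proj_rep G M m \<alpha> \<sigma>" "irreducible_on m \<sigma> M"
      "\<And>x. x \<in> M \<Longrightarrow> \<rho> x * B = B * \<sigma> x"
begin

lemmas rho_rep = proj_repD[OF rep]
lemmas sigma_rep = proj_repD[OF sub(3)]

lemma finM: "finite M" using M(2) L(2) by (rule finite_subset)
lemma M_in_L: "x \<in> M \<Longrightarrow> x \<in> L" using M by auto
lemma L_in_G: "x \<in> L \<Longrightarrow> x \<in> carrier G" using subgroup.mem_carrier[OF L(1)] .
lemma Bdim: "dim_row B = n" "dim_col B = m" using sub(1) by auto

abbreviation \<rho>' where "\<rho>' \<equiv> rep_inv G \<alpha> \<rho>"
abbreviation \<sigma>' where "\<sigma>' \<equiv> rep_inv G \<alpha> \<sigma>"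

lemma rho_inv: "x \<in> L \<Longrightarrow> \<rho>' x \<in> carrier_mat n n" "x \<in> L \<Longrightarrow> \<rho>' x * \<rho> x = 1\<^sub>m n" "x \<in> L \<Longrightarrow> \<rho> x * \<rho>' x = 1\<^sub>m n"
  "x \<in> L \<Longrightarrow> dim_row (\<rho>' x) = n" "x \<in> L \<Longrightarrow> dim_col (\<rho>' x) = n"
  using rep_inv[OF L(1) rep] by auto

lemma sigma_inv: "x \<in> M \<Longrightarrow> \<sigma>' x \<in> carrier_mat m m" "x \<in> M \<Longrightarrow> \<sigma>' x * \<sigma> x = 1\<^sub>m m" "x \<in> M \<Longrightarrow> \<sigma> x * \<sigma>' x = 1\<^sub>m m"
  "x \<in> M \<Longrightarrow> dim_row (\<sigma>' x) = m" "x \<in> M \<Longrightarrow> dim_col (\<sigma>' x) = m"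
  using rep_inv[OF M(1) sub(3)] by auto

abbreviation cf where "cf \<equiv> schur_coeff G M m \<alpha> \<sigma>"

text \<open>Expand a matrix by the values of \<open>\<sigma>\<close> and replace \<open>\<sigma>\<close> by \<open>\<rho>\<close>. The result is an algebra homomorphism,
  not unital in general, from all matrices into the span of \<open>\<rho>(M)\<close>: the inverse of the
  isomorphism between the block of this span that belongs to \<open>\<sigma>\<close> and the full matrix algebra.\<close>

definition \<Phi> :: "complex mat \<Rightarrow> complex mat" where
  "\<Phi> X = msum n n (\<lambda>x. cf x X \<cdot>\<^sub>m \<rho> x) M"

lemma Phi_carrier [simp]: "\<Phi> X \<in> carrier_mat n n" "dim_row (\<Phi> X) = n" "dim_col (\<Phi> X) = n"
  unfolding \<Phi>_def by auto

lemma cf_tr: "x \<in> M \<Longrightarrow> X \<in> carrier_mat m m \<Longrightarrow> cf x X = of_nat m / of_nat (card M) * tr (\<sigma>' x * X)"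
  using sigma_inv[of x] by (auto simp: schur_coeff_def tr_def scalar_prod_def atLeast0LessThan)

lemma cf_msum: "cf x (msum m m f S) = (\<Sum>i\<in>S. cf x (f i))"
proof -
  have "(\<Sum>k<m. \<Sum>l<m. \<sigma>' x $$ (k,l) * msum m m f S $$ (l,k)) = (\<Sum>k<m. \<Sum>l<m. \<Sum>i\<in>S. \<sigma>' x $$ (k,l) * f i $$ (l,k))"
    by (intro sum.cong refl) (auto simp: sum_distrib_left)
  also have "\<dots> = (\<Sum>i\<in>S. \<Sum>k<m. \<Sum>l<m. \<sigma>' x $$ (k,l) * f i $$ (l,k))"
    by (simp only: sum.swap[of _ S "{..<m}"])
  finally show ?thesis by (simp add: schur_coeff_def sum_distrib_left)
qed

lemma cf_smult: "X \<in> carrier_mat m m \<Longrightarrow> cf x (c \<cdot>\<^sub>m X) = c * cf x X"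
  by (auto simp: schur_coeff_def sum_distrib_left mult_ac intro!: sum.cong)

lemma Phi_msum: "\<Phi> (msum m m f S) = msum n n (\<lambda>i. \<Phi> (f i)) S"
proof (rule eq_matI)
  fix i j assume "i < dim_row (msum n n (\<lambda>i. \<Phi> (f i)) S)" "j < dim_col (msum n n (\<lambda>i. \<Phi> (f i)) S)"
  then have ij: "i < n" "j < n" by auto
  have "\<Phi> (msum m m f S) $$ (i,j) = (\<Sum>x\<in>M. \<Sum>s\<in>S. cf x (f s) * \<rho> x $$ (i,j))"
    unfolding \<Phi>_def cf_msum using ij rho_rep(3,4) M_in_L by (auto simp: sum_distrib_right intro!: sum.cong)
  also have "\<dots> = (\<Sum>s\<in>S. \<Sum>x\<in>M. cf x (f s) * \<rho> x $$ (i,j))" by (rule sum.swap)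
  also have "\<dots> = msum n n (\<lambda>i. \<Phi> (f i)) S $$ (i,j)"
    unfolding \<Phi>_def using ij rho_rep(3,4) M_in_L by (auto intro!: sum.cong)
  finally show "\<Phi> (msum m m f S) $$ (i,j) = msum n n (\<lambda>i. \<Phi> (f i)) S $$ (i,j)" .
qed auto

lemma Phi_smult: "X \<in> carrier_mat m m \<Longrightarrow> \<Phi> (c \<cdot>\<^sub>m X) = c \<cdot>\<^sub>m \<Phi> X"
  unfolding \<Phi>_def using rho_rep(2) M_in_L
  by (subst smult_msum) (auto simp: cf_smult mat_smult_smult)

lemma bij_mult_right: "y \<in> M \<Longrightarrow> bij_betw (\<lambda>x. x \<otimes> y) M M"
proof (rule bij_betwI[where g = "\<lambda>x. x \<otimes> inv y"])
  assume y: "y \<in> M"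
  show "(\<lambda>x. x \<otimes> y) \<in> M \<rightarrow> M" "(\<lambda>x. x \<otimes> inv y) \<in> M \<rightarrow> M"
    using M(1) y subgroup.m_closed subgroup.m_inv_closed by fastforce+
  show "x \<otimes> y \<otimes> inv y = x" "x \<otimes> inv y \<otimes> y = x" if "x \<in> M" for x
    using that y subgroup.mem_carrier[OF M(1)] by (auto simp: m_assoc)
qed

lemma bij_mult_left: "y \<in> M \<Longrightarrow> bij_betw (\<lambda>x. y \<otimes> x) M M"
proof (rule bij_betwI[where g = "\<lambda>x. inv y \<otimes> x"])
  assume y: "y \<in> M"
  show "(\<lambda>x. y \<otimes> x) \<in> M \<rightarrow> M" "(\<lambda>x. inv y \<otimes> x) \<in> M \<rightarrow> M"
    using M(1) y subgroup.m_closed subgroup.m_inv_closed by fastforce+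
  show "inv y \<otimes> (y \<otimes> x) = x" "y \<otimes> (inv y \<otimes> x) = x" if "x \<in> M" for x
    using that y subgroup.mem_carrier[OF M(1)] by (auto simp: m_assoc[symmetric])
qed

lemma Phi_left: 
  assumes y: "y \<in> M" and X: "X \<in> carrier_mat m m"
  shows "\<Phi> (\<sigma> y * X) = \<rho> y * \<Phi> X"
proof -
  have tm: "cf (x \<otimes> y) (\<sigma> y * X) \<cdot>\<^sub>m \<rho> (x \<otimes> y) = \<rho> y * (cf x X \<cdot>\<^sub>m \<rho> x)" if x: "x \<in> M" for x
  proof -
    have xy: "x \<otimes> y \<in> M" using subgroup.m_closed[OF M(1) x y] .
    have "\<sigma>' (x \<otimes> y) * (\<sigma> y * X) = \<alpha> (x,y) \<cdot>\<^sub>m (\<sigma>' x * ((\<sigma>' y * \<sigma> y) * X))"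
      unfolding rep_inv_mult[OF M(1) sub(3) x y] using sigma_inv(4,5)[OF x] sigma_inv(4,5)[OF y] sigma_rep(3,4)[OF y] X
      by (simp add: mat_algebra)
    also have "\<dots> = \<alpha> (x,y) \<cdot>\<^sub>m (\<sigma>' x * X)" using sigma_inv(2)[OF y] X by (simp add: mat_algebra)
    finally have "cf (x \<otimes> y) (\<sigma> y * X) = \<alpha> (x,y) * cf x X"
      using cf_tr[OF xy, of "\<sigma> y * X"] cf_tr[OF x X] X sigma_rep(2)[OF y] sigma_inv(1)[OF x]
      by (simp add: tr_smult[of "\<sigma>' x * X" m])
    then show ?thesis using rho_rep(6)[of x y] M_in_L x y xy rho_rep(3,4) by (simp add: mat_algebra mult.commute)
  qed
  have "\<Phi> (\<sigma> y * X) = msum n n (\<lambda>x. cf (x \<otimes> y) (\<sigma> y * X) \<cdot>\<^sub>m \<rho> (x \<otimes> y)) M"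
    unfolding \<Phi>_def by (rule msum_reindex[OF bij_mult_right[OF y]])
  also have "\<dots> = msum n n (\<lambda>x. \<rho> y * (cf x X \<cdot>\<^sub>m \<rho> x)) M" by (rule msum_cong) (rule tm)
  also have "\<dots> = \<rho> y * \<Phi> X" unfolding \<Phi>_def
    by (rule mult_msum[symmetric]) (use rho_rep(2) M_in_L y in auto)
  finally show ?thesis .
qed

lemma Phi_right: 
  assumes y: "y \<in> M" and X: "X \<in> carrier_mat m m"
  shows "\<Phi> (X * \<sigma> y) = \<Phi> X * \<rho> y"
proof -
  have tm: "cf (y \<otimes> x) (X * \<sigma> y) \<cdot>\<^sub>m \<rho> (y \<otimes> x) = (cf x X \<cdot>\<^sub>m \<rho> x) * \<rho> y" if x: "x \<in> M" for x
  proof -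
    have xy: "y \<otimes> x \<in> M" using subgroup.m_closed[OF M(1) y x] .
    have "\<sigma>' (y \<otimes> x) * (X * \<sigma> y) = \<alpha> (y,x) \<cdot>\<^sub>m (\<sigma>' y * (\<sigma>' x * X * \<sigma> y))"
      unfolding rep_inv_mult[OF M(1) sub(3) y x] using sigma_inv(4,5)[OF x] sigma_inv(4,5)[OF y] sigma_rep(3,4)[OF y] X
      by (simp add: mat_algebra)
    then have "tr (\<sigma>' (y \<otimes> x) * (X * \<sigma> y)) = \<alpha> (y,x) * tr (\<sigma>' y * (\<sigma>' x * X * \<sigma> y))"
      using tr_smult[of "\<sigma>' y * (\<sigma>' x * X * \<sigma> y)" m "\<alpha> (y,x)"] sigma_inv(4)[OF y] sigma_rep(4)[OF y] by simp
    also have "tr (\<sigma>' y * (\<sigma>' x * X * \<sigma> y)) = tr ((\<sigma>' x * X * \<sigma> y) * \<sigma>' y)"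
      by (rule tr_mult_commute[of _ m m]) (use sigma_inv(1)[OF x] sigma_inv(1)[OF y] sigma_rep(2)[OF y] X in auto)
    also have "(\<sigma>' x * X * \<sigma> y) * \<sigma>' y = \<sigma>' x * X"
      using sigma_inv[OF x] sigma_inv[OF y] sigma_rep(3,4)[OF y] X by (simp add: mat_algebra)
    finally have "cf (y \<otimes> x) (X * \<sigma> y) = \<alpha> (y,x) * cf x X"
      using cf_tr[OF xy, of "X * \<sigma> y"] cf_tr[OF x X] X sigma_rep(2)[OF y] by simp
    then show ?thesis using rho_rep(6)[of y x] M_in_L x y xy rho_rep(3,4) by (simp add: mat_algebra mult.commute)
  qed
  have "\<Phi> (X * \<sigma> y) = msum n n (\<lambda>x. cf (y \<otimes> x) (X * \<sigma> y) \<cdot>\<^sub>m \<rho> (y \<otimes> x)) M"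
    unfolding \<Phi>_def by (rule msum_reindex[OF bij_mult_left[OF y]])
  also have "\<dots> = msum n n (\<lambda>x. (cf x X \<cdot>\<^sub>m \<rho> x) * \<rho> y) M" by (rule msum_cong) (rule tm)
  also have "\<dots> = \<Phi> X * \<rho> y" unfolding \<Phi>_def
    by (rule msum_mult[symmetric]) (use rho_rep(2) M_in_L y in auto)
  finally show ?thesis .
qed

lemma sigma_expansion: "X \<in> carrier_mat m m \<Longrightarrow> msum m m (\<lambda>x. cf x X \<cdot>\<^sub>m \<sigma> x) M = X"
  by (rule schur_expansion[OF M(1) finM sub(3,4)])

lemma Phi_mult:
  assumes X: "X \<in> carrier_mat m m" and Y: "Y \<in> carrier_mat m m"
  shows "\<Phi> (X * Y) = \<Phi> X * \<Phi> Y"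
proof -
  have "\<Phi> X * \<Phi> Y = msum n n (\<lambda>x. (cf x X \<cdot>\<^sub>m \<rho> x) * \<Phi> Y) M"
    unfolding \<Phi>_def[of X] by (rule msum_mult) (use rho_rep(2) M_in_L in auto)
  also have "\<dots> = msum n n (\<lambda>x. \<Phi> ((cf x X \<cdot>\<^sub>m \<sigma> x) * Y)) M"
    using rho_rep(2,3,4) sigma_rep(2,3,4) M_in_L Y Phi_left[OF _ Y] mult_carrier_mat[OF sigma_rep(2) Y]
    by (intro msum_cong) (simp add: mat_smult_left Phi_smult)
  also have "\<dots> = \<Phi> (msum m m (\<lambda>x. (cf x X \<cdot>\<^sub>m \<sigma> x) * Y) M)" by (simp add: Phi_msum)
  also have "msum m m (\<lambda>x. (cf x X \<cdot>\<^sub>m \<sigma> x) * Y) M = X * Y"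
    using msum_mult[OF Y, of M "\<lambda>x. cf x X \<cdot>\<^sub>m \<sigma> x" m] sigma_rep(2) sigma_expansion[OF X] by simp
  finally show ?thesis by simp
qed

lemma Phi_B:
  assumes X: "X \<in> carrier_mat m m"
  shows "\<Phi> X * B = B * X"
proof -
  have "\<Phi> X * B = msum n m (\<lambda>x. (cf x X \<cdot>\<^sub>m \<rho> x) * B) M"
    unfolding \<Phi>_def by (rule msum_mult) (use rho_rep(2) M_in_L sub(1) in auto)
  also have "\<dots> = msum n m (\<lambda>x. B * (cf x X \<cdot>\<^sub>m \<sigma> x)) M"
    using rho_rep(3,4) sigma_rep(3,4) M_in_L Bdim sub(5) by (intro msum_cong) (simp add: mat_algebra)
  also have "\<dots> = B * msum m m (\<lambda>x. cf x X \<cdot>\<^sub>m \<sigma> x) M"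
    by (rule mult_msum[symmetric]) (use sigma_rep(2) sub(1) in auto)
  finally show ?thesis using sigma_expansion[OF X] by simp
qed

lemma Phi_inj:
  assumes "X \<in> carrier_mat m m" "Y \<in> carrier_mat m m" "\<Phi> X = \<Phi> Y" shows "X = Y"
  using inj_mat_cancel[OF sub(2,1) assms(1,2)] Phi_B assms by metis

lemma spanM_carrier: "\<rho> ` M \<subseteq> carrier_mat n n" using rho_rep(2) M_in_L by auto

lemma Phi_span: "\<Phi> X \<in> mat_span n (\<rho> ` M)"
  unfolding \<Phi>_def
  by (intro msum_in_span finM mat_span_smult mat_span_base spanM_carrier imageI)

text \<open>The unit of the block, that is, the projection onto the homogeneous component of \<open>\<sigma>\<close>.\<close>

definition P where "P = \<Phi> (1\<^sub>m m)"

lemma P_carrier [simp]: "P \<in> carrier_mat n n" "dim_row P = n" "dim_col P = n" unfolding P_def by auto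

lemma P_idem: "P * P = P"
  unfolding P_def using Phi_mult[of "1\<^sub>m m" "1\<^sub>m m"] by simp

lemma P_commute: "y \<in> M \<Longrightarrow> P * \<rho> y = \<rho> y * P"
  unfolding P_def using Phi_left[of y "1\<^sub>m m"] Phi_right[of y "1\<^sub>m m"] sigma_rep(2)[of y] by simp

lemma P_nonzero: "P \<noteq> 0\<^sub>m n n"
proof
  assume "P = 0\<^sub>m n n"
  then have "B * 1\<^sub>m m = B * 0\<^sub>m m m" using Phi_B[of "1\<^sub>m m"] sub(1) unfolding P_def by auto
  then have "1\<^sub>m m = (0\<^sub>m m m :: complex mat)" using inj_mat_cancel[OF sub(2,1), of "1\<^sub>m m" m "0\<^sub>m m m"] by auto
  then have "1\<^sub>m m $$ (0,0) = (0\<^sub>m m m :: complex mat) $$ (0,0)" by simp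
  then show False using sigma_rep(1) by simp
qed

lemma span_commute:
  assumes X: "X \<in> carrier_mat n n" and c: "\<And>y. y \<in> M \<Longrightarrow> X * \<rho> y = \<rho> y * X" and Z: "Z \<in> mat_span n (\<rho> ` M)"
  shows "X * Z = Z * X"
  using Z
proof induction
  case mat_span_zero
  then show ?case using X by simp
next
  case (mat_span_add_smult Z A d)
  then obtain y where y: "y \<in> M" "A = \<rho> y" by auto
  note Zc = mat_span_carrier[OF spanM_carrier mat_span_add_smult(1)]
  show ?case using mat_span_add_smult(3) c[OF y(1)] Zc X rho_rep(2,3,4)[OF M_in_L[OF y(1)]] unfolding y(2)
    by (simp add: mat_add_mult mat_mult_add mat_smult_left mat_smult_right)
qed

text \<open>The matrix by which \<open>Q\<close> acts on the columns of \<open>B\<close> commutes with \<open>\<sigma>\<close>, so that it is a scalar, and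
  \<open>\<Phi>\<close> sends it to \<open>Q P\<close>.\<close>

lemma central_mult_P:
  assumes Q: "Q \<in> mat_span n (\<rho> ` M)" and com: "\<And>y. y \<in> M \<Longrightarrow> Q * \<rho> y = \<rho> y * Q"
  obtains k where "Q * P = k \<cdot>\<^sub>m P"
proof -
  have Qc: "Q \<in> carrier_mat n n" using mat_span_carrier[OF spanM_carrier Q] .
  have "\<exists>s. s \<in> carrier_mat m m \<and> Q * P = \<Phi> s \<and> Q * B = B * s" using Q
  proof induction
    case mat_span_zero
    have "\<Phi> (0\<^sub>m m m) = 0\<^sub>m n n" using Phi_smult[of "0\<^sub>m m m" 0] zero_smult_mat[of "\<Phi> (0\<^sub>m m m)" n n]
      by simp
    then show ?case using sub(1) by (intro exI[of _ "0\<^sub>m m m"]) auto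
  next
    case (mat_span_add_smult Z A d)
    then obtain y s where y: "y \<in> M" "A = \<rho> y" and s: "s \<in> carrier_mat m m" "Z * P = \<Phi> s" "Z * B = B * s" by auto
    have Zc: "Z \<in> carrier_mat n n" by (rule mat_span_carrier[OF spanM_carrier mat_span_add_smult(1)])
    have add: "\<Phi> (X + Y) = \<Phi> X + \<Phi> Y" if "X \<in> carrier_mat m m" "Y \<in> carrier_mat m m" for X Y
    proof -
      have "X + Y = msum m m (\<lambda>b. if b then X else Y) UNIV" using that by (intro eq_matI) (auto simp: UNIV_bool)
      moreover have "\<Phi> X + \<Phi> Y = msum n n (\<lambda>b. \<Phi> (if b then X else Y)) UNIV" by (intro eq_matI) (auto simp: UNIV_bool)
      ultimately show ?thesis using Phi_msum by metis
    qed
    have "\<Phi> (d \<cdot>\<^sub>m \<sigma> y) = d \<cdot>\<^sub>m (\<rho> y * P)" unfolding P_def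
      using Phi_smult[OF sigma_rep(2)[OF y(1)]] Phi_left[OF y(1), of "1\<^sub>m m"] sigma_rep(2)[OF y(1)] by simp
    then have "(Z + d \<cdot>\<^sub>m A) * P = \<Phi> (s + d \<cdot>\<^sub>m \<sigma> y)"
      using s y sigma_rep(2)[OF y(1)] rho_rep(2,3,4)[OF M_in_L[OF y(1)]] Zc add
      by (simp add: mat_add_mult mat_smult_left)
    moreover have "(Z + d \<cdot>\<^sub>m A) * B = B * (s + d \<cdot>\<^sub>m \<sigma> y)"
      using s y sigma_rep(2,3,4)[OF y(1)] rho_rep(2,3,4)[OF M_in_L[OF y(1)]] Zc sub(1) sub(5)[OF y(1)] Bdim
      by (simp add: mat_add_mult mat_mult_add mat_smult_left mat_smult_right)
    ultimately show ?case using s sigma_rep(2)[OF y(1)] by (intro exI[of _ "s + d \<cdot>\<^sub>m \<sigma> y"]) auto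
  qed
  then obtain s where s: "s \<in> carrier_mat m m" "Q * P = \<Phi> s" "Q * B = B * s" by auto
  have "s * \<sigma> y = \<sigma> y * s" if y: "y \<in> M" for y
  proof (rule inj_mat_cancel[OF sub(2,1), where k = m])
    have "B * (s * \<sigma> y) = Q * (B * \<sigma> y)" using s sigma_rep(3)[OF y] Bdim Qc
      by (metis mat_assoc carrier_matD)
    also have "\<dots> = (Q * \<rho> y) * B" using sub(5)[OF y] Bdim Qc rho_rep(3,4)[OF M_in_L[OF y]]
      by (metis mat_assoc carrier_matD)
    also have "\<dots> = \<rho> y * (B * s)" using com[OF y] s(3) Bdim Qc rho_rep(3,4)[OF M_in_L[OF y]]
      by (metis mat_assoc carrier_matD)
    also have "\<dots> = B * (\<sigma> y * s)" using sub(5)[OF y] Bdim s(1) sigma_rep(3,4)[OF y] rho_rep(3,4)[OF M_in_L[OF y]]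
      by (metis mat_assoc carrier_matD)
    finally show "B * (s * \<sigma> y) = B * (\<sigma> y * s)" .
  qed (use s sigma_rep(2)[OF y] in auto)
  then obtain k where "s = k \<cdot>\<^sub>m 1\<^sub>m m" using schur_scalar[OF sub(4) sigma_rep(2) sigma_rep(1) s(1)] by metis
  then have "Q * P = k \<cdot>\<^sub>m P" using s(2) Phi_smult[of "1\<^sub>m m" k] unfolding P_def by simp
  then show ?thesis using that by blast
qed

lemma rho_move_left:
  assumes g: "g \<in> L" and x: "x \<in> M"
  obtains c y where "c \<noteq> 0" "y \<in> M" "\<rho> g * \<rho> x = c \<cdot>\<^sub>m (\<rho> y * \<rho> g)"
proof -
  define y where "y = inv g \<otimes> x \<otimes> g"
  have y: "y \<in> M" unfolding y_def using normal[OF g x] .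
  have xL: "x \<in> L" and yL: "y \<in> L" using M_in_L x y by auto
  have eq: "g \<otimes> y = x \<otimes> g" unfolding y_def using L_in_G[OF g] L_in_G[OF xL]
    by (metis inv_closed m_assoc m_closed r_inv l_one)
  have "\<rho> g * \<rho> x = (\<alpha> (x,g) / \<alpha> (g,y)) \<cdot>\<^sub>m (\<rho> y * \<rho> g)"
    using rho_rep(6)[OF xL g] rho_rep(6)[OF g yL] rho_rep(5)[OF g yL] eq by (simp add: mat_algebra)
  then show ?thesis using that[of "\<alpha> (x,g) / \<alpha> (g,y)" y] y rho_rep(5)[OF xL g] rho_rep(5)[OF g yL] by simp
qed

lemma rho_move_right:
  assumes g: "g \<in> L" and x: "x \<in> M"
  obtains c y where "c \<noteq> 0" "y \<in> M" "\<rho> x * \<rho> g = c \<cdot>\<^sub>m (\<rho> g * \<rho> y)"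
proof -
  define y where "y = inv (inv g) \<otimes> x \<otimes> inv g"
  have iL: "inv g \<in> L" using subgroup.m_inv_closed[OF L(1) g] .
  have y: "y \<in> M" unfolding y_def using normal[OF iL x] .
  have xL: "x \<in> L" and yL: "y \<in> L" using M_in_L x y by auto
  have eq: "y \<otimes> g = g \<otimes> x" unfolding y_def using L_in_G[OF g] L_in_G[OF xL] L_in_G[OF iL]
    by (simp add: m_assoc)
  have "\<rho> x * \<rho> g = (\<alpha> (g,x) / \<alpha> (y,g)) \<cdot>\<^sub>m (\<rho> g * \<rho> y)"
    using rho_rep(6)[OF g xL] rho_rep(6)[OF yL g] rho_rep(5)[OF yL g] eq by (simp add: mat_algebra)
  then show ?thesis using that[of "\<alpha> (g,x) / \<alpha> (y,g)" y] y rho_rep(5)[OF g xL] rho_rep(5)[OF yL g] by simp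
qed

text \<open>Conjugation by \<open>\<rho> g\<close> permutes the matrices \<open>\<rho> x\<close> up to scalars, since \<open>M\<close> is normal. It therefore
  preserves their span and the centre of the span. The two cases are conjugation by \<open>g\<close> and by its
  inverse.\<close>

lemma conj_central:
  assumes g: "g \<in> L" and R: "(R, R') = (\<rho> g, \<rho>' g) \<or> (R, R') = (\<rho>' g, \<rho> g)"
  shows "R * P * R' \<in> mat_span n (\<rho> ` M)" "\<And>y. y \<in> M \<Longrightarrow> (R * P * R') * \<rho> y = \<rho> y * (R * P * R')"
proof -
  have Rc: "R \<in> carrier_mat n n" "R' \<in> carrier_mat n n" "R * R' = 1\<^sub>m n" "R' * R = 1\<^sub>m n"
    using R rho_inv[OF g] rho_rep(2)[OF g] by auto
  note Rd = carrier_matD[OF Rc(1)] carrier_matD[OF Rc(2)]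
  have c1: "\<exists>c y. y \<in> M \<and> R * \<rho> x * R' = c \<cdot>\<^sub>m \<rho> y" if x: "x \<in> M" for x
  proof (cases "(R, R') = (\<rho> g, \<rho>' g)")
    case True
    obtain c y where y: "y \<in> M" "\<rho> g * \<rho> x = c \<cdot>\<^sub>m (\<rho> y * \<rho> g)" using rho_move_left[OF g x] by metis
    have "R * \<rho> x * R' = c \<cdot>\<^sub>m (\<rho> y * (R * R'))" using True y(2) Rd rho_rep(3,4)[OF M_in_L[OF y(1)]]
      by (simp add: mat_algebra)
    then show ?thesis using y(1) rho_rep(3,4)[OF M_in_L[OF y(1)]] Rc by (auto simp: mat_algebra)
  next
    case False
    then have T: "(R, R') = (\<rho>' g, \<rho> g)" using R by auto
    obtain c y where y: "y \<in> M" "\<rho> x * \<rho> g = c \<cdot>\<^sub>m (\<rho> g * \<rho> y)" using rho_move_right[OF g x] by metis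
    have "R * \<rho> x * R' = c \<cdot>\<^sub>m ((R * R') * \<rho> y)" using T y(2) Rd rho_rep(3,4)[OF M_in_L[OF y(1)]] rho_rep(3,4)[OF M_in_L[OF x]]
      by (simp add: mat_algebra)
    then show ?thesis using y(1) rho_rep(3,4)[OF M_in_L[OF y(1)]] Rc by (auto simp: mat_algebra)
  qed
  have c2: "\<exists>c y. y \<in> M \<and> R' * \<rho> x * R = c \<cdot>\<^sub>m \<rho> y" if x: "x \<in> M" for x
  proof (cases "(R, R') = (\<rho> g, \<rho>' g)")
    case False
    then have T: "(R, R') = (\<rho>' g, \<rho> g)" using R by auto
    obtain c y where y: "y \<in> M" "\<rho> g * \<rho> x = c \<cdot>\<^sub>m (\<rho> y * \<rho> g)" using rho_move_left[OF g x] by metis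
    have "R' * \<rho> x * R = c \<cdot>\<^sub>m (\<rho> y * (R' * R))" using T y(2) Rd rho_rep(3,4)[OF M_in_L[OF y(1)]]
      by (simp add: mat_algebra)
    then show ?thesis using y(1) rho_rep(3,4)[OF M_in_L[OF y(1)]] Rc by (auto simp: mat_algebra)
  next
    case T: True
    obtain c y where y: "y \<in> M" "\<rho> x * \<rho> g = c \<cdot>\<^sub>m (\<rho> g * \<rho> y)" using rho_move_right[OF g x] by metis
    have "R' * \<rho> x * R = c \<cdot>\<^sub>m ((R' * R) * \<rho> y)" using T y(2) Rd rho_rep(3,4)[OF M_in_L[OF y(1)]] rho_rep(3,4)[OF M_in_L[OF x]]
      by (simp add: mat_algebra)
    then show ?thesis using y(1) rho_rep(3,4)[OF M_in_L[OF y(1)]] Rc by (auto simp: mat_algebra)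
  qed
  have "R * X * R' \<in> mat_span n (\<rho> ` M)" if "X \<in> mat_span n (\<rho> ` M)" for X using that
  proof induction
    case mat_span_zero
    have "R * 0\<^sub>m n n * R' = 0\<^sub>m n n" using Rc by simp
    then show ?case by (simp add: mat_span.intros)
  next
    case (mat_span_add_smult X A d)
    then obtain x where x: "x \<in> M" "A = \<rho> x" by auto
    have Xc: "X \<in> carrier_mat n n" by (rule mat_span_carrier[OF spanM_carrier mat_span_add_smult(1)])
    obtain c y where y: "y \<in> M" "R * \<rho> x * R' = c \<cdot>\<^sub>m \<rho> y" using c1[OF x(1)] by blast
    have "R * (X + d \<cdot>\<^sub>m A) * R' = R * X * R' + d \<cdot>\<^sub>m (R * \<rho> x * R')"
      using Rc Rd Xc x(2) rho_rep(2,3,4)[OF M_in_L[OF x(1)]]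
      by (simp add: mat_mult_add mat_add_mult mat_smult_left mat_smult_right)
    then show ?case using mat_span_add_smult(3) y by (auto simp: mat_smult_smult intro!: mat_span.intros)
  qed
  then show "R * P * R' \<in> mat_span n (\<rho> ` M)" using Phi_span unfolding P_def by blast
  show "(R * P * R') * \<rho> y = \<rho> y * (R * P * R')" if y: "y \<in> M" for y
  proof -
    obtain c z where z: "z \<in> M" "R' * \<rho> y * R = c \<cdot>\<^sub>m \<rho> z" using c2[OF y] by blast
    note yd = rho_rep(3,4)[OF M_in_L[OF y]] and zd = rho_rep(3,4)[OF M_in_L[OF z(1)]]
    have "(R * P * R') * \<rho> y = R * (P * (R' * (\<rho> y * (R * R'))))" using Rc Rd yd by (simp add: mat_algebra)
    also have "\<dots> = R * (P * ((R' * \<rho> y * R) * R'))" using Rd yd by (simp add: mat_assoc)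
    also have "\<dots> = c \<cdot>\<^sub>m (R * ((P * \<rho> z) * R'))" using z(2) Rd zd by (simp add: mat_algebra)
    also have "\<dots> = R * ((R' * \<rho> y * R) * (P * R'))" unfolding P_commute[OF z(1)] z(2) using Rd zd by (simp add: mat_algebra)
    also have "\<dots> = (R * R') * (\<rho> y * (R * (P * R')))" using Rd yd by (simp add: mat_assoc)
    also have "\<dots> = \<rho> y * (R * P * R')" using Rc Rd yd by (simp add: mat_algebra)
    finally show ?thesis .
  qed
qed

text \<open>The idempotent \<open>P\<close> and its conjugate \<open>Q\<close> are central, and each acts as a scalar on the component of the
  other. If the scalar is zero they are orthogonal; otherwise they are proportional, hence equal.\<close>

lemma P_dichotomy:
  assumes g: "g \<in> L"
  shows "P * \<rho> g = \<rho> g * P \<or> P * \<rho> g * P = 0\<^sub>m n n"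
proof -
  note gd = rho_rep(3,4)[OF g] rho_inv(4,5)[OF g]
  define Q where "Q = \<rho>' g * P * \<rho> g"
  define R where "R = \<rho> g * P * \<rho>' g"
  have Qd: "dim_row Q = n" "dim_col Q = n" and Rd: "dim_row R = n" "dim_col R = n"
    unfolding Q_def R_def using gd by auto
  obtain k where k: "Q * P = k \<cdot>\<^sub>m P"
    using central_mult_P[OF conj_central(1,2)[OF g, of "\<rho>' g" "\<rho> g"]] unfolding Q_def by blast
  obtain l where l: "R * P = l \<cdot>\<^sub>m P"
    using central_mult_P[OF conj_central(1,2)[OF g, of "\<rho> g" "\<rho>' g"]] unfolding R_def by blast
  have "P * Q = \<rho>' g * (R * P) * \<rho> g"
  proof -
    have "\<rho>' g * (R * P) * \<rho> g = (\<rho>' g * \<rho> g) * (P * (\<rho>' g * (P * \<rho> g)))"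
      unfolding R_def using gd by (simp add: mat_assoc)
    then show ?thesis unfolding Q_def using rho_inv(2)[OF g] gd by (simp add: mat_algebra)
  qed
  then have PQ: "P * Q = l \<cdot>\<^sub>m Q" unfolding l Q_def using gd by (simp add: mat_algebra)
  have "P * Q = Q * P"
    by (rule span_commute) (use P_commute conj_central(1)[OF g, of "\<rho>' g" "\<rho> g"] in \<open>auto simp: Q_def\<close>)
  then have kl: "k \<cdot>\<^sub>m P = l \<cdot>\<^sub>m Q" using k PQ by simp
  have QQ: "Q * Q = Q"
  proof -
    have "Q * Q = \<rho>' g * (P * ((\<rho> g * \<rho>' g) * (P * \<rho> g)))" unfolding Q_def using gd by (simp add: mat_assoc)
    also have "\<dots> = \<rho>' g * ((P * P) * \<rho> g)" using rho_inv(3)[OF g] gd by (simp add: mat_algebra)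
    finally show ?thesis unfolding P_idem Q_def using gd by (simp add: mat_algebra)
  qed
  have rQ: "\<rho> g * Q = P * \<rho> g"
  proof -
    have "\<rho> g * Q = (\<rho> g * \<rho>' g) * (P * \<rho> g)" unfolding Q_def using gd by (simp add: mat_assoc)
    then show ?thesis using rho_inv(3)[OF g] gd by (simp add: mat_algebra)
  qed
  show ?thesis
  proof (cases "k = 0")
    case True
    have "P * \<rho> g * P = \<rho> g * (Q * P)" using rQ gd Qd by (simp add: mat_assoc[symmetric])
    also have "\<dots> = 0\<^sub>m n n" unfolding k True zero_smult_mat[OF P_carrier(1)] using rho_rep(2)[OF g] by simp
    finally show ?thesis by simp
  next
    case False
    have P: "P = (l / k) \<cdot>\<^sub>m Q"
    proof (rule smult_mat_cancel[OF False])
      show "k \<cdot>\<^sub>m P = k \<cdot>\<^sub>m (l / k \<cdot>\<^sub>m Q)" using kl False by (simp add: mat_smult_smult)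
    qed
    define e where "e = l / k"
    have "e \<noteq> 0"
    proof
      assume "e = 0"
      then have "P = 0\<^sub>m n n" using P Qd unfolding e_def[symmetric] by auto
      then show False using P_nonzero by simp
    qed
    have "(e * e) \<cdot>\<^sub>m Q = (e \<cdot>\<^sub>m Q) * (e \<cdot>\<^sub>m Q)" using Qd QQ by (simp add: mat_algebra)
    also have "\<dots> = P * P" unfolding e_def P[symmetric] ..
    also have "\<dots> = e \<cdot>\<^sub>m Q" unfolding P_idem e_def P[symmetric] ..
    finally have "e \<cdot>\<^sub>m Q = (e * e) \<cdot>\<^sub>m Q" by simp
    then have "e \<cdot>\<^sub>m Q = e \<cdot>\<^sub>m (e \<cdot>\<^sub>m Q)" unfolding mat_smult_smult .
    then have "Q = e \<cdot>\<^sub>m Q" by (rule smult_mat_cancel[OF \<open>e \<noteq> 0\<close>])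
    then have "P = Q" using P unfolding e_def by simp
    then show ?thesis using rQ by simp
  qed
qed

end

section \<open>Induction from the stabiliser of a homogeneous component\<close>

context clifford
begin

text \<open>The subgroup \<open>S\<close> is the stabiliser of the homogeneous component, and \<open>\<tau>\<close> its action on this component.
  For \<open>g\<close> outside of \<open>S\<close> the compression of \<open>\<rho> g\<close> to the component vanishes. Thus the compression of the span of
  \<open>\<rho>(L)\<close>, the full matrix algebra, is the span of \<open>\<tau>(S)\<close>.\<close>

lemma inhomogeneous:
  assumes "P \<noteq> 1\<^sub>m n"
    and N: "N \<subseteq> L" "\<And>x. x \<in> N \<Longrightarrow> scalar_mat n (\<rho> x)"
  obtains S k \<tau> A where "subgroup S G" "S \<subset> L" "N \<subseteq> S" "proj_rep G S k \<alpha> \<tau>" "full k \<tau> S"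
    "A \<in> carrier_mat n k" "inj_mat A" "\<And>x. x \<in> S \<Longrightarrow> \<rho> x * A = A * \<tau> x"
    "n * card S = k * card L" "\<And>x. x \<in> N \<Longrightarrow> scalar_mat k (\<tau> x)"
proof -
  obtain k A C where A: "A \<in> carrier_mat n k" "C \<in> carrier_mat k n" "A * C = P" "C * A = 1\<^sub>m k" "inj_mat A"
    using idempotent_factorization[OF P_carrier(1) P_idem] by metis
  note Ad = carrier_matD[OF A(1)] carrier_matD[OF A(2)]
  have PA: "P * A = A" and CP: "C * P = C"
    unfolding A(3)[symmetric] using A(4) Ad by (simp_all add: mat_assoc mat_mult_one)
       (simp add: mat_assoc[symmetric] mat_one_mult)
  define S where "S = {g \<in> L. P * \<rho> g = \<rho> g * P}"
  define \<tau> where "\<tau> g = C * \<rho> g * A" for g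
  have SL: "x \<in> L" if "x \<in> S" for x using that unfolding S_def by auto
  have SP: "P * \<rho> x = \<rho> x * P" if "x \<in> S" for x using that unfolding S_def by auto
  have Sub: "subgroup S G"
  proof (rule subgroupI)
    show "S \<subseteq> carrier G" using SL L_in_G by auto
    have "\<one> \<in> S" unfolding S_def using subgroup.one_closed[OF L(1)] rho_rep(7) by (simp add: mat_algebra)
    then show "S \<noteq> {}" by auto
  next
    fix x assume x: "x \<in> S"
    note xL = SL[OF x]
    have iL: "inv x \<in> L" using subgroup.m_inv_closed[OF L(1) xL] .
    note d = rho_rep(3,4)[OF xL] rho_rep(3,4)[OF iL] rho_inv(4,5)[OF xL]
    have "\<rho>' x * (P * \<rho> x) * \<rho>' x = \<rho>' x * (\<rho> x * P) * \<rho>' x" using SP[OF x] by simp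
    then have "(\<rho>' x * P) * (\<rho> x * \<rho>' x) = (\<rho>' x * \<rho> x) * (P * \<rho>' x)" using d by (simp add: mat_assoc)
    then have c: "\<rho>' x * P = P * \<rho>' x" using rho_inv(2,3)[OF xL] d by (simp add: mat_algebra)
    define c where "c = 1 / (\<alpha> (x, inv x) * \<alpha> (\<one>, \<one>))"
    have "c \<noteq> 0" unfolding c_def using rho_rep(5)[OF xL iL] rho_rep(5) subgroup.one_closed[OF L(1)] by simp
    moreover have "\<rho>' x = c \<cdot>\<^sub>m \<rho> (inv x)" unfolding rep_inv_def c_def ..
    ultimately have "c \<cdot>\<^sub>m (P * \<rho> (inv x)) = c \<cdot>\<^sub>m (\<rho> (inv x) * P)" using c d by (simp add: mat_algebra)
    then have "P * \<rho> (inv x) = \<rho> (inv x) * P" using smult_mat_cancel \<open>c \<noteq> 0\<close> by blast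
    then show "inv x \<in> S" unfolding S_def using iL by simp
  next
    fix x y assume x: "x \<in> S" and y: "y \<in> S"
    note xL = SL[OF x] and yL = SL[OF y]
    have xyL: "x \<otimes> y \<in> L" using subgroup.m_closed[OF L(1) xL yL] .
    note d = rho_rep(3,4)[OF xL] rho_rep(3,4)[OF yL] rho_rep(3,4)[OF xyL]
    have "P * (\<rho> y * \<rho> x) = (P * \<rho> y) * \<rho> x" using d by (simp add: mat_assoc)
    also have "\<dots> = \<rho> y * (P * \<rho> x)" unfolding SP[OF y] using d by (simp add: mat_assoc)
    also have "\<dots> = (\<rho> y * \<rho> x) * P" unfolding SP[OF x] using d by (simp add: mat_assoc)
    finally have "\<alpha> (x,y) \<cdot>\<^sub>m (P * \<rho> (x \<otimes> y)) = \<alpha> (x,y) \<cdot>\<^sub>m (\<rho> (x \<otimes> y) * P)"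
      unfolding rho_rep(6)[OF xL yL] using d by (simp add: mat_algebra)
    then have "P * \<rho> (x \<otimes> y) = \<rho> (x \<otimes> y) * P" using smult_mat_cancel[OF rho_rep(5)[OF xL yL]] by blast
    then show "x \<otimes> y \<in> S" unfolding S_def using xyL by simp
  qed
  have SneL: "S \<noteq> L"
  proof
    assume "S = L"
    then have "scalar_mat n P" using commuting_imp_scalar[OF full rho_rep(2) rho_rep(1) P_carrier(1)] SP by auto
    then obtain c where c: "P = c \<cdot>\<^sub>m 1\<^sub>m n" unfolding scalar_mat_def by auto
    then have "(c * c) \<cdot>\<^sub>m 1\<^sub>m n = c \<cdot>\<^sub>m 1\<^sub>m n" using P_idem by (simp add: mat_algebra)
    then have "c * c = c" using smult_one_cancel rho_rep(1) by blast
    moreover have "c \<noteq> 0" using c P_nonzero zero_smult_mat[of "1\<^sub>m n" n n] by auto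
    ultimately show False using c assms(1) by (simp add: mat_smult_one)
  qed
  have \<tau>c: "\<tau> x \<in> carrier_mat k k" "dim_row (\<tau> x) = k" "dim_col (\<tau> x) = k" for x
    unfolding \<tau>_def using Ad by auto
  have hom: "\<rho> x * A = A * \<tau> x" if x: "x \<in> S" for x
  proof -
    note d = rho_rep(3,4)[OF SL[OF x]]
    have "A * \<tau> x = (A * C) * \<rho> x * A" unfolding \<tau>_def using Ad d by (simp add: mat_assoc)
    also have "\<dots> = \<rho> x * (P * A)" unfolding A(3) SP[OF x] using Ad d by (simp add: mat_assoc)
    finally show ?thesis unfolding PA by simp
  qed
  have k0: "0 < k"
  proof (rule ccontr)
    assume "\<not> 0 < k"
    then have "A * C = 0\<^sub>m n n" using Ad by (intro eq_matI) (auto simp: scalar_prod_def)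
    then show False using A(3) P_nonzero by simp
  qed
  have \<tau>rep: "proj_rep G S k \<alpha> \<tau>" unfolding proj_rep_def
  proof (intro conjI ballI)
    fix x y assume x: "x \<in> S" and y: "y \<in> S"
    have xy: "x \<otimes> y \<in> S" using subgroup.m_closed[OF Sub x y] .
    note d = rho_rep(3,4)[OF SL[OF x]] rho_rep(3,4)[OF SL[OF y]] rho_rep(3,4)[OF SL[OF xy]]
    show "\<alpha> (x,y) \<noteq> 0" using rho_rep(5) SL x y by auto
    have "\<tau> y * \<tau> x = C * \<rho> y * (A * \<tau> x)" unfolding \<tau>_def[of y] using Ad d \<tau>c by (simp add: mat_assoc)
    also have "\<dots> = C * (\<rho> y * \<rho> x) * A" unfolding hom[OF x, symmetric] using Ad d by (simp add: mat_assoc)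
    also have "\<dots> = \<alpha> (x,y) \<cdot>\<^sub>m \<tau> (x \<otimes> y)" unfolding rho_rep(6)[OF SL[OF x] SL[OF y]] \<tau>_def
      using Ad d by (simp add: mat_algebra)
    finally show "\<tau> y * \<tau> x = \<alpha> (x,y) \<cdot>\<^sub>m \<tau> (x \<otimes> y)" .
  next
    show "\<tau> \<one> = \<alpha> (\<one>,\<one>) \<cdot>\<^sub>m 1\<^sub>m k" unfolding \<tau>_def rho_rep(7) using Ad A(4) by (simp add: mat_algebra)
  qed (use k0 \<tau>c in auto)
  have off: "C * \<rho> g * A = 0\<^sub>m k k" if g: "g \<in> L" "g \<notin> S" for g
  proof -
    note d = rho_rep(3,4)[OF g(1)]
    have z: "P * \<rho> g * P = 0\<^sub>m n n" using P_dichotomy[OF g(1)] g unfolding S_def by auto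
    have "C * \<rho> g * A = (C * P) * \<rho> g * (P * A)" unfolding PA CP ..
    also have "\<dots> = C * (P * \<rho> g * P) * A" using Ad d by (simp add: mat_assoc)
    finally show ?thesis unfolding z using A(1,2) by simp
  qed
  have \<tau>S: "\<tau> ` S \<subseteq> carrier_mat k k" using \<tau>c by auto
  have \<tau>full: "full k \<tau> S" unfolding full_def
  proof
    fix Y :: "complex mat" assume Y: "Y \<in> carrier_mat k k"
    have comp: "C * X * A \<in> mat_span k (\<tau> ` S)" if "X \<in> mat_span n (\<rho> ` L)" for X using that
    proof induction
      case mat_span_zero
      have "C * 0\<^sub>m n n * A = 0\<^sub>m k k" using A by simp
      then show ?case by (simp add: mat_span.intros)
    next
      case (mat_span_add_smult X R d)
      then obtain g where g: "g \<in> L" "R = \<rho> g" by auto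
      have Lc: "\<rho> ` L \<subseteq> carrier_mat n n" using rho_rep(2) by auto
      note Xc = mat_span_carrier[OF Lc mat_span_add_smult(1)]
      have eq: "C * (X + d \<cdot>\<^sub>m R) * A = C * X * A + d \<cdot>\<^sub>m \<tau> g" unfolding \<tau>_def g(2)
        using Ad Xc rho_rep(3,4)[OF g(1)] by (simp add: mat_mult_add mat_add_mult mat_smult_left mat_smult_right)
      show ?case
      proof (cases "g \<in> S")
        case True
        then show ?thesis unfolding eq using mat_span_add_smult(3) by (auto intro!: mat_span.intros)
      next
        case False
        have "\<tau> g = 0\<^sub>m k k" using off[OF g(1) False] unfolding \<tau>_def .
        then have "C * (X + d \<cdot>\<^sub>m R) * A = C * X * A" unfolding eq using Ad by (intro eq_matI) auto
        then show ?thesis using mat_span_add_smult(3) by simp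
      qed
    qed
    have "A * Y * C \<in> mat_span n (\<rho> ` L)" using full Ad unfolding full_def by auto
    from comp[OF this] have "C * (A * Y * C) * A \<in> mat_span k (\<tau> ` S)" .
    also have "C * (A * Y * C) * A = (C * A) * Y * (C * A)" using Ad Y by (simp add: mat_assoc)
    also have "\<dots> = Y" unfolding A(4) using Y by simp
    finally show "Y \<in> mat_span k (\<tau> ` S)" .
  qed
  have finS: "finite S" using L(2) SL by (meson finite_subset subsetI)
  have dims: "n * card S = k * card L"
  proof -
    \<comment> \<open>The sum of all conjugates of \<open>P\<close> is a scalar \<open>e\<close>. Multiplied by \<open>P\<close> it keeps the conjugates
      by \<open>S\<close> only, which gives \<open>e = |S|\<close>, and its trace is \<open>|L|\<close> times that of \<open>P\<close>.\<close>
    define Z where "Z = msum n n (\<lambda>x. \<rho> x * P * \<rho>' x) L"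
    have tc: "\<rho> x * P * \<rho>' x \<in> carrier_mat n n" if "x \<in> L" for x using rho_rep(3)[OF that] rho_inv(5)[OF that] by simp
    have "Z * \<rho> y = \<rho> y * Z" if "y \<in> L" for y
      unfolding Z_def by (rule average_commutes[OF L(1) rep P_carrier(1) that])
    then have "scalar_mat n Z" using commuting_imp_scalar[OF full rho_rep(2) rho_rep(1)] unfolding Z_def by auto
    then obtain e where e: "Z = e \<cdot>\<^sub>m 1\<^sub>m n" unfolding scalar_mat_def by auto
    have "P * Z = msum n n (\<lambda>x. P * (\<rho> x * P * \<rho>' x)) L"
      unfolding Z_def by (rule mult_msum[OF P_carrier(1) tc])
    also have "\<dots> = msum n n (\<lambda>x. (if x \<in> S then 1 else 0) \<cdot>\<^sub>m P) L"
    proof (rule msum_cong)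
      fix x assume x: "x \<in> L"
      note d = rho_rep(3,4)[OF x] rho_inv(4,5)[OF x]
      have "P * (\<rho> x * P * \<rho>' x) = (P * \<rho> x) * P * \<rho>' x" using d by (simp add: mat_assoc)
      also have "\<dots> = (if x \<in> S then 1 else 0) \<cdot>\<^sub>m P"
      proof (cases "x \<in> S")
        case True
        have "(P * \<rho> x) * P * \<rho>' x = P * (\<rho> x * P) * \<rho>' x" using d by (simp add: mat_assoc)
        also have "\<dots> = (P * P) * (\<rho> x * \<rho>' x)" unfolding SP[OF True, symmetric] using d by (simp add: mat_assoc)
        finally show ?thesis using True rho_inv(3)[OF x] P_idem by (simp add: mat_algebra)
      next
        case False
        then have "P * \<rho> x * P = 0\<^sub>m n n" using P_dichotomy[OF x] x unfolding S_def by auto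
        then show ?thesis using False zero_smult_mat[OF P_carrier(1)] rho_inv(1)[OF x] by simp
      qed
      finally show "P * (\<rho> x * P * \<rho>' x) = (if x \<in> S then 1 else 0) \<cdot>\<^sub>m P" .
    qed
    also have "\<dots> = of_nat (card S) \<cdot>\<^sub>m P"
    proof (rule eq_matI)
      fix i j assume "i < dim_row (of_nat (card S) \<cdot>\<^sub>m P)" "j < dim_col (of_nat (card S) \<cdot>\<^sub>m P)"
      then have ij: "i < n" "j < n" by auto
      have "(\<Sum>x\<in>L. ((if x \<in> S then 1 else 0) \<cdot>\<^sub>m P) $$ (i,j)) = (\<Sum>x\<in>L. if x \<in> S then P $$ (i,j) else 0)"
        using ij by (intro sum.cong) auto
      also have "\<dots> = (\<Sum>x\<in>L \<inter> S. P $$ (i,j))" by (rule sum.inter_restrict[OF L(2), symmetric])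
      also have "L \<inter> S = S" using SL by auto
      finally show "msum n n (\<lambda>x. (if x \<in> S then 1 else 0) \<cdot>\<^sub>m P) L $$ (i,j) = (of_nat (card S) \<cdot>\<^sub>m P) $$ (i,j)"
        using ij by simp
    qed auto
    finally have PZ: "e \<cdot>\<^sub>m P = of_nat (card S) \<cdot>\<^sub>m P" unfolding e by (simp add: mat_algebra)
    have trP: "tr P = of_nat k" unfolding A(3)[symmetric] using tr_mult_commute[OF A(1,2)] A(4) by simp
    have "e * of_nat k = of_nat (card S) * (of_nat k :: complex)"
      using arg_cong[OF PZ, of tr] unfolding tr_smult[OF P_carrier(1)] trP .
    then have es: "e = of_nat (card S)" using k0 by simp
    have "tr Z = (\<Sum>x\<in>L. tr (\<rho> x * P * \<rho>' x))" unfolding Z_def by (rule tr_msum[OF tc])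
    also have "\<dots> = (\<Sum>x\<in>L. tr P)"
    proof (rule sum.cong[OF refl])
      fix x assume x: "x \<in> L"
      note d = rho_rep(3,4)[OF x] rho_inv(4,5)[OF x]
      have "tr (\<rho> x * P * \<rho>' x) = tr (\<rho>' x * (\<rho> x * P))"
        by (rule tr_mult_commute[of _ n n]) (use d rho_inv(1)[OF x] in auto)
      also have "\<rho>' x * (\<rho> x * P) = P" using d rho_inv(2)[OF x] by (simp add: mat_assoc[symmetric] mat_one_mult)
      finally show "tr (\<rho> x * P * \<rho>' x) = tr P" .
    qed
    finally have "of_nat n * e = of_nat (card L) * (of_nat k :: complex)" unfolding e trP
      by (simp add: tr_smult[of _ n] mult.commute)
    then have "(of_nat (n * card S) :: complex) = of_nat (k * card L)" unfolding es by (simp add: mult.commute)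
    then show ?thesis by (simp only: of_nat_eq_iff)
  qed
  have NS: "N \<subseteq> S"
  proof
    fix x assume x: "x \<in> N"
    then obtain c where "\<rho> x = c \<cdot>\<^sub>m 1\<^sub>m n" using N(2) unfolding scalar_mat_def by auto
    then show "x \<in> S" unfolding S_def using N(1) x by (auto simp: mat_algebra)
  qed
  have Nsc: "scalar_mat k (\<tau> x)" if x: "x \<in> N" for x
  proof -
    obtain c where "\<rho> x = c \<cdot>\<^sub>m 1\<^sub>m n" using N(2) x unfolding scalar_mat_def by auto
    then have "\<tau> x = c \<cdot>\<^sub>m 1\<^sub>m k" unfolding \<tau>_def using Ad A(4) by (simp add: mat_algebra)
    then show ?thesis unfolding scalar_mat_def by blast
  qed
  have "S \<subset> L" using SneL SL by auto
  from that[OF Sub this NS \<tau>rep \<tau>full A(1,5) hom dims Nsc] show ?thesis .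
qed

end

section \<open>The homogeneous case: tensor factorization\<close>

definition unit_mat :: "nat \<Rightarrow> nat \<Rightarrow> nat \<Rightarrow> complex mat" where
  "unit_mat m i j = mat m m (\<lambda>(a,b). if a = i \<and> b = j then 1 else 0)"

lemma unit_mat_carrier [simp]: "unit_mat m i j \<in> carrier_mat m m" "dim_row (unit_mat m i j) = m" "dim_col (unit_mat m i j) = m"
  by (auto simp: unit_mat_def)

lemma unit_mat_index [simp]: "a < m \<Longrightarrow> b < m \<Longrightarrow> unit_mat m i j $$ (a,b) = (if a = i \<and> b = j then 1 else 0)"
  by (auto simp: unit_mat_def)

lemma row_unit_mat_mult:
  assumes "X \<in> carrier_mat m m" "i < m" "k < m"
  shows "unit_mat m k i * X = msum m m (\<lambda>j. X $$ (i,j) \<cdot>\<^sub>m unit_mat m k j) {..<m}"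
proof (rule eq_matI)
  fix a b assume "a < dim_row (msum m m (\<lambda>j. X $$ (i,j) \<cdot>\<^sub>m unit_mat m k j) {..<m})"
    "b < dim_col (msum m m (\<lambda>j. X $$ (i,j) \<cdot>\<^sub>m unit_mat m k j) {..<m})"
  then have ab: "a < m" "b < m" by auto
  have "(unit_mat m k i * X) $$ (a,b) = (\<Sum>l<m. if l = i then (if a = k then X $$ (i,b) else 0) else 0)"
  proof -
    have "(unit_mat m k i * X) $$ (a,b) = (\<Sum>l<m. unit_mat m k i $$ (a,l) * X $$ (l,b))"
      using ab assms(1) by (simp add: scalar_prod_def atLeast0LessThan del: unit_mat_index)
    also have "\<dots> = (\<Sum>l<m. if l = i then (if a = k then X $$ (i,b) else 0) else 0)"
      using ab by (intro sum.cong) auto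
    finally show ?thesis .
  qed
  also have "\<dots> = (\<Sum>j<m. if j = b then (if a = k then X $$ (i,b) else 0) else 0)"
    using ab assms(2) by simp
  also have "\<dots> = (\<Sum>j<m. (X $$ (i,j) \<cdot>\<^sub>m unit_mat m k j) $$ (a,b))"
    using ab by (intro sum.cong) auto
  finally show "(unit_mat m k i * X) $$ (a,b) = msum m m (\<lambda>j. X $$ (i,j) \<cdot>\<^sub>m unit_mat m k j) {..<m} $$ (a,b)"
    using ab by simp
qed (use assms in auto)

lemma mult_col_unit_mat:
  assumes "X \<in> carrier_mat m m" "j < m" "k < m"
  shows "X * unit_mat m j k = msum m m (\<lambda>i. X $$ (i,j) \<cdot>\<^sub>m unit_mat m i k) {..<m}"
proof (rule eq_matI)
  fix a b assume "a < dim_row (msum m m (\<lambda>i. X $$ (i,j) \<cdot>\<^sub>m unit_mat m i k) {..<m})"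
    "b < dim_col (msum m m (\<lambda>i. X $$ (i,j) \<cdot>\<^sub>m unit_mat m i k) {..<m})"
  then have ab: "a < m" "b < m" by auto
  have "(X * unit_mat m j k) $$ (a,b) = (\<Sum>l<m. if l = j then (if b = k then X $$ (a,j) else 0) else 0)"
  proof -
    have "(X * unit_mat m j k) $$ (a,b) = (\<Sum>l<m. X $$ (a,l) * unit_mat m j k $$ (l,b))"
      using ab assms(1) by (simp add: scalar_prod_def atLeast0LessThan del: unit_mat_index)
    also have "\<dots> = (\<Sum>l<m. if l = j then (if b = k then X $$ (a,j) else 0) else 0)"
      using ab by (intro sum.cong) auto
    finally show ?thesis .
  qed
  also have "\<dots> = (\<Sum>i<m. if i = a then (if b = k then X $$ (a,j) else 0) else 0)"
    using ab assms(2) by simp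
  also have "\<dots> = (\<Sum>i<m. (X $$ (i,j) \<cdot>\<^sub>m unit_mat m i k) $$ (a,b))"
    using ab by (intro sum.cong) auto
  finally show "(X * unit_mat m j k) $$ (a,b) = msum m m (\<lambda>i. X $$ (i,j) \<cdot>\<^sub>m unit_mat m i k) {..<m} $$ (a,b)"
    using ab by simp
qed (use assms in auto)

lemma unit_mat_mult:
  assumes "i < m" "j < m" "k < m"
  shows "unit_mat m i j * unit_mat m j k = unit_mat m i k"
proof (rule eq_matI)
  fix a b assume "a < dim_row (unit_mat m i k)" "b < dim_col (unit_mat m i k)"
  then have ab: "a < m" "b < m" by auto
  have "(unit_mat m i j * unit_mat m j k) $$ (a,b) = (\<Sum>l<m. if l = j then (if a = i \<and> b = k then 1 else 0) else 0)"
  proof -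
    have "(unit_mat m i j * unit_mat m j k) $$ (a,b) = (\<Sum>l<m. unit_mat m i j $$ (a,l) * unit_mat m j k $$ (l,b))"
      using ab by (simp add: scalar_prod_def atLeast0LessThan del: unit_mat_index)
    also have "\<dots> = (\<Sum>l<m. if l = j then (if a = i \<and> b = k then 1 else 0) else 0)"
      using ab by (intro sum.cong) auto
    finally show ?thesis .
  qed
  then show "(unit_mat m i j * unit_mat m j k) $$ (a,b) = unit_mat m i k $$ (a,b)" using ab assms by simp
qed auto

lemma unit_mat_corner:
  assumes "X \<in> carrier_mat m m" "0 < m"
  shows "unit_mat m 0 0 * X * unit_mat m 0 0 = X $$ (0,0) \<cdot>\<^sub>m unit_mat m 0 0"
proof (rule eq_matI)
  fix a b assume "a < dim_row (X $$ (0,0) \<cdot>\<^sub>m unit_mat m 0 0)" "b < dim_col (X $$ (0,0) \<cdot>\<^sub>m unit_mat m 0 0)"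
  then have ab: "a < m" "b < m" by auto
  have 1: "(unit_mat m 0 0 * X) $$ (a,c) = (if a = 0 then X $$ (0,c) else 0)" if "c < m" for c
  proof -
    have "(unit_mat m 0 0 * X) $$ (a,c) = (\<Sum>l<m. if l = 0 then (if a = 0 then X $$ (0,c) else 0) else 0)"
    proof -
      have "(unit_mat m 0 0 * X) $$ (a,c) = (\<Sum>l<m. unit_mat m 0 0 $$ (a,l) * X $$ (l,c))"
        using ab that assms(1) by (simp add: scalar_prod_def atLeast0LessThan del: unit_mat_index)
      also have "\<dots> = (\<Sum>l<m. if l = 0 then (if a = 0 then X $$ (0,c) else 0) else 0)"
        using ab by (intro sum.cong) auto
      finally show ?thesis .
    qed
    then show ?thesis using assms by simp
  qed
  have "(unit_mat m 0 0 * X * unit_mat m 0 0) $$ (a,b) = (\<Sum>l<m. (unit_mat m 0 0 * X) $$ (a,l) * unit_mat m 0 0 $$ (l,b))"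
    using ab assms(1) by (simp add: scalar_prod_def[of "row _ _"] atLeast0LessThan del: unit_mat_index)
  also have "\<dots> = (\<Sum>l<m. if l = 0 then (if b = 0 \<and> a = 0 then X $$ (0,0) else 0) else 0)"
    using ab by (intro sum.cong) (auto simp: 1)
  finally show "(unit_mat m 0 0 * X * unit_mat m 0 0) $$ (a,b) = (X $$ (0,0) \<cdot>\<^sub>m unit_mat m 0 0) $$ (a,b)"
    using ab assms by simp
qed (use assms in auto)

lemma one_unit_mat: "1\<^sub>m m = msum m m (\<lambda>i. unit_mat m i i) {..<m}"
proof (rule eq_matI)
  fix a b assume "a < dim_row (msum m m (\<lambda>i. unit_mat m i i) {..<m})" "b < dim_col (msum m m (\<lambda>i. unit_mat m i i) {..<m})"
  then have ab: "a < m" "b < m" by auto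
  have "(\<Sum>i<m. unit_mat m i i $$ (a,b)) = (\<Sum>i<m. if i = a then (if a = b then 1 else 0) else 0)"
    using ab by (intro sum.cong) auto
  then show "1\<^sub>m m $$ (a,b) = msum m m (\<lambda>i. unit_mat m i i) {..<m} $$ (a,b)" using ab by simp
qed auto

lemma normalize_det:
  assumes "T \<in> carrier_mat m m" "0 < m" "det T \<noteq> 0"
  obtains c :: complex where "c \<noteq> 0" "det (c \<cdot>\<^sub>m T) = 1"
proof -
  define w where "w = 1 / det T"
  define c where "c = rcis (root m (cmod w)) (Arg w / of_nat m)"
  have cw: "c ^ m = w" unfolding c_def DeMoivre2 using assms(2) by (simp add: rcis_cmod_Arg)
  moreover have "w \<noteq> 0" using assms(3) unfolding w_def by simp
  ultimately have "c \<noteq> 0" using assms(2) by auto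
  then show ?thesis using that[of c] assms cw unfolding w_def by simp
qed

context clifford
begin

text \<open>If \<open>P = 1\<close>, then \<open>\<rho>\<close> is a multiple of \<open>\<sigma>\<close> on \<open>M\<close>, so that \<open>\<sigma>\<close> and its conjugate by \<open>g\<close> are equivalent. The
  matrix \<open>T\<close> is such an equivalence: the embedding \<open>B\<close> followed by \<open>\<rho> g\<close> and by a projection \<open>D r\<close> back to
  \<open>\<sigma>\<close>. Removing \<open>T\<close> from \<open>\<rho> g\<close> leaves a matrix that commutes with \<open>\<rho>(M)\<close>.\<close>

lemma twisted_intertwiner:
  assumes P1: "P = 1\<^sub>m n" and g: "g \<in> L"
  obtains T T' where "T \<in> carrier_mat m m" "T' \<in> carrier_mat m m" "T * T' = 1\<^sub>m m" "T' * T = 1\<^sub>m m"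
    "det T = 1" "\<And>y. y \<in> M \<Longrightarrow> (\<Phi> T' * \<rho> g) * \<rho> y = \<rho> y * (\<Phi> T' * \<rho> g)"
proof -
  have m0: "0 < m" by (rule sigma_rep(1))
  note gd = rho_rep(3,4)[OF g]
  define E where "E i j = \<Phi> (unit_mat m i j)" for i j
  have Ed: "E i j \<in> carrier_mat n n" "dim_row (E i j) = n" "dim_col (E i j) = n" for i j unfolding E_def by auto
  \<comment> \<open>Row \<open>r\<close> of the matrices \<open>\<Phi>(E\<^sub>0\<^sub>i)\<close>, collected over \<open>i\<close>: these maps intertwine \<open>\<rho>\<close> with \<open>\<sigma>\<close>, and
    jointly they are injective, so that one of them does not vanish on the translate of \<open>B\<close>.\<close>
  define D where "D r = mat m n (\<lambda>(i,c). E 0 i $$ (r,c))" for r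
  have Dd: "D r \<in> carrier_mat m n" "dim_row (D r) = m" "dim_col (D r) = n" for r unfolding D_def by auto
  have D\<Phi>: "D r * \<Phi> X = X * D r" if r: "r < n" and X: "X \<in> carrier_mat m m" for r X
  proof (rule eq_matI)
    fix i c assume "i < dim_row (X * D r)" "c < dim_col (X * D r)"
    then have ic: "i < m" "c < n" using X Dd by auto
    have "E 0 i * \<Phi> X = \<Phi> (unit_mat m 0 i * X)" unfolding E_def using Phi_mult[OF _ X] by simp
    also have "\<dots> = msum n n (\<lambda>j. X $$ (i,j) \<cdot>\<^sub>m E 0 j) {..<m}"
      unfolding row_unit_mat_mult[OF X ic(1) m0] Phi_msum E_def by (rule msum_cong) (simp add: Phi_smult)
    finally have eq: "E 0 i * \<Phi> X = msum n n (\<lambda>j. X $$ (i,j) \<cdot>\<^sub>m E 0 j) {..<m}" .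
    have "(D r * \<Phi> X) $$ (i,c) = (E 0 i * \<Phi> X) $$ (r,c)"
      using ic r Ed by (auto simp: D_def scalar_prod_def)
    also have "\<dots> = (\<Sum>j<m. X $$ (i,j) * E 0 j $$ (r,c))" unfolding eq using r ic Ed by simp
    also have "\<dots> = (X * D r) $$ (i,c)" using ic r X by (auto simp: D_def scalar_prod_def atLeast0LessThan)
    finally show "(D r * \<Phi> X) $$ (i,c) = (X * D r) $$ (i,c)" .
  qed (use Dd X in auto)
  have "\<exists>r<n. D r * (\<rho> g * B) \<noteq> 0\<^sub>m m m"
  proof (rule ccontr)
    assume "\<not> ?thesis"
    then have z: "D r * (\<rho> g * B) = 0\<^sub>m m m" if "r < n" for r using that by auto
    have EX: "E 0 i * (\<rho> g * B) = 0\<^sub>m n m" if i: "i < m" for i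
    proof (rule eq_matI)
      fix r c assume "r < dim_row (0\<^sub>m n m)" "c < dim_col (0\<^sub>m n m)"
      then have rc: "r < n" "c < m" by auto
      have "(E 0 i * (\<rho> g * B)) $$ (r,c) = (D r * (\<rho> g * B)) $$ (i,c)"
        using rc i Ed gd Bdim by (auto simp: D_def scalar_prod_def intro!: sum.cong)
      then show "(E 0 i * (\<rho> g * B)) $$ (r,c) = 0\<^sub>m n m $$ (r,c)" using z rc i by simp
    qed (use Ed gd Bdim in auto)
    have one: "1\<^sub>m n = msum n n (\<lambda>i. E i 0 * E 0 i) {..<m}"
    proof -
      have "1\<^sub>m n = \<Phi> (msum m m (\<lambda>i. unit_mat m i i) {..<m})" using P1 unfolding P_def one_unit_mat[of m] by simp
      also have "\<dots> = msum n n (\<lambda>i. E i 0 * E 0 i) {..<m}" unfolding Phi_msum E_def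
        by (rule msum_cong) (use m0 in \<open>simp add: Phi_mult[symmetric] unit_mat_mult\<close>)
      finally show ?thesis .
    qed
    have "\<rho> g * B = 1\<^sub>m n * (\<rho> g * B)" using gd by (simp add: mat_one_mult)
    also have "\<dots> = msum n n (\<lambda>i. E i 0 * E 0 i) {..<m} * (\<rho> g * B)" unfolding one ..
    also have "\<dots> = msum n m (\<lambda>i. E i 0 * E 0 i * (\<rho> g * B)) {..<m}"
      by (rule msum_mult) (use gd Bdim Ed in auto)
    also have "\<dots> = msum n m (\<lambda>i. 0\<^sub>m n m) {..<m}"
    proof (rule msum_cong)
      fix i assume "i \<in> {..<m}"
      then have "E i 0 * E 0 i * (\<rho> g * B) = E i 0 * 0\<^sub>m n m" using EX gd Bdim Ed by (simp add: mat_assoc)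
      then show "E i 0 * E 0 i * (\<rho> g * B) = 0\<^sub>m n m" by (simp add: right_mult_zero_mat[OF Ed(1)])
    qed
    also have "\<dots> = 0\<^sub>m n m" by (intro eq_matI) auto
    finally have "\<rho>' g * (\<rho> g * B) = 0\<^sub>m n m" by (simp add: right_mult_zero_mat[OF rho_inv(1)[OF g]])
    then have "B = 0\<^sub>m n m" using gd Bdim rho_inv[OF g] by (simp add: mat_assoc[symmetric] mat_one_mult)
    then have "B * 1\<^sub>m m = B * 0\<^sub>m m m" by simp
    then have "1\<^sub>m m = (0\<^sub>m m m :: complex mat)" using inj_mat_cancel[OF sub(2,1), of "1\<^sub>m m" m "0\<^sub>m m m"] by simp
    then have "1\<^sub>m m $$ (0,0) = (0\<^sub>m m m :: complex mat) $$ (0,0)" by simp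
    then show False using m0 by simp
  qed
  then obtain r where r: "r < n" "D r * (\<rho> g * B) \<noteq> 0\<^sub>m m m" by blast
  define T where "T = D r * (\<rho> g * B)"
  have T: "T \<in> carrier_mat m m" "dim_row T = m" "dim_col T = m" unfolding T_def using Dd gd Bdim by auto
  have Tn: "T \<noteq> 0\<^sub>m m m" using r(2) unfolding T_def .
  have D\<rho>: "D r * \<rho> y = \<sigma> y * D r" if y: "y \<in> M" for y
  proof -
    have "\<Phi> (\<sigma> y) = \<rho> y" using Phi_left[OF y, of "1\<^sub>m m"] sigma_rep(2)[OF y] rho_rep(2)[OF M_in_L[OF y]] P1 unfolding P_def by simp
    then show ?thesis using D\<Phi>[OF r(1) sigma_rep(2)[OF y]] by simp
  qed
  \<comment> \<open>Up to a scalar, \<open>z\<close> is the conjugate of \<open>y\<close> by \<open>g\<close>.\<close>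
  have tw: "T * \<sigma> y = c \<cdot>\<^sub>m (\<sigma> z * T)" if y: "y \<in> M" and z: "z \<in> M" and e: "\<rho> g * \<rho> y = c \<cdot>\<^sub>m (\<rho> z * \<rho> g)" for y z c
  proof -
    note d = rho_rep(3,4)[OF M_in_L[OF y]] rho_rep(3,4)[OF M_in_L[OF z]] sigma_rep(3,4)[OF y] sigma_rep(3,4)[OF z]
    have "T * \<sigma> y = D r * (\<rho> g * (\<rho> y * B))" unfolding T_def sub(5)[OF y] using d gd Bdim Dd by (simp add: mat_assoc)
    also have "\<dots> = D r * ((\<rho> g * \<rho> y) * B)" using d gd Bdim Dd by (simp add: mat_assoc)
    also have "\<dots> = c \<cdot>\<^sub>m ((D r * \<rho> z) * (\<rho> g * B))" unfolding e using d gd Bdim Dd by (simp add: mat_algebra)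
    also have "\<dots> = c \<cdot>\<^sub>m (\<sigma> z * T)" unfolding D\<rho>[OF z] T_def using d gd Bdim Dd by (simp add: mat_assoc)
    finally show ?thesis .
  qed
  have "inj_mat T"
  proof -
    define W where "W = {v \<in> carrier_vec m. T *\<^sub>v v = 0\<^sub>v m}"
    have "vec_subspace m W" unfolding vec_subspace_def W_def using T
      by (auto simp: mult_add_distrib_mat_vec[of _ m m] mult_mat_vec[of _ m m])
    moreover have "\<sigma> y *\<^sub>v w \<in> W" if y: "y \<in> M" and w: "w \<in> W" for y w
    proof -
      obtain c z where z: "z \<in> M" "\<rho> g * \<rho> y = c \<cdot>\<^sub>m (\<rho> z * \<rho> g)" using rho_move_left[OF g y] by metis
      have wc: "w \<in> carrier_vec m" "T *\<^sub>v w = 0\<^sub>v m" using w unfolding W_def by auto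
      have "T *\<^sub>v (\<sigma> y *\<^sub>v w) = (T * \<sigma> y) *\<^sub>v w" using T sigma_rep(3,4)[OF y] wc by (simp add: mat_vec_assoc)
      also have "\<dots> = c \<cdot>\<^sub>v (\<sigma> z *\<^sub>v (T *\<^sub>v w))" unfolding tw[OF y z] using T sigma_rep(3,4)[OF z(1)] wc(1)
        by (simp add: mat_vec_assoc smult_mat_mult_vec)
      also have "\<dots> = 0\<^sub>v m" unfolding wc(2) using sigma_rep(2)[OF z(1)] by (intro eq_vecI) auto
      finally show ?thesis unfolding W_def using sigma_rep(2)[OF y] wc by simp
    qed
    ultimately have "W = {0\<^sub>v m} \<or> W = carrier_vec m" using sub(4) unfolding irreducible_on_def by blast
    moreover have "W \<noteq> carrier_vec m"
    proof
      assume W: "W = carrier_vec m"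
      have "T = 0\<^sub>m m m"
      proof (rule mat_mult_vec_eq_imp_eq[OF T(1)])
        fix v :: "complex vec" assume v: "v \<in> carrier_vec m"
        then have "T *\<^sub>v v = 0\<^sub>v m" using W unfolding W_def by blast
        also have "\<dots> = 0\<^sub>m m m *\<^sub>v v" using v by auto
        finally show "T *\<^sub>v v = 0\<^sub>m m m *\<^sub>v v" .
      qed simp
      then show False using Tn by simp
    qed
    ultimately have "W = {0\<^sub>v m}" by simp
    then show ?thesis unfolding inj_mat_def using T(2,3) unfolding W_def by auto
  qed
  then obtain S where S: "S \<in> carrier_mat m m" "T * S = 1\<^sub>m m" "S * T = 1\<^sub>m m"
    using square_inj_inverse[OF _ T(1)] by blast
  have "det T * det S = 1" using det_mult[OF T(1) S(1)] S(2) by simp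
  then have "det T \<noteq> 0" by auto
  then obtain c where c: "c \<noteq> 0" "det (c \<cdot>\<^sub>m T) = 1" using normalize_det[OF T(1) m0] by blast
  have Sd: "dim_row S = m" "dim_col S = m" using S by auto
  show ?thesis
  proof (rule that[of "c \<cdot>\<^sub>m T" "(1 / c) \<cdot>\<^sub>m S"])
    show "c \<cdot>\<^sub>m T * (1 / c \<cdot>\<^sub>m S) = 1\<^sub>m m" "1 / c \<cdot>\<^sub>m S * (c \<cdot>\<^sub>m T) = 1\<^sub>m m"
      using T Sd S c by (simp_all add: mat_algebra)
    show "det (c \<cdot>\<^sub>m T) = 1" by fact
    fix y assume y: "y \<in> M"
    obtain d z where z: "z \<in> M" "\<rho> g * \<rho> y = d \<cdot>\<^sub>m (\<rho> z * \<rho> g)" using rho_move_left[OF g y] by metis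
    note dd = rho_rep(3,4)[OF M_in_L[OF y]] rho_rep(3,4)[OF M_in_L[OF z(1)]] sigma_rep(3,4)[OF y] sigma_rep(3,4)[OF z(1)]
    have "S * (T * \<sigma> y) * S = d \<cdot>\<^sub>m (S * (\<sigma> z * T) * S)" unfolding tw[OF y z] using T Sd dd by (simp add: mat_algebra)
    moreover have "S * (T * \<sigma> y) * S = (S * T) * (\<sigma> y * S)" "S * (\<sigma> z * T) * S = S * \<sigma> z * (T * S)"
      using T Sd dd by (simp_all add: mat_assoc)
    ultimately have Ss: "\<sigma> y * S = d \<cdot>\<^sub>m (S * \<sigma> z)" using S Sd dd by (simp add: mat_algebra)
    have "\<Phi> S * \<rho> g * \<rho> y = \<Phi> S * (\<rho> g * \<rho> y)" using gd dd by (simp add: mat_assoc)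
    also have "\<dots> = d \<cdot>\<^sub>m ((\<Phi> S * \<rho> z) * \<rho> g)" unfolding z(2) using gd dd by (simp add: mat_algebra)
    also have "\<dots> = \<Phi> (d \<cdot>\<^sub>m (S * \<sigma> z)) * \<rho> g"
      using Phi_right[OF z(1) S(1)] Phi_smult[of "S * \<sigma> z" d] Sd dd gd by (simp add: mat_algebra)
    also have "\<dots> = \<rho> y * (\<Phi> S * \<rho> g)" unfolding Ss[symmetric] Phi_left[OF y S(1)] using gd dd by (simp add: mat_assoc)
    finally have *: "\<Phi> S * \<rho> g * \<rho> y = \<rho> y * (\<Phi> S * \<rho> g)" .
    show "\<Phi> (1 / c \<cdot>\<^sub>m S) * \<rho> g * \<rho> y = \<rho> y * (\<Phi> (1 / c \<cdot>\<^sub>m S) * \<rho> g)"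
      unfolding Phi_smult[OF S(1)] using * gd dd by (simp add: mat_algebra)
  qed (use T S in auto)
qed

text \<open>Each \<open>\<rho> g\<close> is a product of \<open>\<Phi>(T g)\<close> and a matrix \<open>\<omega> g\<close> that commutes with the image of \<open>\<Phi>\<close>. Since the two
  factors come from commuting algebras that meet in the scalars, \<open>T\<close> and \<open>\<omega>\<close> are
  multiplicative up to scalars, and so is the restriction \<open>W\<close> of \<open>\<omega>\<close> to the range of \<open>\<Phi>(E\<^sub>0\<^sub>0)\<close>. The
  maps \<open>F i\<close> from the space of \<open>W\<close> onto the ranges of \<open>\<Phi>(E\<^sub>i\<^sub>i)\<close> exhibit \<open>\<rho>\<close> as \<open>T \<otimes> W\<close>: the last claim says that
  \<open>e\<^sub>j \<otimes> w \<mapsto> F j w\<close> intertwines the two.\<close>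

lemma homogeneous:
  assumes P1: "P = 1\<^sub>m n"
    and N: "N \<subseteq> M" "\<And>x. x \<in> N \<Longrightarrow> scalar_mat n (\<rho> x)"
  obtains e T \<delta> W F where "proj_rep G L m \<delta> T" "\<And>x. x \<in> L \<Longrightarrow> det (T x) = 1" "irreducible_on m T M"
    "\<And>x. x \<in> N \<Longrightarrow> scalar_mat m (T x)"
    "proj_rep G L e (\<lambda>p. \<alpha> p / \<delta> p) W" "full e W L" "\<And>x. x \<in> M \<Longrightarrow> scalar_mat e (W x)"
    "n = m * e" "\<And>i. i < m \<Longrightarrow> F i \<in> carrier_mat n e" "inj_mat (F 0)"
    "\<And>g j. g \<in> L \<Longrightarrow> j < m \<Longrightarrow> \<rho> g * F j = msum n e (\<lambda>i. T g $$ (i,j) \<cdot>\<^sub>m (F i * W g)) {..<m}"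
proof -
  have m0: "0 < m" by (rule sigma_rep(1))
  have Phi1: "\<Phi> (1\<^sub>m m) = 1\<^sub>m n" using P1 unfolding P_def .
  have "\<forall>g. \<exists>T T'. g \<in> L \<longrightarrow> T \<in> carrier_mat m m \<and> T' \<in> carrier_mat m m \<and> T * T' = 1\<^sub>m m \<and> T' * T = 1\<^sub>m m \<and>
    det T = 1 \<and> (\<forall>y\<in>M. (\<Phi> T' * \<rho> g) * \<rho> y = \<rho> y * (\<Phi> T' * \<rho> g))"
    using twisted_intertwiner[OF P1] by metis
  then obtain T T' where TT: "\<And>g. g \<in> L \<Longrightarrow> T g \<in> carrier_mat m m \<and> T' g \<in> carrier_mat m m \<and> T g * T' g = 1\<^sub>m m \<and> T' g * T g = 1\<^sub>m m \<and>
    det (T g) = 1 \<and> (\<forall>y\<in>M. (\<Phi> (T' g) * \<rho> g) * \<rho> y = \<rho> y * (\<Phi> (T' g) * \<rho> g))"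
    by metis
  have T: "T g \<in> carrier_mat m m" "dim_row (T g) = m" "dim_col (T g) = m"
    "T' g \<in> carrier_mat m m" "dim_row (T' g) = m" "dim_col (T' g) = m"
    "T g * T' g = 1\<^sub>m m" "T' g * T g = 1\<^sub>m m" "det (T g) = 1" if "g \<in> L" for g
    using TT[OF that] by auto
  define \<omega> where "\<omega> g = \<Phi> (T' g) * \<rho> g" for g
  have \<omega>d: "\<omega> g \<in> carrier_mat n n" "dim_row (\<omega> g) = n" "dim_col (\<omega> g) = n" if "g \<in> L" for g
    unfolding \<omega>_def using rho_rep(3,4)[OF that] by auto
  have \<omega>\<Phi>: "\<omega> g * \<Phi> X = \<Phi> X * \<omega> g" if g: "g \<in> L" for g X
    by (rule span_commute[OF \<omega>d(1)[OF g] _ Phi_span]) (use TT[OF g] in \<open>auto simp: \<omega>_def\<close>)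
  have \<rho>\<omega>: "\<rho> g = \<Phi> (T g) * \<omega> g" if g: "g \<in> L" for g
  proof -
    have "\<Phi> (T g) * \<omega> g = \<Phi> (T g * T' g) * \<rho> g" unfolding \<omega>_def Phi_mult[OF T(1)[OF g] T(4)[OF g]]
      using rho_rep(3)[OF g] by (simp add: mat_assoc)
    then show ?thesis unfolding T(7)[OF g] Phi1 using rho_rep(3)[OF g] by (simp add: mat_algebra)
  qed
  define \<omega>' where "\<omega>' g = \<rho>' g * \<Phi> (T g)" for g
  have \<omega>': "\<omega>' g \<in> carrier_mat n n" "dim_row (\<omega>' g) = n" "dim_col (\<omega>' g) = n" "\<omega> g * \<omega>' g = 1\<^sub>m n" if g: "g \<in> L" for g
  proof -
    show "\<omega>' g \<in> carrier_mat n n" "dim_row (\<omega>' g) = n" "dim_col (\<omega>' g) = n" unfolding \<omega>'_def using rho_inv(4)[OF g] by auto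
    have "\<omega> g * \<omega>' g = \<Phi> (T' g) * (\<rho> g * \<rho>' g) * \<Phi> (T g)" unfolding \<omega>_def \<omega>'_def
      using rho_rep(3,4)[OF g] rho_inv(4,5)[OF g] by (simp add: mat_assoc)
    also have "\<dots> = \<Phi> (T' g * T g)" unfolding rho_inv(3)[OF g] Phi_mult[OF T(4)[OF g] T(1)[OF g]] by (simp add: mat_algebra)
    finally show "\<omega> g * \<omega>' g = 1\<^sub>m n" unfolding T(8)[OF g] Phi1 .
  qed
  have commute_scalar: "scalar_mat m U" if U: "U \<in> carrier_mat m m" and c: "\<And>X. X \<in> carrier_mat m m \<Longrightarrow> U * X = X * U" for U
    using schur_scalar[OF sub(4) sigma_rep(2) sigma_rep(1) U c[OF sigma_rep(2)]] unfolding scalar_mat_def by metis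
  have Lm: "x \<otimes> y \<in> L" if "x \<in> L" "y \<in> L" for x y using subgroup.m_closed[OF L(1)] that by auto
  have one: "\<one> \<in> L" using subgroup.one_closed[OF L(1)] .
  have "\<exists>d. d \<noteq> 0 \<and> T y * T x = d \<cdot>\<^sub>m T (x \<otimes> y)" if x: "x \<in> L" and y: "y \<in> L" for x y
  proof -
    note xy = Lm[OF x y]
    note d = T(2,3,5,6)[OF x] T(2,3,5,6)[OF y] T(2,3,5,6)[OF xy] \<omega>d(2,3)[OF x] \<omega>d(2,3)[OF y] \<omega>d(2,3)[OF xy]
      \<omega>'(2,3)[OF x] \<omega>'(2,3)[OF y]
    \<comment> \<open>The matrix \<open>U\<close> measures the failure of \<open>T\<close> to be multiplicative. Its image \<open>\<Phi>(U)\<close> is a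
      product of matrices that commute with the image of \<open>\<Phi>\<close>, so that \<open>U\<close> is central.\<close>
    define U where "U = T' (x \<otimes> y) * (T y * T x)"
    have U: "U \<in> carrier_mat m m" "dim_row U = m" "dim_col U = m" unfolding U_def using d by auto
    have "\<rho> y * \<rho> x = \<Phi> (T y) * (\<omega> y * \<Phi> (T x)) * \<omega> x"
      unfolding \<rho>\<omega>[OF x] \<rho>\<omega>[OF y] using d by (simp add: mat_assoc)
    also have "\<dots> = \<Phi> (T y * T x) * (\<omega> y * \<omega> x)" unfolding \<omega>\<Phi>[OF y] Phi_mult[OF T(1)[OF y] T(1)[OF x]]
      using d by (simp add: mat_assoc)
    finally have "\<Phi> (T y * T x) * (\<omega> y * \<omega> x) = \<alpha> (x,y) \<cdot>\<^sub>m (\<Phi> (T (x \<otimes> y)) * \<omega> (x \<otimes> y))"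
      unfolding rho_rep(6)[OF x y] \<rho>\<omega>[OF xy] by simp
    then have "\<Phi> (T' (x \<otimes> y)) * (\<Phi> (T y * T x) * (\<omega> y * \<omega> x))
      = \<alpha> (x,y) \<cdot>\<^sub>m ((\<Phi> (T' (x \<otimes> y)) * \<Phi> (T (x \<otimes> y))) * \<omega> (x \<otimes> y))" using d by (simp add: mat_algebra)
    moreover have "\<Phi> (T' (x \<otimes> y)) * \<Phi> (T (x \<otimes> y)) = 1\<^sub>m n"
      using Phi_mult[OF T(4)[OF xy] T(1)[OF xy]] T(8)[OF xy] Phi1 by simp
    moreover have "\<Phi> (T' (x \<otimes> y)) * (\<Phi> (T y * T x) * (\<omega> y * \<omega> x)) = \<Phi> U * (\<omega> y * \<omega> x)"
      unfolding U_def using Phi_mult[OF T(4)[OF xy], of "T y * T x"] d by (simp add: mat_assoc)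
    ultimately have key: "\<Phi> U * (\<omega> y * \<omega> x) = \<alpha> (x,y) \<cdot>\<^sub>m \<omega> (x \<otimes> y)" using d by (simp add: mat_algebra)
    have "U * X = X * U" if X: "X \<in> carrier_mat m m" for X
    proof (rule Phi_inj)
      have "\<Phi> (U * X) * (\<omega> y * \<omega> x) = \<Phi> U * (\<Phi> X * \<omega> y) * \<omega> x" unfolding Phi_mult[OF U(1) X] using d by (simp add: mat_assoc)
      also have "\<dots> = \<Phi> U * \<omega> y * (\<Phi> X * \<omega> x)" unfolding \<omega>\<Phi>[OF y, of X, symmetric] using d by (simp add: mat_assoc)
      also have "\<dots> = (\<Phi> U * (\<omega> y * \<omega> x)) * \<Phi> X" unfolding \<omega>\<Phi>[OF x, of X, symmetric] using d by (simp add: mat_assoc)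
      also have "\<dots> = \<alpha> (x,y) \<cdot>\<^sub>m (\<Phi> X * \<omega> (x \<otimes> y))" unfolding key \<omega>\<Phi>[OF xy, of X, symmetric] using d by (simp add: mat_algebra)
      also have "\<dots> = \<Phi> X * (\<Phi> U * (\<omega> y * \<omega> x))" unfolding key using d by (simp add: mat_algebra)
      also have "\<dots> = \<Phi> (X * U) * (\<omega> y * \<omega> x)" unfolding Phi_mult[OF X U(1)] using d by (simp add: mat_assoc)
      finally have "\<Phi> (U * X) * (\<omega> y * \<omega> x) * (\<omega>' x * \<omega>' y) = \<Phi> (X * U) * (\<omega> y * \<omega> x) * (\<omega>' x * \<omega>' y)" by simp
      moreover have "Z * (\<omega> y * \<omega> x) * (\<omega>' x * \<omega>' y) = Z" if "Z \<in> carrier_mat n n" for Z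
      proof -
        have "Z * (\<omega> y * \<omega> x) * (\<omega>' x * \<omega>' y) = Z * (\<omega> y * ((\<omega> x * \<omega>' x) * \<omega>' y))" using d that by (simp add: mat_assoc)
        then show ?thesis unfolding \<omega>'(4)[OF x] using d that \<omega>'(4)[OF y] by (simp add: mat_algebra)
      qed
      ultimately show "\<Phi> (U * X) = \<Phi> (X * U)" by simp
    qed (use U X in auto)
    then obtain c where c: "U = c \<cdot>\<^sub>m 1\<^sub>m m" using commute_scalar[OF U(1)] unfolding scalar_mat_def by auto
    have "T y * T x = (T (x \<otimes> y) * T' (x \<otimes> y)) * (T y * T x)" unfolding T(7)[OF xy] using d by (simp add: mat_algebra)
    also have "\<dots> = T (x \<otimes> y) * U" unfolding U_def using d by (simp add: mat_assoc)
    also have "\<dots> = c \<cdot>\<^sub>m T (x \<otimes> y)" unfolding c using d by (simp add: mat_algebra)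
    finally have eq: "T y * T x = c \<cdot>\<^sub>m T (x \<otimes> y)" .
    have "det (T y * T x) = 1" using det_mult[OF T(1)[OF y] T(1)[OF x]] T(9) x y by simp
    then have "c ^ m * det (T (x \<otimes> y)) = 1" unfolding eq using T(3)[OF xy] by simp
    then have "c \<noteq> 0" using m0 by (auto simp: power_0_left)
    then show ?thesis using eq by blast
  qed
  then obtain \<delta>0 where \<delta>0: "\<And>x y. x \<in> L \<Longrightarrow> y \<in> L \<Longrightarrow> \<delta>0 x y \<noteq> 0 \<and> T y * T x = \<delta>0 x y \<cdot>\<^sub>m T (x \<otimes> y)" by metis
  define \<delta> where "\<delta> = (\<lambda>(x,y). \<delta>0 x y)"
  have \<delta>: "\<delta> (x,y) \<noteq> 0" "T y * T x = \<delta> (x,y) \<cdot>\<^sub>m T (x \<otimes> y)" if "x \<in> L" "y \<in> L" for x y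
    using \<delta>0[OF that] unfolding \<delta>_def by auto
  have T1: "T \<one> = \<delta> (\<one>,\<one>) \<cdot>\<^sub>m 1\<^sub>m m"
  proof -
    have "T' \<one> * (T \<one> * T \<one>) = \<delta> (\<one>,\<one>) \<cdot>\<^sub>m (T' \<one> * T \<one>)" unfolding \<delta>(2)[OF one one]
      using T[OF one] by (simp add: mat_algebra)
    moreover have "T' \<one> * (T \<one> * T \<one>) = (T' \<one> * T \<one>) * T \<one>" using T(2,3,5,6)[OF one] by (simp add: mat_assoc)
    ultimately show ?thesis unfolding T(8)[OF one] using T(2)[OF one] by (simp add: mat_algebra)
  qed
  have repT: "proj_rep G L m \<delta> T" unfolding proj_rep_def using m0 T(1) \<delta> T1 by auto
  have \<omega>m: "\<omega> y * \<omega> x = (\<alpha> (x,y) / \<delta> (x,y)) \<cdot>\<^sub>m \<omega> (x \<otimes> y)" if x: "x \<in> L" and y: "y \<in> L" for x y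
  proof -
    note xy = Lm[OF x y]
    note d = T(2,3,5,6)[OF x] T(2,3,5,6)[OF y] T(2,3,5,6)[OF xy] \<omega>d(2,3)[OF x] \<omega>d(2,3)[OF y] \<omega>d(2,3)[OF xy]
    have "\<rho> y * \<rho> x = \<Phi> (T y) * (\<omega> y * \<Phi> (T x)) * \<omega> x"
      unfolding \<rho>\<omega>[OF x] \<rho>\<omega>[OF y] using d by (simp add: mat_assoc)
    also have "\<dots> = \<Phi> (T y * T x) * (\<omega> y * \<omega> x)" unfolding \<omega>\<Phi>[OF y] Phi_mult[OF T(1)[OF y] T(1)[OF x]]
      using d by (simp add: mat_assoc)
    also have "\<dots> = \<delta> (x,y) \<cdot>\<^sub>m (\<Phi> (T (x \<otimes> y)) * (\<omega> y * \<omega> x))" unfolding \<delta>(2)[OF x y] Phi_smult[OF T(1)[OF xy]]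
      using d by (simp add: mat_algebra)
    finally have "\<Phi> (T' (x \<otimes> y)) * (\<delta> (x,y) \<cdot>\<^sub>m (\<Phi> (T (x \<otimes> y)) * (\<omega> y * \<omega> x)))
        = \<Phi> (T' (x \<otimes> y)) * (\<alpha> (x,y) \<cdot>\<^sub>m (\<Phi> (T (x \<otimes> y)) * \<omega> (x \<otimes> y)))"
      unfolding rho_rep(6)[OF x y] \<rho>\<omega>[OF xy] by simp
    then have "\<delta> (x,y) \<cdot>\<^sub>m ((\<Phi> (T' (x \<otimes> y)) * \<Phi> (T (x \<otimes> y))) * (\<omega> y * \<omega> x))
        = \<alpha> (x,y) \<cdot>\<^sub>m ((\<Phi> (T' (x \<otimes> y)) * \<Phi> (T (x \<otimes> y))) * \<omega> (x \<otimes> y))"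
      using d by (simp add: mat_algebra)
    moreover have "\<Phi> (T' (x \<otimes> y)) * \<Phi> (T (x \<otimes> y)) = 1\<^sub>m n"
      using Phi_mult[OF T(4)[OF xy] T(1)[OF xy]] T(8)[OF xy] Phi1 by simp
    ultimately have k: "\<delta> (x,y) \<cdot>\<^sub>m (\<omega> y * \<omega> x) = \<alpha> (x,y) \<cdot>\<^sub>m \<omega> (x \<otimes> y)" using d by (simp add: mat_algebra)
    show ?thesis
    proof (rule smult_mat_cancel[OF \<delta>(1)[OF x y]])
      show "\<delta> (x,y) \<cdot>\<^sub>m (\<omega> y * \<omega> x) = \<delta> (x,y) \<cdot>\<^sub>m (\<alpha> (x,y) / \<delta> (x,y) \<cdot>\<^sub>m \<omega> (x \<otimes> y))"
        unfolding k using \<delta>(1)[OF x y] by (simp add: mat_smult_smult)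
    qed
  qed
  have \<omega>1: "\<omega> \<one> = (\<alpha> (\<one>,\<one>) / \<delta> (\<one>,\<one>)) \<cdot>\<^sub>m 1\<^sub>m n"
  proof -
    have "\<omega> \<one> * \<omega> \<one> * \<omega>' \<one> = (\<alpha> (\<one>,\<one>) / \<delta> (\<one>,\<one>)) \<cdot>\<^sub>m (\<omega> \<one> * \<omega>' \<one>)"
      unfolding \<omega>m[OF one one] using \<omega>d(2,3)[OF one] \<omega>'(2,3)[OF one] by (simp add: mat_algebra)
    moreover have "\<omega> \<one> * \<omega> \<one> * \<omega>' \<one> = \<omega> \<one> * (\<omega> \<one> * \<omega>' \<one>)" using \<omega>d(2,3)[OF one] \<omega>'(2,3)[OF one] by (simp add: mat_assoc)
    ultimately show ?thesis unfolding \<omega>'(4)[OF one] using \<omega>d(2,3)[OF one] by (simp add: mat_algebra)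
  qed
  \<comment> \<open>On \<open>M\<close> the matrix \<open>\<omega> y\<close> lies in the image of \<open>\<Phi>\<close> and commutes with it.\<close>
  have scM: "\<exists>u. u \<noteq> 0 \<and> \<omega> y = u \<cdot>\<^sub>m 1\<^sub>m n \<and> \<sigma> y = u \<cdot>\<^sub>m T y" if y: "y \<in> M" for y
  proof -
    note yL = M_in_L[OF y]
    note d = T(2,3,5,6)[OF yL] \<omega>d(2,3)[OF yL] sigma_rep(3,4)[OF y] \<omega>'(2,3)[OF yL]
    define U where "U = T' y * \<sigma> y"
    have U: "U \<in> carrier_mat m m" "dim_row U = m" "dim_col U = m" unfolding U_def using d by auto
    have "\<Phi> (\<sigma> y) = \<rho> y" using Phi_left[OF y, of "1\<^sub>m m"] sigma_rep(2)[OF y] rho_rep(2)[OF yL] Phi1 by simp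
    then have \<omega>U: "\<omega> y = \<Phi> U" unfolding \<omega>_def U_def using Phi_mult[OF T(4)[OF yL] sigma_rep(2)[OF y]] by simp
    have "U * X = X * U" if X: "X \<in> carrier_mat m m" for X
      by (rule Phi_inj) (use U X \<omega>\<Phi>[OF yL, of X] in \<open>auto simp: \<omega>U Phi_mult\<close>)
    then obtain u where u: "U = u \<cdot>\<^sub>m 1\<^sub>m m" using commute_scalar[OF U(1)] unfolding scalar_mat_def by auto
    have \<omega>u: "\<omega> y = u \<cdot>\<^sub>m 1\<^sub>m n" unfolding \<omega>U u using Phi_smult[of "1\<^sub>m m" u] Phi1 by simp
    have "u \<noteq> 0"
    proof
      assume "u = 0"
      then have "\<omega> y = 0\<^sub>m n n" using \<omega>u zero_smult_mat[of "1\<^sub>m n" n n] by simp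
      then have "1\<^sub>m n = (0\<^sub>m n n :: complex mat)" using \<omega>'(1,4)[OF yL] by simp
      then have "1\<^sub>m n $$ (0,0) = (0\<^sub>m n n :: complex mat) $$ (0,0)" by simp
      then show False using rho_rep(1) by simp
    qed
    moreover have "\<sigma> y = u \<cdot>\<^sub>m T y"
    proof -
      have "\<sigma> y = (T y * T' y) * \<sigma> y" unfolding T(7)[OF yL] using d by (simp add: mat_algebra)
      also have "\<dots> = T y * U" unfolding U_def using d by (simp add: mat_assoc)
      finally show ?thesis unfolding u using d by (simp add: mat_algebra)
    qed
    ultimately show ?thesis using \<omega>u by blast
  qed
  have irrT: "irreducible_on m T M" unfolding irreducible_on_def
  proof (intro allI impI, elim conjE)
    fix W assume W: "vec_subspace m W" and inv: "\<forall>x\<in>M. \<forall>w\<in>W. T x *\<^sub>v w \<in> W"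
    have "\<sigma> x *\<^sub>v w \<in> W" if x: "x \<in> M" and w: "w \<in> W" for x w
    proof -
      obtain u where "\<sigma> x = u \<cdot>\<^sub>m T x" using scM[OF x] by auto
      moreover have "dim_vec w = m" using W w unfolding vec_subspace_def by auto
      ultimately have "\<sigma> x *\<^sub>v w = u \<cdot>\<^sub>v (T x *\<^sub>v w)" using T(3)[OF M_in_L[OF x]] by (simp add: smult_mat_mult_vec)
      then show ?thesis using W inv x w unfolding vec_subspace_def by auto
    qed
    then show "W = {0\<^sub>v m} \<or> W = carrier_vec m" using sub(4) W unfolding irreducible_on_def by blast
  qed
  have TN: "scalar_mat m (T x)" if x: "x \<in> N" for x
  proof -
    have xM: "x \<in> M" using x N(1) by auto
    obtain c where c: "\<rho> x = c \<cdot>\<^sub>m 1\<^sub>m n" using N(2)[OF x] unfolding scalar_mat_def by auto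
    obtain u where u: "u \<noteq> 0" "\<sigma> x = u \<cdot>\<^sub>m T x" using scM[OF xM] by auto
    have "B * \<sigma> x = B * (c \<cdot>\<^sub>m 1\<^sub>m m)" unfolding sub(5)[OF xM, symmetric] c using Bdim by (simp add: mat_algebra)
    then have "\<sigma> x = c \<cdot>\<^sub>m 1\<^sub>m m"
      using inj_mat_cancel[OF sub(2,1), of "\<sigma> x" m "c \<cdot>\<^sub>m 1\<^sub>m m"] sigma_rep(2)[OF xM] by simp
    then have "u \<cdot>\<^sub>m T x = u \<cdot>\<^sub>m ((c / u) \<cdot>\<^sub>m 1\<^sub>m m)" using u by (simp add: mat_smult_smult)
    then show ?thesis using smult_mat_cancel[OF u(1)] unfolding scalar_mat_def by blast
  qed
  define E where "E i j = \<Phi> (unit_mat m i j)" for i j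
  have Ed: "E i j \<in> carrier_mat n n" "dim_row (E i j) = n" "dim_col (E i j) = n" for i j unfolding E_def by auto
  have EE: "E i j * E j k = E i k" if "i < m" "j < m" "k < m" for i j k
    unfolding E_def using unit_mat_mult[OF that] Phi_mult[of "unit_mat m i j" "unit_mat m j k"] by simp
  obtain e A C where A: "A \<in> carrier_mat n e" "C \<in> carrier_mat e n" "A * C = E 0 0" "C * A = 1\<^sub>m e" "inj_mat A"
    using idempotent_factorization[OF Ed(1) EE[OF m0 m0 m0]] by metis
  note Ad = carrier_matD[OF A(1)] carrier_matD[OF A(2)]
  have EA: "E 0 0 * A = A" and CE: "C * E 0 0 = C"
    unfolding A(3)[symmetric] using A(4) Ad by (simp_all add: mat_assoc mat_mult_one)
       (simp add: mat_assoc[symmetric] mat_one_mult)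
  define W where "W g = C * \<omega> g * A" for g
  have Wc: "W g \<in> carrier_mat e e" "dim_row (W g) = e" "dim_col (W g) = e" for g unfolding W_def using Ad by auto
  have \<omega>A: "\<omega> g * A = A * W g" if g: "g \<in> L" for g
  proof -
    have "\<omega> g * A = (\<omega> g * E 0 0) * A" using EA Ad \<omega>d(2,3)[OF g] Ed by (simp add: mat_assoc)
    also have "\<dots> = A * W g" unfolding E_def \<omega>\<Phi>[OF g] W_def unfolding E_def[symmetric] A(3)[symmetric]
      using Ad \<omega>d(2,3)[OF g] by (simp add: mat_assoc)
    finally show ?thesis .
  qed
  have e0: "0 < e"
  proof (rule ccontr)
    assume "\<not> 0 < e"
    then have "E 0 0 = 0\<^sub>m n n" unfolding A(3)[symmetric] using Ad by (intro eq_matI) (auto simp: scalar_prod_def)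
    also have "\<dots> = \<Phi> (0\<^sub>m m m)" using Phi_smult[of "0\<^sub>m m m" 0] zero_smult_mat[of "\<Phi> (0\<^sub>m m m)" n n] by simp
    finally have "\<Phi> (unit_mat m 0 0) = \<Phi> (0\<^sub>m m m)" unfolding E_def .
    then have "unit_mat m 0 0 = 0\<^sub>m m m" by (rule Phi_inj[OF unit_mat_carrier(1) zero_carrier_mat])
    then have "unit_mat m 0 0 $$ (0,0) = 0\<^sub>m m m $$ (0,0)" by simp
    then show False using m0 by simp
  qed
  have repW: "proj_rep G L e (\<lambda>p. \<alpha> p / \<delta> p) W" unfolding proj_rep_def
  proof (intro conjI ballI)
    fix x y assume x: "x \<in> L" and y: "y \<in> L"
    show "\<alpha> (x,y) / \<delta> (x,y) \<noteq> 0" using rho_rep(5)[OF x y] \<delta>(1)[OF x y] by simp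
    note d = \<omega>d(2,3)[OF x] \<omega>d(2,3)[OF y] \<omega>d(2,3)[OF Lm[OF x y]]
    have "W y * W x = C * \<omega> y * (A * W x)" unfolding W_def[of y] using Ad d Wc by (simp add: mat_assoc)
    also have "\<dots> = C * (\<omega> y * \<omega> x) * A" unfolding \<omega>A[OF x, symmetric] using Ad d by (simp add: mat_assoc)
    also have "\<dots> = (\<alpha> (x,y) / \<delta> (x,y)) \<cdot>\<^sub>m W (x \<otimes> y)" unfolding \<omega>m[OF x y] W_def using Ad d by (simp add: mat_algebra)
    finally show "W y * W x = (\<alpha> (x,y) / \<delta> (x,y)) \<cdot>\<^sub>m W (x \<otimes> y)" .
  next
    show "W \<one> = (\<alpha> (\<one>,\<one>) / \<delta> (\<one>,\<one>)) \<cdot>\<^sub>m 1\<^sub>m e" unfolding W_def \<omega>1 using Ad A(4) by (simp add: mat_algebra)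
  qed (use e0 Wc in auto)
  \<comment> \<open>Compression to the range of \<open>\<Phi>(E\<^sub>0\<^sub>0)\<close> maps the span of \<open>\<rho>(L)\<close>, the full matrix algebra, onto
    the full matrix algebra, and into the span of \<open>W(L)\<close>.\<close>
  have corner: "C * \<rho> g * A = T g $$ (0,0) \<cdot>\<^sub>m W g" if g: "g \<in> L" for g
  proof -
    note d = T(2,3)[OF g] \<omega>d(2,3)[OF g]
    have "C * \<rho> g * A = C * E 0 0 * (\<Phi> (T g) * (\<omega> g * (E 0 0 * A)))" unfolding CE EA \<rho>\<omega>[OF g] using Ad d by (simp add: mat_assoc)
    also have "\<dots> = C * (E 0 0 * \<Phi> (T g) * (\<omega> g * E 0 0)) * A" using Ad d Ed by (simp add: mat_assoc)
    also have "\<dots> = C * ((E 0 0 * \<Phi> (T g) * E 0 0) * \<omega> g) * A" unfolding E_def \<omega>\<Phi>[OF g] using Ad d by (simp add: mat_assoc)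
    also have "E 0 0 * \<Phi> (T g) * E 0 0 = T g $$ (0,0) \<cdot>\<^sub>m E 0 0" unfolding E_def
      using unit_mat_corner[OF T(1)[OF g] m0] Phi_mult[OF _ T(1)[OF g], of "unit_mat m 0 0"] Phi_smult[of "unit_mat m 0 0" "T g $$ (0,0)"]
        Phi_mult[of "unit_mat m 0 0 * T g" "unit_mat m 0 0"] d by simp
    also have "C * (T g $$ (0,0) \<cdot>\<^sub>m E 0 0 * \<omega> g) * A = T g $$ (0,0) \<cdot>\<^sub>m (C * E 0 0 * \<omega> g * A)" using Ad d Ed by (simp add: mat_algebra)
    finally show ?thesis unfolding CE W_def .
  qed
  have WL: "W ` L \<subseteq> carrier_mat e e" using Wc by auto
  have fullW: "full e W L" unfolding full_def
  proof
    fix Y :: "complex mat" assume Y: "Y \<in> carrier_mat e e"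
    have comp: "C * X * A \<in> mat_span e (W ` L)" if "X \<in> mat_span n (\<rho> ` L)" for X using that
    proof induction
      case mat_span_zero
      have "C * 0\<^sub>m n n * A = 0\<^sub>m e e" using A by simp
      then show ?case by (simp add: mat_span.intros)
    next
      case (mat_span_add_smult X R d)
      then obtain g where g: "g \<in> L" "R = \<rho> g" by auto
      have Lc: "\<rho> ` L \<subseteq> carrier_mat n n" using rho_rep(2) by auto
      note Xc = mat_span_carrier[OF Lc mat_span_add_smult(1)]
      have "C * (X + d \<cdot>\<^sub>m R) * A = C * X * A + d \<cdot>\<^sub>m (C * \<rho> g * A)" unfolding g(2)
        using Ad Xc rho_rep(3,4)[OF g(1)] by (simp add: mat_mult_add mat_add_mult mat_smult_left mat_smult_right)
      then show ?case unfolding corner[OF g(1)] using mat_span_add_smult(3) g(1)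
        by (auto simp: mat_smult_smult intro!: mat_span.intros)
    qed
    have "A * Y * C \<in> mat_span n (\<rho> ` L)" using full Ad unfolding full_def by auto
    from comp[OF this] have "C * (A * Y * C) * A \<in> mat_span e (W ` L)" .
    also have "C * (A * Y * C) * A = (C * A) * Y * (C * A)" using Ad Y by (simp add: mat_assoc)
    also have "\<dots> = Y" unfolding A(4) using Y by simp
    finally show "Y \<in> mat_span e (W ` L)" .
  qed
  have WM: "scalar_mat e (W x)" if x: "x \<in> M" for x
  proof -
    obtain u where "\<omega> x = u \<cdot>\<^sub>m 1\<^sub>m n" using scM[OF x] by auto
    then have "W x = u \<cdot>\<^sub>m 1\<^sub>m e" unfolding W_def using Ad A(4) by (simp add: mat_algebra)
    then show ?thesis unfolding scalar_mat_def by blast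
  qed
  have nme: "n = m * e"
  proof -
    have trE: "tr (E i i) = of_nat e" if i: "i < m" for i
    proof -
      have "tr (E i i) = tr (E 0 i * E i 0)" unfolding EE[OF i m0 i, symmetric] by (rule tr_mult_commute[OF Ed(1) Ed(1)])
      also have "\<dots> = tr (C * A)" unfolding EE[OF m0 i m0] A(3)[symmetric] by (rule tr_mult_commute[OF A(1,2)])
      finally show ?thesis unfolding A(4) by simp
    qed
    have "1\<^sub>m n = msum n n (\<lambda>i. E i i) {..<m}" unfolding Phi1[symmetric] one_unit_mat[of m] Phi_msum E_def ..
    then have "of_nat n = (\<Sum>i<m. tr (E i i))" using tr_msum[of "{..<m}" "\<lambda>i. E i i" n] Ed tr_one[of n] by simp
    also have "\<dots> = of_nat (m * e)" using trE by simp
    finally show ?thesis by (simp only: of_nat_eq_iff)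
  qed
  define F where "F i = E i 0 * A" for i
  have Fc: "F i \<in> carrier_mat n e" for i unfolding F_def using Ed Ad by auto
  have F0: "inj_mat (F 0)" unfolding F_def EA by (rule A(5))
  have Feq: "\<rho> g * F j = msum n e (\<lambda>i. T g $$ (i,j) \<cdot>\<^sub>m (F i * W g)) {..<m}" if g: "g \<in> L" and j: "j < m" for g j
  proof -
    note d = T(2,3)[OF g] \<omega>d(2,3)[OF g]
    have "\<rho> g * F j = \<Phi> (T g) * (\<omega> g * E j 0) * A" unfolding F_def \<rho>\<omega>[OF g] using Ad d Ed by (simp add: mat_assoc)
    also have "\<dots> = (\<Phi> (T g) * E j 0) * (\<omega> g * A)" unfolding E_def \<omega>\<Phi>[OF g] using Ad d by (simp add: mat_assoc)
    also have "\<Phi> (T g) * E j 0 = msum n n (\<lambda>i. T g $$ (i,j) \<cdot>\<^sub>m E i 0) {..<m}"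
    proof -
      have "\<Phi> (T g) * E j 0 = \<Phi> (T g * unit_mat m j 0)" unfolding E_def using Phi_mult[OF T(1)[OF g]] by simp
      also have "\<dots> = msum n n (\<lambda>i. T g $$ (i,j) \<cdot>\<^sub>m E i 0) {..<m}"
        unfolding mult_col_unit_mat[OF T(1)[OF g] j m0] Phi_msum E_def by (rule msum_cong) (simp add: Phi_smult)
      finally show ?thesis .
    qed
    also have "msum n n (\<lambda>i. T g $$ (i,j) \<cdot>\<^sub>m E i 0) {..<m} * (\<omega> g * A)
        = msum n e (\<lambda>i. (T g $$ (i,j) \<cdot>\<^sub>m E i 0) * (\<omega> g * A)) {..<m}"
      by (rule msum_mult) (use Ed Ad d in auto)
    also have "\<dots> = msum n e (\<lambda>i. T g $$ (i,j) \<cdot>\<^sub>m (F i * W g)) {..<m}"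
      unfolding \<omega>A[OF g] F_def by (rule msum_cong) (use Ed Ad Wc in \<open>simp add: mat_algebra\<close>)
    finally show ?thesis .
  qed
  show ?thesis
    by (rule that[OF repT T(9) irrT TN repW fullW WM nme Fc F0 Feq])
qed

end

section \<open>Torsion of cocycles, sections of separable groups\<close>

lemma pi_number_dvd: "pi_number \<pi> n \<Longrightarrow> d dvd n \<Longrightarrow> pi_number \<pi> d"
  unfolding pi_number_def using dvd_prime_factors[of n d] by (auto dest: dvd_pos_nat)

lemma pi_number_coprime:
  assumes "pi_number \<pi> k" "pi_number (primes_compl \<pi>) l" shows "coprime k l"
proof (rule coprimeI)
  fix d assume d: "d dvd k" "d dvd l"
  show "is_unit d"
  proof (rule ccontr)
    assume "\<not> is_unit d"
    moreover have "d \<noteq> 0" using d assms unfolding pi_number_def by auto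
    ultimately obtain p where "Factorial_Ring.prime p" "p dvd d" by (meson prime_divisorE)
    then have "p \<in> prime_factors k" "p \<in> prime_factors l"
      using assms d unfolding pi_number_def by (auto simp: prime_factors_dvd intro: dvd_trans)
    then show False using assms unfolding pi_number_def primes_compl_def by auto
  qed
qed

lemma primes_compl_compl: "\<pi> \<subseteq> {p. Factorial_Ring.prime p} \<Longrightarrow> primes_compl (primes_compl \<pi>) = \<pi>"
  unfolding primes_compl_def by auto

lemma pi_number_mult: "pi_number \<pi> a \<Longrightarrow> pi_number \<pi> b \<Longrightarrow> pi_number \<pi> (a * b)"
  unfolding pi_number_def by (auto simp: prime_factors_product)

text \<open>Cocycles are considered on subgroups \<open>L\<close> of \<open>G\<close> without restricting them, and the order of a
  coclass enters only through an exponent that annihilates it.\<close>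

definition coboundary_on :: "('g, 'm) monoid_scheme \<Rightarrow> 'g set \<Rightarrow> ('g \<times> 'g \<Rightarrow> complex) \<Rightarrow> bool" where
  "coboundary_on G L \<beta> \<longleftrightarrow> (\<exists>\<mu>. (\<forall>x\<in>L. \<mu> x \<noteq> 0) \<and>
     (\<forall>x\<in>L. \<forall>y\<in>L. \<beta> (x,y) = \<mu> x * \<mu> y / \<mu> (x \<otimes>\<^bsub>G\<^esub> y)))"

definition torsion_on :: "nat set \<Rightarrow> ('g, 'm) monoid_scheme \<Rightarrow> 'g set \<Rightarrow> ('g \<times> 'g \<Rightarrow> complex) \<Rightarrow> bool" where
  "torsion_on \<pi> G L \<beta> \<longleftrightarrow> (\<exists>k. pi_number \<pi> k \<and> coboundary_on G L (\<lambda>p. \<beta> p ^ k))"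

lemma coboundary_on_mono: "coboundary_on G L \<beta> \<Longrightarrow> M \<subseteq> L \<Longrightarrow> coboundary_on G M \<beta>"
  unfolding coboundary_on_def by (meson subsetD)

lemma coboundary_on_cong:
  "coboundary_on G L \<beta> \<Longrightarrow> (\<And>x y. x \<in> L \<Longrightarrow> y \<in> L \<Longrightarrow> \<gamma> (x,y) = \<beta> (x,y)) \<Longrightarrow> coboundary_on G L \<gamma>"
  unfolding coboundary_on_def by auto

lemma torsion_on_mono: "torsion_on \<pi> G L \<beta> \<Longrightarrow> M \<subseteq> L \<Longrightarrow> torsion_on \<pi> G M \<beta>"
  unfolding torsion_on_def using coboundary_on_mono by blast

lemma torsion_on_cong:
  assumes "torsion_on \<pi> G L \<beta>" "\<And>x y. x \<in> L \<Longrightarrow> y \<in> L \<Longrightarrow> \<gamma> (x,y) = \<beta> (x,y)" shows "torsion_on \<pi> G L \<gamma>"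
proof -
  obtain k where k: "pi_number \<pi> k" "coboundary_on G L (\<lambda>p. \<beta> p ^ k)" using assms(1) unfolding torsion_on_def by auto
  have "coboundary_on G L (\<lambda>p. \<gamma> p ^ k)" by (rule coboundary_on_cong[OF k(2)]) (use assms(2) in auto)
  then show ?thesis unfolding torsion_on_def using k(1) by auto
qed

lemma coboundary_on_mult:
  assumes "coboundary_on G L \<beta>" "coboundary_on G L \<gamma>" shows "coboundary_on G L (\<lambda>p. \<beta> p * \<gamma> p)"
proof -
  obtain \<mu> \<nu> where "\<forall>x\<in>L. \<mu> x \<noteq> 0" "\<forall>x\<in>L. \<forall>y\<in>L. \<beta> (x,y) = \<mu> x * \<mu> y / \<mu> (x \<otimes>\<^bsub>G\<^esub> y)"
    "\<forall>x\<in>L. \<nu> x \<noteq> 0" "\<forall>x\<in>L. \<forall>y\<in>L. \<gamma> (x,y) = \<nu> x * \<nu> y / \<nu> (x \<otimes>\<^bsub>G\<^esub> y)"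
    using assms unfolding coboundary_on_def by auto
  then show ?thesis unfolding coboundary_on_def
    by (intro exI[of _ "\<lambda>x. \<mu> x * \<nu> x"]) auto
qed

lemma coboundary_on_powi:
  assumes "coboundary_on G L \<beta>" shows "coboundary_on G L (\<lambda>p. \<beta> p powi i)"
proof -
  obtain \<mu> where "\<forall>x\<in>L. \<mu> x \<noteq> 0" "\<forall>x\<in>L. \<forall>y\<in>L. \<beta> (x,y) = \<mu> x * \<mu> y / \<mu> (x \<otimes>\<^bsub>G\<^esub> y)"
    using assms unfolding coboundary_on_def by auto
  then show ?thesis unfolding coboundary_on_def
    by (intro exI[of _ "\<lambda>x. \<mu> x powi i"]) (auto simp: power_int_mult_distrib power_int_divide_distrib)
qed

text \<open>Write \<open>1 = u k + v l\<close> in the exponent of \<open>\<beta>\<close>.\<close>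

lemma coprime_coboundary:
  assumes k: "coboundary_on G L (\<lambda>p. \<beta> p ^ k)" and l: "coboundary_on G L (\<lambda>p. \<beta> p ^ l)" and c: "coprime k l"
    and nz: "\<And>x y. x \<in> L \<Longrightarrow> y \<in> L \<Longrightarrow> \<beta> (x,y) \<noteq> 0"
  shows "coboundary_on G L \<beta>"
proof -
  obtain u v where uv: "u * int k + v * int l = 1" using c bezout_int[of "int k" "int l"] by auto
  have cb: "coboundary_on G L (\<lambda>p. (\<beta> p ^ k) powi u * (\<beta> p ^ l) powi v)"
    by (intro coboundary_on_mult coboundary_on_powi k l)
  have eq: "(\<beta> (x,y) ^ k) powi u * (\<beta> (x,y) ^ l) powi v = \<beta> (x,y)" if "x \<in> L" "y \<in> L" for x y
  proof -
    have "(\<beta> (x,y) ^ k) powi u * (\<beta> (x,y) ^ l) powi v = \<beta> (x,y) powi (int k * u + int l * v)"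
      using nz[OF that] by (simp add: power_int_add power_int_mult)
    also have "int k * u + int l * v = 1" using uv by (simp add: mult.commute)
    finally show ?thesis by simp
  qed
  show ?thesis by (rule coboundary_on_cong[OF cb]) (simp add: eq)
qed

lemma torsion_coprime_coboundary:
  assumes "torsion_on \<pi> G L \<beta>" "torsion_on (primes_compl \<pi>) G L \<beta>" "\<And>x y. x \<in> L \<Longrightarrow> y \<in> L \<Longrightarrow> \<beta> (x,y) \<noteq> 0"
  shows "coboundary_on G L \<beta>"
proof -
  obtain k l where "pi_number \<pi> k" "coboundary_on G L (\<lambda>p. \<beta> p ^ k)"
    "pi_number (primes_compl \<pi>) l" "coboundary_on G L (\<lambda>p. \<beta> p ^ l)"
    using assms(1,2) unfolding torsion_on_def by auto
  then show ?thesis using coprime_coboundary pi_number_coprime assms(3) by metis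
qed

lemma torsion_on_div:
  assumes "torsion_on \<pi> G L \<beta>" "torsion_on \<pi> G L \<delta>"
  shows "torsion_on \<pi> G L (\<lambda>p. \<beta> p / \<delta> p)"
proof -
  obtain k l where k: "pi_number \<pi> k" "coboundary_on G L (\<lambda>p. \<beta> p ^ k)"
    and l: "pi_number \<pi> l" "coboundary_on G L (\<lambda>p. \<delta> p ^ l)"
    using assms unfolding torsion_on_def by auto
  have "coboundary_on G L (\<lambda>p. (\<beta> p ^ k) powi int l * (\<delta> p ^ l) powi (- int k))"
    by (intro coboundary_on_mult coboundary_on_powi k l)
  then have "coboundary_on G L (\<lambda>p. (\<beta> p / \<delta> p) ^ (k * l))"
    by (rule coboundary_on_cong)
      (simp add: power_int_minus power_divide power_mult[symmetric] divide_inverse mult.commute power_mult_distrib power_inverse)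
  then show ?thesis unfolding torsion_on_def using pi_number_mult[OF k(1) l(1)] by auto
qed

lemma coboundary_imp_torsion_on: "coboundary_on G L \<beta> \<Longrightarrow> torsion_on \<pi> G L \<beta>"
  unfolding torsion_on_def by (rule exI[of _ 1]) (auto simp: pi_number_def)

definition normal_in :: "('g, 'm) monoid_scheme \<Rightarrow> 'g set \<Rightarrow> 'g set \<Rightarrow> bool" where
  "normal_in G N L \<longleftrightarrow> subgroup N G \<and> N \<subseteq> L \<and> (\<forall>g\<in>L. \<forall>x\<in>N. inv\<^bsub>G\<^esub> g \<otimes>\<^bsub>G\<^esub> x \<otimes>\<^bsub>G\<^esub> g \<in> N)"

context group
begin

text \<open>The order of a group annihilates its second cohomology: multiply the cocycle identity over all
  values of the last argument.\<close>

lemma order_coboundary: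
  assumes L: "subgroup L G" "finite L"
    and nz: "\<And>x y. x \<in> L \<Longrightarrow> y \<in> L \<Longrightarrow> \<alpha> (x,y) \<noteq> 0"
    and coc: "\<And>x y z. x \<in> L \<Longrightarrow> y \<in> L \<Longrightarrow> z \<in> L \<Longrightarrow> \<alpha> (x,y) * \<alpha> (x \<otimes> y, z) = \<alpha> (x, y \<otimes> z) * \<alpha> (y,z)"
  shows "coboundary_on G L (\<lambda>p. \<alpha> p ^ card L)"
  unfolding coboundary_on_def
proof (intro exI conjI ballI)
  define f where "f x = (\<Prod>z\<in>L. \<alpha> (x,z))" for x
  show fn: "f x \<noteq> 0" if "x \<in> L" for x unfolding f_def using nz that L(2) by simp
  fix x y assume x: "x \<in> L" and y: "y \<in> L"
  have bij: "bij_betw (\<lambda>z. y \<otimes> z) L L"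
  proof (rule bij_betwI[where g = "\<lambda>z. inv y \<otimes> z"])
    show "(\<lambda>z. y \<otimes> z) \<in> L \<rightarrow> L" "(\<lambda>z. inv y \<otimes> z) \<in> L \<rightarrow> L"
      using L(1) y subgroup.m_closed subgroup.m_inv_closed by fastforce+
    show "inv y \<otimes> (y \<otimes> z) = z" "y \<otimes> (inv y \<otimes> z) = z" if "z \<in> L" for z
      using that y subgroup.mem_carrier[OF L(1)] by (auto simp: m_assoc[symmetric])
  qed
  have "\<alpha> (x,y) ^ card L * f (x \<otimes> y) = (\<Prod>z\<in>L. \<alpha> (x,y) * \<alpha> (x \<otimes> y, z))"
    unfolding f_def by (simp add: prod.distrib)
  also have "\<dots> = (\<Prod>z\<in>L. \<alpha> (x, y \<otimes> z)) * f y"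
    unfolding f_def prod.distrib[symmetric] by (intro prod.cong refl coc x y)
  also have "(\<Prod>z\<in>L. \<alpha> (x, y \<otimes> z)) = f x" unfolding f_def
    by (rule prod.reindex_bij_betw[OF bij, of "\<lambda>z. \<alpha> (x,z)"])
  finally show "\<alpha> (x,y) ^ card L = f x * f y / f (x \<otimes> y)"
    using fn[OF subgroup.m_closed[OF L(1) x y]] by (simp add: field_simps)
qed

lemma card_subgroup_dvd:
  assumes "subgroup A G" "subgroup B G" "A \<subseteq> B"
  shows "card A dvd card B"
proof -
  interpret B: group "G\<lparr>carrier := B\<rparr>" using subgroup_imp_group[OF assms(2)] .
  have "card (rcosets\<^bsub>G\<lparr>carrier := B\<rparr>\<^esub> A) * card A = card B"
    using B.lagrange[OF subgroup_incl[OF assms]] by (simp add: Coset.order_def)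
  then show ?thesis by (metis dvd_triv_right)
qed

lemma card_subgroup_pos: "subgroup A G \<Longrightarrow> finite A \<Longrightarrow> 0 < card A"
  using subgroup.one_closed by (metis card_gt_0_iff empty_iff)

lemma card_product:
  assumes A: "subgroup A G" "finite A" and B: "subgroup B G" "finite B"
  shows "card ((\<lambda>(a,b). a \<otimes> b) ` (A \<times> B)) * card (A \<inter> B) = card A * card B"
proof -
  let ?f = "\<lambda>(a,b). a \<otimes> b"
  have mA: "a \<in> carrier G" if "a \<in> A" for a using subgroup.mem_carrier[OF A(1) that] .
  have mB: "b \<in> carrier G" if "b \<in> B" for b using subgroup.mem_carrier[OF B(1) that] .
  have "card {p \<in> A \<times> B. ?f p = z} = card (A \<inter> B)" if z: "z \<in> ?f ` (A \<times> B)" for z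
  proof -
    obtain a b where ab: "a \<in> A" "b \<in> B" "z = a \<otimes> b" using z by auto
    have "bij_betw (\<lambda>d. (a \<otimes> d, inv d \<otimes> b)) (A \<inter> B) {p \<in> A \<times> B. ?f p = z}"
    proof (rule bij_betwI[where g = "\<lambda>p. inv a \<otimes> fst p"])
      show "(\<lambda>d. (a \<otimes> d, inv d \<otimes> b)) \<in> A \<inter> B \<rightarrow> {p \<in> A \<times> B. ?f p = z}"
      proof
        fix d assume d: "d \<in> A \<inter> B"
        have "d \<otimes> (inv d \<otimes> b) = b" using mB[OF ab(2)] mA[of d] d by (simp add: m_assoc[symmetric])
        then have "a \<otimes> d \<otimes> (inv d \<otimes> b) = z" using mA[OF ab(1)] mB[OF ab(2)] mA[of d] d ab(3) by (simp add: m_assoc)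
        then show "(a \<otimes> d, inv d \<otimes> b) \<in> {p \<in> A \<times> B. ?f p = z}"
          using d ab subgroup.m_closed[OF A(1)] subgroup.m_closed[OF B(1)] subgroup.m_inv_closed[OF B(1)] by auto
      qed
      show "(\<lambda>p. inv a \<otimes> fst p) \<in> {p \<in> A \<times> B. ?f p = z} \<rightarrow> A \<inter> B"
      proof
        fix p assume "p \<in> {p \<in> A \<times> B. ?f p = z}"
        then obtain a' b' where p: "p = (a',b')" "a' \<in> A" "b' \<in> B" "a' \<otimes> b' = a \<otimes> b" using ab(3) by auto
        have "inv a \<otimes> a' = inv a \<otimes> (a' \<otimes> b') \<otimes> inv b'" using mA[OF ab(1)] mA[OF p(2)] mB[OF p(3)] by (simp add: m_assoc)
        also have "\<dots> = b \<otimes> inv b'" unfolding p(4) using mA[OF ab(1)] mB[OF ab(2)] mB[OF p(3)]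
          by (simp add: m_assoc[symmetric])
        finally have "inv a \<otimes> a' \<in> B" using subgroup.m_closed[OF B(1) ab(2) subgroup.m_inv_closed[OF B(1) p(3)]] by simp
        then show "inv a \<otimes> fst p \<in> A \<inter> B" using p subgroup.m_closed[OF A(1) subgroup.m_inv_closed[OF A(1) ab(1)] p(2)] by simp
      qed
      show "inv a \<otimes> fst (a \<otimes> d, inv d \<otimes> b) = d" if "d \<in> A \<inter> B" for d
        using mA[OF ab(1)] mA[of d] that by (simp add: m_assoc[symmetric])
      fix p assume "p \<in> {p \<in> A \<times> B. ?f p = z}"
      then obtain a' b' where p: "p = (a',b')" "a' \<in> A" "b' \<in> B" "a' \<otimes> b' = a \<otimes> b" using ab(3) by auto
      have "inv (inv a \<otimes> a') \<otimes> b = inv a' \<otimes> (a \<otimes> b)" using mA[OF ab(1)] mA[OF p(2)] mB[OF ab(2)]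
        by (simp add: inv_mult_group m_assoc)
      also have "\<dots> = b'" unfolding p(4)[symmetric] using mA[OF p(2)] mB[OF p(3)] by (simp add: m_assoc[symmetric])
      finally show "(a \<otimes> (inv a \<otimes> fst p), inv (inv a \<otimes> fst p) \<otimes> b) = p"
        using p mA[OF ab(1)] mA[OF p(2)] by (simp add: m_assoc[symmetric])
    qed
    then show ?thesis by (rule bij_betw_same_card[symmetric])
  qed
  then have "(\<Sum>z\<in>?f ` (A \<times> B). card {p \<in> A \<times> B. ?f p = z}) = card (?f ` (A \<times> B)) * card (A \<inter> B)" by simp
  moreover have "card (A \<times> B) = (\<Sum>z\<in>?f ` (A \<times> B). card {p \<in> A \<times> B. ?f p = z})"
    using sum.image_gen[of "A \<times> B" "\<lambda>_. 1 :: nat" ?f] A(2) B(2) by simp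
  ultimately show ?thesis by (simp add: card_cartesian_product)
qed

lemma product_lower:
  assumes "subgroup A G" "subgroup B G" shows "A \<subseteq> (\<lambda>(a,b). a \<otimes> b) ` (A \<times> B)"
proof
  fix x assume "x \<in> A"
  then show "x \<in> (\<lambda>(a,b). a \<otimes> b) ` (A \<times> B)"
    using subgroup.one_closed[OF assms(2)] subgroup.mem_carrier[OF assms(1)] by (intro image_eqI[of _ _ "(x, \<one>)"]) auto
qed

lemma product_upper:
  assumes "subgroup A G" "subgroup B G" shows "B \<subseteq> (\<lambda>(a,b). a \<otimes> b) ` (A \<times> B)"
proof
  fix x assume "x \<in> B"
  then show "x \<in> (\<lambda>(a,b). a \<otimes> b) ` (A \<times> B)"
    using subgroup.one_closed[OF assms(1)] subgroup.mem_carrier[OF assms(2)] by (intro image_eqI[of _ _ "(\<one>, x)"]) auto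
qed

lemma normal_inD:
  assumes "normal_in G N L"
  shows "subgroup N G" "N \<subseteq> L" "g \<in> L \<Longrightarrow> x \<in> N \<Longrightarrow> inv g \<otimes> x \<otimes> g \<in> N"
  using assms unfolding normal_in_def by auto

lemma subgroup_product:
  assumes A: "subgroup A G" "A \<subseteq> L" and N: "normal_in G N L" and L: "subgroup L G"
  shows "subgroup ((\<lambda>(a,b). a \<otimes> b) ` (A \<times> N)) G"
proof (rule subgroupI)
  note N' = normal_inD[OF N]
  have mL: "a \<in> carrier G" if "a \<in> L" for a using subgroup.mem_carrier[OF L that] .
  have AL: "a \<in> L" if "a \<in> A" for a using A(2) that by auto
  have NL: "a \<in> L" if "a \<in> N" for a using N'(2) that by auto
  show "(\<lambda>(a,b). a \<otimes> b) ` (A \<times> N) \<subseteq> carrier G" using mL AL NL by auto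
  show "(\<lambda>(a,b). a \<otimes> b) ` (A \<times> N) \<noteq> {}" using subgroup.one_closed[OF A(1)] subgroup.one_closed[OF N'(1)] by auto
  fix x assume "x \<in> (\<lambda>(a,b). a \<otimes> b) ` (A \<times> N)"
  then obtain a n where x: "a \<in> A" "n \<in> N" "x = a \<otimes> n" by auto
  note ia = subgroup.m_inv_closed[OF A(1) x(1)] and iN = subgroup.m_inv_closed[OF N'(1) x(2)]
  have "inv x = inv a \<otimes> (inv (inv a) \<otimes> inv n \<otimes> inv a)" using mL AL NL x by (simp add: inv_mult_group m_assoc[symmetric])
  moreover have "inv (inv a) \<otimes> inv n \<otimes> inv a \<in> N" by (rule N'(3)[OF AL[OF ia] iN])
  ultimately show "inv x \<in> (\<lambda>(a,b). a \<otimes> b) ` (A \<times> N)" using ia by auto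
  fix y assume "y \<in> (\<lambda>(a,b). a \<otimes> b) ` (A \<times> N)"
  then obtain b k where y: "b \<in> A" "k \<in> N" "y = b \<otimes> k" by auto
  have ab: "a \<otimes> b \<in> A" using subgroup.m_closed[OF A(1) x(1) y(1)] .
  have "x \<otimes> y = (a \<otimes> b) \<otimes> ((inv b \<otimes> n \<otimes> b) \<otimes> k)"
  proof -
    have c: "a \<in> carrier G" "b \<in> carrier G" "n \<in> carrier G" "k \<in> carrier G" using mL AL NL x y by auto
    have "b \<otimes> (inv b \<otimes> (n \<otimes> (b \<otimes> k))) = n \<otimes> (b \<otimes> k)" using c by (simp add: m_assoc[symmetric])
    then show ?thesis using c x y by (simp add: m_assoc)
  qed
  moreover have "(inv b \<otimes> n \<otimes> b) \<otimes> k \<in> N" by (intro subgroup.m_closed[OF N'(1)] N'(3) AL y x)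
  ultimately show "x \<otimes> y \<in> (\<lambda>(a,b). a \<otimes> b) ` (A \<times> N)" using ab by auto
qed

text \<open>Let \<open>A = H N\<close> and \<open>B = A M\<close>. The index of \<open>A\<close> in \<open>B\<close> divides \<open>|M : N|\<close>, a \<open>\<pi>\<close>-number, and \<open>|J : H|\<close>, a
  \<open>\<pi>'\<close>-number. So it is one, and \<open>M \<subseteq> A\<close>.\<close>

lemma hall_covers_section:
  assumes J: "subgroup J G" "finite J" and H: "subgroup H G" "H \<subseteq> J"
    and idx: "pi_number (primes_compl \<pi>) (card J div card H)"
    and N: "normal_in G N J" and M: "normal_in G M J" "N \<subseteq> M" and sec: "pi_number \<pi> (card M div card N)"
  shows "M \<subseteq> (\<lambda>(a,b). a \<otimes> b) ` (H \<times> N)"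
proof -
  note N' = normal_inD[OF N] and M' = normal_inD[OF M(1)]
  define A where "A = (\<lambda>(a,b). a \<otimes> b) ` (H \<times> N)"
  define B where "B = (\<lambda>(a,b). a \<otimes> b) ` (A \<times> M)"
  have A: "subgroup A G" unfolding A_def by (rule subgroup_product[OF H N J(1)])
  have AJ: "A \<subseteq> J" unfolding A_def using H(2) N'(2) subgroup.m_closed[OF J(1)] by auto
  have B: "subgroup B G" unfolding B_def by (rule subgroup_product[OF A AJ M(1) J(1)])
  have BJ: "B \<subseteq> J" unfolding B_def using AJ M'(2) subgroup.m_closed[OF J(1)] by auto
  have fin: "finite A" "finite B" "finite M" "finite N" "finite H"
    using finite_subset[OF AJ J(2)] finite_subset[OF BJ J(2)] finite_subset[OF M'(2) J(2)]
      finite_subset[OF N'(2) J(2)] finite_subset[OF H(2) J(2)] by auto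
  have NA: "N \<subseteq> A" unfolding A_def by (rule product_upper[OF H(1) N'(1)])
  have HA: "H \<subseteq> A" unfolding A_def by (rule product_lower[OF H(1) N'(1)])
  have MB: "M \<subseteq> B" unfolding B_def by (rule product_upper[OF A M'(1)])
  have AB: "A \<subseteq> B" unfolding B_def by (rule product_lower[OF A M'(1)])
  have AM: "subgroup (A \<inter> M) G" using subgroups_Inter_pair[OF A M'(1)] .
  have prod: "card B * card (A \<inter> M) = card A * card M" unfolding B_def
    by (rule card_product[OF A fin(1) M'(1) fin(3)])
  obtain q where q: "card B = card A * q" using card_subgroup_dvd[OF A B AB] by auto
  have pos: "0 < card A" "0 < card (A \<inter> M)" "0 < card N" "0 < card H" "0 < card M"
    using card_subgroup_pos A AM N'(1) H(1) M'(1) fin by auto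
  have qM: "card M = q * card (A \<inter> M)" using prod q pos(1) by simp
  have "card N dvd card (A \<inter> M)" using card_subgroup_dvd[OF N'(1) AM] NA M(2) by simp
  then obtain r where r: "card (A \<inter> M) = card N * r" by (rule dvdE)
  have "card M div card N = q * r" using qM r pos by simp
  then have "pi_number \<pi> q" using pi_number_dvd[OF sec] by simp
  moreover have "pi_number (primes_compl \<pi>) q"
  proof (rule pi_number_dvd[OF idx])
    obtain s where s: "card A = card H * s" using card_subgroup_dvd[OF H(1) A HA] by auto
    obtain t where t: "card J = card B * t" using card_subgroup_dvd[OF B J(1) BJ] by auto
    have "card J = card H * (s * q * t)" using s t q by simp
    then have "card J div card H = s * q * t" using pos by simp
    then show "q dvd card J div card H" by simp
  qed
  ultimately have "coprime q q" by (rule pi_number_coprime)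
  then have "q = 1" by simp
  then have "card B = card A" using q by simp
  then have "A = B" using AB fin card_subset_eq by metis
  then show ?thesis using MB unfolding A_def by simp
qed

lemma normal_inI_normal:
  assumes K: "K \<lhd> G" and L: "subgroup L G"
  shows "normal_in G (L \<inter> K) L"
  unfolding normal_in_def
proof (intro conjI ballI)
  show "subgroup (L \<inter> K) G" using subgroups_Inter_pair[OF L normal_imp_subgroup[OF K]] .
  fix g x assume g: "g \<in> L" and x: "x \<in> L \<inter> K"
  have "inv g \<otimes> x \<otimes> g \<in> K" using normal.inv_op_closed1[OF K subgroup.mem_carrier[OF L g]] x by auto
  moreover have "inv g \<otimes> x \<otimes> g \<in> L" using g x by (intro subgroup.m_closed[OF L] subgroup.m_inv_closed[OF L]) auto
  ultimately show "inv g \<otimes> x \<otimes> g \<in> L \<inter> K" by simp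
qed auto

text \<open>Let \<open>S i\<close> be the first member of a series of \<open>G\<close> such that \<open>L \<inter> S i\<close> is not contained in \<open>N\<close>, and let
  \<open>M = N (L \<inter> S i)\<close>. Then the order of \<open>M/N\<close> divides that of the factor of the series below \<open>S i\<close>, since
  \<open>N\<close> contains the intersection of \<open>L\<close> with the preceding member.\<close>

lemma next_normal_subgroup:
  assumes fin: "finite (carrier G)" and sep: "pi_separable \<pi> G" and L: "subgroup L G"
    and N: "normal_in G N L" and ne: "N \<noteq> L"
  obtains M where "normal_in G M L" "N \<subset> M"
    "pi_number \<pi> (card M div card N) \<or> pi_number (primes_compl \<pi>) (card M div card N)"
proof -
  note N' = normal_inD[OF N]
  obtain l S where S: "S 0 = {\<one>}" "S l = carrier G" "\<forall>i\<le>l. S i \<lhd> G"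
    and fac: "\<forall>i<l. S i \<subseteq> S (Suc i) \<and> (let f = Coset.order (G\<lparr>carrier := S (Suc i)\<rparr> Mod S i)
         in pi_number \<pi> f \<or> pi_number (primes_compl \<pi>) f)"
    using sep unfolding pi_separable_def by blast
  have LG: "L \<subseteq> carrier G" using subgroup.subset[OF L] .
  have finL: "finite L" using finite_subset[OF LG fin] .
  define i where "i = (LEAST i. \<not> L \<inter> S i \<subseteq> N)"
  have l: "\<not> L \<inter> S l \<subseteq> N" using S(2) ne N'(2) LG by auto
  have i: "\<not> L \<inter> S i \<subseteq> N" "i \<le> l" unfolding i_def using LeastI[of "\<lambda>i. \<not> L \<inter> S i \<subseteq> N", OF l] Least_le[of "\<lambda>i. \<not> L \<inter> S i \<subseteq> N", OF l] by auto
  have "i \<noteq> 0" using i(1) S(1) subgroup.one_closed[OF N'(1)] by auto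
  then obtain k where k: "i = Suc k" by (cases i) auto
  have below: "L \<inter> S k \<subseteq> N" using not_less_Least[of k "\<lambda>i. \<not> L \<inter> S i \<subseteq> N"] k unfolding i_def by auto
  have kl: "k < l" using i(2) k by simp
  have Sk: "S k \<lhd> G" "S i \<lhd> G" "S k \<subseteq> S i" using S(3) fac kl i(2) k by auto
  note sSk = normal_imp_subgroup[OF Sk(1)] and sSi = normal_imp_subgroup[OF Sk(2)]
  define K where "K = L \<inter> S i"
  have K: "normal_in G K L" unfolding K_def by (rule normal_inI_normal[OF Sk(2) L])
  note K' = normal_inD[OF K]
  define M where "M = (\<lambda>(a,b). a \<otimes> b) ` (N \<times> K)"
  have M: "subgroup M G" unfolding M_def by (rule subgroup_product[OF N'(1,2) K L])
  have MsubL: "M \<subseteq> L" unfolding M_def using N'(2) K'(2) subgroup.m_closed[OF L] by auto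
  have nM: "normal_in G M L" unfolding normal_in_def
  proof (intro conjI ballI M MsubL)
    fix g x assume g: "g \<in> L" and "x \<in> M"
    then obtain a b where x: "a \<in> N" "b \<in> K" "x = a \<otimes> b" unfolding M_def by auto
    have c: "a \<in> carrier G" "b \<in> carrier G" "g \<in> carrier G"
      using x g N'(2) K'(2) LG by auto
    have "g \<otimes> (inv g \<otimes> (b \<otimes> g)) = b \<otimes> g" using c by (simp add: m_assoc[symmetric])
    then have "inv g \<otimes> x \<otimes> g = (inv g \<otimes> a \<otimes> g) \<otimes> (inv g \<otimes> b \<otimes> g)" using c x by (simp add: m_assoc)
    then show "inv g \<otimes> x \<otimes> g \<in> M" unfolding M_def using N'(3)[OF g x(1)] K'(3)[OF g x(2)] by auto
  qed
  have NM: "N \<subseteq> M" unfolding M_def by (rule product_lower[OF N'(1) K'(1)])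
  have KM: "K \<subseteq> M" unfolding M_def by (rule product_upper[OF N'(1) K'(1)])
  have "N \<noteq> M" using KM i(1) unfolding K_def by auto
  have fins: "finite N" "finite K" "finite M" "finite (S k)" "finite (S i)"
    using finite_subset[OF N'(2) finL] finite_subset[OF K'(2) finL] finite_subset[OF MsubL finL]
      finite_subset[OF subgroup.subset[OF sSk] fin] finite_subset[OF subgroup.subset[OF sSi] fin] by auto
  define R where "R = (\<lambda>(a,b). a \<otimes> b) ` (K \<times> S k)"
  have Sknorm: "normal_in G (S k) (carrier G)" unfolding normal_in_def
    using sSk subgroup.subset[OF sSk] normal.inv_op_closed1[OF Sk(1)] by auto
  have R: "subgroup R G" unfolding R_def
    by (rule subgroup_product[OF K'(1) _ Sknorm subgroup_self]) (use K'(2) LG in auto)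
  have RS: "R \<subseteq> S i" unfolding R_def using Sk(3) subgroup.m_closed[OF sSi] unfolding K_def by auto
  have SR: "S k \<subseteq> R" unfolding R_def by (rule product_upper[OF K'(1) sSk])
  have NK: "subgroup (N \<inter> K) G" and KS: "subgroup (K \<inter> S k) G"
    using subgroups_Inter_pair N'(1) K'(1) sSk by auto
  have pos: "0 < card N" "0 < card (N \<inter> K)" "0 < card (S k)" "0 < card (K \<inter> S k)"
    using card_subgroup_pos N'(1) NK sSk KS fins by auto
  have p1: "card M * card (N \<inter> K) = card N * card K" unfolding M_def
    by (rule card_product[OF N'(1) fins(1) K'(1) fins(2)])
  have p2: "card R * card (K \<inter> S k) = card K * card (S k)" unfolding R_def
    by (rule card_product[OF K'(1) fins(2) sSk fins(4)])
  obtain q where q: "card M = card N * q" using card_subgroup_dvd[OF N'(1) M NM] by auto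
  obtain t where t: "card (N \<inter> K) = card (K \<inter> S k) * t"
    using card_subgroup_dvd[OF KS NK] below unfolding K_def by auto
  obtain r where r: "card R = card (S k) * r" using card_subgroup_dvd[OF sSk R SR] by auto
  obtain u where u: "card (S i) = card R * u" using card_subgroup_dvd[OF R sSi RS] by auto
  have "q * card (N \<inter> K) = card K" using p1 q pos(1) by simp
  moreover have "r * card (K \<inter> S k) = card K" using p2 r pos(3) by simp
  ultimately have "q * t * card (K \<inter> S k) = r * card (K \<inter> S k)" using t by (simp add: mult_ac)
  then have qr: "q * t = r" using pos(4) by simp
  interpret Gi: group "G\<lparr>carrier := S i\<rparr>" using subgroup_imp_group[OF sSi] .
  have "card (rcosets\<^bsub>G\<lparr>carrier := S i\<rparr>\<^esub> S k) * card (S k) = card (S i)"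
    using Gi.lagrange[OF subgroup_incl[OF sSk sSi Sk(3)]] by (simp add: Coset.order_def)
  then have "Coset.order (G\<lparr>carrier := S i\<rparr> Mod S k) = q * t * u"
    using u r qr pos(3) unfolding Coset.order_def FactGroup_def by simp
  then have dv: "q dvd Coset.order (G\<lparr>carrier := S i\<rparr> Mod S k)" by simp
  have "pi_number \<pi> (Coset.order (G\<lparr>carrier := S i\<rparr> Mod S k)) \<or> pi_number (primes_compl \<pi>) (Coset.order (G\<lparr>carrier := S i\<rparr> Mod S k))"
    using fac kl unfolding k Let_def by auto
  then have "pi_number \<pi> q \<or> pi_number (primes_compl \<pi>) q" using pi_number_dvd[OF _ dv] by auto
  moreover have "card M div card N = q" using q pos(1) by simp
  ultimately show ?thesis using that[OF nM] NM \<open>N \<noteq> M\<close> by auto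
qed

end

section \<open>Tensor products of representations\<close>

definition kron :: "complex mat \<Rightarrow> complex mat \<Rightarrow> complex mat" where
  "kron A B = mat (dim_row A * dim_row B) (dim_col A * dim_col B)
     (\<lambda>(i,j). A $$ (i div dim_row B, j div dim_col B) * B $$ (i mod dim_row B, j mod dim_col B))"

lemma kron_dim [simp]: "dim_row (kron A B) = dim_row A * dim_row B" "dim_col (kron A B) = dim_col A * dim_col B"
  by (auto simp: kron_def)

lemma div_less_iff_mult: "i < m * k \<Longrightarrow> i div k < (m :: nat)"
  by (simp add: less_mult_imp_div_less)

lemma mod_less_mult: "i < m * k \<Longrightarrow> i mod k < (k :: nat)"
  by (cases "k = 0") auto

lemma kron_index:
  assumes "A \<in> carrier_mat m m'" "B \<in> carrier_mat k k'" "i < m * k" "j < m' * k'"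
  shows "kron A B $$ (i,j) = A $$ (i div k, j div k') * B $$ (i mod k, j mod k')"
  using assms by (auto simp: kron_def)

lemma sum_div_mod:
  fixes f :: "nat \<Rightarrow> nat \<Rightarrow> 'b :: comm_monoid_add"
  shows "(\<Sum>i<m * k. f (i div k) (i mod k)) = (\<Sum>a<m. \<Sum>b<k. f a b)"
proof (cases "k = 0")
  case False
  have "(\<Sum>a<m. \<Sum>b<k. f a b) = (\<Sum>(a,b)\<in>{..<m} \<times> {..<k}. f a b)" by (rule sum.cartesian_product)
  also have "\<dots> = (\<Sum>i<m * k. f (i div k) (i mod k))"
    by (rule sum.reindex_bij_witness[of _ "\<lambda>i. (i div k, i mod k)" "\<lambda>(a,b). a * k + b"])
      (use False in \<open>auto simp: div_less_iff_mult less_mult_imp_div_less intro: mod_less_mult\<close>,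
       metis Suc_leI add.commute add_less_mono1 less_le_trans mult.commute mult_Suc_right mult_le_mono2)
  finally show ?thesis by simp
qed auto

lemma kron_mult:
  assumes "A \<in> carrier_mat m m" "A' \<in> carrier_mat m m" "B \<in> carrier_mat k k" "B' \<in> carrier_mat k k"
  shows "kron A B * kron A' B' = kron (A * A') (B * B')"
proof (rule eq_matI)
  fix i j assume "i < dim_row (kron (A * A') (B * B'))" "j < dim_col (kron (A * A') (B * B'))"
  then have ij: "i < m * k" "j < m * k" using assms by auto
  note dm = div_less_iff_mult[OF ij(1)] div_less_iff_mult[OF ij(2)] mod_less_mult[OF ij(1)] mod_less_mult[OF ij(2)]
  have "(kron A B * kron A' B') $$ (i,j) = (\<Sum>l<m * k. kron A B $$ (i,l) * kron A' B' $$ (l,j))"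
    using ij assms by (simp add: scalar_prod_def atLeast0LessThan)
  also have "\<dots> = (\<Sum>l<m * k. (\<lambda>a b. (A $$ (i div k, a) * A' $$ (a, j div k)) * (B $$ (i mod k, b) * B' $$ (b, j mod k))) (l div k) (l mod k))"
    using ij by (intro sum.cong) (auto simp: kron_index[OF assms(1,3)] kron_index[OF assms(2,4)] mult_ac)
  also have "\<dots> = (\<Sum>a<m. \<Sum>b<k. (A $$ (i div k, a) * A' $$ (a, j div k)) * (B $$ (i mod k, b) * B' $$ (b, j mod k)))"
    by (rule sum_div_mod)
  also have "\<dots> = (\<Sum>a<m. A $$ (i div k, a) * A' $$ (a, j div k)) * (\<Sum>b<k. B $$ (i mod k, b) * B' $$ (b, j mod k))"
    by (simp add: sum_product)
  also have "\<dots> = (A * A') $$ (i div k, j div k) * (B * B') $$ (i mod k, j mod k)"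
    using dm assms by (simp add: scalar_prod_def atLeast0LessThan)
  also have "\<dots> = kron (A * A') (B * B') $$ (i,j)"
    by (rule kron_index[symmetric, of _ m m _ k k]) (use ij assms in auto)
  finally show "(kron A B * kron A' B') $$ (i,j) = kron (A * A') (B * B') $$ (i,j)" .
qed (use assms in auto)

lemma kron_smult: "kron (c \<cdot>\<^sub>m A) (d \<cdot>\<^sub>m B) = (c * d) \<cdot>\<^sub>m kron A B"
proof (rule eq_matI)
  fix i j assume "i < dim_row ((c * d) \<cdot>\<^sub>m kron A B)" "j < dim_col ((c * d) \<cdot>\<^sub>m kron A B)"
  then have ij: "i < dim_row A * dim_row B" "j < dim_col A * dim_col B" by auto
  show "kron (c \<cdot>\<^sub>m A) (d \<cdot>\<^sub>m B) $$ (i,j) = ((c * d) \<cdot>\<^sub>m kron A B) $$ (i,j)"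
    using ij div_less_iff_mult[OF ij(1)] div_less_iff_mult[OF ij(2)] mod_less_mult[OF ij(1)] mod_less_mult[OF ij(2)]
    by (simp add: kron_def)
qed auto

lemma kron_add_smult:
  assumes "A \<in> carrier_mat m m" "A' \<in> carrier_mat m m" "B \<in> carrier_mat k k" "B' \<in> carrier_mat k k"
  shows "kron (A + c \<cdot>\<^sub>m A') B = kron A B + c \<cdot>\<^sub>m kron A' B" "kron A (B + c \<cdot>\<^sub>m B') = kron A B + c \<cdot>\<^sub>m kron A B'"
  unfolding kron_def using assms
  by (auto simp: div_less_iff_mult mod_less_mult algebra_simps)

lemma nat_div_mod_eq: "i div k = j div k \<Longrightarrow> i mod k = j mod k \<Longrightarrow> i = (j :: nat)"
  by (metis div_mult_mod_eq)

lemma kron_one: "kron (1\<^sub>m m) (1\<^sub>m k) = 1\<^sub>m (m * k)"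
proof (rule eq_matI)
  fix i j assume "i < dim_row (1\<^sub>m (m * k))" "j < dim_col (1\<^sub>m (m * k))"
  then have ij: "i < m * k" "j < m * k" by auto
  show "kron (1\<^sub>m m) (1\<^sub>m k) $$ (i,j) = 1\<^sub>m (m * k) $$ (i,j)"
    using ij div_less_iff_mult[OF ij(1)] div_less_iff_mult[OF ij(2)] mod_less_mult[OF ij(1)] mod_less_mult[OF ij(2)]
      nat_div_mod_eq[of i k j]
    by (subst kron_index[of _ m m _ k k]) auto
qed auto

lemma kron_unit:
  assumes "i < m * k" "j < m * k"
  shows "unit_mat (m * k) i j = kron (unit_mat m (i div k) (j div k)) (unit_mat k (i mod k) (j mod k))"
proof (rule eq_matI)
  fix a b assume "a < dim_row (kron (unit_mat m (i div k) (j div k)) (unit_mat k (i mod k) (j mod k)))"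
    "b < dim_col (kron (unit_mat m (i div k) (j div k)) (unit_mat k (i mod k) (j mod k)))"
  then have ab: "a < m * k" "b < m * k" by auto
  show "unit_mat (m * k) i j $$ (a,b) = kron (unit_mat m (i div k) (j div k)) (unit_mat k (i mod k) (j mod k)) $$ (a,b)"
    using ab div_less_iff_mult[OF ab(1)] div_less_iff_mult[OF ab(2)] mod_less_mult[OF ab(1)] mod_less_mult[OF ab(2)]
      nat_div_mod_eq[of a k i] nat_div_mod_eq[of b k j]
    by (subst kron_index[of _ m m _ k k]) auto
qed auto

lemma mat_unit_expansion:
  assumes "Z \<in> carrier_mat n n"
  shows "Z = msum n n (\<lambda>p. Z $$ p \<cdot>\<^sub>m unit_mat n (fst p) (snd p)) ({..<n} \<times> {..<n})"
proof (rule eq_matI)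
  fix a b assume "a < dim_row (msum n n (\<lambda>p. Z $$ p \<cdot>\<^sub>m unit_mat n (fst p) (snd p)) ({..<n} \<times> {..<n}))"
    "b < dim_col (msum n n (\<lambda>p. Z $$ p \<cdot>\<^sub>m unit_mat n (fst p) (snd p)) ({..<n} \<times> {..<n}))"
  then have ab: "a < n" "b < n" by auto
  have "(\<Sum>p\<in>{..<n} \<times> {..<n}. (Z $$ p \<cdot>\<^sub>m unit_mat n (fst p) (snd p)) $$ (a,b)) =
    (\<Sum>p\<in>{..<n} \<times> {..<n}. if p = (a,b) then Z $$ (a,b) else 0)"
    using ab by (intro sum.cong) auto
  also have "\<dots> = Z $$ (a,b)" using ab by (subst sum.delta) auto
  finally show "Z $$ (a,b) = msum n n (\<lambda>p. Z $$ p \<cdot>\<^sub>m unit_mat n (fst p) (snd p)) ({..<n} \<times> {..<n}) $$ (a,b)"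
    using ab by simp
qed (use assms in auto)

context group
begin

lemma proj_rep_kron:
  assumes T: "proj_rep G J m \<delta> T" and \<tau>: "proj_rep G J k \<epsilon> \<tau>"
    and \<beta>: "\<And>x y. x \<in> J \<Longrightarrow> y \<in> J \<Longrightarrow> \<beta> (x,y) = \<delta> (x,y) * \<epsilon> (x,y)" and one: "\<one> \<in> J"
  shows "proj_rep G J (m * k) \<beta> (\<lambda>x. kron (T x) (\<tau> x))"
  unfolding proj_rep_def
proof (intro conjI ballI)
  note D = proj_repD[OF T] and E = proj_repD[OF \<tau>]
  show "0 < m * k" using D(1) E(1) by simp
  show "kron (T x) (\<tau> x) \<in> carrier_mat (m * k) (m * k)" if "x \<in> J" for x using D(3,4)[OF that] E(3,4)[OF that] by (intro carrier_matI) auto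
  fix x y assume x: "x \<in> J" and y: "y \<in> J"
  show "\<beta> (x,y) \<noteq> 0" using D(5) E(5) \<beta> x y by simp
  show "kron (T y) (\<tau> y) * kron (T x) (\<tau> x) = \<beta> (x,y) \<cdot>\<^sub>m kron (T (x \<otimes> y)) (\<tau> (x \<otimes> y))"
    using kron_mult[OF D(2)[OF y] D(2)[OF x] E(2)[OF y] E(2)[OF x]] D(6)[OF x y] E(6)[OF x y] \<beta>[OF x y]
    by (simp add: kron_smult)
next
  show "kron (T \<one>) (\<tau> \<one>) = \<beta> (\<one>,\<one>) \<cdot>\<^sub>m 1\<^sub>m (m * k)"
    using proj_repD(7)[OF T] proj_repD(7)[OF \<tau>] \<beta>[OF one one] by (simp add: kron_smult kron_one)
qed

text \<open>On \<open>K\<close> the second factor is scalar, so that the span contains all \<open>X \<otimes> 1\<close>. Then it also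
  contains \<open>1 \<otimes> \<tau>(x)\<close>, the product of \<open>T(x)\<^sup>-\<^sup>1 \<otimes> 1\<close> and \<open>T(x) \<otimes> \<tau>(x)\<close>, hence everything.\<close>

lemma full_kron:
  assumes H: "subgroup H G" and T: "proj_rep G H m \<delta> T" and \<tau>: "proj_rep G H k \<epsilon> \<tau>"
    and K: "K \<subseteq> H" "full m T K" "\<And>x. x \<in> K \<Longrightarrow> scalar_mat k (\<tau> x)" and fH: "full k \<tau> H"
  shows "full (m * k) (\<lambda>x. kron (T x) (\<tau> x)) H"
  unfolding full_def
proof
  let ?R = "\<lambda>x. kron (T x) (\<tau> x)"
  note D = proj_repD[OF T] and E = proj_repD[OF \<tau>]
  have rep: "proj_rep G H (m * k) (\<lambda>p. \<delta> p * \<epsilon> p) ?R"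
    by (rule proj_rep_kron[OF T \<tau> refl subgroup.one_closed[OF H]])
  have S: "?R ` H \<subseteq> carrier_mat (m * k) (m * k)" using proj_repD(2)[OF rep] by auto
  have TK: "T ` K \<subseteq> carrier_mat m m" using D(2) K(1) by auto
  have \<tau>H: "\<tau> ` H \<subseteq> carrier_mat k k" using E(2) by auto
  have left: "kron X (1\<^sub>m k) \<in> mat_span (m * k) (?R ` H)" if "X \<in> carrier_mat m m" for X
  proof -
    have "X \<in> mat_span m (T ` K)" using K(2) that unfolding full_def by auto
    then show ?thesis
    proof induction
      case mat_span_zero
      have "kron (0\<^sub>m m m) (1\<^sub>m k) = 0\<^sub>m (m * k) (m * k)" unfolding kron_def
        by (intro eq_matI) (auto simp: div_less_iff_mult)
      then show ?case by (simp add: mat_span.intros)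
    next
      case (mat_span_add_smult X A d)
      then obtain x where x: "x \<in> K" "A = T x" by auto
      have xH: "x \<in> H" using K(1) x by auto
      have Xc: "X \<in> carrier_mat m m" by (rule mat_span_carrier[OF TK mat_span_add_smult(1)])
      obtain c where c: "\<tau> x = c \<cdot>\<^sub>m 1\<^sub>m k" using K(3)[OF x(1)] unfolding scalar_mat_def by auto
      have "c \<noteq> 0"
      proof
        assume "c = 0"
        then have z: "\<tau> x = 0\<^sub>m k k" using c zero_smult_mat[of "1\<^sub>m k" k k] by simp
        have "rep_inv G \<epsilon> \<tau> x * \<tau> x = 1\<^sub>m k" "rep_inv G \<epsilon> \<tau> x \<in> carrier_mat k k" using rep_inv[OF H \<tau> xH] by auto
        then have "1\<^sub>m k = (0\<^sub>m k k :: complex mat)" unfolding z by simp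
        then have "1\<^sub>m k $$ (0,0) = (0\<^sub>m k k :: complex mat) $$ (0,0)" by simp
        then show False using E(1) by simp
      qed
      have "kron (X + d \<cdot>\<^sub>m A) (1\<^sub>m k) = kron X (1\<^sub>m k) + d \<cdot>\<^sub>m kron (T x) (1\<^sub>m k)"
        unfolding x(2) by (rule kron_add_smult(1)[OF Xc D(2)[OF xH] one_carrier_mat one_carrier_mat])
      also have "kron (T x) (1\<^sub>m k) = (1 / c) \<cdot>\<^sub>m ?R x"
        using kron_smult[of 1 "T x" c "1\<^sub>m k"] \<open>c \<noteq> 0\<close> unfolding c by (simp add: mat_smult_smult mat_smult_one)
      finally show ?case using mat_span_add_smult(3) xH by (auto simp: mat_smult_smult intro!: mat_span.intros)
    qed
  qed
  have right: "kron (1\<^sub>m m) Y \<in> mat_span (m * k) (?R ` H)" if "Y \<in> carrier_mat k k" for Y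
  proof -
    have "Y \<in> mat_span k (\<tau> ` H)" using fH that unfolding full_def by auto
    then show ?thesis
    proof induction
      case mat_span_zero
      have "kron (1\<^sub>m m) (0\<^sub>m k k) = 0\<^sub>m (m * k) (m * k)" unfolding kron_def
        by (intro eq_matI) (auto simp: mod_less_mult)
      then show ?case by (simp add: mat_span.intros)
    next
      case (mat_span_add_smult Y A d)
      then obtain x where x: "x \<in> H" "A = \<tau> x" by auto
      have Yc: "Y \<in> carrier_mat k k" by (rule mat_span_carrier[OF \<tau>H mat_span_add_smult(1)])
      note I = rep_inv[OF H T x(1)]
      have "kron (1\<^sub>m m) (\<tau> x) = kron (rep_inv G \<delta> T x) (1\<^sub>m k) * ?R x"
        using kron_mult[OF I(1) D(2)[OF x(1)] one_carrier_mat E(2)[OF x(1)]] I(2) E(2)[OF x(1)] by simp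
      also have "\<dots> \<in> mat_span (m * k) (?R ` H)"
        by (rule mat_span_closed_mult[OF H rep left[OF I(1)] mat_span_base[OF S imageI[OF x(1)]]])
      finally have g: "kron (1\<^sub>m m) (\<tau> x) \<in> mat_span (m * k) (?R ` H)" .
      have "kron (1\<^sub>m m) (Y + d \<cdot>\<^sub>m A) = kron (1\<^sub>m m) Y + d \<cdot>\<^sub>m kron (1\<^sub>m m) (\<tau> x)"
        unfolding x(2) by (rule kron_add_smult(2)[OF one_carrier_mat one_carrier_mat Yc E(2)[OF x(1)]])
      then show ?case using mat_span_add[OF S mat_span_add_smult(3) mat_span_smult[OF S g]] by simp
    qed
  qed
  have both: "kron X Y \<in> mat_span (m * k) (?R ` H)" if "X \<in> carrier_mat m m" "Y \<in> carrier_mat k k" for X Y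
    using mat_span_closed_mult[OF H rep left[OF that(1)] right[OF that(2)]]
      kron_mult[OF that(1) one_carrier_mat one_carrier_mat that(2)] that by simp
  fix Z :: "complex mat" assume Z: "Z \<in> carrier_mat (m * k) (m * k)"
  show "Z \<in> mat_span (m * k) (?R ` H)"
    by (subst mat_unit_expansion[OF Z]) (rule msum_in_span[OF _ _ S], auto simp: kron_unit intro!: mat_span_smult[OF S] both)
qed

text \<open>Every element of \<open>M\<close> is the product of an element of \<open>H \<inter> M\<close> and an element of \<open>N\<close>, on which \<open>T\<close> is scalar.\<close>

lemma full_covering:
  assumes J: "subgroup J G" and T: "proj_rep G J m \<delta> T" and fM: "full m T M"
    and sub: "H \<subseteq> J" "N \<subseteq> J" and cov: "M \<subseteq> (\<lambda>(a,b). a \<otimes> b) ` (H \<times> N)"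
    and N: "N \<subseteq> M" "subgroup M G" and sc: "\<And>x. x \<in> N \<Longrightarrow> scalar_mat m (T x)"
  shows "full m T (H \<inter> M)"
  unfolding full_def
proof
  note D = proj_repD[OF T]
  have S: "T ` (H \<inter> M) \<subseteq> carrier_mat m m" using D(2) sub by auto
  fix Z :: "complex mat" assume "Z \<in> carrier_mat m m"
  then have "Z \<in> mat_span m (T ` M)" using fM unfolding full_def by auto
  then show "Z \<in> mat_span m (T ` (H \<inter> M))"
  proof induction
    case mat_span_zero
    show ?case by (rule mat_span.intros)
  next
    case (mat_span_add_smult X A d)
    then obtain x where x: "x \<in> M" "A = T x" by auto
    then obtain h n where h: "h \<in> H" "n \<in> N" "x = h \<otimes> n" using cov by auto
    have hJ: "h \<in> J" and nJ: "n \<in> J" using h sub by auto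
    note hG = subgroup.mem_carrier[OF J hJ] and nG = subgroup.mem_carrier[OF J nJ]
    have "h = x \<otimes> inv n" using h(3) hG nG by (simp add: m_assoc)
    then have hM: "h \<in> M" using x(1) h(2) N subgroup.m_closed[OF N(2)] subgroup.m_inv_closed[OF N(2)] by auto
    obtain c where c: "T n = c \<cdot>\<^sub>m 1\<^sub>m m" using sc[OF h(2)] unfolding scalar_mat_def by auto
    have "\<delta> (h,n) \<cdot>\<^sub>m T x = \<delta> (h,n) \<cdot>\<^sub>m ((c / \<delta> (h,n)) \<cdot>\<^sub>m T h)"
      using D(6)[OF hJ nJ] D(5)[OF hJ nJ] D(3)[OF hJ] unfolding c h(3) by (simp add: mat_algebra)
    then have "T x = (c / \<delta> (h,n)) \<cdot>\<^sub>m T h" by (rule smult_mat_cancel[OF D(5)[OF hJ nJ]])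
    then show ?case using mat_span_add_smult(3) h(1) hM x(2)
      by (auto simp: mat_smult_smult intro!: mat_span.intros)
  qed
qed

end

section \<open>The factorization\<close>

text \<open>Representations of \<open>J\<close>, irreducible on \<open>J\<close> and on the relevant Hall subgroups, together with a
  nonzero equivariant bilinear map, given by its structure constants \<open>D\<close>, into the representation
  \<open>\<rho>\<close> of \<open>L\<close>. The extension of this map to the induced representation is onto if \<open>\<rho>\<close> is
  irreducible, and then bijective by the equation between the dimensions. That both factors are scalar on \<open>N\<close> is what
  keeps the tensor product with a further factor irreducible in the homogeneous step.\<close>

definition equivariant ::
  "'g set \<Rightarrow> nat \<Rightarrow> nat \<Rightarrow> nat \<Rightarrow> ('g \<Rightarrow> complex mat) \<Rightarrow> ('g \<Rightarrow> complex mat) \<Rightarrow> ('g \<Rightarrow> complex mat) \<Rightarrow>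
    (nat \<Rightarrow> nat \<Rightarrow> nat \<Rightarrow> complex) \<Rightarrow> bool" where
  "equivariant J n k1 k2 \<rho> \<tau>1 \<tau>2 D \<longleftrightarrow>
     (\<exists>r<n. \<exists>i<k1. \<exists>j<k2. D r i j \<noteq> 0) \<and>
     (\<forall>x\<in>J. \<forall>r<n. \<forall>i<k1. \<forall>j<k2. (\<Sum>s<n. \<rho> x $$ (r,s) * D s i j) =
        (\<Sum>a<k1. \<Sum>b<k2. \<tau>1 x $$ (a,i) * \<tau>2 x $$ (b,j) * D r a b))"

definition factors ::
  "nat set \<Rightarrow> ('g, 'm) monoid_scheme \<Rightarrow> 'g set \<Rightarrow> 'g set \<Rightarrow> nat \<Rightarrow> ('g \<Rightarrow> complex mat) \<Rightarrow>
    ('g \<times> 'g \<Rightarrow> complex) \<Rightarrow> ('g \<times> 'g \<Rightarrow> complex) \<Rightarrow> 'g set \<Rightarrow> nat \<Rightarrow> nat \<Rightarrow>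
    ('g \<Rightarrow> complex mat) \<Rightarrow> ('g \<Rightarrow> complex mat) \<Rightarrow> (nat \<Rightarrow> nat \<Rightarrow> nat \<Rightarrow> complex) \<Rightarrow> bool" where
  "factors \<pi> G L N n \<rho> \<beta> \<gamma> J k1 k2 \<tau>1 \<tau>2 D \<longleftrightarrow>
     subgroup J G \<and> N \<subseteq> J \<and> J \<subseteq> L \<and>
     proj_rep G J k1 \<beta> \<tau>1 \<and> proj_rep G J k2 \<gamma> \<tau>2 \<and> full k1 \<tau>1 J \<and> full k2 \<tau>2 J \<and>
     (\<forall>x\<in>N. scalar_mat k1 (\<tau>1 x) \<and> scalar_mat k2 (\<tau>2 x)) \<and>
     (\<forall>H. subgroup H G \<and> H \<subseteq> J \<and> pi_number (primes_compl \<pi>) (card J div card H) \<longrightarrow> full k1 \<tau>1 H) \<and>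
     (\<forall>H. subgroup H G \<and> H \<subseteq> J \<and> pi_number \<pi> (card J div card H) \<longrightarrow> full k2 \<tau>2 H) \<and>
     n * card J = k1 * k2 * card L \<and> equivariant J n k1 k2 \<rho> \<tau>1 \<tau>2 D"

definition factorizable ::
  "nat set \<Rightarrow> ('g, 'm) monoid_scheme \<Rightarrow> 'g set \<Rightarrow> 'g set \<Rightarrow> nat \<Rightarrow> ('g \<Rightarrow> complex mat) \<Rightarrow>
    ('g \<times> 'g \<Rightarrow> complex) \<Rightarrow> ('g \<times> 'g \<Rightarrow> complex) \<Rightarrow> bool" where
  "factorizable \<pi> G L N n \<rho> \<beta> \<gamma> \<longleftrightarrow> (\<exists>J k1 k2 \<tau>1 \<tau>2 D. factors \<pi> G L N n \<rho> \<beta> \<gamma> J k1 k2 \<tau>1 \<tau>2 D)"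

lemma factorizable_swap:
  assumes \<pi>: "\<pi> \<subseteq> {p. Factorial_Ring.prime p}" and "factorizable (primes_compl \<pi>) G L N n \<rho> \<gamma> \<beta>"
  shows "factorizable \<pi> G L N n \<rho> \<beta> \<gamma>"
proof -
  obtain J k1 k2 \<tau>1 \<tau>2 D where F: "factors (primes_compl \<pi>) G L N n \<rho> \<gamma> \<beta> J k1 k2 \<tau>1 \<tau>2 D"
    using assms(2) unfolding factorizable_def by blast
  have eq: "equivariant J n k1 k2 \<rho> \<tau>1 \<tau>2 D" using F unfolding factors_def by blast
  have "equivariant J n k2 k1 \<rho> \<tau>2 \<tau>1 (\<lambda>r j i. D r i j)"
    unfolding equivariant_def
  proof (intro conjI ballI allI impI)
    show "\<exists>r<n. \<exists>i<k2. \<exists>j<k1. D r j i \<noteq> 0" using eq unfolding equivariant_def by blast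
    fix x r j i assume *: "x \<in> J" "r < n" "j < k2" "i < k1"
    then have "(\<Sum>s<n. \<rho> x $$ (r,s) * D s i j) = (\<Sum>a<k1. \<Sum>b<k2. \<tau>1 x $$ (a,i) * \<tau>2 x $$ (b,j) * D r a b)"
      using eq unfolding equivariant_def by blast
    also have "\<dots> = (\<Sum>b<k2. \<Sum>a<k1. \<tau>2 x $$ (b,j) * \<tau>1 x $$ (a,i) * D r a b)"
      by (subst sum.swap) (simp add: mult_ac)
    finally show "(\<Sum>s<n. \<rho> x $$ (r,s) * D s i j) = (\<Sum>b<k2. \<Sum>a<k1. \<tau>2 x $$ (b,j) * \<tau>1 x $$ (a,i) * D r a b)" .
  qed
  then have "factors \<pi> G L N n \<rho> \<beta> \<gamma> J k2 k1 \<tau>2 \<tau>1 (\<lambda>r j i. D r i j)"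
    using F unfolding factors_def primes_compl_compl[OF \<pi>] by (simp add: mult_ac)
  then show ?thesis unfolding factorizable_def by blast
qed

lemma inj_mat_apply_nonzero:
  assumes "inj_mat A" "A \<in> carrier_mat n k" "s0 < k" "d s0 \<noteq> 0"
  shows "\<exists>r<n. (\<Sum>s<k. A $$ (r,s) * d s) \<noteq> 0"
proof (rule ccontr)
  assume no: "\<not> ?thesis"
  have "A *\<^sub>v vec k d = 0\<^sub>v n"
    by (rule eq_vecI) (use assms(2) no in \<open>auto simp: scalar_prod_def atLeast0LessThan\<close>)
  then have "vec k d = 0\<^sub>v k" using assms(1,2) unfolding inj_mat_def by auto
  then have "vec k d $ s0 = 0" using assms(3) by simp
  then show False using assms(3,4) by simp
qed

context group
begin

text \<open>Transitivity of induction: the bilinear map for \<open>\<tau>\<close> is composed with the embedding \<open>A\<close> of \<open>\<tau>\<close> into \<open>\<rho>\<close>.\<close>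

lemma factorizable_induced:
  assumes L: "L \<subseteq> carrier G" "finite L" and rep: "proj_rep G L n \<alpha> \<rho>"
    and S: "subgroup S G" "S \<subseteq> L" and A: "A \<in> carrier_mat n k" "inj_mat A"
    and hom: "\<And>x. x \<in> S \<Longrightarrow> \<rho> x * A = A * \<tau> x" and \<tau>: "proj_rep G S k \<alpha> \<tau>" and dims: "n * card S = k * card L"
    and fac: "factorizable \<pi> G S N k \<tau> \<beta> \<gamma>"
  shows "factorizable \<pi> G L N n \<rho> \<beta> \<gamma>"
proof -
  obtain J k1 k2 \<tau>1 \<tau>2 D where F: "factors \<pi> G S N k \<tau> \<beta> \<gamma> J k1 k2 \<tau>1 \<tau>2 D"
    using fac unfolding factorizable_def by blast
  have JS: "J \<subseteq> S" and d2: "k * card J = k1 * k2 * card S" and eq: "equivariant J k k1 k2 \<tau> \<tau>1 \<tau>2 D"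
    using F unfolding factors_def by blast+
  have eqv: "(\<Sum>s<k. \<tau> x $$ (r,s) * D s i j) = (\<Sum>a<k1. \<Sum>b<k2. \<tau>1 x $$ (a,i) * \<tau>2 x $$ (b,j) * D r a b)"
    if "x \<in> J" "r < k" "i < k1" "j < k2" for x r i j using eq that unfolding equivariant_def by blast
  define D' where "D' r i j = (\<Sum>s<k. A $$ (r,s) * D s i j)" for r i j
  have "equivariant J n k1 k2 \<rho> \<tau>1 \<tau>2 D'" unfolding equivariant_def
  proof (intro conjI ballI allI impI)
    obtain s0 i j where "s0 < k" "i < k1" "j < k2" "D s0 i j \<noteq> 0" using eq unfolding equivariant_def by blast
    then show "\<exists>r<n. \<exists>i<k1. \<exists>j<k2. D' r i j \<noteq> 0"
      using inj_mat_apply_nonzero[OF A(2,1), of s0 "\<lambda>s. D s i j"] unfolding D'_def by blast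
    fix x r i j assume *: "x \<in> J" "r < n" "i < k1" "j < k2"
    have xS: "x \<in> S" and xL: "x \<in> L" using * JS S(2) by auto
    note d = proj_repD(3,4)[OF rep xL] proj_repD(3,4)[OF \<tau> xS]
    have "(\<Sum>s<n. \<rho> x $$ (r,s) * D' s i j) = (\<Sum>t<k. (\<Sum>s<n. \<rho> x $$ (r,s) * A $$ (s,t)) * D t i j)"
      unfolding D'_def sum_distrib_left sum_distrib_right by (subst sum.swap) (simp add: mult_ac)
    also have "\<dots> = (\<Sum>t<k. (\<rho> x * A) $$ (r,t) * D t i j)"
      using * d A(1) by (auto simp: scalar_prod_def atLeast0LessThan intro!: sum.cong)
    also have "\<dots> = (\<Sum>t<k. (\<Sum>s<k. A $$ (r,s) * \<tau> x $$ (s,t)) * D t i j)"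
      unfolding hom[OF xS] using * d A(1) by (auto simp: scalar_prod_def atLeast0LessThan intro!: sum.cong)
    also have "\<dots> = (\<Sum>s<k. A $$ (r,s) * (\<Sum>t<k. \<tau> x $$ (s,t) * D t i j))"
      unfolding sum_distrib_left sum_distrib_right by (subst sum.swap) (simp add: mult_ac)
    also have "\<dots> = (\<Sum>s<k. A $$ (r,s) * (\<Sum>a<k1. \<Sum>b<k2. \<tau>1 x $$ (a,i) * \<tau>2 x $$ (b,j) * D s a b))"
      by (rule sum.cong[OF refl], rule arg_cong2[of _ _ _ _ "(*)"], rule refl, rule eqv) (use * in auto)
    also have "\<dots> = (\<Sum>s<k. \<Sum>a<k1. \<Sum>b<k2. \<tau>1 x $$ (a,i) * \<tau>2 x $$ (b,j) * (A $$ (r,s) * D s a b))"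
      by (simp add: sum_distrib_left mult_ac)
    also have "\<dots> = (\<Sum>a<k1. \<Sum>b<k2. \<Sum>s<k. \<tau>1 x $$ (a,i) * \<tau>2 x $$ (b,j) * (A $$ (r,s) * D s a b))"
      by (simp only: sum.swap[of _ _ "{..<k}"])
    also have "\<dots> = (\<Sum>a<k1. \<Sum>b<k2. \<tau>1 x $$ (a,i) * \<tau>2 x $$ (b,j) * D' r a b)"
      unfolding D'_def by (simp add: sum_distrib_left)
    finally show "(\<Sum>s<n. \<rho> x $$ (r,s) * D' s i j) = (\<Sum>a<k1. \<Sum>b<k2. \<tau>1 x $$ (a,i) * \<tau>2 x $$ (b,j) * D' r a b)" .
  qed
  moreover have "n * card J = k1 * k2 * card L"
  proof -
    have "0 < card S" using card_subgroup_pos[OF S(1)] finite_subset[OF S(2) L(2)] by simp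
    moreover have "n * card J * card S = k1 * k2 * card L * card S"
      using dims d2 by (metis mult.assoc mult.commute)
    ultimately show ?thesis by simp
  qed
  ultimately have "factors \<pi> G L N n \<rho> \<beta> \<gamma> J k1 k2 \<tau>1 \<tau>2 D'"
    using F S(2) unfolding factors_def by auto
  then show ?thesis unfolding factorizable_def by blast
qed

text \<open>The homogeneous step over a \<open>\<pi>\<close>-section: the extension \<open>T\<close> is absorbed by the \<open>\<pi>\<close>-factor \<open>\<tau>1\<close>. On a subgroup \<open>H\<close>
  of \<open>\<pi>'\<close>-index the product \<open>T \<otimes> \<tau>1\<close> remains irreducible, for \<open>H\<close> covers \<open>M/N\<close>, so that \<open>T\<close> is irreducible on
  \<open>H \<inter> M\<close>, and there \<open>\<tau>1\<close> is scalar. The bilinear map for \<open>\<rho>\<close> is that for \<open>W\<close>, tensored with the identity of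
  the space of \<open>T\<close>.\<close>

lemma factorizable_tensor:
  assumes L: "subgroup L G" "finite L" and N: "normal_in G N L" and M: "normal_in G M L" "N \<subseteq> M"
    and sec: "pi_number \<pi> (card M div card N)"
    and T: "proj_rep G L m \<delta> T" "irreducible_on m T M" "\<And>x. x \<in> N \<Longrightarrow> scalar_mat m (T x)"
    and rep: "proj_rep G L n \<alpha> \<rho>"
    and W: "proj_rep G L e \<epsilon> W" and dims: "n = m * e"
    and F: "\<And>i. i < m \<Longrightarrow> F i \<in> carrier_mat n e" "inj_mat (F 0)"
    and Feq: "\<And>g j. g \<in> L \<Longrightarrow> j < m \<Longrightarrow> \<rho> g * F j = msum n e (\<lambda>i. T g $$ (i,j) \<cdot>\<^sub>m (F i * W g)) {..<m}"
    and fac: "factorizable \<pi> G L M e W (\<lambda>p. \<beta> p / \<delta> p) \<gamma>"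
  shows "factorizable \<pi> G L N n \<rho> \<beta> \<gamma>"
proof -
  note N' = normal_inD[OF N] and M' = normal_inD[OF M(1)]
  obtain J k1 k2 \<tau>1 \<tau>2 D where FF: "factors \<pi> G L M e W (\<lambda>p. \<beta> p / \<delta> p) \<gamma> J k1 k2 \<tau>1 \<tau>2 D"
    using fac unfolding factorizable_def by blast
  have J: "subgroup J G" "M \<subseteq> J" "J \<subseteq> L" and \<tau>1: "proj_rep G J k1 (\<lambda>p. \<beta> p / \<delta> p) \<tau>1" "full k1 \<tau>1 J"
    "\<And>x. x \<in> M \<Longrightarrow> scalar_mat k1 (\<tau>1 x)"
    "\<And>H. subgroup H G \<Longrightarrow> H \<subseteq> J \<Longrightarrow> pi_number (primes_compl \<pi>) (card J div card H) \<Longrightarrow> full k1 \<tau>1 H"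
    and \<tau>2: "proj_rep G J k2 \<gamma> \<tau>2" "full k2 \<tau>2 J" "\<And>x. x \<in> M \<Longrightarrow> scalar_mat k2 (\<tau>2 x)"
    "\<And>H. subgroup H G \<Longrightarrow> H \<subseteq> J \<Longrightarrow> pi_number \<pi> (card J div card H) \<Longrightarrow> full k2 \<tau>2 H"
    and d2: "e * card J = k1 * k2 * card L" and eq: "equivariant J e k1 k2 W \<tau>1 \<tau>2 D"
    using FF unfolding factors_def by blast+
  have finJ: "finite J" using finite_subset[OF J(3) L(2)] .
  have finM: "finite M" using finite_subset[OF J(2) finJ] .
  note TJ = proj_rep_mono[OF T(1) J(3)]
  define R where "R x = kron (T x) (\<tau>1 x)" for x
  have R: "proj_rep G J (m * k1) \<beta> R" unfolding R_def
    by (rule proj_rep_kron[OF TJ \<tau>1(1) _ subgroup.one_closed[OF J(1)]]) (use proj_repD(5)[OF TJ] in auto)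
  have fTM: "full m T M" by (rule irreducible_imp_full[OF M'(1) finM proj_rep_mono[OF T(1) M'(2)] T(2)])
  have NJ: "normal_in G N J" and MJ: "normal_in G M J" using N M J M(2) unfolding normal_in_def by auto
  have hall: "full (m * k1) R H" if H: "subgroup H G" "H \<subseteq> J" "pi_number (primes_compl \<pi>) (card J div card H)" for H
  proof -
    have cov: "M \<subseteq> (\<lambda>(a,b). a \<otimes> b) ` (H \<times> N)"
      by (rule hall_covers_section[OF J(1) finJ H NJ MJ M(2) sec])
    have "full m T (H \<inter> M)"
      by (rule full_covering[OF J(1) TJ fTM H(2) _ cov M(2) M'(1) T(3)]) (use M(2) J(2) in auto)
    then show ?thesis unfolding R_def
      by (intro full_kron[OF H(1) proj_rep_mono[OF TJ H(2)] proj_rep_mono[OF \<tau>1(1) H(2)], of "H \<inter> M"])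
        (use \<tau>1(3) \<tau>1(4)[OF H] in auto)
  qed
  have fJ: "full (m * k1) R J" unfolding R_def
    by (rule full_kron[OF J(1) TJ \<tau>1(1) J(2) fTM \<tau>1(3,2)])
  have RN: "scalar_mat (m * k1) (R x)" if x: "x \<in> N" for x
  proof -
    obtain c d where "T x = c \<cdot>\<^sub>m 1\<^sub>m m" "\<tau>1 x = d \<cdot>\<^sub>m 1\<^sub>m k1" using T(3)[OF x] \<tau>1(3)[of x] M(2) x unfolding scalar_mat_def by auto
    then have "R x = (c * d) \<cdot>\<^sub>m 1\<^sub>m (m * k1)" unfolding R_def by (simp add: kron_smult kron_one)
    then show ?thesis unfolding scalar_mat_def by blast
  qed
  have m0: "0 < m" using proj_repD(1)[OF T(1)] .
  have k10: "0 < k1" using proj_repD(1)[OF \<tau>1(1)] .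
  have eqv: "(\<Sum>s<e. W x $$ (r,s) * D s i j) = (\<Sum>a<k1. \<Sum>b<k2. \<tau>1 x $$ (a,i) * \<tau>2 x $$ (b,j) * D r a b)"
    if "x \<in> J" "r < e" "i < k1" "j < k2" for x r i j using eq that unfolding equivariant_def by blast
  define D' where "D' r i j = (\<Sum>s<e. F (i div k1) $$ (r,s) * D s (i mod k1) j)" for r i j
  have "equivariant J n (m * k1) k2 \<rho> R \<tau>2 D'" unfolding equivariant_def
  proof (intro conjI ballI allI impI)
    obtain s0 i j where ij: "s0 < e" "i < k1" "j < k2" "D s0 i j \<noteq> 0" using eq unfolding equivariant_def by blast
    obtain r where "r < n" "(\<Sum>s<e. F 0 $$ (r,s) * D s i j) \<noteq> 0"
      using inj_mat_apply_nonzero[OF F(2) F(1)[OF m0] ij(1), of "\<lambda>s. D s i j"] ij(4) by blast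
    moreover have "i < m * k1" using ij(2) m0 by (metis less_le_trans mult.commute mult_le_mono2 nat_mult_1_right Suc_leI One_nat_def)
    ultimately show "\<exists>r<n. \<exists>i<m * k1. \<exists>j<k2. D' r i j \<noteq> 0"
      using ij(2,3) unfolding D'_def by (intro exI[of _ r] exI[of _ i] exI[of _ j] conjI) auto
    fix x r i j assume x: "x \<in> J" and r: "r < n" and i: "i < m * k1" and j: "j < k2"
    have xL: "x \<in> L" using x J(3) by auto
    define u v where "u = i div k1" and "v = i mod k1"
    have u: "u < m" and v: "v < k1" unfolding u_def v_def using div_less_iff_mult[OF i] mod_less_mult[OF i] by auto
    note d = proj_repD(3,4)[OF rep xL] proj_repD(3,4)[OF W xL] proj_repD(3,4)[OF T(1) xL] proj_repD(3,4)[OF \<tau>1(1) x]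
    have Fd: "dim_row (F a) = n" "dim_col (F a) = e" if "a < m" for a using F(1)[OF that] by auto
    have "(\<Sum>s<n. \<rho> x $$ (r,s) * D' s i j) = (\<Sum>t<e. (\<Sum>s<n. \<rho> x $$ (r,s) * F u $$ (s,t)) * D t v j)"
      unfolding D'_def u_def v_def sum_distrib_left sum_distrib_right by (subst sum.swap) (simp add: mult_ac)
    also have "\<dots> = (\<Sum>t<e. (\<rho> x * F u) $$ (r,t) * D t v j)"
      using r d Fd[OF u] by (auto simp: scalar_prod_def atLeast0LessThan intro!: sum.cong)
    also have "\<dots> = (\<Sum>t<e. (\<Sum>a<m. T x $$ (a,u) * (\<Sum>s<e. F a $$ (r,s) * W x $$ (s,t))) * D t v j)"
      unfolding Feq[OF xL u] using r d Fd by (auto simp: scalar_prod_def atLeast0LessThan intro!: sum.cong)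
    also have "\<dots> = (\<Sum>t<e. \<Sum>a<m. \<Sum>s<e. T x $$ (a,u) * (F a $$ (r,s) * (W x $$ (s,t) * D t v j)))"
      by (simp add: sum_distrib_left sum_distrib_right mult_ac)
    also have "\<dots> = (\<Sum>a<m. \<Sum>s<e. \<Sum>t<e. T x $$ (a,u) * (F a $$ (r,s) * (W x $$ (s,t) * D t v j)))"
      by (subst sum.swap, rule sum.cong[OF refl], rule sum.swap)
    also have "\<dots> = (\<Sum>a<m. \<Sum>s<e. T x $$ (a,u) * (F a $$ (r,s) * (\<Sum>t<e. W x $$ (s,t) * D t v j)))"
      by (simp add: sum_distrib_left)
    also have "\<dots> = (\<Sum>a<m. \<Sum>s<e. T x $$ (a,u) * (F a $$ (r,s) * (\<Sum>c<k1. \<Sum>b<k2. \<tau>1 x $$ (c,v) * \<tau>2 x $$ (b,j) * D s c b)))"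
      by (rule sum.cong[OF refl], rule sum.cong[OF refl], rule arg_cong2[of _ _ _ _ "(*)"], rule refl,
          rule arg_cong2[of _ _ _ _ "(*)"], rule refl, rule eqv) (use x v j in auto)
    also have "\<dots> = (\<Sum>a<m. \<Sum>s<e. \<Sum>c<k1. \<Sum>b<k2. T x $$ (a,u) * (F a $$ (r,s) * (\<tau>1 x $$ (c,v) * \<tau>2 x $$ (b,j) * D s c b)))"
      by (simp only: sum_distrib_left)
    also have "\<dots> = (\<Sum>a<m. \<Sum>c<k1. \<Sum>b<k2. \<Sum>s<e. T x $$ (a,u) * (F a $$ (r,s) * (\<tau>1 x $$ (c,v) * \<tau>2 x $$ (b,j) * D s c b)))"
      by (rule sum.cong[OF refl]) (simp only: sum.swap[of _ _ "{..<e}"])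
    also have "\<dots> = (\<Sum>a<m. \<Sum>c<k1. \<Sum>b<k2. T x $$ (a,u) * \<tau>1 x $$ (c,v) * \<tau>2 x $$ (b,j) * (\<Sum>s<e. F a $$ (r,s) * D s c b))"
      by (simp add: sum_distrib_left mult_ac)
    also have "\<dots> = (\<Sum>a<m * k1. (\<lambda>a c. \<Sum>b<k2. T x $$ (a,u) * \<tau>1 x $$ (c,v) * \<tau>2 x $$ (b,j) * (\<Sum>s<e. F a $$ (r,s) * D s c b)) (a div k1) (a mod k1))"
      by (rule sum_div_mod[symmetric])
    also have "\<dots> = (\<Sum>a<m * k1. \<Sum>b<k2. R x $$ (a,i) * \<tau>2 x $$ (b,j) * D' r a b)"
      unfolding D'_def R_def using i
      by (intro sum.cong refl) (auto simp: kron_index[OF proj_repD(2)[OF T(1) xL] proj_repD(2)[OF \<tau>1(1) x]] u_def v_def)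
    finally show "(\<Sum>s<n. \<rho> x $$ (r,s) * D' s i j) = (\<Sum>a<m * k1. \<Sum>b<k2. R x $$ (a,i) * \<tau>2 x $$ (b,j) * D' r a b)" .
  qed
  moreover have "n * card J = m * k1 * k2 * card L" using dims d2 by (metis mult.assoc)
  moreover have "N \<subseteq> J" using M(2) J(2) by auto
  moreover have "\<forall>x\<in>N. scalar_mat (m * k1) (R x) \<and> scalar_mat k2 (\<tau>2 x)" using RN \<tau>2(3) M(2) by auto
  ultimately have "factors \<pi> G L N n \<rho> \<beta> \<gamma> J (m * k1) k2 R \<tau>2 D'"
    unfolding factors_def using J R \<tau>2 fJ hall by auto
  then show ?thesis unfolding factorizable_def by blast
qed

text \<open>A full algebra of scalar matrices has degree one, so that \<open>\<alpha>\<close> is a coboundary. Up to coboundaries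
  \<open>\<beta>\<close> is then the inverse of \<open>\<gamma>\<close>; its order is both a \<open>\<pi>\<close>-number and a \<open>\<pi>'\<close>-number, and \<open>\<beta>\<close> is a coboundary
  itself. This splits \<open>\<rho>\<close> into two representations of degree one.\<close>

lemma factorizable_scalar:
  assumes L: "subgroup L G" and rep: "proj_rep G L n \<alpha> \<rho>" and full: "full n \<rho> L"
    and sc: "\<And>x. x \<in> L \<Longrightarrow> scalar_mat n (\<rho> x)"
    and \<alpha>: "\<And>x y. x \<in> L \<Longrightarrow> y \<in> L \<Longrightarrow> \<alpha> (x,y) = \<beta> (x,y) * \<gamma> (x,y)"
    and \<beta>: "torsion_on \<pi> G L \<beta>" and \<gamma>: "torsion_on (primes_compl \<pi>) G L \<gamma>"
  shows "factorizable \<pi> G L L n \<rho> \<beta> \<gamma>"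
proof -
  note D = proj_repD[OF rep]
  have one: "\<one> \<in> L" using subgroup.one_closed[OF L] .
  have scal: "scalar_mat n X" if "X \<in> carrier_mat n n" for X
  proof -
    have "X \<in> mat_span n (\<rho> ` L)" using full that unfolding full_def by auto
    then show ?thesis
    proof induction
      case mat_span_zero
      show ?case unfolding scalar_mat_def using zero_smult_mat[of "1\<^sub>m n" n n] by (intro exI[of _ 0]) simp
    next
      case (mat_span_add_smult X A c)
      obtain a where "X = a \<cdot>\<^sub>m 1\<^sub>m n" using mat_span_add_smult(3) unfolding scalar_mat_def by blast
      moreover obtain b where "A = b \<cdot>\<^sub>m 1\<^sub>m n" using mat_span_add_smult(2) sc unfolding scalar_mat_def by blast
      ultimately have "X + c \<cdot>\<^sub>m A = (a + c * b) \<cdot>\<^sub>m 1\<^sub>m n" by (intro eq_matI) (auto simp: algebra_simps)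
      then show ?case unfolding scalar_mat_def by blast
    qed
  qed
  have n1: "n = 1"
  proof (rule ccontr)
    assume "n \<noteq> 1"
    then have n: "0 < n" "1 < n" using D(1) by auto
    obtain c where "unit_mat n 0 1 = c \<cdot>\<^sub>m 1\<^sub>m n" using scal[of "unit_mat n 0 1"] unfolding scalar_mat_def by auto
    then have "unit_mat n 0 1 $$ (0,1) = (c \<cdot>\<^sub>m 1\<^sub>m n) $$ (0,1)" by simp
    then show False using n by simp
  qed
  define v where "v x = \<rho> x $$ (0,0)" for x
  have \<rho>v: "\<rho> x = v x \<cdot>\<^sub>m 1\<^sub>m 1" if "x \<in> L" for x using D(2)[OF that] n1 unfolding v_def by (intro eq_matI) auto
  have Lm: "x \<otimes> y \<in> L" if "x \<in> L" "y \<in> L" for x y using subgroup.m_closed[OF L] that by auto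
  have vm: "v x * v y = \<alpha> (x,y) * v (x \<otimes> y)" if "x \<in> L" "y \<in> L" for x y
  proof -
    have "(v y * v x) \<cdot>\<^sub>m 1\<^sub>m 1 = (\<alpha> (x,y) * v (x \<otimes> y)) \<cdot>\<^sub>m 1\<^sub>m 1"
      using D(6)[OF that] \<rho>v that Lm[OF that] by (simp add: mat_algebra mult.commute)
    then have "v y * v x = \<alpha> (x,y) * v (x \<otimes> y)" by (intro smult_one_cancel[of 1]) simp_all
    then show ?thesis by (simp add: mult.commute)
  qed
  have vn: "v x \<noteq> 0" if x: "x \<in> L" for x
  proof
    assume "v x = 0"
    then have z: "\<rho> x = 0\<^sub>m 1 1" using \<rho>v[OF x] zero_smult_mat[of "1\<^sub>m 1" 1 1] by simp
    have "rep_inv G \<alpha> \<rho> x * \<rho> x = 1\<^sub>m n" "rep_inv G \<alpha> \<rho> x \<in> carrier_mat n n" using rep_inv[OF L rep x] by auto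
    then have "1\<^sub>m 1 = (0\<^sub>m 1 1 :: complex mat)" unfolding z n1 by simp
    then have "1\<^sub>m 1 $$ (0,0) = (0\<^sub>m 1 1 :: complex mat) $$ (0,0)" by simp
    then show False by simp
  qed
  have \<alpha>cob: "coboundary_on G L \<alpha>" unfolding coboundary_on_def
    by (rule exI[of _ v]) (use vn vm Lm in \<open>auto simp: field_simps\<close>)
  have nz: "\<beta> (x,y) \<noteq> 0" "\<gamma> (x,y) \<noteq> 0" if "x \<in> L" "y \<in> L" for x y using D(5)[OF that] \<alpha>[OF that] by auto
  have "torsion_on (primes_compl \<pi>) G L (\<lambda>p. \<alpha> p / \<gamma> p)"
    by (rule torsion_on_div[OF coboundary_imp_torsion_on[OF \<alpha>cob] \<gamma>])
  then have "torsion_on (primes_compl \<pi>) G L \<beta>"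
    by (rule torsion_on_cong) (use \<alpha> nz in auto)
  then have "coboundary_on G L \<beta>" by (rule torsion_coprime_coboundary[OF \<beta> _ nz(1)])
  then obtain \<mu> where \<mu>: "\<And>x. x \<in> L \<Longrightarrow> \<mu> x \<noteq> 0"
    "\<And>x y. x \<in> L \<Longrightarrow> y \<in> L \<Longrightarrow> \<beta> (x,y) = \<mu> x * \<mu> y / \<mu> (x \<otimes> y)" unfolding coboundary_on_def by auto
  define \<tau>1 where "\<tau>1 x = \<mu> x \<cdot>\<^sub>m (1\<^sub>m 1 :: complex mat)" for x
  define \<tau>2 where "\<tau>2 x = (v x / \<mu> x) \<cdot>\<^sub>m (1\<^sub>m 1 :: complex mat)" for x
  have r1: "proj_rep G L 1 \<beta> \<tau>1" unfolding proj_rep_def \<tau>1_def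
    using \<mu> nz one Lm by (auto simp: mat_algebra mult.commute)
  have \<gamma>v: "(v y / \<mu> y) * (v x / \<mu> x) = \<gamma> (x,y) * (v (x \<otimes> y) / \<mu> (x \<otimes> y))" if "x \<in> L" "y \<in> L" for x y
    using vm[OF that] \<alpha>[OF that] \<mu>(2)[OF that] \<mu>(1)[OF that(1)] \<mu>(1)[OF that(2)] \<mu>(1)[OF Lm[OF that]]
    by (simp add: field_simps)
  have "v \<one> / \<mu> \<one> = \<gamma> (\<one>,\<one>)" using \<gamma>v[OF one one] \<mu>(1)[OF one] vn[OF one] by (simp add: divide_simps)
  then have t1: "\<tau>2 \<one> = \<gamma> (\<one>,\<one>) \<cdot>\<^sub>m 1\<^sub>m 1" unfolding \<tau>2_def by simp
  have "\<tau>2 y * \<tau>2 x = \<gamma> (x,y) \<cdot>\<^sub>m \<tau>2 (x \<otimes> y)" if "x \<in> L" "y \<in> L" for x y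
  proof -
    have "\<tau>2 y * \<tau>2 x = ((v y / \<mu> y) * (v x / \<mu> x)) \<cdot>\<^sub>m 1\<^sub>m 1" unfolding \<tau>2_def
      by (simp add: mat_smult_left mat_smult_right mat_smult_smult mult.commute)
    then show ?thesis unfolding \<gamma>v[OF that] \<tau>2_def by (simp add: mat_smult_smult)
  qed
  then have r2: "proj_rep G L 1 \<gamma> \<tau>2" unfolding proj_rep_def using nz t1 by (auto simp: \<tau>2_def)
  have f1: "full 1 (\<lambda>x. w x \<cdot>\<^sub>m (1\<^sub>m 1 :: complex mat)) H" if H: "subgroup H G" "H \<subseteq> L" and w: "\<And>x. x \<in> L \<Longrightarrow> w x \<noteq> 0"
    for w :: "'a \<Rightarrow> complex" and H
    unfolding full_def
  proof
    fix X :: "complex mat" assume X: "X \<in> carrier_mat 1 1"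
    have oH: "\<one> \<in> H" using subgroup.one_closed[OF H(1)] .
    let ?S = "(\<lambda>x. w x \<cdot>\<^sub>m (1\<^sub>m 1 :: complex mat)) ` H"
    have "X = (X $$ (0,0) / w \<one>) \<cdot>\<^sub>m (w \<one> \<cdot>\<^sub>m 1\<^sub>m 1)" using X w[OF one] by (intro eq_matI) auto
    moreover have "(X $$ (0,0) / w \<one>) \<cdot>\<^sub>m (w \<one> \<cdot>\<^sub>m 1\<^sub>m 1) \<in> mat_span 1 ?S"
      by (intro mat_span_smult mat_span_base) (use oH in auto)
    ultimately show "X \<in> mat_span 1 ?S" by simp
  qed
  have fu1: "full 1 \<tau>1 H" if "subgroup H G" "H \<subseteq> L" for H unfolding \<tau>1_def by (rule f1[OF that \<mu>(1)])
  have fu2: "full 1 \<tau>2 H" if "subgroup H G" "H \<subseteq> L" for H unfolding \<tau>2_def by (rule f1[OF that]) (use vn \<mu>(1) in auto)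
  have "equivariant L n 1 1 \<rho> \<tau>1 \<tau>2 (\<lambda>_ _ _. 1)" unfolding equivariant_def n1
    using \<rho>v \<mu>(1) by (auto simp: \<tau>1_def \<tau>2_def)
  then have "factors \<pi> G L L n \<rho> \<beta> \<gamma> L 1 1 \<tau>1 \<tau>2 (\<lambda>_ _ _. 1)"
    unfolding factors_def using L r1 r2 fu1 fu2 n1 by (auto simp: scalar_mat_def \<tau>1_def \<tau>2_def)
  then show ?thesis unfolding factorizable_def by blast
qed

text \<open>In the inhomogeneous case \<open>L\<close> becomes smaller, in the homogeneous case \<open>N\<close> becomes larger. The normalisation
  \<open>det T = 1\<close> is made over all of \<open>L\<close>, while the degree divides \<open>|M/N|\<close>: this is what makes the
  order of the cocycle of \<open>T\<close> on \<open>L\<close> a \<open>\<pi>\<close>-number although \<open>L/M\<close> is arbitrary.\<close>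

theorem factorization:
  assumes fin: "finite (carrier G)" and sep: "pi_separable \<pi> G" and \<pi>: "\<pi> \<subseteq> {p. Factorial_Ring.prime p}"
    and L: "subgroup L G" and N: "normal_in G N L"
    and rep: "proj_rep G L n \<alpha> \<rho>" and full: "full n \<rho> L" and sc: "\<And>x. x \<in> N \<Longrightarrow> scalar_mat n (\<rho> x)"
    and \<alpha>: "\<And>x y. x \<in> L \<Longrightarrow> y \<in> L \<Longrightarrow> \<alpha> (x,y) = \<beta> (x,y) * \<gamma> (x,y)"
    and \<beta>: "torsion_on \<pi> G L \<beta>" and \<gamma>: "torsion_on (primes_compl \<pi>) G L \<gamma>"
  shows "factorizable \<pi> G L N n \<rho> \<beta> \<gamma>"
  using L N rep full sc \<alpha> \<beta> \<gamma>
proof (induction "card L - card N" arbitrary: L N n \<alpha> \<rho> \<beta> \<gamma> rule: less_induct)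
  case less
  note L = less.prems(1) and N = less.prems(2) and rep = less.prems(3) and full = less.prems(4)
    and sc = less.prems(5) and \<alpha> = less.prems(6) and \<beta> = less.prems(7) and \<gamma> = less.prems(8)
  note N' = normal_inD[OF N]
  have finL: "finite L" using finite_subset[OF subgroup.subset[OF L] fin] .
  show ?case
  proof (cases "N = L")
    case True
    show ?thesis unfolding True by (rule factorizable_scalar[OF L rep full _ \<alpha> \<beta> \<gamma>]) (use sc True in auto)
  next
    case False
    obtain M where M: "normal_in G M L" "N \<subset> M"
      and sec: "pi_number \<pi> (card M div card N) \<or> pi_number (primes_compl \<pi>) (card M div card N)"
      using next_normal_subgroup[OF fin sep L N False] by metis
    note M' = normal_inD[OF M(1)]
    have finM: "finite M" using finite_subset[OF M'(2) finL] .
    have NM: "N \<subseteq> M" using M(2) by auto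
    obtain m B \<sigma> where sub: "B \<in> carrier_mat n m" "inj_mat B" "proj_rep G M m \<alpha> \<sigma>" "irreducible_on m \<sigma> M"
      "\<And>x. x \<in> M \<Longrightarrow> \<rho> x * B = B * \<sigma> x"
      using minimal_submodule[OF M'(1) proj_rep_mono[OF rep M'(2)]] by metis
    interpret C: clifford G L M n m \<alpha> \<rho> \<sigma> B
      by (intro clifford.intro clifford_axioms.intro is_group L finL M' rep full sub)
    show ?thesis
    proof (cases "C.P = 1\<^sub>m n")
      case False
      obtain S k \<tau> A where S: "subgroup S G" "S \<subset> L" "N \<subseteq> S" and \<tau>: "proj_rep G S k \<alpha> \<tau>" "full k \<tau> S"
        and A: "A \<in> carrier_mat n k" "inj_mat A" "\<And>x. x \<in> S \<Longrightarrow> \<rho> x * A = A * \<tau> x"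
        and dims: "n * card S = k * card L" and sN: "\<And>x. x \<in> N \<Longrightarrow> scalar_mat k (\<tau> x)"
        by (rule C.inhomogeneous[OF False N'(2) sc], assumption, blast)
      have SL: "S \<subseteq> L" using S(2) by auto
      have NS: "normal_in G N S" using N S unfolding normal_in_def by auto
      have "card S < card L" using psubset_card_mono[OF finL S(2)] .
      moreover have "card N \<le> card S" using card_mono[OF finite_subset[OF SL finL] S(3)] .
      ultimately have "card S - card N < card L - card N" by linarith
      then have fac: "factorizable \<pi> G S N k \<tau> \<beta> \<gamma>"
        by (rule less.hyps[OF _ S(1) NS \<tau> sN _ torsion_on_mono[OF \<beta> SL] torsion_on_mono[OF \<gamma> SL]]) (use \<alpha> SL in auto)
      show ?thesis
        by (rule factorizable_induced[OF subgroup.subset[OF L] finL rep S(1) SL A(1,2) _ \<tau>(1) dims fac]) (rule A(3))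
    next
      case True
      obtain e T \<delta> W F where T: "proj_rep G L m \<delta> T" "\<And>x. x \<in> L \<Longrightarrow> det (T x) = 1" "irreducible_on m T M"
        "\<And>x. x \<in> N \<Longrightarrow> scalar_mat m (T x)"
        and W: "proj_rep G L e (\<lambda>p. \<alpha> p / \<delta> p) W" "full e W L" "\<And>x. x \<in> M \<Longrightarrow> scalar_mat e (W x)"
        and dims: "n = m * e" and F: "\<And>i. i < m \<Longrightarrow> F i \<in> carrier_mat n e" "inj_mat (F 0)"
        "\<And>g j. g \<in> L \<Longrightarrow> j < m \<Longrightarrow> \<rho> g * F j = msum n e (\<lambda>i. T g $$ (i,j) \<cdot>\<^sub>m (F i * W g)) {..<m}"
        by (rule C.homogeneous[OF True NM sc], assumption, blast)
      have "m * card N dvd card M"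
        by (rule degree_dvd_index[OF M'(1) finM N'(1) NM proj_rep_mono[OF T(1) M'(2)] T(3) _ T(4)]) (use T(2) M'(2) in auto)
      moreover have "0 < card N" using card_subgroup_pos[OF N'(1)] finite_subset[OF NM finM] by simp
      ultimately have mdvd: "m dvd card M div card N" by (auto elim!: dvdE)
      have \<delta>m: "\<delta> (x,y) ^ m = 1" if x: "x \<in> L" and y: "y \<in> L" for x y
      proof -
        have "det (T y * T x) = det (T y) * det (T x)"
          by (rule det_mult) (use proj_repD(2)[OF T(1)] x y in auto)
        then show ?thesis unfolding proj_repD(6)[OF T(1) x y]
          using T(2) x y subgroup.m_closed[OF L x y] proj_repD(4)[OF T(1)] by simp
      qed
      have \<delta>cob: "coboundary_on G L (\<lambda>p. \<delta> p ^ m)" unfolding coboundary_on_def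
        by (rule exI[of _ "\<lambda>_. 1"]) (use \<delta>m in auto)
      have "card N < card M" using psubset_card_mono[OF finM M(2)] .
      moreover have "card M \<le> card L" using card_mono[OF finL M'(2)] .
      ultimately have less: "card L - card M < card L - card N" by linarith
      have \<delta>n: "\<delta> (x,y) \<noteq> 0" if "x \<in> L" "y \<in> L" for x y using proj_repD(5)[OF T(1) that] .
      show ?thesis
      proof (cases "pi_number \<pi> (card M div card N)")
        case pi: True
        have \<delta>t: "torsion_on \<pi> G L \<delta>" unfolding torsion_on_def using \<delta>cob pi_number_dvd[OF pi mdvd] by blast
        have fac: "factorizable \<pi> G L M e W (\<lambda>p. \<beta> p / \<delta> p) \<gamma>"
          by (rule less.hyps[OF less L M(1) W _ torsion_on_div[OF \<beta> \<delta>t] \<gamma>]) (use \<alpha> \<delta>n in auto)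
        show ?thesis
          by (rule factorizable_tensor[where \<beta> = \<beta> and \<delta> = \<delta> and F = F, OF L finL N M(1) NM pi T(1,3) _ rep W(1) dims _ F(2) _ fac])
            (use T(4) F in auto)
      next
        case False
        then have pi: "pi_number (primes_compl \<pi>) (card M div card N)" using sec by simp
        have \<delta>t: "torsion_on (primes_compl \<pi>) G L \<delta>" unfolding torsion_on_def using \<delta>cob pi_number_dvd[OF pi mdvd] by blast
        have "factorizable \<pi> G L M e W \<beta> (\<lambda>p. \<gamma> p / \<delta> p)"
          by (rule less.hyps[OF less L M(1) W _ \<beta> torsion_on_div[OF \<gamma> \<delta>t]]) (use \<alpha> \<delta>n in auto)
        then have fac: "factorizable (primes_compl \<pi>) G L M e W (\<lambda>p. \<gamma> p / \<delta> p) \<beta>"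
          using factorizable_swap[of "primes_compl \<pi>" G L M e W \<beta> "\<lambda>p. \<gamma> p / \<delta> p"] primes_compl_compl[OF \<pi>]
          by (auto simp: primes_compl_def)
        have "factorizable (primes_compl \<pi>) G L N n \<rho> \<gamma> \<beta>"
          by (rule factorizable_tensor[where \<beta> = \<gamma> and \<delta> = \<delta> and F = F, OF L finL N M(1) NM pi T(1,3) _ rep W(1) dims _ F(2) _ fac])
            (use T(4) F in auto)
        then show ?thesis by (rule factorizable_swap[OF \<pi>])
      qed
    qed
  qed
qed

end

section \<open>Coclasses and their primary parts\<close>

lemma Z2_simps:
  "carrier (Z2 G) = {\<alpha> \<in> carrier G \<times> carrier G \<rightarrow>\<^sub>E UNIV - {0}.
     \<forall>x\<in>carrier G. \<forall>y\<in>carrier G. \<forall>z\<in>carrier G.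
       \<alpha> (x, y) * \<alpha> (x \<otimes>\<^bsub>G\<^esub> y, z) = \<alpha> (x, y \<otimes>\<^bsub>G\<^esub> z) * \<alpha> (y, z)}"
  "\<alpha> \<otimes>\<^bsub>Z2 G\<^esub> \<beta> = (\<lambda>p\<in>carrier G \<times> carrier G. \<alpha> p * \<beta> p)"
  "\<one>\<^bsub>Z2 G\<^esub> = (\<lambda>p\<in>carrier G \<times> carrier G. 1)"
  by (simp_all add: Z2_def)

lemma Z2I:
  assumes "\<And>x y. x \<in> carrier G \<Longrightarrow> y \<in> carrier G \<Longrightarrow> f (x,y) \<noteq> 0"
    and "\<And>x y z. x \<in> carrier G \<Longrightarrow> y \<in> carrier G \<Longrightarrow> z \<in> carrier G \<Longrightarrow>
      f (x, y) * f (x \<otimes>\<^bsub>G\<^esub> y, z) = f (x, y \<otimes>\<^bsub>G\<^esub> z) * f (y, z)"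
    and "group G"
  shows "(\<lambda>p\<in>carrier G \<times> carrier G. f p) \<in> carrier (Z2 G)"
proof -
  interpret group G by fact
  show ?thesis unfolding Z2_simps using assms(1,2) by auto
qed

lemma Z2D:
  assumes "\<alpha> \<in> carrier (Z2 G)"
  shows "x \<in> carrier G \<Longrightarrow> y \<in> carrier G \<Longrightarrow> \<alpha> (x,y) \<noteq> 0"
    "x \<in> carrier G \<Longrightarrow> y \<in> carrier G \<Longrightarrow> z \<in> carrier G \<Longrightarrow>
      \<alpha> (x, y) * \<alpha> (x \<otimes>\<^bsub>G\<^esub> y, z) = \<alpha> (x, y \<otimes>\<^bsub>G\<^esub> z) * \<alpha> (y, z)"
    "(\<lambda>p\<in>carrier G \<times> carrier G. \<alpha> p) = \<alpha>"
proof -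
  have "\<alpha> \<in> carrier G \<times> carrier G \<rightarrow>\<^sub>E UNIV - {0}" using assms unfolding Z2_simps by auto
  then show "x \<in> carrier G \<Longrightarrow> y \<in> carrier G \<Longrightarrow> \<alpha> (x,y) \<noteq> 0" and "(\<lambda>p\<in>carrier G \<times> carrier G. \<alpha> p) = \<alpha>"
    by (auto simp: PiE_def Pi_def extensional_restrict)
  show "x \<in> carrier G \<Longrightarrow> y \<in> carrier G \<Longrightarrow> z \<in> carrier G \<Longrightarrow>
      \<alpha> (x, y) * \<alpha> (x \<otimes>\<^bsub>G\<^esub> y, z) = \<alpha> (x, y \<otimes>\<^bsub>G\<^esub> z) * \<alpha> (y, z)"
    using assms unfolding Z2_simps by auto
qed

lemma Z2_eqI:
  assumes "\<alpha> \<in> carrier (Z2 G)" "\<beta> \<in> carrier (Z2 G)"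
    "\<And>x y. x \<in> carrier G \<Longrightarrow> y \<in> carrier G \<Longrightarrow> \<alpha> (x,y) = \<beta> (x,y)"
  shows "\<alpha> = \<beta>"
proof -
  have "(\<lambda>p\<in>carrier G \<times> carrier G. \<alpha> p) = (\<lambda>p\<in>carrier G \<times> carrier G. \<beta> p)"
    by (rule restrict_ext) (use assms(3) in auto)
  then show ?thesis unfolding Z2D(3)[OF assms(1)] Z2D(3)[OF assms(2)] .
qed

context group
begin

lemma Z2_mult_closed: "\<alpha> \<in> carrier (Z2 G) \<Longrightarrow> \<beta> \<in> carrier (Z2 G) \<Longrightarrow> \<alpha> \<otimes>\<^bsub>Z2 G\<^esub> \<beta> \<in> carrier (Z2 G)"
  unfolding Z2_simps(2)
proof (rule Z2I)
  assume A: "\<alpha> \<in> carrier (Z2 G)" "\<beta> \<in> carrier (Z2 G)"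
  show "\<alpha> (x,y) * \<beta> (x,y) \<noteq> 0" if "x \<in> carrier G" "y \<in> carrier G" for x y
    using Z2D(1)[OF A(1) that] Z2D(1)[OF A(2) that] by simp
  fix x y z assume c: "x \<in> carrier G" "y \<in> carrier G" "z \<in> carrier G"
  have "\<alpha> (x, y) * \<beta> (x, y) * (\<alpha> (x \<otimes> y, z) * \<beta> (x \<otimes> y, z)) = (\<alpha> (x, y) * \<alpha> (x \<otimes> y, z)) * (\<beta> (x, y) * \<beta> (x \<otimes> y, z))"
    by (simp add: mult_ac)
  also have "\<dots> = (\<alpha> (x, y \<otimes> z) * \<alpha> (y, z)) * (\<beta> (x, y \<otimes> z) * \<beta> (y, z))"
    unfolding Z2D(2)[OF A(1) c] Z2D(2)[OF A(2) c] ..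
  finally show "\<alpha> (x, y) * \<beta> (x, y) * (\<alpha> (x \<otimes> y, z) * \<beta> (x \<otimes> y, z)) = \<alpha> (x, y \<otimes> z) * \<beta> (x, y \<otimes> z) * (\<alpha> (y, z) * \<beta> (y, z))"
    by (simp add: mult_ac)
qed (rule is_group)

definition Z2_powi :: "('a \<times> 'a \<Rightarrow> complex) \<Rightarrow> int \<Rightarrow> 'a \<times> 'a \<Rightarrow> complex" where
  "Z2_powi \<alpha> i = (\<lambda>p\<in>carrier G \<times> carrier G. \<alpha> p powi i)"

lemma Z2_powi_closed: "\<alpha> \<in> carrier (Z2 G) \<Longrightarrow> Z2_powi \<alpha> i \<in> carrier (Z2 G)"
  unfolding Z2_powi_def
proof (rule Z2I)
  assume A: "\<alpha> \<in> carrier (Z2 G)"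
  show "\<alpha> (x,y) powi i \<noteq> 0" if "x \<in> carrier G" "y \<in> carrier G" for x y
    using Z2D(1)[OF A that] by simp
  fix x y z assume c: "x \<in> carrier G" "y \<in> carrier G" "z \<in> carrier G"
  show "\<alpha> (x, y) powi i * \<alpha> (x \<otimes> y, z) powi i = \<alpha> (x, y \<otimes> z) powi i * \<alpha> (y, z) powi i"
    unfolding power_int_mult_distrib[symmetric] Z2D(2)[OF A c] ..
qed (rule is_group)

lemma Z2_comm_group: "comm_group (Z2 G)"
proof (rule comm_groupI)
  show "\<one>\<^bsub>Z2 G\<^esub> \<in> carrier (Z2 G)" unfolding Z2_simps(3) by (rule Z2I) (auto intro: is_group)
  show "x \<otimes>\<^bsub>Z2 G\<^esub> y \<in> carrier (Z2 G)" if "x \<in> carrier (Z2 G)" "y \<in> carrier (Z2 G)" for x y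
    by (rule Z2_mult_closed[OF that])
  show "x \<otimes>\<^bsub>Z2 G\<^esub> y \<otimes>\<^bsub>Z2 G\<^esub> z = x \<otimes>\<^bsub>Z2 G\<^esub> (y \<otimes>\<^bsub>Z2 G\<^esub> z)" for x y z
    unfolding Z2_simps(2) by (rule restrict_ext) (simp add: mult_ac)
  show "x \<otimes>\<^bsub>Z2 G\<^esub> y = y \<otimes>\<^bsub>Z2 G\<^esub> x" for x y
    unfolding Z2_simps(2) by (rule restrict_ext) (simp add: mult_ac)
  show "\<one>\<^bsub>Z2 G\<^esub> \<otimes>\<^bsub>Z2 G\<^esub> x = x" if "x \<in> carrier (Z2 G)" for x
  proof -
    have "\<one>\<^bsub>Z2 G\<^esub> \<otimes>\<^bsub>Z2 G\<^esub> x = (\<lambda>p\<in>carrier G \<times> carrier G. x p)" unfolding Z2_simps(2,3) by (rule restrict_ext) simp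
    then show ?thesis using Z2D(3)[OF that] by simp
  qed
  show "\<exists>y\<in>carrier (Z2 G). y \<otimes>\<^bsub>Z2 G\<^esub> x = \<one>\<^bsub>Z2 G\<^esub>" if "x \<in> carrier (Z2 G)" for x
  proof (rule bexI[OF _ Z2_powi_closed[OF that, of "-1"]])
    show "Z2_powi x (- 1) \<otimes>\<^bsub>Z2 G\<^esub> x = \<one>\<^bsub>Z2 G\<^esub>" unfolding Z2_simps(2,3) Z2_powi_def
      by (rule restrict_ext) (use Z2D(1)[OF that] in \<open>auto simp: power_int_minus\<close>)
  qed
qed

lemma B2_iff: "\<beta> \<in> B2 G \<longleftrightarrow> \<beta> \<in> carrier (Z2 G) \<and> coboundary_on G (carrier G) \<beta>"
proof
  assume "\<beta> \<in> B2 G"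
  then obtain \<mu> where \<mu>: "\<mu> \<in> carrier G \<rightarrow> UNIV - {0}"
    "\<beta> = (\<lambda>(x, y)\<in>carrier G \<times> carrier G. \<mu> x * \<mu> y / \<mu> (x \<otimes> y))" unfolding B2_def by blast
  have n: "\<mu> x \<noteq> 0" if "x \<in> carrier G" for x using \<mu>(1) that by auto
  have "\<beta> \<in> carrier (Z2 G)" unfolding \<mu>(2)
    by (rule Z2I) (use n in \<open>auto simp: m_assoc intro: is_group\<close>)
  moreover have "coboundary_on G (carrier G) \<beta>" unfolding coboundary_on_def \<mu>(2) using n by (intro exI[of _ \<mu>]) auto
  ultimately show "\<beta> \<in> carrier (Z2 G) \<and> coboundary_on G (carrier G) \<beta>" ..
next
  assume b: "\<beta> \<in> carrier (Z2 G) \<and> coboundary_on G (carrier G) \<beta>"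
  then obtain \<mu> where \<mu>: "\<forall>x\<in>carrier G. \<mu> x \<noteq> 0"
    "\<forall>x\<in>carrier G. \<forall>y\<in>carrier G. \<beta> (x,y) = \<mu> x * \<mu> y / \<mu> (x \<otimes> y)" unfolding coboundary_on_def by auto
  have "\<beta> = (\<lambda>p\<in>carrier G \<times> carrier G. \<beta> p)" using Z2D(3)[of \<beta> G] b by simp
  also have "\<dots> = (\<lambda>(x, y)\<in>carrier G \<times> carrier G. \<mu> x * \<mu> y / \<mu> (x \<otimes> y))"
    by (rule restrict_ext) (use \<mu>(2) in auto)
  finally show "\<beta> \<in> B2 G" unfolding B2_def using \<mu>(1) by blast
qed

lemma B2_subgroup: "subgroup (B2 G) (Z2 G)"
proof -
  interpret Z: comm_group "Z2 G" by (rule Z2_comm_group)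
  have mult: "\<alpha> \<otimes>\<^bsub>Z2 G\<^esub> \<beta> \<in> B2 G" if "\<alpha> \<in> B2 G" "\<beta> \<in> B2 G" for \<alpha> \<beta>
  proof -
    have "coboundary_on G (carrier G) (\<lambda>p. \<alpha> p * \<beta> p)" using coboundary_on_mult that unfolding B2_iff by blast
    then have "coboundary_on G (carrier G) (\<alpha> \<otimes>\<^bsub>Z2 G\<^esub> \<beta>)" by (rule coboundary_on_cong) (simp add: Z2_simps)
    then show ?thesis using that unfolding B2_iff by simp
  qed
  have powi: "Z2_powi \<alpha> i \<in> B2 G" if "\<alpha> \<in> B2 G" for \<alpha> i
  proof -
    have "coboundary_on G (carrier G) (\<lambda>p. \<alpha> p powi i)" using coboundary_on_powi that unfolding B2_iff by blast
    then have "coboundary_on G (carrier G) (Z2_powi \<alpha> i)" by (rule coboundary_on_cong) (simp add: Z2_powi_def)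
    then show ?thesis using that Z2_powi_closed unfolding B2_iff by simp
  qed
  have one: "\<one>\<^bsub>Z2 G\<^esub> \<in> B2 G" unfolding B2_iff coboundary_on_def by (auto simp: Z2_simps(3) intro!: exI[of _ "\<lambda>_. 1"])
    (simp add: Z2_simps(3)[symmetric])
  show ?thesis
  proof (rule Z.subgroupI)
    show "B2 G \<subseteq> carrier (Z2 G)" using B2_iff by auto
    show "B2 G \<noteq> {}" using one by auto
    show "inv\<^bsub>Z2 G\<^esub> a \<in> B2 G" if "a \<in> B2 G" for a
    proof -
      have aZ: "a \<in> carrier (Z2 G)" using that B2_iff by auto
      have "Z2_powi a (-1) \<otimes>\<^bsub>Z2 G\<^esub> a = \<one>\<^bsub>Z2 G\<^esub>" unfolding Z2_simps(2,3) Z2_powi_def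
        by (rule restrict_ext) (use Z2D(1)[OF aZ] in \<open>auto simp: power_int_minus\<close>)
      then have "inv\<^bsub>Z2 G\<^esub> a = Z2_powi a (-1)" using Z.inv_equality aZ Z2_powi_closed[OF aZ] by blast
      then show ?thesis using powi[OF that] by simp
    qed
  qed (rule mult)
qed

lemma B2_normal: "B2 G \<lhd> Z2 G"
  using comm_group.subgroup_imp_normal[OF Z2_comm_group B2_subgroup] .

lemma coclass_mult:
  "\<alpha> \<in> carrier (Z2 G) \<Longrightarrow> \<beta> \<in> carrier (Z2 G) \<Longrightarrow> coclass G \<alpha> \<otimes>\<^bsub>H2 G\<^esub> coclass G \<beta> = coclass G (\<alpha> \<otimes>\<^bsub>Z2 G\<^esub> \<beta>)"
  unfolding coclass_def H2_def using normal.rcos_sum[OF B2_normal] by (simp add: FactGroup_def)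

lemma coclass_closed: "\<alpha> \<in> carrier (Z2 G) \<Longrightarrow> coclass G \<alpha> \<in> carrier (H2 G)"
  unfolding coclass_def H2_def FactGroup_def RCOSETS_def by auto

lemma coclass_one: "\<alpha> \<in> B2 G \<Longrightarrow> coclass G \<alpha> = \<one>\<^bsub>H2 G\<^esub>"
proof -
  interpret Z: comm_group "Z2 G" by (rule Z2_comm_group)
  assume a: "\<alpha> \<in> B2 G"
  then have "B2 G #>\<^bsub>Z2 G\<^esub> \<alpha> = B2 G" using Z.coset_join2[OF _ B2_subgroup a] B2_iff by auto
  then show ?thesis unfolding coclass_def H2_def FactGroup_def by simp
qed

lemma coclass_self: "\<alpha> \<in> carrier (Z2 G) \<Longrightarrow> \<alpha> \<in> coclass G \<alpha>"
proof -
  interpret Z: comm_group "Z2 G" by (rule Z2_comm_group)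
  show "\<alpha> \<in> carrier (Z2 G) \<Longrightarrow> \<alpha> \<in> coclass G \<alpha>" unfolding coclass_def using Z.rcos_self B2_subgroup by auto
qed

lemma coclass_eq:
  assumes "c \<in> carrier (H2 G)" "\<alpha> \<in> c" shows "\<alpha> \<in> carrier (Z2 G)" "c = coclass G \<alpha>"
proof -
  interpret Z: comm_group "Z2 G" by (rule Z2_comm_group)
  obtain \<beta> where \<beta>: "\<beta> \<in> carrier (Z2 G)" "c = B2 G #>\<^bsub>Z2 G\<^esub> \<beta>"
    using assms(1) unfolding H2_def FactGroup_def RCOSETS_def by auto
  have BZ: "B2 G \<subseteq> carrier (Z2 G)" using subgroup.subset[OF B2_subgroup] .
  show "\<alpha> \<in> carrier (Z2 G)" using assms(2) \<beta> Z.r_coset_subset_G[OF BZ \<beta>(1)] by auto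
  show "c = coclass G \<alpha>" unfolding coclass_def \<beta>(2) using Z.repr_independence[OF _ \<beta>(1) B2_subgroup] assms(2) \<beta>(2) by auto
qed

lemma H2_comm_group: "comm_group (H2 G)"
  unfolding H2_def by (rule comm_group.abelian_FactGroup[OF Z2_comm_group B2_subgroup])

lemma coclass_pow:
  assumes "\<beta> \<in> carrier (Z2 G)" "coboundary_on G (carrier G) (\<lambda>p. \<beta> p ^ k)"
  shows "coclass G \<beta> [^]\<^bsub>H2 G\<^esub> k = \<one>\<^bsub>H2 G\<^esub>"
proof -
  interpret H: comm_group "H2 G" by (rule H2_comm_group)
  have "coclass G \<beta> [^]\<^bsub>H2 G\<^esub> j = coclass G (Z2_powi \<beta> (int j))" for j :: nat
  proof (induction j)
    case 0
    have "Z2_powi \<beta> 0 = \<one>\<^bsub>Z2 G\<^esub>" unfolding Z2_powi_def Z2_simps by simp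
    then show ?case using coclass_one subgroup.one_closed[OF B2_subgroup] by simp
  next
    case (Suc j)
    have "Z2_powi \<beta> (int j) \<otimes>\<^bsub>Z2 G\<^esub> \<beta> = Z2_powi \<beta> (int (Suc j))" unfolding Z2_powi_def Z2_simps(2)
      by (rule restrict_ext) (use Z2D(1)[OF assms(1)] in \<open>auto simp: power_int_add mult.commute\<close>)
    then show ?case using Suc coclass_mult[OF Z2_powi_closed[OF assms(1)] assms(1)] by simp
  qed
  moreover have "coboundary_on G (carrier G) (Z2_powi \<beta> (int k))"
    using assms(2) by (rule coboundary_on_cong) (simp add: Z2_powi_def)
  then have "Z2_powi \<beta> (int k) \<in> B2 G" unfolding B2_iff using Z2_powi_closed[OF assms(1)] by simp
  ultimately show ?thesis using coclass_one by simp
qed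

end

text \<open>For uniqueness, the quotient of two such elements has an order which is both a \<open>\<pi>\<close>-number
  and a \<open>\<pi>'\<close>-number.\<close>

lemma (in comm_group) pi_part_eq:
  assumes d: "d \<in> carrier G" "pi_number \<pi> (ord d)" and e: "e \<in> carrier G" "pi_number (primes_compl \<pi>) (ord e)"
  shows "pi_part \<pi> G (d \<otimes> e) = d"
  unfolding pi_part_def
proof (rule the_equality)
  show "d \<in> carrier G \<and> pi_number \<pi> (ord d) \<and> (\<exists>e'\<in>carrier G. pi_number (primes_compl \<pi>) (ord e') \<and> d \<otimes> e = d \<otimes> e')"
    using assms by blast
  fix d' assume "d' \<in> carrier G \<and> pi_number \<pi> (ord d') \<and> (\<exists>e'\<in>carrier G. pi_number (primes_compl \<pi>) (ord e') \<and> d \<otimes> e = d' \<otimes> e')"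
  then obtain e' where d': "d' \<in> carrier G" "pi_number \<pi> (ord d')" and e': "e' \<in> carrier G" "pi_number (primes_compl \<pi>) (ord e')"
    and eq: "d \<otimes> e = d' \<otimes> e'" by auto
  define x where "x = inv d' \<otimes> d"
  have xc: "x \<in> carrier G" unfolding x_def using d d' by simp
  have x2: "x = e' \<otimes> inv e"
  proof -
    have "x = inv d' \<otimes> (d \<otimes> e) \<otimes> inv e" unfolding x_def using d d' e by (simp add: m_assoc)
    then show ?thesis unfolding eq using d' e e' by (simp add: m_assoc[symmetric])
  qed
  have "x [^] (ord d * ord d') = \<one>"
  proof -
    have "x [^] (ord d * ord d') = (inv d') [^] (ord d * ord d') \<otimes> d [^] (ord d * ord d')"
      unfolding x_def using d d' by (simp add: pow_mult_distrib m_comm)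
    also have "d [^] (ord d * ord d') = \<one>" using d by (simp add: nat_pow_pow[symmetric])
    also have "(inv d') [^] (ord d * ord d') = \<one>"
      using d' by (simp add: nat_pow_pow[symmetric] mult.commute[of "ord d"] nat_pow_inv)
    finally show ?thesis by simp
  qed
  then have o1: "ord x dvd ord d * ord d'" using pow_eq_id[OF xc] by simp
  have "x [^] (ord e * ord e') = \<one>"
  proof -
    have "x [^] (ord e * ord e') = e' [^] (ord e * ord e') \<otimes> (inv e) [^] (ord e * ord e')"
      unfolding x2 using e e' by (simp add: pow_mult_distrib m_comm)
    also have "(inv e) [^] (ord e * ord e') = \<one>" using e by (simp add: nat_pow_pow[symmetric] nat_pow_inv)
    also have "e' [^] (ord e * ord e') = \<one>"
      using e' by (simp add: nat_pow_pow[symmetric] mult.commute[of "ord e"])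
    finally show ?thesis by simp
  qed
  then have o2: "ord x dvd ord e * ord e'" using pow_eq_id[OF xc] by simp
  have "pi_number \<pi> (ord x)" using pi_number_dvd[OF pi_number_mult[OF d(2) d'(2)] o1] .
  moreover have "pi_number (primes_compl \<pi>) (ord x)" using pi_number_dvd[OF pi_number_mult[OF e(2) e'(2)] o2] .
  ultimately have "coprime (ord x) (ord x)" by (rule pi_number_coprime)
  then have "ord x = 1" by simp
  then have "x = \<one>" using xc pow_ord_eq_1[OF xc] by simp
  then have "d' \<otimes> (inv d' \<otimes> d) = d'" unfolding x_def using d' by simp
  then show "d' = d" using d d' by (simp add: m_assoc[symmetric])
qed

context group
begin

text \<open>Let \<open>|G| = a b\<close> with a \<open>\<pi>\<close>-number \<open>a\<close> and a \<open>\<pi>'\<close>-number \<open>b\<close>, and \<open>u a + v b = 1\<close>. The factors are the powers of \<open>\<alpha>\<close> with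
  exponents \<open>v b\<close> and \<open>u a\<close>, so that the product is \<open>\<alpha>\<close> itself and not merely cohomologous to it.\<close>

lemma cocycle_splitting:
  assumes fin: "finite (carrier G)" and \<pi>: "\<pi> \<subseteq> {p. Factorial_Ring.prime p}"
    and c: "c \<in> carrier (H2 G)" "\<alpha> \<in> c"
  obtains \<beta> \<gamma> where "\<beta> \<in> carrier (Z2 G)" "\<gamma> \<in> carrier (Z2 G)" "\<alpha> = \<beta> \<otimes>\<^bsub>Z2 G\<^esub> \<gamma>"
    "\<beta> \<in> pi_part \<pi> (H2 G) c" "\<gamma> \<in> pi_part (primes_compl \<pi>) (H2 G) c"
    "torsion_on \<pi> G (carrier G) \<beta>" "torsion_on (primes_compl \<pi>) G (carrier G) \<gamma>"
proof -
  interpret H: comm_group "H2 G" by (rule H2_comm_group)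
  note \<alpha> = coclass_eq[OF c]
  note Zd = Z2D[OF \<alpha>(1)]
  define q where "q = card (carrier G)"
  have q0: "q \<noteq> 0" unfolding q_def using fin one_closed by (metis card_0_eq empty_iff)
  have cob: "coboundary_on G (carrier G) (\<lambda>p. \<alpha> p ^ q)"
    unfolding q_def by (rule order_coboundary[OF subgroup_self fin]) (use Zd in auto)
  define a where "a = prod_mset (filter_mset (\<lambda>p. p \<in> \<pi>) (prime_factorization q))"
  define b where "b = prod_mset (filter_mset (\<lambda>p. p \<notin> \<pi>) (prime_factorization q))"
  have ab: "q = a * b"
  proof -
    have "q = prod_mset (prime_factorization q)" using q0 by (simp add: prod_mset_prime_factorization_nat)
    also have "\<dots> = a * b" unfolding a_def b_def
      by (simp flip: prod_mset_Un multiset_partition)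
    finally show ?thesis .
  qed
  have pf: "prime_factorization (prod_mset (filter_mset P (prime_factorization q))) = filter_mset P (prime_factorization q)" for P
    by (rule prime_factorization_prod_mset_primes) auto
  have ab0: "0 < a" "0 < b" using q0 unfolding ab by auto
  have a: "pi_number \<pi> a" unfolding pi_number_def
    by (rule conjI[OF ab0(1)], unfold a_def pf) auto
  have b: "pi_number (primes_compl \<pi>) b" unfolding pi_number_def primes_compl_def
    by (rule conjI[OF ab0(2)], unfold b_def pf) auto
  have "coprime a b" using pi_number_coprime[OF a b] .
  then obtain u v where uv: "u * int a + v * int b = 1" using bezout_int[of "int a" "int b"] by auto
  define \<beta> where "\<beta> = Z2_powi \<alpha> (v * int b)"
  define \<gamma> where "\<gamma> = Z2_powi \<alpha> (u * int a)"
  have \<beta>Z: "\<beta> \<in> carrier (Z2 G)" and \<gamma>Z: "\<gamma> \<in> carrier (Z2 G)" unfolding \<beta>_def \<gamma>_def using Z2_powi_closed[OF \<alpha>(1)] by auto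
  have prod: "\<alpha> = \<beta> \<otimes>\<^bsub>Z2 G\<^esub> \<gamma>"
  proof (rule Z2_eqI[OF \<alpha>(1) Z2_mult_closed[OF \<beta>Z \<gamma>Z]])
    fix x y assume xy: "x \<in> carrier G" "y \<in> carrier G"
    have "\<beta> (x,y) * \<gamma> (x,y) = \<alpha> (x,y) powi (v * int b + u * int a)"
      unfolding \<beta>_def \<gamma>_def Z2_powi_def using xy Zd(1)[OF xy] by (simp add: power_int_add)
    also have "v * int b + u * int a = 1" using uv by simp
    finally show "\<alpha> (x,y) = (\<beta> \<otimes>\<^bsub>Z2 G\<^esub> \<gamma>) (x,y)" using xy by (simp add: Z2_simps)
  qed
  have pw: "coboundary_on G (carrier G) (\<lambda>p. Z2_powi \<alpha> (w * int e) p ^ d)" if "q = d * e" for w d e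
  proof -
    have "coboundary_on G (carrier G) (\<lambda>p. (\<alpha> p ^ q) powi w)" by (rule coboundary_on_powi[OF cob])
    then show ?thesis
    proof (rule coboundary_on_cong)
      fix x y assume xy: "x \<in> carrier G" "y \<in> carrier G"
      have "Z2_powi \<alpha> (w * int e) (x,y) ^ d = (\<alpha> (x,y) powi (w * int e)) powi (int d)" using xy by (simp add: Z2_powi_def)
      also have "\<dots> = (\<alpha> (x,y) powi int q) powi w" unfolding power_int_mult[symmetric] that by (simp add: mult_ac)
      finally show "Z2_powi \<alpha> (w * int e) (x,y) ^ d = (\<alpha> (x,y) ^ q) powi w" by simp
    qed
  qed
  have \<beta>a: "coboundary_on G (carrier G) (\<lambda>p. \<beta> p ^ a)" unfolding \<beta>_def by (rule pw[OF ab])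
  have \<gamma>b: "coboundary_on G (carrier G) (\<lambda>p. \<gamma> p ^ b)" unfolding \<gamma>_def by (rule pw) (simp add: ab)
  have od: "pi_number \<pi> (H.ord (coclass G \<beta>))"
    using pi_number_dvd[OF a] H.pow_eq_id[OF coclass_closed[OF \<beta>Z]] coclass_pow[OF \<beta>Z \<beta>a] by simp
  have oe: "pi_number (primes_compl \<pi>) (H.ord (coclass G \<gamma>))"
    using pi_number_dvd[OF b] H.pow_eq_id[OF coclass_closed[OF \<gamma>Z]] coclass_pow[OF \<gamma>Z \<gamma>b] by simp
  have cc: "c = coclass G \<beta> \<otimes>\<^bsub>H2 G\<^esub> coclass G \<gamma>" unfolding \<alpha>(2) coclass_mult[OF \<beta>Z \<gamma>Z] prod[symmetric] ..
  have "pi_part \<pi> (H2 G) c = coclass G \<beta>" unfolding cc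
    by (rule H.pi_part_eq[OF coclass_closed[OF \<beta>Z] od coclass_closed[OF \<gamma>Z] oe])
  moreover have "pi_part (primes_compl \<pi>) (H2 G) c = coclass G \<gamma>"
  proof -
    have "pi_number (primes_compl (primes_compl \<pi>)) (H.ord (coclass G \<beta>))" using od unfolding primes_compl_compl[OF \<pi>] .
    then show ?thesis unfolding cc H.m_comm[OF coclass_closed[OF \<beta>Z] coclass_closed[OF \<gamma>Z]]
      by (rule H.pi_part_eq[OF coclass_closed[OF \<gamma>Z] oe coclass_closed[OF \<beta>Z]])
  qed
  moreover have "torsion_on \<pi> G (carrier G) \<beta>" "torsion_on (primes_compl \<pi>) G (carrier G) \<gamma>"
    unfolding torsion_on_def using a b \<beta>a \<gamma>b by auto
  ultimately show ?thesis using that[OF \<beta>Z \<gamma>Z prod] coclass_self \<beta>Z \<gamma>Z by auto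
qed

text \<open>The order of \<open>H\<close>, a \<open>\<pi>'\<close>-number, annihilates the restricted coclass, and so does some \<open>\<pi>\<close>-number.\<close>

lemma res_cocycle_ordinary:
  assumes fin: "finite (carrier G)" and \<beta>: "\<beta> \<in> carrier (Z2 G)" and tor: "torsion_on \<pi> G (carrier G) \<beta>"
    and H: "subgroup H G" and card: "pi_number (primes_compl \<pi>) (card H)"
  shows "coclass (G\<lparr>carrier := H\<rparr>) (res_cocycle H \<beta>) = \<one>\<^bsub>H2 (G\<lparr>carrier := H\<rparr>)\<^esub>"
proof -
  interpret GH: group "G\<lparr>carrier := H\<rparr>" using subgroup_imp_group[OF H] .
  note HG = subgroup.mem_carrier[OF H]
  have finH: "finite H" using finite_subset[OF subgroup.subset[OF H] fin] .
  have "coboundary_on G H (\<lambda>p. \<beta> p ^ card H)"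
    by (rule order_coboundary[OF H finH]) (use Z2D[OF \<beta>] HG in auto)
  then have "torsion_on (primes_compl \<pi>) G H \<beta>" unfolding torsion_on_def using card by auto
  then have cb: "coboundary_on G H \<beta>"
    by (rule torsion_coprime_coboundary[OF torsion_on_mono[OF tor subgroup.subset[OF H]]]) (use Z2D(1)[OF \<beta>] HG in auto)
  have "res_cocycle H \<beta> \<in> carrier (Z2 (G\<lparr>carrier := H\<rparr>))"
    unfolding res_cocycle_def using Z2I[of "G\<lparr>carrier := H\<rparr>" \<beta>] Z2D[OF \<beta>] HG GH.is_group by auto
  moreover have "coboundary_on (G\<lparr>carrier := H\<rparr>) (carrier (G\<lparr>carrier := H\<rparr>)) (res_cocycle H \<beta>)"
    using cb unfolding coboundary_on_def res_cocycle_def by auto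
  ultimately show ?thesis using GH.coclass_one GH.B2_iff by blast
qed

end

section \<open>Quotients of free spaces as fibres of an evaluation\<close>

lemma free_space_simps:
  "carrier (free_space S) = {f. finite {s. f s \<noteq> 0} \<and> {s. f s \<noteq> 0} \<subseteq> S}"
  "f \<oplus>\<^bsub>free_space S\<^esub> g = (\<lambda>s. f s + g s)" "\<zero>\<^bsub>free_space S\<^esub> = (\<lambda>s. 0)"
  "k \<odot>\<^bsub>free_space S\<^esub> f = (\<lambda>s. k * f s)"
  by (simp_all add: free_space_def)

lemma free_space_add_closed:
  assumes "f \<in> carrier (free_space S)" "g \<in> carrier (free_space S)"
  shows "(\<lambda>s. f s + g s) \<in> carrier (free_space S)"
proof -
  have "{s. f s + g s \<noteq> 0} \<subseteq> {s. f s \<noteq> 0} \<union> {s. g s \<noteq> 0}" by auto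
  moreover have "finite ({s. f s \<noteq> 0} \<union> {s. g s \<noteq> 0})" "{s. f s \<noteq> 0} \<union> {s. g s \<noteq> 0} \<subseteq> S"
    using assms unfolding free_space_simps by auto
  ultimately show ?thesis unfolding free_space_simps by (auto intro: finite_subset)
qed

lemma free_space_smult_closed:
  assumes "f \<in> carrier (free_space S)" shows "(\<lambda>s. k * f s) \<in> carrier (free_space S)"
proof -
  have "{s. k * f s \<noteq> 0} \<subseteq> {s. f s \<noteq> 0}" by auto
  then show ?thesis using assms unfolding free_space_simps by (auto intro: finite_subset)
qed

lemma free_space_vectorspace: "vectorspace class_ring (free_space S)"
proof (rule vs_criteria)
  show "field (class_ring :: complex ring)" by (rule class_field)
  show "\<forall>v w. v \<in> carrier (free_space S) \<and> w \<in> carrier (free_space S) \<longrightarrow> v \<oplus>\<^bsub>free_space S\<^esub> w \<in> carrier (free_space S)"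
    using free_space_add_closed unfolding free_space_simps(2) by blast
  show "\<forall>v\<in>carrier (free_space S). \<exists>neg_v\<in>carrier (free_space S). v \<oplus>\<^bsub>free_space S\<^esub> neg_v = \<zero>\<^bsub>free_space S\<^esub>"
  proof
    fix v assume "v \<in> carrier (free_space S)"
    then have "(\<lambda>s. (-1) * v s) \<in> carrier (free_space S)" by (rule free_space_smult_closed)
    then show "\<exists>neg_v\<in>carrier (free_space S). v \<oplus>\<^bsub>free_space S\<^esub> neg_v = \<zero>\<^bsub>free_space S\<^esub>"
      by (rule bexI[rotated]) (simp add: free_space_simps)
  qed
  show "\<forall>c v. c \<in> carrier class_ring \<and> v \<in> carrier (free_space S) \<longrightarrow> c \<odot>\<^bsub>free_space S\<^esub> v \<in> carrier (free_space S)"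
    using free_space_smult_closed unfolding free_space_simps(4) by blast
qed (auto simp: free_space_simps algebra_simps)

text \<open>Evaluation of formal linear combinations, linearly extending a map \<open>b\<close> of the basis.\<close>

definition ev :: "('s \<Rightarrow> 'r \<Rightarrow> complex) \<Rightarrow> ('s \<Rightarrow> complex) \<Rightarrow> 'r \<Rightarrow> complex" where
  "ev b f r = (\<Sum>s | f s \<noteq> 0. f s * b s r)"

lemma ev_superset: "finite A \<Longrightarrow> {s. f s \<noteq> 0} \<subseteq> A \<Longrightarrow> ev b f r = (\<Sum>s\<in>A. f s * b s r)"
  unfolding ev_def by (rule sum.mono_neutral_left) auto

lemma ev_add:
  assumes "f \<in> carrier (free_space S)" "g \<in> carrier (free_space S)"
  shows "ev b (\<lambda>s. f s + g s) r = ev b f r + ev b g r"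
proof -
  let ?A = "{s. f s \<noteq> 0} \<union> {s. g s \<noteq> 0}"
  have A: "finite ?A" using assms unfolding free_space_simps by auto
  have "ev b (\<lambda>s. f s + g s) r = (\<Sum>s\<in>?A. (f s + g s) * b s r)" by (rule ev_superset[OF A]) auto
  also have "\<dots> = (\<Sum>s\<in>?A. f s * b s r) + (\<Sum>s\<in>?A. g s * b s r)" by (simp add: distrib_right sum.distrib)
  finally show ?thesis using ev_superset[OF A, of f b r] ev_superset[OF A, of g b r] by simp
qed

lemma ev_smult:
  assumes "f \<in> carrier (free_space S)"
  shows "ev b (\<lambda>s. k * f s) r = k * ev b f r"
proof -
  let ?A = "{s. f s \<noteq> 0}"
  have A: "finite ?A" using assms unfolding free_space_simps by auto
  have "ev b (\<lambda>s. k * f s) r = (\<Sum>s\<in>?A. k * f s * b s r)" by (rule ev_superset[OF A]) auto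
  also have "\<dots> = k * ev b f r" unfolding ev_def by (simp add: sum_distrib_left mult.assoc)
  finally show ?thesis .
qed

lemma point_closed: "s \<in> S \<Longrightarrow> point s \<in> carrier (free_space S)"
  unfolding free_space_simps point_def by auto

lemma ev_point: "ev b (point s) = b s"
  by (rule ext) (simp add: ev_superset[of "{s}"] point_def)

lemma ev_zero: "ev b (\<lambda>s. 0) r = 0"
  by (simp add: ev_def)

lemma free_space_diff_closed:
  assumes "f \<in> carrier (free_space S)" "g \<in> carrier (free_space S)"
  shows "(\<lambda>s. f s - k * g s) \<in> carrier (free_space S)"
  using free_space_add_closed[OF assms(1) free_space_smult_closed[OF assms(2), of "-k"]] by simp

lemma ev_diff:
  assumes "f \<in> carrier (free_space S)" "g \<in> carrier (free_space S)"
  shows "ev b (\<lambda>s. f s - k * g s) r = ev b f r - k * ev b g r"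
proof -
  have "ev b (\<lambda>s. f s + (-k) * g s) r = ev b f r + ev b (\<lambda>s. (-k) * g s) r"
    by (rule ev_add[OF assms(1) free_space_smult_closed[OF assms(2)]])
  moreover have "ev b (\<lambda>s. (-k) * g s) r = (-k) * ev b g r" by (rule ev_smult[OF assms(2)])
  ultimately show ?thesis by simp
qed

lemma free_space_sum_closed:
  assumes "finite A" "\<And>i. i \<in> A \<Longrightarrow> F i \<in> carrier (free_space S)"
  shows "(\<lambda>p. \<Sum>i\<in>A. c i * F i p) \<in> carrier (free_space S)"
  using assms
proof (induction A)
  case empty
  then show ?case by (simp add: free_space_simps)
next
  case (insert i A)
  then show ?case using free_space_add_closed[OF free_space_smult_closed[of "F i" S "c i"]] by simp
qed

lemma ev_sum:
  assumes "finite A" "\<And>i. i \<in> A \<Longrightarrow> F i \<in> carrier (free_space S)"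
  shows "ev b (\<lambda>p. \<Sum>i\<in>A. c i * F i p) r = (\<Sum>i\<in>A. c i * ev b (F i) r)"
  using assms
proof (induction A)
  case empty
  then show ?case by (simp add: ev_zero)
next
  case (insert i A)
  have 1: "(\<lambda>p. c i * F i p) \<in> carrier (free_space S)" using insert by (intro free_space_smult_closed) auto
  have 2: "(\<lambda>p. \<Sum>i\<in>A. c i * F i p) \<in> carrier (free_space S)" using insert by (intro free_space_sum_closed) auto
  have "ev b (\<lambda>p. \<Sum>i\<in>insert i A. c i * F i p) r = ev b (\<lambda>p. c i * F i p + (\<Sum>i\<in>A. c i * F i p)) r"
    using insert by simp
  also have "\<dots> = c i * ev b (F i) r + (\<Sum>i\<in>A. c i * ev b (F i) r)"
    unfolding ev_add[OF 1 2] using insert ev_smult[of "F i" S b "c i" r] by simp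
  finally show ?case using insert by simp
qed

definition free_subspace :: "'s set \<Rightarrow> ('s \<Rightarrow> complex) set \<Rightarrow> bool" where
  "free_subspace S K \<longleftrightarrow> K \<subseteq> carrier (free_space S) \<and> (\<lambda>_. 0) \<in> K \<and>
     (\<forall>f\<in>K. \<forall>g\<in>K. (\<lambda>p. f p + g p) \<in> K) \<and> (\<forall>c. \<forall>f\<in>K. (\<lambda>p. c * f p) \<in> K)"

lemma free_subspaceD:
  assumes "free_subspace S K"
  shows "K \<subseteq> carrier (free_space S)" "(\<lambda>_. 0) \<in> K" "f \<in> K \<Longrightarrow> g \<in> K \<Longrightarrow> (\<lambda>p. f p + g p) \<in> K"
    "f \<in> K \<Longrightarrow> (\<lambda>p. c * f p) \<in> K"
  using assms unfolding free_subspace_def by auto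

lemma free_subspace_iff_submodule: "free_subspace S K \<longleftrightarrow> submodule class_ring K (free_space S)"
proof -
  have "module class_ring (free_space S)" using free_space_vectorspace[of S] by (simp add: vectorspace_def)
  then show ?thesis unfolding free_subspace_def submodule_def by (auto simp: free_space_simps)
qed

lemma span_free_subspace:
  assumes "R \<subseteq> carrier (free_space S)"
  shows "free_subspace S (module.span class_ring (free_space S) R)" "R \<subseteq> module.span class_ring (free_space S) R"
    "free_subspace S Q \<Longrightarrow> R \<subseteq> Q \<Longrightarrow> module.span class_ring (free_space S) R \<subseteq> Q"
proof -
  interpret vectorspace class_ring "free_space S" by (rule free_space_vectorspace)
  show "free_subspace S (span R)" unfolding free_subspace_iff_submodule by (rule span_is_submodule[OF assms])
  show "R \<subseteq> span R" by (rule in_own_span[OF assms])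
  show "free_subspace S Q \<Longrightarrow> R \<subseteq> Q \<Longrightarrow> span R \<subseteq> Q" unfolding free_subspace_iff_submodule by (rule span_is_subset)
qed

definition ev_kernel :: "('s \<Rightarrow> 'r \<Rightarrow> complex) \<Rightarrow> 's set \<Rightarrow> ('s \<Rightarrow> complex) set" where
  "ev_kernel b S = {f \<in> carrier (free_space S). \<forall>r. ev b f r = 0}"

lemma ev_kernel_subspace: "free_subspace S (ev_kernel b S)"
  unfolding free_subspace_def ev_kernel_def
  using free_space_add_closed free_space_smult_closed
  by (auto simp: ev_add ev_smult ev_zero free_space_simps)

definition reducible_to :: "('s \<Rightarrow> complex) set \<Rightarrow> 'i set \<Rightarrow> ('i \<Rightarrow> 's) \<Rightarrow> ('s \<Rightarrow> complex) set" where
  "reducible_to K I t = {f. \<exists>c. (\<lambda>p. f p - (\<Sum>i\<in>I. c i * point (t i) p)) \<in> K}"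

lemma reducible_add:
  assumes K: "free_subspace S K" and "f \<in> reducible_to K I t" "g \<in> reducible_to K I t"
  shows "(\<lambda>p. f p + g p) \<in> reducible_to K I t"
proof -
  obtain c d where "(\<lambda>p. f p - (\<Sum>i\<in>I. c i * point (t i) p)) \<in> K" "(\<lambda>p. g p - (\<Sum>i\<in>I. d i * point (t i) p)) \<in> K"
    using assms unfolding reducible_to_def by auto
  from free_subspaceD(3)[OF K this]
  have "(\<lambda>p. (f p + g p) - (\<Sum>i\<in>I. (c i + d i) * point (t i) p)) \<in> K"
    by (simp add: algebra_simps sum.distrib)
  then show ?thesis unfolding reducible_to_def by (intro CollectI exI[of _ "\<lambda>i. c i + d i"])
qed

lemma reducible_smult:
  assumes K: "free_subspace S K" and "f \<in> reducible_to K I t"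
  shows "(\<lambda>p. k * f p) \<in> reducible_to K I t"
proof -
  obtain c where "(\<lambda>p. f p - (\<Sum>i\<in>I. c i * point (t i) p)) \<in> K" using assms unfolding reducible_to_def by auto
  from free_subspaceD(4)[OF K this, of k]
  have "(\<lambda>p. k * f p - (\<Sum>i\<in>I. (k * c i) * point (t i) p)) \<in> K"
    by (simp add: algebra_simps sum_distrib_left)
  then show ?thesis unfolding reducible_to_def by (intro CollectI exI[of _ "\<lambda>i. k * c i"])
qed

lemma reducible_kernel: "f \<in> K \<Longrightarrow> f \<in> reducible_to K I t"
  unfolding reducible_to_def by (intro CollectI exI[of _ "\<lambda>_. 0"]) simp

lemma reducible_point:
  assumes K: "free_subspace S K" and "finite I" "i \<in> I"
  shows "point (t i) \<in> reducible_to K I t"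
proof -
  have "(\<lambda>p. point (t i) p - (\<Sum>j\<in>I. (if j = i then 1 else 0) * point (t j) p)) = (\<lambda>_. 0)"
    using assms(2,3) by (simp add: if_distrib[of "\<lambda>x. x * _"] cong: if_cong)
  then show ?thesis unfolding reducible_to_def using free_subspaceD(2)[OF K]
    by (intro CollectI exI[of _ "\<lambda>j. if j = i then 1 else 0"]) simp
qed

lemma reducible_all:
  assumes K: "free_subspace S K" and red: "\<And>s. s \<in> S \<Longrightarrow> point s \<in> reducible_to K I t"
    and f: "f \<in> carrier (free_space S)"
  shows "f \<in> reducible_to K I t"
proof -
  define A where "A = {s. f s \<noteq> 0}"
  have A: "finite A" "A \<subseteq> S" using f unfolding A_def free_space_simps by auto
  have "(\<lambda>p. \<Sum>s\<in>B. f s * point s p) \<in> reducible_to K I t" if "B \<subseteq> A" for B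
    using finite_subset[OF that A(1)] that
  proof (induction B)
    case empty
    then show ?case using reducible_kernel[OF free_subspaceD(2)[OF K]] by simp
  next
    case (insert s B)
    then have "point s \<in> reducible_to K I t" using red A(2) by auto
    from reducible_add[OF K reducible_smult[OF K this, of "f s"] insert.IH] show ?case using insert by simp
  qed
  from this[of A] have "(\<lambda>p. \<Sum>s\<in>A. f s * point s p) \<in> reducible_to K I t" by simp
  moreover have "(\<lambda>p. \<Sum>s\<in>A. f s * point s p) = f"
  proof
    fix p
    have "(\<Sum>s\<in>A. f s * point s p) = (\<Sum>s\<in>A. if s = p then f p else 0)"
      by (rule sum.cong) (auto simp: point_def)
    then show "(\<Sum>s\<in>A. f s * point s p) = f p" using A(1) by (auto simp: A_def)
  qed
  ultimately show ?thesis by simp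
qed

lemma ev_reduced:
  assumes K: "K \<subseteq> ev_kernel b S" and I: "finite I" "\<And>i. i \<in> I \<Longrightarrow> t i \<in> S"
    and f: "f \<in> carrier (free_space S)" and c: "(\<lambda>p. f p - (\<Sum>i\<in>I. c i * point (t i) p)) \<in> K"
  shows "ev b f r = (\<Sum>i\<in>I. c i * b (t i) r)"
proof -
  have pF: "point (t i) \<in> carrier (free_space S)" if "i \<in> I" for i using point_closed I(2)[OF that] .
  have sF: "(\<lambda>p. \<Sum>i\<in>I. c i * point (t i) p) \<in> carrier (free_space S)" by (rule free_space_sum_closed[OF I(1) pF])
  have "ev b (\<lambda>p. f p - 1 * (\<Sum>i\<in>I. c i * point (t i) p)) r = 0" using c K unfolding ev_kernel_def by auto
  then have "ev b f r = ev b (\<lambda>p. \<Sum>i\<in>I. c i * point (t i) p) r" unfolding ev_diff[OF f sF] by simp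
  also have "\<dots> = (\<Sum>i\<in>I. c i * ev b (point (t i)) r)" by (rule ev_sum[OF I(1) pF])
  finally show ?thesis by (simp add: ev_point)
qed

text \<open>A combination that evaluates to zero is congruent modulo \<open>K\<close> to a combination of the points \<open>t i\<close>, whose
  coefficients vanish by independence. In this way the relations are shown to be complete, without
  any count of dimensions in the free space.\<close>

lemma ev_kernel_eq:
  assumes K: "free_subspace S K" and kill: "K \<subseteq> ev_kernel b S" and I: "finite I" "\<And>i. i \<in> I \<Longrightarrow> t i \<in> S"
    and red: "\<And>s. s \<in> S \<Longrightarrow> point s \<in> reducible_to K I t"
    and indep: "\<And>c. (\<And>r. (\<Sum>i\<in>I. c i * b (t i) r) = 0) \<Longrightarrow> \<forall>i\<in>I. c i = 0"
  shows "K = ev_kernel b S"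
proof
  show "ev_kernel b S \<subseteq> K"
  proof
    fix f assume f: "f \<in> ev_kernel b S"
    then have fF: "f \<in> carrier (free_space S)" and f0: "\<And>r. ev b f r = 0" unfolding ev_kernel_def by auto
    obtain c where c: "(\<lambda>p. f p - (\<Sum>i\<in>I. c i * point (t i) p)) \<in> K"
      using reducible_all[OF K red fF] unfolding reducible_to_def by auto
    have "(\<Sum>i\<in>I. c i * b (t i) r) = 0" for r using ev_reduced[OF kill I fF c] f0 by simp
    then have "\<forall>i\<in>I. c i = 0" by (rule indep)
    then show "f \<in> K" using c by simp
  qed
qed (rule kill)

lemma ev_linear:
  assumes f: "f \<in> carrier (free_space S)" and b': "\<And>s. s \<in> S \<Longrightarrow> b' s r = (\<Sum>p\<in>P. C p * b s p)"
  shows "ev b' f r = (\<Sum>p\<in>P. C p * ev b f p)"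
proof -
  have "{s. f s \<noteq> 0} \<subseteq> S" using f unfolding free_space_simps by auto
  then have "ev b' f r = (\<Sum>s | f s \<noteq> 0. f s * (\<Sum>p\<in>P. C p * b s p))"
    unfolding ev_def using b' by (intro sum.cong refl arg_cong2[of _ _ _ _ "(*)"]) auto
  also have "\<dots> = (\<Sum>s | f s \<noteq> 0. \<Sum>p\<in>P. C p * (f s * b s p))"
    unfolding sum_distrib_left by (intro sum.cong refl) (simp add: mult_ac)
  also have "\<dots> = (\<Sum>p\<in>P. C p * ev b f p)" unfolding ev_def sum_distrib_left by (rule sum.swap)
  finally show ?thesis .
qed

text \<open>The cosets of the kernel are the fibres of the evaluation.\<close>

definition fibre :: "('s \<Rightarrow> 'r \<Rightarrow> complex) \<Rightarrow> 's set \<Rightarrow> ('r \<Rightarrow> complex) \<Rightarrow> ('s \<Rightarrow> complex) set" where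
  "fibre b S y = {f \<in> carrier (free_space S). ev b f = y}"

lemma kernel_coset:
  assumes f: "f \<in> carrier (free_space S)"
  shows "ev_kernel b S +>\<^bsub>free_space S\<^esub> f = fibre b S (ev b f)"
proof -
  have "ev_kernel b S +>\<^bsub>free_space S\<^esub> f = {\<lambda>s. h s + f s | h. h \<in> ev_kernel b S}"
    unfolding a_r_coset_def' free_space_simps by auto
  also have "\<dots> = fibre b S (ev b f)"
  proof (intro equalityI subsetI)
    fix g assume "g \<in> {\<lambda>s. h s + f s | h. h \<in> ev_kernel b S}"
    then obtain h where h: "h \<in> carrier (free_space S)" "\<And>r. ev b h r = 0" "g = (\<lambda>s. h s + f s)" unfolding ev_kernel_def by auto
    then show "g \<in> fibre b S (ev b f)" unfolding fibre_def h(3)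
      using free_space_add_closed[OF h(1) f] by (auto simp: ev_add[OF h(1) f])
  next
    fix g assume "g \<in> fibre b S (ev b f)"
    then have g: "g \<in> carrier (free_space S)" "ev b g = ev b f" unfolding fibre_def by auto
    have "(\<lambda>s. g s - 1 * f s) \<in> ev_kernel b S" unfolding ev_kernel_def
      using free_space_diff_closed[OF g(1) f, of 1] ev_diff[OF g(1) f, of b 1] g(2) by simp
    then show "g \<in> {\<lambda>s. h s + f s | h. h \<in> ev_kernel b S}"
      by (intro CollectI exI[of _ "\<lambda>s. g s - 1 * f s"]) simp
  qed
  finally show ?thesis .
qed

lemma fibre_nonempty_unique: "f \<in> fibre b S y \<Longrightarrow> f \<in> fibre b S z \<Longrightarrow> y = z"
  unfolding fibre_def by auto

lemma quotient_space_simps: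
  "carrier (quotient_space V W) = a_rcosets\<^bsub>V\<^esub> W" "\<zero>\<^bsub>quotient_space V W\<^esub> = W"
  "(\<oplus>\<^bsub>quotient_space V W\<^esub>) = (<+>\<^bsub>V\<^esub>)"
  "k \<odot>\<^bsub>quotient_space V W\<^esub> X = (\<Union>x\<in>X. W +>\<^bsub>V\<^esub> (k \<odot>\<^bsub>V\<^esub> x))"
  by (simp_all add: quotient_space_def)

lemma quotient_carrier:
  "carrier (quotient_space (free_space S) (ev_kernel b S)) = {fibre b S (ev b f) | f. f \<in> carrier (free_space S)}"
  unfolding quotient_space_simps A_RCOSETS_def'
  using kernel_coset[of _ S b] by auto

lemma quotient_add:
  assumes f: "f \<in> carrier (free_space S)" and g: "g \<in> carrier (free_space S)"
  shows "fibre b S (ev b f) \<oplus>\<^bsub>quotient_space (free_space S) (ev_kernel b S)\<^esub> fibre b S (ev b g)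
    = fibre b S (\<lambda>r. ev b f r + ev b g r)"
  unfolding quotient_space_simps set_add_def' free_space_simps
proof (intro equalityI subsetI)
  fix h assume "h \<in> (\<Union>h\<in>fibre b S (ev b f). \<Union>k\<in>fibre b S (ev b g). {\<lambda>s. h s + k s})"
  then obtain f' g' where h: "f' \<in> fibre b S (ev b f)" "g' \<in> fibre b S (ev b g)" "h = (\<lambda>s. f' s + g' s)" by auto
  then show "h \<in> fibre b S (\<lambda>r. ev b f r + ev b g r)" unfolding fibre_def
    using free_space_add_closed ev_add[of f' S g' b] by auto
next
  fix h assume h: "h \<in> fibre b S (\<lambda>r. ev b f r + ev b g r)"
  then have hF: "h \<in> carrier (free_space S)" "ev b h = (\<lambda>r. ev b f r + ev b g r)" unfolding fibre_def by auto
  have "(\<lambda>s. h s - 1 * g s) \<in> fibre b S (ev b f)" unfolding fibre_def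
    using free_space_diff_closed[OF hF(1) g, of 1] ev_diff[OF hF(1) g, of b 1] hF(2) by auto
  moreover have "g \<in> fibre b S (ev b g)" using g unfolding fibre_def by simp
  ultimately show "h \<in> (\<Union>h\<in>fibre b S (ev b f). \<Union>k\<in>fibre b S (ev b g). {\<lambda>s. h s + k s})"
    by (intro UN_I[of "\<lambda>s. h s - 1 * g s"] UN_I[of g]) auto
qed

lemma quotient_smult:
  assumes f: "f \<in> carrier (free_space S)"
  shows "k \<odot>\<^bsub>quotient_space (free_space S) (ev_kernel b S)\<^esub> fibre b S (ev b f) = fibre b S (\<lambda>r. k * ev b f r)"
proof -
  have "ev_kernel b S +>\<^bsub>free_space S\<^esub> (k \<odot>\<^bsub>free_space S\<^esub> x) = fibre b S (\<lambda>r. k * ev b f r)" if "x \<in> fibre b S (ev b f)" for x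
  proof -
    have x: "x \<in> carrier (free_space S)" "ev b x = ev b f" using that unfolding fibre_def by auto
    have "ev b (\<lambda>s. k * x s) = (\<lambda>r. k * ev b f r)" using ev_smult[OF x(1), of b k] x(2) by auto
    then show ?thesis unfolding free_space_simps(4) using kernel_coset[OF free_space_smult_closed[OF x(1)], of b k] by simp
  qed
  moreover have "f \<in> fibre b S (ev b f)" using f unfolding fibre_def by simp
  ultimately show ?thesis unfolding quotient_space_simps(4) by auto
qed

lemma pushforward_closed:
  assumes "f \<in> carrier (free_space S)" "\<And>s. s \<in> S \<Longrightarrow> h s \<in> S"
  shows "pushforward h f \<in> carrier (free_space S)"
proof -
  have f: "finite {s. f s \<noteq> 0}" "{s. f s \<noteq> 0} \<subseteq> S" using assms(1) unfolding free_space_simps by auto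
  have "pushforward h f t = 0" if "t \<notin> h ` {s. f s \<noteq> 0}" for t
    unfolding pushforward_def by (rule sum.neutral) (use that in auto)
  then have "{t. pushforward h f t \<noteq> 0} \<subseteq> h ` {s. f s \<noteq> 0}" by blast
  then show ?thesis unfolding free_space_simps using f assms(2) finite_subset by blast
qed

lemma ev_pushforward:
  assumes "f \<in> carrier (free_space S)"
  shows "ev b (pushforward h f) r = ev (\<lambda>s. b (h s)) f r"
proof -
  let ?A = "{s. f s \<noteq> 0}"
  have A: "finite ?A" using assms unfolding free_space_simps by auto
  have "pushforward h f t = 0" if "t \<notin> h ` ?A" for t
    unfolding pushforward_def by (rule sum.neutral) (use that in auto)
  then have "{t. pushforward h f t \<noteq> 0} \<subseteq> h ` ?A" by blast
  then have "ev b (pushforward h f) r = (\<Sum>t\<in>h ` ?A. pushforward h f t * b t r)"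
    by (intro ev_superset finite_imageI A)
  also have "\<dots> = (\<Sum>t\<in>h ` ?A. \<Sum>s | s \<in> ?A \<and> h s = t. f s * b (h s) r)"
    unfolding pushforward_def sum_distrib_right by (intro sum.cong refl) auto
  also have "\<dots> = (\<Sum>s\<in>?A. f s * b (h s) r)" by (rule sum.image_gen[OF A, symmetric])
  finally show ?thesis by (simp add: ev_def)
qed

lemma tensor_map_fibre:
  assumes K: "tensor_kernel U W E = ev_kernel b (carrier U \<times> carrier W)"
    and f: "f \<in> carrier (free_space (carrier U \<times> carrier W))"
    and S: "\<And>u. u \<in> carrier U \<Longrightarrow> S u \<in> carrier U" and T: "\<And>w. w \<in> carrier W \<Longrightarrow> T w \<in> carrier W"
    and A: "\<And>f r. f \<in> carrier (free_space (carrier U \<times> carrier W)) \<Longrightarrow>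
      ev (\<lambda>s. b (map_prod S T s)) f r = A (ev b f) r"
  shows "tensor_map U W E S T (fibre b (carrier U \<times> carrier W) (ev b f)) = fibre b (carrier U \<times> carrier W) (A (ev b f))"
proof -
  let ?X = "carrier U \<times> carrier W"
  have m: "map_prod S T s \<in> ?X" if "s \<in> ?X" for s using that S T by auto
  have "ev_kernel b ?X +>\<^bsub>free_space ?X\<^esub> pushforward (map_prod S T) g = fibre b ?X (A (ev b f))" if "g \<in> fibre b ?X (ev b f)" for g
  proof -
    have g: "g \<in> carrier (free_space ?X)" "ev b g = ev b f" using that unfolding fibre_def by auto
    have "ev b (pushforward (map_prod S T) g) = A (ev b f)"
      using ev_pushforward[OF g(1), of b "map_prod S T"] A[OF g(1)] g(2) by auto
    then show ?thesis using kernel_coset[OF pushforward_closed[OF g(1), of "map_prod S T"], of b] m by auto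
  qed
  moreover have "f \<in> fibre b ?X (ev b f)" using f unfolding fibre_def by simp
  ultimately show ?thesis unfolding tensor_map_def K by auto
qed

section \<open>Coordinates on abstract modules\<close>

text \<open>Coefficient vectors with index set \<open>R\<close>, extended by zero.\<close>

definition supported :: "'r set \<Rightarrow> ('r \<Rightarrow> complex) set" where
  "supported R = {y. \<forall>r. r \<notin> R \<longrightarrow> y r = 0}"

lemma supported_closed:
  "y \<in> supported R \<Longrightarrow> z \<in> supported R \<Longrightarrow> (\<lambda>r. y r + z r) \<in> supported R"
  "y \<in> supported R \<Longrightarrow> (\<lambda>r. k * y r) \<in> supported R"
  "(\<lambda>_. 0) \<in> supported R" "r \<in> R \<Longrightarrow> point r \<in> supported R"
  "(\<And>i. i \<in> A \<Longrightarrow> f i \<in> supported R) \<Longrightarrow> (\<lambda>r. \<Sum>i\<in>A. f i r) \<in> supported R"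
  unfolding supported_def point_def by auto

text \<open>The operations of \<open>V\<close> are transported from coefficient vectors. Quotient spaces become accessible in this way before they are known to be vector spaces.\<close>

locale coordinates =
  fixes R :: "'r set" and V :: "(complex, 'v, 'n) module_scheme" and \<Phi> :: "('r \<Rightarrow> complex) \<Rightarrow> 'v"
  assumes finite_index: "finite R" and bij: "bij_betw \<Phi> (supported R) (carrier V)"
    and zero: "\<Phi> (\<lambda>_. 0) = \<zero>\<^bsub>V\<^esub>"
    and add: "y \<in> supported R \<Longrightarrow> z \<in> supported R \<Longrightarrow> \<Phi> (\<lambda>r. y r + z r) = \<Phi> y \<oplus>\<^bsub>V\<^esub> \<Phi> z"
    and smult: "y \<in> supported R \<Longrightarrow> \<Phi> (\<lambda>r. k * y r) = k \<odot>\<^bsub>V\<^esub> \<Phi> y"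
begin

definition coord :: "'v \<Rightarrow> 'r \<Rightarrow> complex" where
  "coord v = inv_into (supported R) \<Phi> v"

lemma Phi_closed: "y \<in> supported R \<Longrightarrow> \<Phi> y \<in> carrier V"
  using bij unfolding bij_betw_def by auto

lemma coord_supported: "v \<in> carrier V \<Longrightarrow> coord v \<in> supported R"
  using bij unfolding bij_betw_def coord_def by (metis inv_into_into)

lemma coord_outside: "v \<in> carrier V \<Longrightarrow> r \<notin> R \<Longrightarrow> coord v r = 0"
  using coord_supported unfolding supported_def by auto

lemma Phi_coord: "v \<in> carrier V \<Longrightarrow> \<Phi> (coord v) = v"
  using bij unfolding bij_betw_def coord_def by (metis f_inv_into_f)

lemma coord_Phi: "y \<in> supported R \<Longrightarrow> coord (\<Phi> y) = y"
  using bij unfolding bij_betw_def coord_def by (metis inv_into_f_f)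

lemma coord_eqI: "v \<in> carrier V \<Longrightarrow> w \<in> carrier V \<Longrightarrow> (\<And>r. coord v r = coord w r) \<Longrightarrow> v = w"
  using Phi_coord by (metis ext)

lemma add_closed: "v \<in> carrier V \<Longrightarrow> w \<in> carrier V \<Longrightarrow> v \<oplus>\<^bsub>V\<^esub> w \<in> carrier V"
  using add[OF coord_supported coord_supported, of v w] Phi_closed[OF supported_closed(1)[OF coord_supported coord_supported], of v w]
  by (simp add: Phi_coord)

lemma smult_closed: "v \<in> carrier V \<Longrightarrow> k \<odot>\<^bsub>V\<^esub> v \<in> carrier V"
  using smult[OF coord_supported, of v k] Phi_closed[OF supported_closed(2)[OF coord_supported], of v k]
  by (simp add: Phi_coord)

lemma zero_closed: "\<zero>\<^bsub>V\<^esub> \<in> carrier V"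
  using Phi_closed[OF supported_closed(3)] zero by simp

lemma coord_add: "v \<in> carrier V \<Longrightarrow> w \<in> carrier V \<Longrightarrow> coord (v \<oplus>\<^bsub>V\<^esub> w) = (\<lambda>r. coord v r + coord w r)"
  using add[OF coord_supported coord_supported, of v w] coord_Phi[OF supported_closed(1)[OF coord_supported coord_supported], of v w]
  by (simp add: Phi_coord)

lemma coord_smult: "v \<in> carrier V \<Longrightarrow> coord (k \<odot>\<^bsub>V\<^esub> v) = (\<lambda>r. k * coord v r)"
  using smult[OF coord_supported, of v k] coord_Phi[OF supported_closed(2)[OF coord_supported], of v k]
  by (simp add: Phi_coord)

lemma coord_zero: "coord \<zero>\<^bsub>V\<^esub> = (\<lambda>_. 0)"
  using coord_Phi[OF supported_closed(3)] zero by simp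

lemma coord_basis: "i \<in> R \<Longrightarrow> coord (\<Phi> (point i)) r = (if r = i then 1 else 0)"
  using coord_Phi[OF supported_closed(4)] unfolding point_def by metis

lemma basis_closed: "i \<in> R \<Longrightarrow> \<Phi> (point i) \<in> carrier V"
  by (rule Phi_closed[OF supported_closed(4)])

lemma basis_induct [consumes 1, case_names zero basis add smult]:
  assumes v: "v \<in> carrier V" and 0: "P \<zero>\<^bsub>V\<^esub>" and base: "\<And>i. i \<in> R \<Longrightarrow> P (\<Phi> (point i))"
    and plus: "\<And>u w. u \<in> carrier V \<Longrightarrow> w \<in> carrier V \<Longrightarrow> P u \<Longrightarrow> P w \<Longrightarrow> P (u \<oplus>\<^bsub>V\<^esub> w)"
    and scale: "\<And>k u. u \<in> carrier V \<Longrightarrow> P u \<Longrightarrow> P (k \<odot>\<^bsub>V\<^esub> u)"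
  shows "P v"
proof -
  have "P (\<Phi> (\<lambda>r. \<Sum>i\<in>B. coord v i * point i r))" if "B \<subseteq> R" for B
    using finite_subset[OF that finite_index] that
  proof (induction B)
    case empty
    then show ?case using 0 zero by simp
  next
    case (insert i B)
    have i: "(\<lambda>r. coord v i * point i r) \<in> supported R" "point i \<in> supported R"
      using insert by (auto intro: supported_closed)
    have B: "(\<lambda>r. \<Sum>i\<in>B. coord v i * point i r) \<in> supported R"
      using insert.prems by (intro supported_closed(5) supported_closed(2) supported_closed(4)) auto
    have "P (\<Phi> (\<lambda>r. coord v i * point i r) \<oplus>\<^bsub>V\<^esub> \<Phi> (\<lambda>r. \<Sum>i\<in>B. coord v i * point i r))"
    proof (rule plus[OF Phi_closed[OF i(1)] Phi_closed[OF B]])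
      show "P (\<Phi> (\<lambda>r. coord v i * point i r))" unfolding smult[OF i(2)]
        using insert.prems by (intro scale base basis_closed) auto
      show "P (\<Phi> (\<lambda>r. \<Sum>i\<in>B. coord v i * point i r))" using insert by auto
    qed
    then show ?case unfolding add[OF i(1) B, symmetric] using insert by simp
  qed
  from this[of R] have "P (\<Phi> (\<lambda>r. \<Sum>i\<in>R. coord v i * point i r))" by simp
  moreover have "(\<lambda>r. \<Sum>i\<in>R. coord v i * point i r) = coord v"
  proof
    fix r
    have "(\<Sum>i\<in>R. coord v i * point i r) = (\<Sum>i\<in>R. if i = r then coord v r else 0)"
      by (rule sum.cong) (auto simp: point_def)
    then show "(\<Sum>i\<in>R. coord v i * point i r) = coord v r" using finite_index coord_outside[OF v] by auto
  qed
  ultimately show ?thesis using Phi_coord[OF v] by simp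
qed

lemma abelian_monoid: "abelian_monoid V"
proof (rule abelian_monoidI)
  fix x y z assume c: "x \<in> carrier V" "y \<in> carrier V"
  show "x \<oplus>\<^bsub>V\<^esub> y \<in> carrier V" by (rule add_closed[OF c])
  show "x \<oplus>\<^bsub>V\<^esub> y = y \<oplus>\<^bsub>V\<^esub> x" by (rule coord_eqI) (auto simp: c add_closed coord_add)
  show "x \<oplus>\<^bsub>V\<^esub> y \<oplus>\<^bsub>V\<^esub> z = x \<oplus>\<^bsub>V\<^esub> (y \<oplus>\<^bsub>V\<^esub> z)" if z: "z \<in> carrier V"
    by (rule coord_eqI) (auto simp: c z add_closed coord_add)
next
  show "\<zero>\<^bsub>V\<^esub> \<in> carrier V" by (rule zero_closed)
  show "\<zero>\<^bsub>V\<^esub> \<oplus>\<^bsub>V\<^esub> x = x" if "x \<in> carrier V" for x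
    by (rule coord_eqI) (auto simp: that zero_closed add_closed coord_add coord_zero)
qed

lemma finsum_coord:
  assumes "finite A" "\<And>i. i \<in> A \<Longrightarrow> f i \<in> carrier V"
  shows "finsum V f A \<in> carrier V" "coord (finsum V f A) r = (\<Sum>i\<in>A. coord (f i) r)"
proof -
  interpret V: abelian_monoid V by (rule abelian_monoid)
  show "finsum V f A \<in> carrier V" using assms by (intro V.finsum_closed) auto
  show "coord (finsum V f A) r = (\<Sum>i\<in>A. coord (f i) r)"
    using assms
  proof (induction A)
    case empty
    then show ?case by (simp add: coord_zero)
  next
    case (insert i A)
    then have "finsum V f A \<in> carrier V" "f i \<in> carrier V" by (auto intro!: V.finsum_closed)
    moreover have "finsum V f (insert i A) = f i \<oplus>\<^bsub>V\<^esub> finsum V f A" using insert by (intro V.finsum_insert) auto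
    ultimately show ?case using insert by (simp add: coord_add)
  qed
qed

end

definition represented :: "'r set \<Rightarrow> (('r \<Rightarrow> complex) \<Rightarrow> 'v) \<Rightarrow> ('v \<Rightarrow> 'v) \<Rightarrow> ('r \<Rightarrow> 'r \<Rightarrow> complex) \<Rightarrow> bool" where
  "represented R \<Phi> F A \<longleftrightarrow>
     (\<forall>y\<in>supported R. F (\<Phi> y) = \<Phi> (\<lambda>a. if a \<in> R then \<Sum>i\<in>R. A a i * y i else 0))"

lemma (in coordinates) representedD:
  assumes "represented R \<Phi> F A" "v \<in> carrier V"
  shows "F v \<in> carrier V" "a \<in> R \<Longrightarrow> coord (F v) a = (\<Sum>i\<in>R. A a i * coord v i)"
proof -
  have s: "(\<lambda>a. if a \<in> R then \<Sum>i\<in>R. A a i * coord v i else 0) \<in> supported R" unfolding supported_def by auto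
  have F: "F v = \<Phi> (\<lambda>a. if a \<in> R then \<Sum>i\<in>R. A a i * coord v i else 0)"
    using bspec[OF assms(1)[unfolded represented_def] coord_supported[OF assms(2)]] Phi_coord[OF assms(2)] by simp
  show "F v \<in> carrier V" unfolding F by (rule Phi_closed[OF s])
  show "a \<in> R \<Longrightarrow> coord (F v) a = (\<Sum>i\<in>R. A a i * coord v i)" unfolding F coord_Phi[OF s] by simp
qed

lemma cmodule_isomorphic_coordinates:
  assumes "coordinates R V \<Phi>" "coordinates R Q \<Psi>"
    and "\<And>g. g \<in> carrier G \<Longrightarrow> represented R \<Phi> (\<phi> g) (A g)"
    and "\<And>g. g \<in> carrier G \<Longrightarrow> represented R \<Psi> (\<psi> g) (A g)"
  shows "cmodule_isomorphic G V \<phi> Q \<psi>"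
proof -
  interpret V: coordinates R V \<Phi> by fact
  interpret Q: coordinates R Q \<Psi> by fact
  let ?T = "\<lambda>v. \<Psi> (V.coord v)"
  have "?T \<in> module_hom class_ring V Q" unfolding module_hom_def
    by (auto simp: Q.Phi_closed V.coord_supported V.coord_add V.coord_smult Q.add Q.smult)
  moreover have "bij_betw ?T (carrier V) (carrier Q)"
  proof (rule bij_betw_byWitness[where f' = "\<lambda>w. \<Phi> (Q.coord w)"])
    show "\<forall>a\<in>carrier V. \<Phi> (Q.coord (\<Psi> (V.coord a))) = a" by (simp add: Q.coord_Phi V.coord_supported V.Phi_coord)
    show "\<forall>a\<in>carrier Q. \<Psi> (V.coord (\<Phi> (Q.coord a))) = a" by (simp add: V.coord_Phi Q.coord_supported Q.Phi_coord)
  qed (auto simp: Q.Phi_closed V.coord_supported V.Phi_closed Q.coord_supported)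
  moreover have "?T (\<phi> x v) = \<psi> x (?T v)" if x: "x \<in> carrier G" and v: "v \<in> carrier V" for x v
  proof -
    let ?y = "\<lambda>a. if a \<in> R then \<Sum>i\<in>R. A x a i * V.coord v i else 0"
    have y: "?y \<in> supported R" unfolding supported_def by auto
    have "\<phi> x v = \<Phi> ?y"
      using bspec[OF assms(3)[OF x, unfolded represented_def] V.coord_supported[OF v]] V.Phi_coord[OF v] by simp
    moreover have "\<psi> x (?T v) = \<Psi> ?y"
      using bspec[OF assms(4)[OF x, unfolded represented_def] V.coord_supported[OF v]] .
    ultimately show ?thesis using V.coord_Phi[OF y] by simp
  qed
  ultimately show ?thesis unfolding cmodule_isomorphic_def by blast
qed

text \<open>A fibre has the common value of its elements as coordinates.\<close>

lemma fibre_coordinates: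
  assumes R: "finite R" and out: "\<And>s r. s \<in> S \<Longrightarrow> r \<notin> R \<Longrightarrow> b s r = 0"
    and surj: "\<And>y. y \<in> supported R \<Longrightarrow> \<exists>f\<in>carrier (free_space S). ev b f = y"
  shows "coordinates R (quotient_space (free_space S) (ev_kernel b S)) (fibre b S)"
proof
  let ?Q = "quotient_space (free_space S) (ev_kernel b S)"
  have sup: "ev b f \<in> supported R" if "f \<in> carrier (free_space S)" for f
  proof -
    have "{s. f s \<noteq> 0} \<subseteq> S" using that unfolding free_space_simps by auto
    then show ?thesis unfolding supported_def ev_def using out by (auto intro!: sum.neutral)
  qed
  show "finite R" by fact
  show "bij_betw (fibre b S) (supported R) (carrier ?Q)"
  proof (rule bij_betwI')
    fix y z assume y: "y \<in> supported R" and z: "z \<in> supported R"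
    obtain f where "f \<in> fibre b S y" using surj[OF y] unfolding fibre_def by auto
    then show "(fibre b S y = fibre b S z) = (y = z)" using fibre_nonempty_unique by blast
  next
    fix y assume "y \<in> supported R"
    then show "fibre b S y \<in> carrier ?Q" unfolding quotient_carrier using surj by blast
  next
    fix X assume "X \<in> carrier ?Q"
    then show "\<exists>y\<in>supported R. X = fibre b S y" unfolding quotient_carrier using sup by blast
  qed
  show "fibre b S (\<lambda>_. 0) = \<zero>\<^bsub>?Q\<^esub>" unfolding quotient_space_simps fibre_def ev_kernel_def by (auto simp: fun_eq_iff)
  fix y assume "y \<in> supported R"
  then obtain f where f: "f \<in> carrier (free_space S)" "ev b f = y" using surj by blast
  show "fibre b S (\<lambda>r. k * y r) = k \<odot>\<^bsub>?Q\<^esub> fibre b S y" for k using quotient_smult[OF f(1), of b k] unfolding f(2) by simp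
  fix z assume "z \<in> supported R"
  then obtain g where g: "g \<in> carrier (free_space S)" "ev b g = z" using surj by blast
  show "fibre b S (\<lambda>r. y r + z r) = fibre b S y \<oplus>\<^bsub>?Q\<^esub> fibre b S z" using quotient_add[OF f(1) g(1), of b] unfolding f(2) g(2) by simp
qed

lemma fibre_represented:
  assumes K: "tensor_kernel U W E = ev_kernel b (carrier U \<times> carrier W)"
    and surj: "\<And>y. y \<in> supported R \<Longrightarrow> \<exists>f\<in>carrier (free_space (carrier U \<times> carrier W)). ev b f = y"
    and F: "\<And>u. u \<in> carrier U \<Longrightarrow> F1 u \<in> carrier U" "\<And>w. w \<in> carrier W \<Longrightarrow> F2 w \<in> carrier W"
    and out: "\<And>s r. s \<in> carrier U \<times> carrier W \<Longrightarrow> r \<notin> R \<Longrightarrow> b s r = 0"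
    and A: "\<And>u w r. u \<in> carrier U \<Longrightarrow> w \<in> carrier W \<Longrightarrow> r \<in> R \<Longrightarrow> b (F1 u, F2 w) r = (\<Sum>i\<in>R. A r i * b (u,w) i)"
  shows "represented R (fibre b (carrier U \<times> carrier W)) (tensor_map U W E F1 F2) A"
  unfolding represented_def
proof
  let ?S = "carrier U \<times> carrier W"
  fix y assume "y \<in> supported R"
  then obtain f where f: "f \<in> carrier (free_space ?S)" "ev b f = y" using surj by blast
  have "tensor_map U W E F1 F2 (fibre b ?S (ev b f)) =
      fibre b ?S ((\<lambda>y a. if a \<in> R then \<Sum>i\<in>R. A a i * y i else 0) (ev b f))"
  proof (rule tensor_map_fibre[OF K f(1) F])
    fix g r assume g: "g \<in> carrier (free_space ?S)"
    show "ev (\<lambda>s. b (map_prod F1 F2 s)) g r = (if r \<in> R then \<Sum>i\<in>R. A r i * ev b g i else 0)"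
    proof (cases "r \<in> R")
      case True
      then show ?thesis using ev_linear[OF g, of "\<lambda>s. b (map_prod F1 F2 s)" r "A r" b R] A by auto
    next
      case False
      have "{s. g s \<noteq> 0} \<subseteq> ?S" using g unfolding free_space_simps by auto
      then have "g s * b (map_prod F1 F2 s) r = 0" for s using out[of "map_prod F1 F2 s" r] False F by (cases "g s = 0") auto
      then show ?thesis using False unfolding ev_def by simp
    qed
  qed
  then show "tensor_map U W E F1 F2 (fibre b ?S y) = fibre b ?S (\<lambda>a. if a \<in> R then \<Sum>i\<in>R. A a i * y i else 0)"
    unfolding f(2) by simp
qed

section \<open>Tensor products in coordinates\<close>

definition bilinear_on ::
  "(complex, 'u, 'm) module_scheme \<Rightarrow> (complex, 'w, 'n) module_scheme \<Rightarrow> ('u \<times> 'w \<Rightarrow> 'r \<Rightarrow> complex) \<Rightarrow> bool" where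
  "bilinear_on U W b \<longleftrightarrow>
     (\<forall>u\<in>carrier U. \<forall>u'\<in>carrier U. \<forall>w\<in>carrier W. \<forall>r. b (u \<oplus>\<^bsub>U\<^esub> u', w) r = b (u, w) r + b (u', w) r) \<and>
     (\<forall>u\<in>carrier U. \<forall>w\<in>carrier W. \<forall>w'\<in>carrier W. \<forall>r. b (u, w \<oplus>\<^bsub>W\<^esub> w') r = b (u, w) r + b (u, w') r) \<and>
     (\<forall>u\<in>carrier U. \<forall>w\<in>carrier W. \<forall>k r. b (k \<odot>\<^bsub>U\<^esub> u, w) r = k * b (u, w) r) \<and>
     (\<forall>u\<in>carrier U. \<forall>w\<in>carrier W. \<forall>k r. b (u, k \<odot>\<^bsub>W\<^esub> w) r = k * b (u, w) r)"

lemma point_relation2: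
  assumes "x \<in> S" "y \<in> S"
  shows "(\<lambda>p. point x p - k * point y p) \<in> carrier (free_space S)"
    "ev b (\<lambda>p. point x p - k * point y p) r = b x r - k * b y r"
  using free_space_diff_closed[OF point_closed[OF assms(1)] point_closed[OF assms(2)]]
    ev_diff[OF point_closed[OF assms(1)] point_closed[OF assms(2)]] by (simp_all add: ev_point)

lemma point_relation3:
  assumes "x \<in> S" "y \<in> S" "z \<in> S"
  shows "(\<lambda>p. point x p - point y p - point z p) \<in> carrier (free_space S)"
    "ev b (\<lambda>p. point x p - point y p - point z p) r = b x r - b y r - b z r"
  using free_space_diff_closed[OF point_relation2(1)[OF assms(1,2)] point_closed[OF assms(3)], of 1 1]
    ev_diff[OF point_relation2(1)[OF assms(1,2)] point_closed[OF assms(3)], of b 1 1 r]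
    point_relation2(2)[OF assms(1,2), of b 1 r] by (simp_all add: ev_point)

locale coordinate_pair = U: coordinates R1 U \<Phi>1 + W: coordinates R2 W \<Phi>2
  for R1 :: "'r set" and U :: "(complex, 'u, 'm) module_scheme" and \<Phi>1
    and R2 :: "'s set" and W :: "(complex, 'w, 'n) module_scheme" and \<Phi>2
begin

abbreviation pairs where "pairs \<equiv> carrier U \<times> carrier W"

lemma bilinear_relations_closed: "bilinear_relations U W \<subseteq> carrier (free_space pairs)"
proof
  fix f assume "f \<in> bilinear_relations U W"
  then show "f \<in> carrier (free_space pairs)" unfolding bilinear_relations_def
    by (elim UnE CollectE exE conjE; hypsubst) (intro point_relation2 point_relation3 SigmaI; simp add: U.add_closed W.add_closed U.smult_closed W.smult_closed)+
qed

lemma bilinear_relations_killed: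
  assumes "bilinear_on U W b" shows "bilinear_relations U W \<subseteq> ev_kernel b pairs"
proof
  fix f assume f: "f \<in> bilinear_relations U W"
  note B = assms[unfolded bilinear_on_def]
  have "ev b f r = 0" for r
    using f unfolding bilinear_relations_def
  proof (elim UnE CollectE exE conjE, goal_cases)
    case (1 u u' w)
    then show ?case using B point_relation3(2)[of "(u \<oplus>\<^bsub>U\<^esub> u', w)" pairs "(u,w)" "(u',w)" b r] U.add_closed by simp
  next
    case (2 u w w')
    then show ?case using B point_relation3(2)[of "(u, w \<oplus>\<^bsub>W\<^esub> w')" pairs "(u,w)" "(u,w')" b r] W.add_closed by simp
  next
    case (3 k u w)
    then show ?case using B point_relation2(2)[of "(k \<odot>\<^bsub>U\<^esub> u, w)" pairs "(u,w)" b k r] U.smult_closed by simp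
  next
    case (4 k u w)
    then show ?case using B point_relation2(2)[of "(u, k \<odot>\<^bsub>W\<^esub> w)" pairs "(u,w)" b k r] W.smult_closed by simp
  qed
  then show "f \<in> ev_kernel b pairs" unfolding ev_kernel_def using f bilinear_relations_closed by blast
qed

lemma reducible_congruent:
  assumes K: "free_subspace S K" and "(\<lambda>p. f p - g p) \<in> K" "g \<in> reducible_to K I t"
  shows "f \<in> reducible_to K I t"
  using reducible_add[OF K reducible_kernel[OF assms(2)] assms(3)] by simp

text \<open>The bilinear relations reduce a pair to the pairs with a basis vector in the first place.\<close>

lemma reducible_left:
  assumes K: "free_subspace S K" "bilinear_relations U W \<subseteq> K" and u: "u \<in> carrier U" and w: "w \<in> carrier W"
    and base: "\<And>i. i \<in> R1 \<Longrightarrow> point (\<Phi>1 (point i), w) \<in> reducible_to K I t"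
  shows "point (u, w) \<in> reducible_to K I t"
  using u
proof (induction rule: U.basis_induct)
  have scale: "point (k \<odot>\<^bsub>U\<^esub> v, w) \<in> reducible_to K I t" if "v \<in> carrier U" "(\<lambda>p. k * point (v, w) p) \<in> reducible_to K I t" for k v
    by (rule reducible_congruent[OF K(1) subsetD[OF K(2)] that(2)])
      (use that(1) w in \<open>unfold bilinear_relations_def, blast\<close>)
  { case zero
    have "0 \<odot>\<^bsub>U\<^esub> u = \<zero>\<^bsub>U\<^esub>" by (rule U.coord_eqI) (auto simp: u U.smult_closed U.zero_closed U.coord_smult U.coord_zero)
    moreover have "(\<lambda>p. 0 * point (u, w) p) \<in> reducible_to K I t" using reducible_kernel[OF free_subspaceD(2)[OF K(1)]] by simp
    ultimately show ?case using scale[OF u, of 0] by simp }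
  { case (basis i)
    then show ?case by (rule base) }
  { case (add v v')
    have "(\<lambda>p. point (v \<oplus>\<^bsub>U\<^esub> v', w) p - point (v, w) p - point (v', w) p) \<in> K"
      using w add.hyps by (intro subsetD[OF K(2)]) (unfold bilinear_relations_def, blast)
    then show ?case
      by (intro reducible_congruent[OF K(1) _ reducible_add[OF K(1) add.IH]]) (simp add: diff_diff_eq) }
  { case (smult k v)
    then show ?case by (intro scale reducible_smult[OF K(1)]) }
qed

lemma reducible_right:
  assumes K: "free_subspace S K" "bilinear_relations U W \<subseteq> K" and u: "u \<in> carrier U" and w: "w \<in> carrier W"
    and base: "\<And>i. i \<in> R2 \<Longrightarrow> point (u, \<Phi>2 (point i)) \<in> reducible_to K I t"
  shows "point (u, w) \<in> reducible_to K I t"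
  using w
proof (induction rule: W.basis_induct)
  have scale: "point (u, k \<odot>\<^bsub>W\<^esub> v) \<in> reducible_to K I t" if "v \<in> carrier W" "(\<lambda>p. k * point (u, v) p) \<in> reducible_to K I t" for k v
    by (rule reducible_congruent[OF K(1) subsetD[OF K(2)] that(2)])
      (use that(1) u in \<open>unfold bilinear_relations_def, blast\<close>)
  { case zero
    have "0 \<odot>\<^bsub>W\<^esub> w = \<zero>\<^bsub>W\<^esub>" by (rule W.coord_eqI) (auto simp: w W.smult_closed W.zero_closed W.coord_smult W.coord_zero)
    moreover have "(\<lambda>p. 0 * point (u, w) p) \<in> reducible_to K I t" using reducible_kernel[OF free_subspaceD(2)[OF K(1)]] by simp
    ultimately show ?case using scale[OF w, of 0] by simp }
  { case (basis i)
    then show ?case by (rule base) }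
  { case (add v v')
    have "(\<lambda>p. point (u, v \<oplus>\<^bsub>W\<^esub> v') p - point (u, v) p - point (u, v') p) \<in> K"
      using u add.hyps by (intro subsetD[OF K(2)]) (unfold bilinear_relations_def, blast)
    then show ?case
      by (intro reducible_congruent[OF K(1) _ reducible_add[OF K(1) add.IH]]) (simp add: diff_diff_eq) }
  { case (smult k v)
    then show ?case by (intro scale reducible_smult[OF K(1)]) }
qed

lemma tensor_kernel_facts:
  assumes E: "E \<subseteq> ev_kernel b pairs" and b: "bilinear_on U W b"
  shows "free_subspace pairs (tensor_kernel U W E)" "bilinear_relations U W \<subseteq> tensor_kernel U W E"
    "E \<subseteq> tensor_kernel U W E" "tensor_kernel U W E \<subseteq> ev_kernel b pairs"
proof -
  have "bilinear_relations U W \<union> E \<subseteq> ev_kernel b pairs" using E bilinear_relations_killed[OF b] by simp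
  moreover from this have "bilinear_relations U W \<union> E \<subseteq> carrier (free_space pairs)" unfolding ev_kernel_def by auto
  ultimately show "free_subspace pairs (tensor_kernel U W E)" "bilinear_relations U W \<subseteq> tensor_kernel U W E"
    "E \<subseteq> tensor_kernel U W E" "tensor_kernel U W E \<subseteq> ev_kernel b pairs"
    unfolding tensor_kernel_def using span_free_subspace[of "bilinear_relations U W \<union> E" pairs]
      ev_kernel_subspace[of pairs b] by blast+
qed

definition product_coord :: "'u \<times> 'w \<Rightarrow> 'r \<times> 's \<Rightarrow> complex" where
  "product_coord p q = U.coord (fst p) (fst q) * W.coord (snd p) (snd q)"

lemma product_coord_bilinear: "bilinear_on U W product_coord"
  unfolding bilinear_on_def product_coord_def
  by (auto simp: U.coord_add W.coord_add U.coord_smult W.coord_smult algebra_simps)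

lemma product_coord_basis:
  "q \<in> R1 \<times> R2 \<Longrightarrow> product_coord (\<Phi>1 (point (fst q)), \<Phi>2 (point (snd q))) r = (if r = q then 1 else 0)"
  unfolding product_coord_def by (cases r; cases q) (auto simp: U.coord_basis W.coord_basis)

text \<open>All pairs reduce to pairs of basis vectors, whose values are the unit vectors.\<close>

lemma tensor_kernel_product: "tensor_kernel U W {} = ev_kernel product_coord pairs"
proof (rule ev_kernel_eq[where I = "R1 \<times> R2" and t = "\<lambda>q. (\<Phi>1 (point (fst q)), \<Phi>2 (point (snd q)))"])
  note K = tensor_kernel_facts[OF empty_subsetI product_coord_bilinear]
  show "free_subspace pairs (tensor_kernel U W {})" "tensor_kernel U W {} \<subseteq> ev_kernel product_coord pairs" by (fact K)+
  show "finite (R1 \<times> R2)" using U.finite_index W.finite_index by simp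
  show "(\<Phi>1 (point (fst q)), \<Phi>2 (point (snd q))) \<in> pairs" if "q \<in> R1 \<times> R2" for q
    using that by (auto simp: U.basis_closed W.basis_closed)
  show "point s \<in> reducible_to (tensor_kernel U W {}) (R1 \<times> R2) (\<lambda>q. (\<Phi>1 (point (fst q)), \<Phi>2 (point (snd q))))"
    if sp: "s \<in> pairs" for s
  proof -
    obtain u w where s: "s = (u,w)" "u \<in> carrier U" "w \<in> carrier W" using sp by auto
    show ?thesis unfolding s(1)
    proof (rule reducible_left[OF K(1,2) s(2,3)], rule reducible_right[OF K(1,2) U.basis_closed s(3)])
      fix i j assume "i \<in> R1" "j \<in> R2"
      then show "point (\<Phi>1 (point i), \<Phi>2 (point j)) \<in> reducible_to (tensor_kernel U W {}) (R1 \<times> R2) (\<lambda>q. (\<Phi>1 (point (fst q)), \<Phi>2 (point (snd q))))"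
        using reducible_point[OF K(1), of "R1 \<times> R2" "(i,j)" "\<lambda>q. (\<Phi>1 (point (fst q)), \<Phi>2 (point (snd q)))"]
          U.finite_index W.finite_index by simp
    qed
  qed
  show "\<forall>q\<in>R1 \<times> R2. c q = 0"
    if "\<And>r. (\<Sum>q\<in>R1 \<times> R2. c q * product_coord (\<Phi>1 (point (fst q)), \<Phi>2 (point (snd q))) r) = 0" for c
  proof
    fix r assume r: "r \<in> R1 \<times> R2"
    have "(\<Sum>q\<in>R1 \<times> R2. c q * product_coord (\<Phi>1 (point (fst q)), \<Phi>2 (point (snd q))) r) = (\<Sum>q\<in>R1 \<times> R2. if q = r then c r else 0)"
      by (intro sum.cong refl) (auto simp: product_coord_basis)
    also have "\<dots> = c r" using r U.finite_index W.finite_index by simp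
    finally show "c r = 0" using that[of r] by simp
  qed
qed

lemma product_coord_surj:
  assumes "y \<in> supported (R1 \<times> R2)" shows "\<exists>f\<in>carrier (free_space pairs). ev product_coord f = y"
proof -
  let ?t = "\<lambda>q. (\<Phi>1 (point (fst q)), \<Phi>2 (point (snd q)))"
  let ?f = "\<lambda>p. \<Sum>q\<in>R1 \<times> R2. y q * point (?t q) p"
  have fin: "finite (R1 \<times> R2)" using U.finite_index W.finite_index by simp
  have t: "point (?t q) \<in> carrier (free_space pairs)" if "q \<in> R1 \<times> R2" for q
    using that by (intro point_closed) (auto simp: U.basis_closed W.basis_closed)
  have "ev product_coord ?f r = y r" for r
  proof -
    have "ev product_coord ?f r = (\<Sum>q\<in>R1 \<times> R2. y q * ev product_coord (point (?t q)) r)" by (rule ev_sum[OF fin t])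
    also have "\<dots> = (\<Sum>q\<in>R1 \<times> R2. if q = r then y r else 0)"
      by (intro sum.cong refl) (auto simp: ev_point product_coord_basis)
    also have "\<dots> = (if r \<in> R1 \<times> R2 then y r else 0)" by (rule sum.delta[OF fin])
    also have "\<dots> = y r" using assms by (auto simp: supported_def simp del: split_paired_All mem_Times_iff)
    finally show ?thesis .
  qed
  then have "ev product_coord ?f = y" ..
  moreover have "?f \<in> carrier (free_space pairs)" by (rule free_space_sum_closed[OF fin t])
  ultimately show ?thesis by (rule bexI)
qed

lemma product_coord_outside: "s \<in> pairs \<Longrightarrow> q \<notin> R1 \<times> R2 \<Longrightarrow> product_coord s q = 0"
  unfolding product_coord_def using U.coord_outside W.coord_outside by (cases s; cases q) auto

theorem tensor_coordinates: "coordinates (R1 \<times> R2) (tensor U W) (fibre product_coord pairs)"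
  unfolding tensor_space_def tensor_kernel_product
  by (rule fibre_coordinates) (use U.finite_index W.finite_index product_coord_outside product_coord_surj in auto)

theorem tensor_represented:
  assumes F1: "represented R1 \<Phi>1 F1 A1" and F2: "represented R2 \<Phi>2 F2 A2"
  shows "represented (R1 \<times> R2) (fibre product_coord pairs) (tensor_map U W {} F1 F2)
    (\<lambda>q p. A1 (fst q) (fst p) * A2 (snd q) (snd p))"
proof (rule fibre_represented[OF tensor_kernel_product product_coord_surj])
  show "F1 u \<in> carrier U" if "u \<in> carrier U" for u by (rule U.representedD(1)[OF F1 that])
  show "F2 w \<in> carrier W" if "w \<in> carrier W" for w by (rule W.representedD(1)[OF F2 that])
  show "product_coord s r = 0" if "s \<in> pairs" "r \<notin> R1 \<times> R2" for s r by (rule product_coord_outside[OF that])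
  fix u w q assume u: "u \<in> carrier U" and w: "w \<in> carrier W" and q: "q \<in> R1 \<times> R2"
  have "product_coord (F1 u, F2 w) q
      = (\<Sum>i\<in>R1. A1 (fst q) i * U.coord u i) * (\<Sum>j\<in>R2. A2 (snd q) j * W.coord w j)"
    using q U.representedD(2)[OF F1 u] W.representedD(2)[OF F2 w] unfolding product_coord_def by auto
  also have "\<dots> = (\<Sum>p\<in>R1 \<times> R2. A1 (fst q) (fst p) * A2 (snd q) (snd p) * product_coord (u,w) p)"
    unfolding sum_product sum.cartesian_product product_coord_def by (rule sum.cong) (auto simp: mult_ac)
  finally show "product_coord (F1 u, F2 w) q = (\<Sum>p\<in>R1 \<times> R2. A1 (fst q) (fst p) * A2 (snd q) (snd p) * product_coord (u,w) p)" .
qed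

end

section \<open>Induced modules in coordinates\<close>

text \<open>The matrix with the columns \<open>v p\<close> has a right inverse; being square it is invertible.\<close>

lemma spanning_imp_independent:
  fixes v :: "'i \<Rightarrow> nat \<Rightarrow> complex"
  assumes I: "finite I" "card I = n" and span: "\<And>y. \<exists>c. \<forall>r<n. y r = (\<Sum>p\<in>I. c p * v p r)"
    and c0: "\<And>r. r < n \<Longrightarrow> (\<Sum>p\<in>I. c0 p * v p r) = 0"
  shows "\<forall>p\<in>I. c0 p = 0"
proof -
  obtain e where e: "bij_betw e {..<n} I" using ex_bij_betw_nat_finite[OF I(1)] I(2) by (auto simp: atLeast0LessThan)
  define M where "M = mat n n (\<lambda>(r,q). v (e q) r)"
  have M: "M \<in> carrier_mat n n" unfolding M_def by simp
  have mult: "(M *\<^sub>v vec n (\<lambda>q. c (e q))) $ r = (\<Sum>p\<in>I. c p * v p r)" if "r < n" for c r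
  proof -
    have "(M *\<^sub>v vec n (\<lambda>q. c (e q))) $ r = (\<Sum>q<n. c (e q) * v (e q) r)"
      using that unfolding M_def by (simp add: scalar_prod_def atLeast0LessThan mult.commute)
    also have "\<dots> = (\<Sum>p\<in>I. c p * v p r)" by (rule sum.reindex_bij_betw[OF e])
    finally show ?thesis .
  qed
  have "\<exists>C. \<forall>k. \<forall>r<n. (if r = k then 1 else 0) = (\<Sum>p\<in>I. C k p * v p r)"
  proof (rule choice, rule allI)
    show "\<exists>c. \<forall>r<n. (if r = k then 1 else 0) = (\<Sum>p\<in>I. c p * v p r)" for k
      using span[of "\<lambda>r. if r = k then 1 else 0"] .
  qed
  then obtain C where "\<forall>k. \<forall>r<n. (if r = k then 1 else 0) = (\<Sum>p\<in>I. C k p * v p r)" ..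
  then have C: "(if r = k then 1 else 0) = (\<Sum>p\<in>I. C k p * v p r)" if "r < n" for k r using that by blast
  define N where "N = mat n n (\<lambda>(q,k). C k (e q))"
  have N: "N \<in> carrier_mat n n" unfolding N_def by simp
  have "M * N = 1\<^sub>m n"
  proof (rule eq_matI)
    fix r k assume rk: "r < dim_row (1\<^sub>m n)" "k < dim_col (1\<^sub>m n)"
    have "col N k = vec n (\<lambda>q. C k (e q))" using rk by (auto simp: N_def)
    then have "(M * N) $$ (r,k) = (M *\<^sub>v vec n (\<lambda>q. C k (e q))) $ r" using rk M N by simp
    then show "(M * N) $$ (r,k) = 1\<^sub>m n $$ (r,k)" using mult[of r "C k"] C[of r k] rk by auto
  qed (use M N in auto)
  then have NM: "N * M = 1\<^sub>m n" by (rule mat_mult_left_right_inverse[OF M N])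
  let ?c = "vec n (\<lambda>q. c0 (e q))"
  have "M *\<^sub>v ?c = 0\<^sub>v n" by (rule eq_vecI) (use mult[of _ c0] c0 M in auto)
  then have "N *\<^sub>v (M *\<^sub>v ?c) = 0\<^sub>v n" using N by auto
  moreover have "N *\<^sub>v (M *\<^sub>v ?c) = ?c"
    by (subst assoc_mult_mat_vec[OF N M, symmetric]) (simp_all add: NM)
  ultimately have c: "?c = 0\<^sub>v n" by simp
  show ?thesis
  proof
    fix p assume "p \<in> I"
    then obtain q where q: "q < n" "e q = p" using e unfolding bij_betw_def by auto
    have "?c $ q = 0\<^sub>v n $ q" unfolding c ..
    then show "c0 p = 0" using q by simp
  qed
qed

lemma twisted_algebra_simps:
  "carrier (twisted_algebra G \<alpha>) = supported (carrier G)"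
  "a \<otimes>\<^bsub>twisted_algebra G \<alpha>\<^esub> b =
     (\<lambda>x. \<Sum>(g, h) | g \<in> carrier G \<and> h \<in> carrier G \<and> g \<otimes>\<^bsub>G\<^esub> h = x. \<alpha> (g, h) * a g * b h)"
  "\<zero>\<^bsub>twisted_algebra G \<alpha>\<^esub> = (\<lambda>x. 0)" "a \<oplus>\<^bsub>twisted_algebra G \<alpha>\<^esub> b = (\<lambda>x. a x + b x)"
  "k \<odot>\<^bsub>twisted_algebra G \<alpha>\<^esub> a = (\<lambda>x. k * a x)"
  by (simp_all add: twisted_algebra_def supported_def)

lemma twisted_algebra_coordinates:
  "finite (carrier G) \<Longrightarrow> coordinates (carrier G) (twisted_algebra G \<alpha>) (\<lambda>y. y)"
  by unfold_locales (auto simp: twisted_algebra_simps bij_betw_def)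

context group
begin

lemma twisted_mult_closed: "a \<otimes>\<^bsub>twisted_algebra G \<alpha>\<^esub> b \<in> carrier (twisted_algebra G \<alpha>)"
  unfolding twisted_algebra_simps supported_def mem_Collect_eq
proof (intro allI impI)
  fix x assume "x \<notin> carrier G"
  then have e: "{(g, h). g \<in> carrier G \<and> h \<in> carrier G \<and> g \<otimes> h = x} = {}" by auto
  show "(\<Sum>(g, h) | g \<in> carrier G \<and> h \<in> carrier G \<and> g \<otimes> h = x. \<alpha> (g, h) * a g * b h) = 0"
    unfolding e by simp
qed

lemma twisted_mult_sum:
  assumes fin: "finite (carrier G)"
  shows "(\<Sum>x\<in>carrier G. (a \<otimes>\<^bsub>twisted_algebra G \<alpha>\<^esub> b) x * e x) =
    (\<Sum>h\<in>carrier G. \<Sum>g\<in>carrier G. \<alpha> (h, g) * a h * b g * e (h \<otimes> g))"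
proof -
  let ?P = "carrier G \<times> carrier G" and ?m = "\<lambda>p. fst p \<otimes> snd p"
  let ?F = "\<lambda>p. \<alpha> p * a (fst p) * b (snd p) * e (?m p)"
  have "(\<Sum>x\<in>carrier G. (a \<otimes>\<^bsub>twisted_algebra G \<alpha>\<^esub> b) x * e x) = (\<Sum>x\<in>carrier G. \<Sum>p | p \<in> ?P \<and> ?m p = x. ?F p)"
  proof (rule sum.cong[OF refl])
    fix x assume "x \<in> carrier G"
    have "{(g, h). g \<in> carrier G \<and> h \<in> carrier G \<and> g \<otimes> h = x} = {p. p \<in> ?P \<and> ?m p = x}" by auto
    then show "(a \<otimes>\<^bsub>twisted_algebra G \<alpha>\<^esub> b) x * e x = (\<Sum>p | p \<in> ?P \<and> ?m p = x. ?F p)"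
      unfolding twisted_algebra_simps sum_distrib_right by (intro sum.cong) (auto simp: split_def)
  qed
  also have "\<dots> = sum ?F ?P" by (rule sum.group) (use fin in auto)
  also have "\<dots> = (\<Sum>h\<in>carrier G. \<Sum>g\<in>carrier G. \<alpha> (h, g) * a h * b g * e (h \<otimes> g))"
    unfolding sum.cartesian_product by (rule sum.cong) auto
  finally show ?thesis .
qed

lemma twisted_mult_points:
  assumes fin: "finite (carrier G)" and "g \<in> carrier G" "h \<in> carrier G"
  shows "point g \<otimes>\<^bsub>twisted_algebra G \<alpha>\<^esub> point h = \<alpha> (g, h) \<odot>\<^bsub>twisted_algebra G \<alpha>\<^esub> point (g \<otimes> h)"
proof
  fix x
  have eq: "(case p of (g', h') \<Rightarrow> \<alpha> (g', h') * point g g' * point h h') = (if p = (g,h) then \<alpha> (g,h) else 0)" for p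
    by (cases p) (auto simp: point_def)
  show "(point g \<otimes>\<^bsub>twisted_algebra G \<alpha>\<^esub> point h) x = (\<alpha> (g, h) \<odot>\<^bsub>twisted_algebra G \<alpha>\<^esub> point (g \<otimes> h)) x"
  proof (cases "x = g \<otimes> h")
    case True
    let ?S = "{(g', h'). g' \<in> carrier G \<and> h' \<in> carrier G \<and> g' \<otimes> h' = x}"
    have "finite ?S" by (rule finite_subset[of _ "carrier G \<times> carrier G"]) (use fin in auto)
    then have "(\<Sum>p\<in>?S. if p = (g,h) then \<alpha> (g,h) else 0) = (if (g,h) \<in> ?S then \<alpha> (g,h) else 0)"
      by (rule sum.delta)
    also have "\<dots> = \<alpha> (g,h)" using True assms by simp
    finally have "(\<Sum>p\<in>?S. if p = (g,h) then \<alpha> (g,h) else 0) = \<alpha> (g,h)" .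
    then show ?thesis using True unfolding twisted_algebra_simps eq by (simp add: point_def)
  next
    case False
    then show ?thesis unfolding twisted_algebra_simps eq by (auto simp: point_def intro!: sum.neutral)
  qed
qed

end

text \<open>A \<open>J\<close>-module \<open>U\<close> and an equivariant linear map \<open>D\<close> from \<open>U\<close> to the irreducible representation
  \<open>\<rho>\<close> of \<open>G\<close>. By Frobenius reciprocity \<open>D\<close> extends to the induced module. The extension is surjective by
  irreducibility, and bijective by the equation between the dimensions.\<close>

locale induced_data = group G + U: coordinates R U \<Phi>
  for G :: "('g, 'm) monoid_scheme" (structure)
    and R :: "'r set" and U :: "(complex, 'u, 'n) module_scheme" and \<Phi> +
  fixes \<alpha> :: "'g \<times> 'g \<Rightarrow> complex" and n :: nat and \<rho> :: "'g \<Rightarrow> complex mat" and J :: "'g set"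
    and \<phi> :: "'g \<Rightarrow> 'u \<Rightarrow> 'u" and A :: "'g \<Rightarrow> 'r \<Rightarrow> 'r \<Rightarrow> complex" and D :: "nat \<Rightarrow> 'r \<Rightarrow> complex"
  assumes fin: "finite (carrier G)" and J: "subgroup J G"
    and rep: "proj_rep G (carrier G) n \<alpha> \<rho>" and full: "full n \<rho> (carrier G)"
    and act: "h \<in> J \<Longrightarrow> represented R \<Phi> (\<phi> h) (A h)"
    and equiv: "h \<in> J \<Longrightarrow> r < n \<Longrightarrow> i \<in> R \<Longrightarrow> (\<Sum>s<n. \<rho> h $$ (r,s) * D s i) = (\<Sum>a\<in>R. A h a i * D r a)"
    and nonzero: "\<exists>r<n. \<exists>i\<in>R. D r i \<noteq> 0"
    and count: "n * card J = card R * card (carrier G)"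
begin

sublocale coordinate_pair R U \<Phi> "carrier G" "twisted_algebra G \<alpha>" "\<lambda>y. y"
  using twisted_algebra_coordinates[OF fin] U.coordinates_axioms by (simp add: coordinate_pair_def)

lemma J_in_G: "h \<in> J \<Longrightarrow> h \<in> carrier G"
  using subgroup.mem_carrier[OF J] .

lemma finite_J: "finite J"
  using finite_subset[OF subgroup.subset[OF J] fin] .

text \<open>The image of \<open>X\<close> under \<open>D\<close>, and the value of \<open>X \<otimes> a\<close> under the extension of \<open>D\<close> to the induced module.\<close>

definition dvec :: "'u \<Rightarrow> complex vec" where
  "dvec X = vec n (\<lambda>s. \<Sum>i\<in>R. D s i * U.coord X i)"

definition bval :: "'u \<times> ('g \<Rightarrow> complex) \<Rightarrow> nat \<Rightarrow> complex" where
  "bval p r = (if r < n then \<Sum>g\<in>carrier G. snd p g * (\<rho> g *\<^sub>v dvec (fst p)) $ r else 0)"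

lemma dvec_dim [simp]: "dvec X \<in> carrier_vec n" "dim_vec (dvec X) = n"
  unfolding dvec_def by simp_all

lemma rho_dim [simp]: "g \<in> carrier G \<Longrightarrow> dim_row (\<rho> g) = n" "g \<in> carrier G \<Longrightarrow> dim_col (\<rho> g) = n"
  using proj_repD(3,4)[OF rep] by simp_all

lemma rho_dvec: "g \<in> carrier G \<Longrightarrow> r < n \<Longrightarrow> (\<rho> g *\<^sub>v x) $ r = (\<Sum>s<n. \<rho> g $$ (r,s) * x $ s)" if "x \<in> carrier_vec n"
  using proj_repD(3,4)[OF rep, of g] that by (simp add: scalar_prod_def atLeast0LessThan)

lemma rho_rho_dvec:
  assumes "h \<in> carrier G" "g \<in> carrier G" "r < n"
  shows "(\<rho> g *\<^sub>v (\<rho> h *\<^sub>v dvec X)) $ r = \<alpha> (h, g) * (\<rho> (h \<otimes> g) *\<^sub>v dvec X) $ r"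
proof -
  note D = proj_repD[OF rep]
  have "\<rho> g *\<^sub>v (\<rho> h *\<^sub>v dvec X) = \<rho> g * \<rho> h *\<^sub>v dvec X" using D(3,4) assms by (subst mat_vec_assoc) auto
  also have "\<dots> = \<alpha> (h, g) \<cdot>\<^sub>v (\<rho> (h \<otimes> g) *\<^sub>v dvec X)"
    unfolding D(6)[OF assms(1,2)] using D(4)[of "h \<otimes> g"] assms by (subst smult_mat_mult_vec) auto
  finally show ?thesis using assms by (simp add: index_smult_vec del: index_mult_mat_vec)
qed

text \<open>Equivariance of \<open>D\<close>, extended from basis vectors to \<open>U\<close>.\<close>

lemma dvec_act:
  assumes h: "h \<in> J" and X: "X \<in> carrier U"
  shows "dvec (\<phi> h X) = \<rho> h *\<^sub>v dvec X"
proof (rule eq_vecI)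
  show "dim_vec (dvec (\<phi> h X)) = dim_vec (\<rho> h *\<^sub>v dvec X)" using J_in_G[OF h] by simp
  fix r assume "r < dim_vec (\<rho> h *\<^sub>v dvec X)"
  then have r: "r < n" using J_in_G[OF h] by simp
  have "(\<rho> h *\<^sub>v dvec X) $ r = (\<Sum>s<n. \<Sum>i\<in>R. \<rho> h $$ (r,s) * D s i * U.coord X i)"
    unfolding rho_dvec[OF dvec_dim(1) J_in_G[OF h] r] by (simp add: dvec_def sum_distrib_left mult.assoc)
  also have "\<dots> = (\<Sum>i\<in>R. (\<Sum>s<n. \<rho> h $$ (r,s) * D s i) * U.coord X i)"
    unfolding sum_distrib_right by (rule sum.swap)
  also have "\<dots> = (\<Sum>i\<in>R. (\<Sum>a\<in>R. A h a i * D r a) * U.coord X i)"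
    by (rule sum.cong[OF refl]) (simp add: equiv[OF h r])
  also have "\<dots> = (\<Sum>a\<in>R. D r a * (\<Sum>i\<in>R. A h a i * U.coord X i))"
    unfolding sum_distrib_right sum_distrib_left by (subst sum.swap) (intro sum.cong refl, simp add: mult_ac)
  also have "\<dots> = dvec (\<phi> h X) $ r" using r U.representedD(2)[OF act[OF h] X] by (simp add: dvec_def)
  finally show "dvec (\<phi> h X) $ r = (\<rho> h *\<^sub>v dvec X) $ r" by simp
qed

lemma bval_point: "g \<in> carrier G \<Longrightarrow> r < n \<Longrightarrow> bval (X, point g) r = (\<rho> g *\<^sub>v dvec X) $ r"
proof -
  assume g: "g \<in> carrier G" and r: "r < n"
  have "bval (X, point g) r = (\<Sum>g'\<in>carrier G. if g' = g then (\<rho> g *\<^sub>v dvec X) $ r else 0)"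
    unfolding bval_def using r by (auto simp: point_def intro!: sum.cong)
  then show ?thesis using g fin by simp
qed

lemma bval_outside: "r \<notin> {..<n} \<Longrightarrow> bval p r = 0"
  unfolding bval_def by simp

lemma bval_bilinear: "bilinear_on U (twisted_algebra G \<alpha>) bval"
proof -
  have d: "dvec (u \<oplus>\<^bsub>U\<^esub> u') = dvec u + dvec u'" if "u \<in> carrier U" "u' \<in> carrier U" for u u'
    by (rule eq_vecI) (auto simp: dvec_def U.coord_add that distrib_left sum.distrib)
  have k: "dvec (k \<odot>\<^bsub>U\<^esub> u) = k \<cdot>\<^sub>v dvec u" if "u \<in> carrier U" for u k
    by (rule eq_vecI) (auto simp: dvec_def U.coord_smult that sum_distrib_left mult_ac)
  have d': "(\<rho> g *\<^sub>v dvec (u \<oplus>\<^bsub>U\<^esub> u')) $ r = (\<rho> g *\<^sub>v dvec u) $ r + (\<rho> g *\<^sub>v dvec u') $ r"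
    if "u \<in> carrier U" "u' \<in> carrier U" "g \<in> carrier G" "r < n" for u u' g r
    using that unfolding d[OF that(1,2)]
    by (simp add: mult_add_distrib_mat_vec[OF proj_repD(2)[OF rep] dvec_dim(1) dvec_dim(1)] del: index_mult_mat_vec)
  have k': "(\<rho> g *\<^sub>v dvec (k \<odot>\<^bsub>U\<^esub> u)) $ r = k * (\<rho> g *\<^sub>v dvec u) $ r"
    if "u \<in> carrier U" "g \<in> carrier G" "r < n" for u k g r
    using that proj_repD(4)[OF rep that(2)] unfolding k[OF that(1)] by (simp add: mat_mult_smult_vec del: index_mult_mat_vec)
  show ?thesis unfolding bilinear_on_def bval_def twisted_algebra_simps
    by (auto simp: d' k' distrib_left distrib_right sum.distrib sum_distrib_left mult_ac simp del: index_mult_mat_vec intro!: sum.cong)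
qed

lemma algebra_action_eq:
  assumes X: "X \<in> carrier U"
  shows "algebra_action (G\<lparr>carrier := J\<rparr>) U \<phi> X a \<in> carrier U"
    "U.coord (algebra_action (G\<lparr>carrier := J\<rparr>) U \<phi> X a) i = (\<Sum>h\<in>J. a h * U.coord (\<phi> h X) i)"
proof -
  have c: "\<phi> h X \<in> carrier U" if "h \<in> J" for h by (rule U.representedD(1)[OF act[OF that] X])
  then have c': "a h \<odot>\<^bsub>U\<^esub> \<phi> h X \<in> carrier U" if "h \<in> J" for h using U.smult_closed that by blast
  show "algebra_action (G\<lparr>carrier := J\<rparr>) U \<phi> X a \<in> carrier U"
    unfolding algebra_action_def using U.finsum_coord(1)[OF finite_J c'] by simp
  show "U.coord (algebra_action (G\<lparr>carrier := J\<rparr>) U \<phi> X a) i = (\<Sum>h\<in>J. a h * U.coord (\<phi> h X) i)"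
    unfolding algebra_action_def using U.finsum_coord(2)[OF finite_J c', of "\<lambda>h. h"]
    by (simp add: U.finsum_coord(2)[OF finite_J c'] U.coord_smult c)
qed

text \<open>For elements \<open>h\<close> of \<open>J\<close> and \<open>g\<close> of \<open>G\<close> the claim is \<open>\<rho>(g) \<rho>(h) = \<alpha>(h,g) \<rho>(h g)\<close>, applied to \<open>dvec X\<close>.\<close>

lemma bval_balanced:
  assumes X: "X \<in> carrier U" and a: "a \<in> carrier (twisted_algebra (G\<lparr>carrier := J\<rparr>) (res_cocycle J \<alpha>))"
  shows "bval (algebra_action (G\<lparr>carrier := J\<rparr>) U \<phi> X a, b) r = bval (X, a \<otimes>\<^bsub>twisted_algebra G \<alpha>\<^esub> b) r"
proof (cases "r < n")
  case r: True
  let ?Y = "algebra_action (G\<lparr>carrier := J\<rparr>) U \<phi> X a"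
  let ?e = "\<lambda>x. (\<rho> x *\<^sub>v dvec X) $ r"
  have d: "dvec ?Y $ s = (\<Sum>h\<in>J. a h * (\<rho> h *\<^sub>v dvec X) $ s)" if s: "s < n" for s
  proof -
    have "dvec ?Y $ s = (\<Sum>h\<in>J. a h * dvec (\<phi> h X) $ s)"
      using s unfolding dvec_def by (simp add: algebra_action_eq(2)[OF X] sum_distrib_left)
        (subst sum.swap, intro sum.cong refl, simp add: mult_ac)
    then show ?thesis by (simp add: dvec_act[OF _ X] cong: sum.cong del: index_mult_mat_vec)
  qed
  have Y: "(\<rho> g *\<^sub>v dvec ?Y) $ r = (\<Sum>h\<in>carrier G. a h * \<alpha> (h, g) * ?e (h \<otimes> g))" if g: "g \<in> carrier G" for g
  proof -
    have "(\<rho> g *\<^sub>v dvec ?Y) $ r = (\<Sum>s<n. \<rho> g $$ (r,s) * (\<Sum>h\<in>J. a h * (\<rho> h *\<^sub>v dvec X) $ s))"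
      unfolding rho_dvec[OF dvec_dim(1) g r] by (rule sum.cong[OF refl]) (simp add: d del: index_mult_mat_vec)
    also have "\<dots> = (\<Sum>h\<in>J. a h * (\<Sum>s<n. \<rho> g $$ (r,s) * (\<rho> h *\<^sub>v dvec X) $ s))"
      unfolding sum_distrib_left by (subst sum.swap) (intro sum.cong refl, simp add: mult_ac)
    also have "\<dots> = (\<Sum>h\<in>J. a h * (\<rho> g *\<^sub>v (\<rho> h *\<^sub>v dvec X)) $ r)"
      by (intro sum.cong refl) (subst rho_dvec[OF _ g r], auto simp: J_in_G carrier_vecI simp del: index_mult_mat_vec)
    also have "\<dots> = (\<Sum>h\<in>J. a h * \<alpha> (h, g) * ?e (h \<otimes> g))"
      using J_in_G g r by (intro sum.cong refl) (simp add: rho_rho_dvec del: index_mult_mat_vec)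
    also have "\<dots> = (\<Sum>h\<in>carrier G. a h * \<alpha> (h, g) * ?e (h \<otimes> g))"
      using a by (intro sum.mono_neutral_left fin subgroup.subset[OF J]) (auto simp: twisted_algebra_simps supported_def)
    finally show ?thesis .
  qed
  have "bval (?Y, b) r = (\<Sum>g\<in>carrier G. \<Sum>h\<in>carrier G. \<alpha> (h, g) * a h * b g * ?e (h \<otimes> g))"
    unfolding bval_def using r Y by (simp add: sum_distrib_left mult_ac del: index_mult_mat_vec cong: sum.cong)
  also have "\<dots> = bval (X, a \<otimes>\<^bsub>twisted_algebra G \<alpha>\<^esub> b) r"
    unfolding bval_def using r by (subst sum.swap) (simp add: twisted_mult_sum[OF fin] del: index_mult_mat_vec)
  finally show ?thesis .
qed (simp add: bval_def)

lemma balanced_killed: "balanced_relations G \<alpha> J U \<phi> \<subseteq> ev_kernel bval pairs"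
proof
  fix f assume "f \<in> balanced_relations G \<alpha> J U \<phi>"
  then obtain X a b where f: "f = (\<lambda>p. point (algebra_action (G\<lparr>carrier := J\<rparr>) U \<phi> X a, b) p
      - point (X, a \<otimes>\<^bsub>twisted_algebra G \<alpha>\<^esub> b) p)" and X: "X \<in> carrier U"
    and a: "a \<in> carrier (twisted_algebra (G\<lparr>carrier := J\<rparr>) (res_cocycle J \<alpha>))" and b: "b \<in> carrier (twisted_algebra G \<alpha>)"
    unfolding balanced_relations_def by blast
  have m: "(algebra_action (G\<lparr>carrier := J\<rparr>) U \<phi> X a, b) \<in> pairs" "(X, a \<otimes>\<^bsub>twisted_algebra G \<alpha>\<^esub> b) \<in> pairs"
    using algebra_action_eq(1)[OF X] X b twisted_mult_closed by auto
  show "f \<in> ev_kernel bval pairs" unfolding f ev_kernel_def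
    using point_relation2(1)[OF m, of 1] point_relation2(2)[OF m, of bval 1] bval_balanced[OF X a] by simp
qed

definition coset_rep :: "'g set \<Rightarrow> 'g" where
  "coset_rep C = (SOME x. x \<in> C)"

lemma coset_rep:
  assumes "C \<in> rcosets J"
  shows "coset_rep C \<in> C" "coset_rep C \<in> carrier G"
proof -
  obtain x where x: "x \<in> carrier G" "C = J #> x" using assms unfolding RCOSETS_def by auto
  then have "x \<in> C" using rcos_self[OF x(1) J] by simp
  then show "coset_rep C \<in> C" unfolding coset_rep_def by (rule someI)
  then show "coset_rep C \<in> carrier G" using rcosets_part_G[OF J] assms by blast
qed

lemma coset_decomposition:
  assumes g: "g \<in> carrier G"
  obtains h C where "h \<in> J" "C \<in> rcosets J" "g = h \<otimes> coset_rep C"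
proof -
  let ?C = "J #> g"
  have C: "?C \<in> rcosets J" unfolding RCOSETS_def using g by auto
  obtain j where j: "j \<in> J" "coset_rep ?C = j \<otimes> g" using coset_rep(1)[OF C] unfolding r_coset_def by auto
  have "g = inv j \<otimes> coset_rep ?C" unfolding j(2) using j(1) J_in_G[OF j(1)] g by (simp add: m_assoc[symmetric])
  then show thesis using that subgroup.m_inv_closed[OF J j(1)] C by blast
qed

definition basis_index :: "('r \<times> 'g set) set" where
  "basis_index = R \<times> (rcosets J)"

definition basis_tensor :: "'r \<times> 'g set \<Rightarrow> 'u \<times> ('g \<Rightarrow> complex)" where
  "basis_tensor q = (\<Phi> (point (fst q)), point (coset_rep (snd q)))"

lemma basis_index: "finite basis_index" "card basis_index = n"
proof -
  have f: "finite (rcosets J)" using finite_subset[of "rcosets J" "Pow (carrier G)"] rcosets_part_G[OF J] fin by auto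
  then show "finite basis_index" unfolding basis_index_def using U.finite_index by simp
  have "0 < card J" using finite_J subgroup.one_closed[OF J] card_gt_0_iff by blast
  moreover have "card basis_index * card J = n * card J"
    unfolding basis_index_def card_cartesian_product count using lagrange[OF J] by (simp add: Coset.order_def mult.assoc)
  ultimately show "card basis_index = n" by simp
qed

lemma point_supported: "g \<in> carrier G \<Longrightarrow> point g \<in> carrier (twisted_algebra G \<alpha>)"
  unfolding twisted_algebra_simps by (rule supported_closed(4))

lemma basis_tensor_pairs: "q \<in> basis_index \<Longrightarrow> basis_tensor q \<in> pairs"
  unfolding basis_index_def basis_tensor_def using coset_rep(2) by (auto simp: U.basis_closed point_supported)

abbreviation kernel where "kernel \<equiv> tensor_kernel U (twisted_algebra G \<alpha>) (balanced_relations G \<alpha> J U \<phi>)"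

lemmas kernel_facts = tensor_kernel_facts[OF balanced_killed bval_bilinear]

lemma point_reducible_coset:
  assumes "X \<in> carrier U" "C \<in> rcosets J"
  shows "point (X, point (coset_rep C)) \<in> reducible_to kernel basis_index basis_tensor"
proof (rule reducible_left[OF kernel_facts(1,2) assms(1) point_supported[OF coset_rep(2)[OF assms(2)]]])
  fix i assume "i \<in> R"
  then have "(i, C) \<in> basis_index" using assms(2) unfolding basis_index_def by simp
  from reducible_point[OF kernel_facts(1) basis_index(1) this, of basis_tensor]
  show "point (\<Phi> (point i), point (coset_rep C)) \<in> reducible_to kernel basis_index basis_tensor"
    by (simp add: basis_tensor_def)
qed

text \<open>If \<open>g = h t\<close> with \<open>t\<close> in the transversal, \<open>h\<close> can be moved across the tensor sign, at the cost of the
  scalar \<open>\<alpha>(h,t)\<close>.\<close>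

lemma point_reducible_group:
  assumes X: "X \<in> carrier U" and g: "g \<in> carrier G"
  shows "point (X, point g) \<in> reducible_to kernel basis_index basis_tensor"
proof -
  obtain h C where h: "h \<in> J" and C: "C \<in> rcosets J" and g': "g = h \<otimes> coset_rep C" using coset_decomposition[OF g] .
  let ?x = "coset_rep C" and ?Y = "algebra_action (G\<lparr>carrier := J\<rparr>) U \<phi> X (point h)"
  let ?k = "\<alpha> (h, ?x)"
  note x = coset_rep(2)[OF C] and hG = J_in_G[OF h]
  have k: "?k \<noteq> 0" by (rule proj_repD(5)[OF rep hG x])
  have ph: "point h \<in> carrier (twisted_algebra (G\<lparr>carrier := J\<rparr>) (res_cocycle J \<alpha>))"
    unfolding twisted_algebra_simps using h by (simp add: supported_closed(4))
  have m: "point h \<otimes>\<^bsub>twisted_algebra G \<alpha>\<^esub> point ?x = ?k \<odot>\<^bsub>twisted_algebra G \<alpha>\<^esub> point g"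
    unfolding g' by (rule twisted_mult_points[OF fin hG x])
  have "(\<lambda>p. point (?Y, point ?x) p - point (X, point h \<otimes>\<^bsub>twisted_algebra G \<alpha>\<^esub> point ?x) p) \<in> balanced_relations G \<alpha> J U \<phi>"
    unfolding balanced_relations_def using X ph point_supported[OF x] by blast
  then have 1: "(\<lambda>p. point (?Y, point ?x) p - point (X, ?k \<odot>\<^bsub>twisted_algebra G \<alpha>\<^esub> point g) p) \<in> kernel"
    unfolding m using kernel_facts(3) by blast
  have "(\<lambda>p. point (X, ?k \<odot>\<^bsub>twisted_algebra G \<alpha>\<^esub> point g) p - ?k * point (X, point g) p) \<in> bilinear_relations U (twisted_algebra G \<alpha>)"
    unfolding bilinear_relations_def using X point_supported[OF g] by blast
  then have 2: "(\<lambda>p. point (X, ?k \<odot>\<^bsub>twisted_algebra G \<alpha>\<^esub> point g) p - ?k * point (X, point g) p) \<in> kernel"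
    using kernel_facts(2) by blast
  have "(\<lambda>p. (- 1 / ?k) * ((point (?Y, point ?x) p - point (X, ?k \<odot>\<^bsub>twisted_algebra G \<alpha>\<^esub> point g) p)
      + (point (X, ?k \<odot>\<^bsub>twisted_algebra G \<alpha>\<^esub> point g) p - ?k * point (X, point g) p))) \<in> kernel"
    by (rule free_subspaceD(4)[OF kernel_facts(1) free_subspaceD(3)[OF kernel_facts(1) 1 2]])
  also have "(\<lambda>p. (- 1 / ?k) * ((point (?Y, point ?x) p - point (X, ?k \<odot>\<^bsub>twisted_algebra G \<alpha>\<^esub> point g) p)
      + (point (X, ?k \<odot>\<^bsub>twisted_algebra G \<alpha>\<^esub> point g) p - ?k * point (X, point g) p)))
    = (\<lambda>p. point (X, point g) p - (1 / ?k) * point (?Y, point ?x) p)"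
    using k by (intro ext) (simp add: field_simps)
  finally have 3: "(\<lambda>p. point (X, point g) p - (1 / ?k) * point (?Y, point ?x) p) \<in> kernel" .
  show ?thesis
    by (rule reducible_congruent[OF kernel_facts(1) 3 reducible_smult[OF kernel_facts(1)
          point_reducible_coset[OF algebra_action_eq(1)[OF X] C]]])
qed

lemma point_reducible:
  assumes "s \<in> pairs" shows "point s \<in> reducible_to kernel basis_index basis_tensor"
proof -
  obtain X b where s: "s = (X, b)" and X: "X \<in> carrier U" and b: "b \<in> carrier (twisted_algebra G \<alpha>)"
    using assms by (cases s) auto
  show ?thesis unfolding s
    by (rule reducible_right[OF kernel_facts(1,2) X b point_reducible_group[OF X]])
qed

lemma bval_translate:
  assumes g: "g \<in> carrier G" and r: "r < n"
  shows "bval (X, b \<otimes>\<^bsub>twisted_algebra G \<alpha>\<^esub> point g) r = (\<Sum>s<n. \<rho> g $$ (r,s) * bval (X, b) s)"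
proof -
  let ?e = "\<lambda>x. (\<rho> x *\<^sub>v dvec X) $ r"
  have "bval (X, b \<otimes>\<^bsub>twisted_algebra G \<alpha>\<^esub> point g) r
      = (\<Sum>h\<in>carrier G. \<Sum>g'\<in>carrier G. \<alpha> (h, g') * b h * point g g' * ?e (h \<otimes> g'))"
    unfolding bval_def using r by (simp add: twisted_mult_sum[OF fin] del: index_mult_mat_vec)
  also have "\<dots> = (\<Sum>h\<in>carrier G. \<Sum>g'\<in>carrier G. if g' = g then b h * (\<alpha> (h, g) * ?e (h \<otimes> g)) else 0)"
    by (intro sum.cong refl) (auto simp: point_def)
  also have "\<dots> = (\<Sum>h\<in>carrier G. b h * (\<alpha> (h, g) * ?e (h \<otimes> g)))" using g fin by simp
  also have "\<dots> = (\<Sum>h\<in>carrier G. b h * (\<Sum>s<n. \<rho> g $$ (r,s) * (\<rho> h *\<^sub>v dvec X) $ s))"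
    by (intro sum.cong refl, subst rho_rho_dvec[OF _ g r, symmetric], assumption, subst rho_dvec[OF _ g r])
      (auto simp: carrier_vecI simp del: index_mult_mat_vec)
  also have "\<dots> = (\<Sum>s<n. \<rho> g $$ (r,s) * (\<Sum>h\<in>carrier G. b h * (\<rho> h *\<^sub>v dvec X) $ s))"
    unfolding sum_distrib_left by (subst sum.swap) (intro sum.cong refl, simp add: mult_ac)
  finally show ?thesis by (simp add: bval_def del: index_mult_mat_vec)
qed

text \<open>The values form an invariant subspace of the space of \<open>\<rho>\<close>, which is not zero as \<open>D\<close> is not zero.\<close>

lemma bval_surj:
  assumes y: "y \<in> supported {..<n}"
  shows "\<exists>f\<in>carrier (free_space pairs). ev bval f = y"
proof -
  let ?F = "carrier (free_space pairs)"
  define W where "W = {vec n (ev bval f) | f. f \<in> ?F}"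
  have sub: "vec_subspace n W"
    unfolding vec_subspace_def
  proof (intro conjI ballI allI)
    show "W \<subseteq> carrier_vec n" unfolding W_def by auto
    have "(\<lambda>_. 0) \<in> ?F" unfolding free_space_simps by simp
    moreover have "0\<^sub>v n = vec n (ev bval (\<lambda>_. 0))" by (rule eq_vecI) (auto simp: ev_zero)
    ultimately show "0\<^sub>v n \<in> W" unfolding W_def by blast
    fix v assume "v \<in> W"
    then obtain f where f: "f \<in> ?F" "v = vec n (ev bval f)" unfolding W_def by auto
    show "k \<cdot>\<^sub>v v \<in> W" for k
    proof -
      have "k \<cdot>\<^sub>v v = vec n (ev bval (\<lambda>s. k * f s))" unfolding f(2) by (rule eq_vecI) (auto simp: ev_smult[OF f(1)])
      then show ?thesis unfolding W_def using free_space_smult_closed[OF f(1)] by blast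
    qed
    fix w assume "w \<in> W"
    then obtain g where g: "g \<in> ?F" "w = vec n (ev bval g)" unfolding W_def by auto
    have "v + w = vec n (ev bval (\<lambda>s. f s + g s))" unfolding f(2) g(2) by (rule eq_vecI) (auto simp: ev_add[OF f(1) g(1)])
    then show "v + w \<in> W" unfolding W_def using free_space_add_closed[OF f(1) g(1)] by blast
  qed
  have inv: "\<rho> g *\<^sub>v w \<in> W" if g: "g \<in> carrier G" and w: "w \<in> W" for g w
  proof -
    obtain f where f: "f \<in> ?F" "w = vec n (ev bval f)" using w unfolding W_def by auto
    let ?h = "map_prod id (\<lambda>b. b \<otimes>\<^bsub>twisted_algebra G \<alpha>\<^esub> point g)"
    have "pushforward ?h f \<in> ?F" by (rule pushforward_closed[OF f(1)]) (auto intro: twisted_mult_closed)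
    moreover have "\<rho> g *\<^sub>v w = vec n (ev bval (pushforward ?h f))"
    proof (rule eq_vecI)
      fix r assume "r < dim_vec (vec n (ev bval (pushforward ?h f)))"
      then have r: "r < n" by simp
      have "ev bval (pushforward ?h f) r = ev (\<lambda>s. bval (?h s)) f r" by (rule ev_pushforward[OF f(1)])
      also have "\<dots> = (\<Sum>s<n. \<rho> g $$ (r,s) * ev bval f s)"
        by (rule ev_linear[OF f(1)]) (auto simp: bval_translate[OF g r])
      finally show "(\<rho> g *\<^sub>v w) $ r = vec n (ev bval (pushforward ?h f)) $ r"
        using r unfolding rho_dvec[OF subsetD[of W, OF _ w] g r] f(2) by (simp add: rho_dvec[OF _ g r] del: index_mult_mat_vec)
    qed (use g in simp)
    ultimately show ?thesis unfolding W_def by blast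
  qed
  have "W \<noteq> {0\<^sub>v n}"
  proof
    assume W0: "W = {0\<^sub>v n}"
    obtain r i where r: "r < n" "i \<in> R" "D r i \<noteq> 0" using nonzero by blast
    let ?p = "(\<Phi> (point i), point \<one>)"
    have "point ?p \<in> ?F" by (intro point_closed) (use r in \<open>auto simp: U.basis_closed point_supported\<close>)
    then have "vec n (ev bval (point ?p)) = 0\<^sub>v n" using W0 unfolding W_def by blast
    then have "vec n (ev bval (point ?p)) $ r = 0" using r(1) by simp
    then have "(\<rho> \<one> *\<^sub>v dvec (\<Phi> (point i))) $ r = 0" using r(1) by (simp add: ev_point bval_point del: index_mult_mat_vec)
    moreover have "\<rho> \<one> *\<^sub>v dvec (\<Phi> (point i)) = \<alpha> (\<one>, \<one>) \<cdot>\<^sub>v dvec (\<Phi> (point i))"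
      unfolding proj_repD(7)[OF rep] by (subst smult_mat_mult_vec) auto
    moreover have "dvec (\<Phi> (point i)) $ r = D r i"
    proof -
      have "(\<Sum>j\<in>R. D r j * U.coord (\<Phi> (point i)) j) = (\<Sum>j\<in>R. if j = i then D r i else 0)"
        using r(2) by (intro sum.cong refl) (simp add: U.coord_basis)
      then show ?thesis using r U.finite_index by (simp add: dvec_def)
    qed
    ultimately show False using r proj_repD(5)[OF rep one_closed one_closed] by simp
  qed
  then have "W = carrier_vec n"
    using full_imp_irreducible[OF full proj_repD(2)[OF rep]] sub inv unfolding irreducible_on_def by blast
  then have "vec n y \<in> W" by simp
  then obtain f where f: "f \<in> ?F" "vec n y = vec n (ev bval f)" unfolding W_def by auto
  have "ev bval f r = y r" for r
  proof (cases "r < n")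
    case True
    have "vec n y $ r = vec n (ev bval f) $ r" unfolding f(2) ..
    then show ?thesis using True by simp
  next
    case False
    then show ?thesis using y unfolding supported_def ev_def by (simp add: bval_outside)
  qed
  then have "ev bval f = y" ..
  then show ?thesis using f(1) by (rule bexI)
qed

text \<open>All pairs reduce to the \<open>n\<close> pairs \<open>basis_tensor q\<close>, whose values therefore span a space of dimension \<open>n\<close>.\<close>

lemma bval_independent:
  assumes c: "\<And>r. (\<Sum>q\<in>basis_index. c q * bval (basis_tensor q) r) = 0"
  shows "\<forall>q\<in>basis_index. c q = 0"
proof (rule spanning_imp_independent[OF basis_index])
  show "(\<Sum>q\<in>basis_index. c q * bval (basis_tensor q) r) = 0" for r by (rule c)
  fix y :: "nat \<Rightarrow> complex"
  have "(\<lambda>r. if r < n then y r else 0) \<in> supported {..<n}" unfolding supported_def by simp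
  then obtain f where f: "f \<in> carrier (free_space pairs)" "ev bval f = (\<lambda>r. if r < n then y r else 0)"
    using bval_surj by blast
  obtain d where d: "(\<lambda>p. f p - (\<Sum>q\<in>basis_index. d q * point (basis_tensor q) p)) \<in> kernel"
    using reducible_all[OF kernel_facts(1) point_reducible f(1)] unfolding reducible_to_def by auto
  have "ev bval f r = (\<Sum>q\<in>basis_index. d q * bval (basis_tensor q) r)" for r
    by (rule ev_reduced[OF kernel_facts(4) basis_index(1) basis_tensor_pairs f(1) d])
  then have "\<forall>r<n. y r = (\<Sum>q\<in>basis_index. d q * bval (basis_tensor q) r)" unfolding f(2) by metis
  then show "\<exists>c. \<forall>r<n. y r = (\<Sum>q\<in>basis_index. c q * bval (basis_tensor q) r)" by (intro exI[of _ d])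
qed

lemma kernel_eq: "kernel = ev_kernel bval pairs"
  by (rule ev_kernel_eq[OF kernel_facts(1,4) basis_index(1) basis_tensor_pairs point_reducible bval_independent])

theorem induced_coordinates: "coordinates {..<n} (induced G \<alpha> J U \<phi>) (fibre bval pairs)"
  unfolding induced_def tensor_space_def kernel_eq
  by (rule fibre_coordinates[OF finite_lessThan bval_outside bval_surj])

theorem induced_represented:
  assumes g: "g \<in> carrier G"
  shows "represented {..<n} (fibre bval pairs) (induced_action G \<alpha> J U \<phi> g) (\<lambda>r s. \<rho> g $$ (r,s))"
  unfolding induced_action_def
  by (rule fibre_represented[OF kernel_eq bval_surj])
    (auto simp: bval_outside bval_translate[OF g] intro: twisted_mult_closed)

end

section \<open>Passage between modules and matrices\<close>

lemma coordinates_reindex: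
  assumes V: "coordinates R V \<Phi>" and e: "bij_betw e S R"
  shows "coordinates S V (\<lambda>y. \<Phi> (\<lambda>r. if r \<in> R then y (inv_into S e r) else 0))"
proof -
  interpret V: coordinates R V \<Phi> by fact
  let ?F = "\<lambda>y r. if r \<in> R then y (inv_into S e r) else (0::complex)"
  have i: "inv_into S e (e s) = s" if "s \<in> S" for s using e that unfolding bij_betw_def by simp
  have f: "e (inv_into S e r) = r" "inv_into S e r \<in> S" if "r \<in> R" for r
    using e that unfolding bij_betw_def by (auto simp: f_inv_into_f inv_into_into)
  have eR: "e s \<in> R" if "s \<in> S" for s using e that unfolding bij_betw_def by auto
  have sup: "?F y \<in> supported R" for y unfolding supported_def by simp
  have bijF: "bij_betw ?F (supported S) (supported R)"
  proof (rule bij_betw_byWitness[where f' = "\<lambda>z s. if s \<in> S then z (e s) else 0"])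
    show "\<forall>y\<in>supported S. (\<lambda>s. if s \<in> S then ?F y (e s) else 0) = y"
      by (auto simp: supported_def i eR fun_eq_iff)
    show "\<forall>z\<in>supported R. ?F (\<lambda>s. if s \<in> S then z (e s) else 0) = z"
      by (auto simp: supported_def f fun_eq_iff)
  qed (auto simp: supported_def)
  show ?thesis
  proof
    show "finite S" using V.finite_index bij_betw_finite[OF e] by simp
    show "bij_betw (\<lambda>y. \<Phi> (?F y)) (supported S) (carrier V)"
      using bij_betw_trans[OF bijF V.bij] by (simp add: comp_def)
    show "\<Phi> (?F (\<lambda>_. 0)) = \<zero>\<^bsub>V\<^esub>" using V.zero by (simp cong: if_cong)
    show "\<Phi> (?F (\<lambda>r. y r + z r)) = \<Phi> (?F y) \<oplus>\<^bsub>V\<^esub> \<Phi> (?F z)" for y z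
    proof -
      have "?F (\<lambda>r. y r + z r) = (\<lambda>r. ?F y r + ?F z r)" by auto
      then show ?thesis using V.add[OF sup sup, of y z] by simp
    qed
    show "\<Phi> (?F (\<lambda>r. k * y r)) = k \<odot>\<^bsub>V\<^esub> \<Phi> (?F y)" for k y
    proof -
      have "?F (\<lambda>r. k * y r) = (\<lambda>r. k * ?F y r)" by auto
      then show ?thesis using V.smult[OF sup, of k y] by simp
    qed
  qed
qed

lemma ex1_unique: "\<exists>!x. P x \<Longrightarrow> P a \<Longrightarrow> P b \<Longrightarrow> a = b"
  by auto

lemma finite_dimensional_coordinates:
  fixes V :: "(complex, 'v, 'n) module_scheme"
  assumes "vectorspace class_ring V" "vectorspace.fin_dim class_ring V"
  obtains n \<Phi> where "coordinates {..<n::nat} V \<Phi>"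
proof -
  interpret V: vectorspace class_ring V by fact
  obtain B where B: "finite B" "V.basis B" using V.finite_basis_exists[OF assms(2)] by blast
  have BV: "B \<subseteq> carrier V" using B(2) unfolding V.basis_def by simp
  have crit: "\<exists>!a. a \<in> B \<rightarrow>\<^sub>E UNIV \<and> V.lincomb a B = v" if "v \<in> carrier V" for v
    using V.basis_criterion[OF B(1) BV] B(2) that by simp
  let ?\<Phi> = "\<lambda>y. V.lincomb y B"
  have sm: "(\<lambda>v. y v \<odot>\<^bsub>V\<^esub> v) \<in> B \<rightarrow> carrier V" for y using BV by auto
  have cl: "?\<Phi> y \<in> carrier V" for y unfolding V.lincomb_def by (rule V.finsum_closed[OF sm])
  have res: "?\<Phi> (restrict y B) = ?\<Phi> y" for y
    unfolding V.lincomb_def by (rule V.finsum_cong') (use sm in auto)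
  have "coordinates B V ?\<Phi>"
  proof
    show "finite B" by fact
    show "bij_betw ?\<Phi> (supported B) (carrier V)"
    proof (rule bij_betwI')
      fix y z assume y: "y \<in> supported B" and z: "z \<in> supported B"
      show "(?\<Phi> y = ?\<Phi> z) = (y = z)"
      proof
        assume eq: "?\<Phi> y = ?\<Phi> z"
        have "restrict y B = restrict z B"
        proof (rule ex1_unique[OF crit[OF cl[of y]]])
          show "restrict y B \<in> B \<rightarrow>\<^sub>E UNIV \<and> V.lincomb (restrict y B) B = ?\<Phi> y" using res by auto
          show "restrict z B \<in> B \<rightarrow>\<^sub>E UNIV \<and> V.lincomb (restrict z B) B = ?\<Phi> y" using res eq by auto
        qed
        then have "y r = z r" for r
        proof (cases "r \<in> B")
          case True
          then show ?thesis using fun_cong[OF \<open>restrict y B = restrict z B\<close>, of r] by simp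
        qed (use y z in \<open>simp add: supported_def\<close>)
        then show "y = z" ..
      qed simp
    next
      show "?\<Phi> y \<in> carrier V" for y by (rule cl)
      fix v assume "v \<in> carrier V"
      from ex1_implies_ex[OF crit[OF this]] obtain a where a: "V.lincomb a B = v" by blast
      have "?\<Phi> (\<lambda>b. if b \<in> B then a b else 0) = v"
        unfolding a[symmetric] V.lincomb_def by (rule V.finsum_cong') (use sm in auto)
      then show "\<exists>y\<in>supported B. v = ?\<Phi> y"
        by (intro bexI[of _ "\<lambda>b. if b \<in> B then a b else 0"]) (auto simp: supported_def)
    qed
    show "?\<Phi> (\<lambda>_. 0) = \<zero>\<^bsub>V\<^esub>"
    proof -
      have "?\<Phi> (\<lambda>_. 0) = finsum V (\<lambda>_. \<zero>\<^bsub>V\<^esub>) B"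
        unfolding V.lincomb_def by (rule V.finsum_cong') (use BV V.lmult_0 in auto)
      then show ?thesis by simp
    qed
    show "?\<Phi> (\<lambda>r. y r + z r) = ?\<Phi> y \<oplus>\<^bsub>V\<^esub> ?\<Phi> z" for y z
    proof -
      have "?\<Phi> (\<lambda>r. y r + z r) = finsum V (\<lambda>v. y v \<odot>\<^bsub>V\<^esub> v \<oplus>\<^bsub>V\<^esub> z v \<odot>\<^bsub>V\<^esub> v) B"
        unfolding V.lincomb_def
        by (rule V.finsum_cong') (use BV V.smult_l_distr in auto)
      then show ?thesis unfolding V.lincomb_def using V.finsum_addf[OF sm sm] by simp
    qed
    show "?\<Phi> (\<lambda>r. k * y r) = k \<odot>\<^bsub>V\<^esub> ?\<Phi> y" for k y
    proof -
      have "?\<Phi> (\<lambda>r. k * y r) = finsum V (\<lambda>v. k \<odot>\<^bsub>V\<^esub> (y v \<odot>\<^bsub>V\<^esub> v)) B"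
        unfolding V.lincomb_def by (rule V.finsum_cong') (use BV V.smult_assoc1 in auto)
      then show ?thesis unfolding V.lincomb_def using V.finsum_smult[OF _ sm, of k] by simp
    qed
  qed
  moreover obtain e where "bij_betw e {..<card B} B"
    using ex_bij_betw_nat_finite[OF B(1)] by (auto simp: atLeast0LessThan)
  ultimately show thesis using that coordinates_reindex by blast
qed

lemma (in coordinates) represented_hom:
  assumes F: "F \<in> module_hom class_ring V V"
  shows "represented R \<Phi> F (\<lambda>a i. coord (F (\<Phi> (point i))) a)"
proof -
  have Fc: "F v \<in> carrier V" if "v \<in> carrier V" for v using F that unfolding module_hom_def by auto
  have Fa: "F (u \<oplus>\<^bsub>V\<^esub> w) = F u \<oplus>\<^bsub>V\<^esub> F w" if "u \<in> carrier V" "w \<in> carrier V" for u w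
    using F that unfolding module_hom_def by auto
  have Fs: "F (k \<odot>\<^bsub>V\<^esub> u) = k \<odot>\<^bsub>V\<^esub> F u" if "u \<in> carrier V" for k u
    using F that unfolding module_hom_def by auto
  have *: "\<forall>a. coord (F v) a = (\<Sum>i\<in>R. coord (F (\<Phi> (point i))) a * coord v i)" if "v \<in> carrier V" for v
    using that
  proof (induction rule: basis_induct)
    case zero
    have "0 \<odot>\<^bsub>V\<^esub> \<zero>\<^bsub>V\<^esub> = \<zero>\<^bsub>V\<^esub>" by (rule coord_eqI) (auto simp: zero_closed smult_closed coord_smult coord_zero)
    then have "F \<zero>\<^bsub>V\<^esub> = 0 \<odot>\<^bsub>V\<^esub> F \<zero>\<^bsub>V\<^esub>" using Fs[OF zero_closed, of 0] by simp
    then have "coord (F \<zero>\<^bsub>V\<^esub>) = (\<lambda>_. 0)" using coord_smult[OF Fc[OF zero_closed], of 0] by simp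
    then show ?case by (simp add: coord_zero)
  next
    case (basis j)
    have "(\<Sum>i\<in>R. coord (F (\<Phi> (point i))) a * coord (\<Phi> (point j)) i) = (\<Sum>i\<in>R. if i = j then coord (F (\<Phi> (point j))) a else 0)" for a
      using basis by (intro sum.cong refl) (simp add: coord_basis)
    then show ?case using basis finite_index by simp
  next
    case (add u w)
    then show ?case by (simp add: Fa Fc coord_add distrib_left sum.distrib)
  next
    case (smult k u)
    then show ?case by (simp add: Fs Fc coord_smult sum_distrib_left mult_ac)
  qed
  show ?thesis unfolding represented_def
  proof
    fix y assume y: "y \<in> supported R"
    note v = Phi_closed[OF y]
    have "(\<lambda>a. if a \<in> R then \<Sum>i\<in>R. coord (F (\<Phi> (point i))) a * y i else 0) = coord (F (\<Phi> y))"
      using *[OF v] coord_outside[OF Fc[OF v]] by (auto simp: coord_Phi[OF y])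
    then show "F (\<Phi> y) = \<Phi> (\<lambda>a. if a \<in> R then \<Sum>i\<in>R. coord (F (\<Phi> (point i))) a * y i else 0)"
      using Phi_coord[OF Fc[OF v]] by simp
  qed
qed

text \<open>Matrices with respect to a basis of \<open>V\<close>. Irreducibility is transported along the coordinates.\<close>

lemma cmodule_matrices:
  fixes G :: "('g, 'm) monoid_scheme" (structure) and V :: "(complex, 'v, 'k) module_scheme"
  assumes G: "group G" and \<alpha>: "\<alpha> \<in> carrier (Z2 G)" and irr: "irreducible_cmodule G \<alpha> V \<phi>"
  obtains n \<rho> \<Phi> where "coordinates {..<n} V \<Phi>" "proj_rep G (carrier G) n \<alpha> \<rho>" "irreducible_on n \<rho> (carrier G)"
    "\<And>x. x \<in> carrier G \<Longrightarrow> represented {..<n} \<Phi> (\<phi> x) (\<lambda>r s. \<rho> x $$ (r,s))"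
proof -
  interpret group G by fact
  have c: "cmodule G \<alpha> V \<phi>" using irr unfolding irreducible_cmodule_def by simp
  have vs: "vectorspace class_ring V" and fd: "vectorspace.fin_dim class_ring V" and nz: "carrier V \<noteq> {\<zero>\<^bsub>V\<^esub>}"
    and hom: "\<And>x. x \<in> carrier G \<Longrightarrow> \<phi> x \<in> module_hom class_ring V V"
    and bij: "\<And>x. x \<in> carrier G \<Longrightarrow> bij_betw (\<phi> x) (carrier V) (carrier V)"
    and law: "\<And>x y v. x \<in> carrier G \<Longrightarrow> y \<in> carrier G \<Longrightarrow> v \<in> carrier V \<Longrightarrow>
      \<phi> y (\<phi> x v) = \<alpha> (x, y) \<odot>\<^bsub>V\<^esub> \<phi> (x \<otimes> y) v"
    using c unfolding cmodule_def by auto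
  obtain n :: nat and \<Phi> where co: "coordinates {..<n} V \<Phi>" using finite_dimensional_coordinates[OF vs fd] .
  interpret V: coordinates "{..<n}" V \<Phi> by fact
  define \<rho> where "\<rho> x = mat n n (\<lambda>(a,i). V.coord (\<phi> x (\<Phi> (point i))) a)" for x
  have \<rho>: "\<rho> x \<in> carrier_mat n n" "dim_row (\<rho> x) = n" "dim_col (\<rho> x) = n" for x unfolding \<rho>_def by simp_all
  have \<rho>i: "\<rho> x $$ (a,i) = V.coord (\<phi> x (\<Phi> (point i))) a" if "a < n" "i < n" for x a i
    unfolding \<rho>_def using that by simp
  have repr: "represented {..<n} \<Phi> (\<phi> x) (\<lambda>r s. \<rho> x $$ (r,s))" if x: "x \<in> carrier G" for x
  proof -
    have "represented {..<n} \<Phi> (\<phi> x) (\<lambda>r s. \<rho> x $$ (r,s)) = represented {..<n} \<Phi> (\<phi> x) (\<lambda>a i. V.coord (\<phi> x (\<Phi> (point i))) a)"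
      unfolding represented_def by (simp add: \<rho>i cong: if_cong)
    then show ?thesis using V.represented_hom[OF hom[OF x]] by simp
  qed
  have cl: "\<phi> x v \<in> carrier V" if "x \<in> carrier G" "v \<in> carrier V" for x v
    using V.representedD(1)[OF repr[OF that(1)] that(2)] .
  have n: "0 < n"
  proof (rule ccontr)
    assume "\<not> 0 < n"
    then have "supported {..<n} = {\<lambda>_. 0}" unfolding supported_def by auto
    then have "carrier V = {\<zero>\<^bsub>V\<^esub>}" using V.bij V.zero unfolding bij_betw_def by auto
    then show False using nz by simp
  qed
  have rep: "proj_rep G (carrier G) n \<alpha> \<rho>"
    unfolding proj_rep_def
  proof (intro conjI ballI)
    show "0 < n" by (rule n)
    show "\<rho> x \<in> carrier_mat n n" for x by (rule \<rho>)
    show "\<alpha> (x, y) \<noteq> 0" if "x \<in> carrier G" "y \<in> carrier G" for x y using Z2D(1)[OF \<alpha> that] .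
    show "\<rho> y * \<rho> x = \<alpha> (x, y) \<cdot>\<^sub>m \<rho> (x \<otimes> y)" if xy: "x \<in> carrier G" "y \<in> carrier G" for x y
    proof (rule eq_matI)
      fix a i assume "a < dim_row (\<alpha> (x, y) \<cdot>\<^sub>m \<rho> (x \<otimes> y))" "i < dim_col (\<alpha> (x, y) \<cdot>\<^sub>m \<rho> (x \<otimes> y))"
      then have ai: "a < n" "i < n" by (simp_all add: \<rho>)
      then have e: "\<Phi> (point i) \<in> carrier V" by (intro V.basis_closed) simp
      have "(\<rho> y * \<rho> x) $$ (a,i) = (\<Sum>s<n. \<rho> y $$ (a,s) * V.coord (\<phi> x (\<Phi> (point i))) s)"
        using ai by (simp add: \<rho> scalar_prod_def atLeast0LessThan \<rho>i)
      also have "\<dots> = V.coord (\<phi> y (\<phi> x (\<Phi> (point i)))) a"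
        using V.representedD(2)[OF repr[OF xy(2)] cl[OF xy(1) e], of a] ai by simp
      also have "\<dots> = \<alpha> (x, y) * V.coord (\<phi> (x \<otimes> y) (\<Phi> (point i))) a"
        unfolding law[OF xy e] using V.coord_smult[OF cl[OF m_closed[OF xy] e]] by simp
      finally show "(\<rho> y * \<rho> x) $$ (a,i) = (\<alpha> (x, y) \<cdot>\<^sub>m \<rho> (x \<otimes> y)) $$ (a,i)" using ai by (simp add: \<rho> \<rho>i)
    qed (simp_all add: \<rho>)
    show "\<rho> \<one> = \<alpha> (\<one>, \<one>) \<cdot>\<^sub>m 1\<^sub>m n"
    proof (rule eq_matI)
      fix a i assume "a < dim_row (\<alpha> (\<one>, \<one>) \<cdot>\<^sub>m 1\<^sub>m n)" "i < dim_col (\<alpha> (\<one>, \<one>) \<cdot>\<^sub>m 1\<^sub>m n)"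
      then have ai: "a < n" "i < n" by simp_all
      then have e: "\<Phi> (point i) \<in> carrier V" by (intro V.basis_closed) simp
      \<comment> \<open>The identity \<open>\<phi>(1) \<phi>(1) = \<alpha>(1,1) \<phi>(1)\<close> determines \<open>\<phi>(1)\<close> because \<open>\<phi>(1)\<close> is surjective.\<close>
      obtain v where v: "v \<in> carrier V" "\<Phi> (point i) = \<phi> \<one> v"
        using bij[OF one_closed] e unfolding bij_betw_def by auto
      have "\<phi> \<one> (\<Phi> (point i)) = \<alpha> (\<one>, \<one>) \<odot>\<^bsub>V\<^esub> \<Phi> (point i)"
        unfolding v(2) using law[OF one_closed one_closed v(1)] by simp
      then show "\<rho> \<one> $$ (a,i) = (\<alpha> (\<one>, \<one>) \<cdot>\<^sub>m 1\<^sub>m n) $$ (a,i)"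
        using ai by (simp add: \<rho>i V.coord_smult[OF e] V.coord_basis)
    qed (simp_all add: \<rho>)
  qed
  have "irreducible_on n \<rho> (carrier G)"
    unfolding irreducible_on_def
  proof (intro allI impI, elim conjE)
    fix W assume W: "vec_subspace n W" and inv: "\<forall>x\<in>carrier G. \<forall>w\<in>W. \<rho> x *\<^sub>v w \<in> W"
    define \<kappa> where "\<kappa> w = (\<lambda>r. if r < n then w $ r else 0)" for w :: "complex vec"
    have \<kappa>: "\<kappa> w \<in> supported {..<n}" for w unfolding \<kappa>_def supported_def by simp
    note Wd = W[unfolded vec_subspace_def]
    have Wc: "w \<in> carrier_vec n" if "w \<in> W" for w using Wd that by auto
    have inj: "v = w" if "v \<in> carrier_vec n" "w \<in> carrier_vec n" "\<Phi> (\<kappa> v) = \<Phi> (\<kappa> w)" for v w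
    proof (rule eq_vecI)
      have "\<kappa> v = \<kappa> w" using that(3) V.coord_Phi[OF \<kappa>] by metis
      then show "v $ r = w $ r" if "r < dim_vec w" for r
        using fun_cong[of "\<kappa> v" "\<kappa> w" r] that \<open>w \<in> carrier_vec n\<close> unfolding \<kappa>_def by simp
    qed (use that in auto)
    let ?W = "(\<lambda>w. \<Phi> (\<kappa> w)) ` W"
    have \<kappa>0: "\<Phi> (\<kappa> (0\<^sub>v n)) = \<zero>\<^bsub>V\<^esub>" using V.zero by (simp add: \<kappa>_def cong: if_cong)
    have "submodule class_ring ?W V"
      unfolding submodule_def
    proof (intro conjI allI impI)
      show "module class_ring V" using vs by (simp add: vectorspace_def)
      show "?W \<subseteq> carrier V" using V.Phi_closed[OF \<kappa>] by auto
      show "\<zero>\<^bsub>V\<^esub> \<in> ?W" using Wd \<kappa>0 by (auto intro!: image_eqI[of _ _ "0\<^sub>v n"])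
      fix u v assume "u \<in> ?W" "v \<in> ?W"
      then obtain a b where ab: "a \<in> W" "b \<in> W" "u = \<Phi> (\<kappa> a)" "v = \<Phi> (\<kappa> b)" by auto
      have "\<kappa> (a + b) = (\<lambda>r. \<kappa> a r + \<kappa> b r)" using Wc[OF ab(1)] Wc[OF ab(2)] by (auto simp: \<kappa>_def)
      then have "u \<oplus>\<^bsub>V\<^esub> v = \<Phi> (\<kappa> (a + b))" using V.add[OF \<kappa> \<kappa>, of a b] ab by simp
      then show "u \<oplus>\<^bsub>V\<^esub> v \<in> ?W" using Wd ab by auto
    next
      fix k :: complex and u assume "u \<in> ?W"
      then obtain a where a: "a \<in> W" "u = \<Phi> (\<kappa> a)" by auto
      have "\<kappa> (k \<cdot>\<^sub>v a) = (\<lambda>r. k * \<kappa> a r)" using Wc[OF a(1)] by (auto simp: \<kappa>_def)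
      then have "k \<odot>\<^bsub>V\<^esub> u = \<Phi> (\<kappa> (k \<cdot>\<^sub>v a))" using V.smult[OF \<kappa>, of k a] a by simp
      then show "k \<odot>\<^bsub>V\<^esub> u \<in> ?W" using Wd a by auto
    qed
    then have "subspace class_ring ?W V" using vs by (simp add: subspace_def)
    moreover have "\<phi> x ` ?W \<subseteq> ?W" if x: "x \<in> carrier G" for x
    proof
      fix u assume "u \<in> \<phi> x ` ?W"
      then obtain w where w: "w \<in> W" "u = \<phi> x (\<Phi> (\<kappa> w))" by auto
      have "u = \<Phi> (\<lambda>a. if a \<in> {..<n} then \<Sum>i<n. \<rho> x $$ (a,i) * \<kappa> w i else 0)"
        unfolding w(2) using repr[OF x] \<kappa> unfolding represented_def by simp
      also have "(\<lambda>a. if a \<in> {..<n} then \<Sum>i<n. \<rho> x $$ (a,i) * \<kappa> w i else 0) = \<kappa> (\<rho> x *\<^sub>v w)"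
        using Wc[OF w(1)] by (auto simp: \<kappa>_def \<rho> scalar_prod_def atLeast0LessThan)
      finally show "u \<in> ?W" using inv x w(1) by auto
    qed
    ultimately have "?W = {\<zero>\<^bsub>V\<^esub>} \<or> ?W = carrier V" using irr unfolding irreducible_cmodule_def by blast
    then show "W = {0\<^sub>v n} \<or> W = carrier_vec n"
    proof
      assume W0: "?W = {\<zero>\<^bsub>V\<^esub>}"
      have "w = 0\<^sub>v n" if "w \<in> W" for w
        by (rule inj[OF Wc[OF that]]) (use W0 that \<kappa>0 in auto)
      then show ?thesis using Wd by auto
    next
      assume W1: "?W = carrier V"
      have "v \<in> W" if v: "v \<in> carrier_vec n" for v
      proof -
        have "\<Phi> (\<kappa> v) \<in> ?W" unfolding W1 by (rule V.Phi_closed[OF \<kappa>])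
        then obtain w where w: "w \<in> W" "\<Phi> (\<kappa> v) = \<Phi> (\<kappa> w)" by auto
        then show ?thesis using inj[OF v Wc[OF w(1)] w(2)] by simp
      qed
      then show ?thesis using Wc by auto
    qed
  qed
  then show thesis using that[OF co rep] repr by blast
qed

lemma module_vec_coordinates: "coordinates {..<k} (module_vec TYPE(complex) k) (\<lambda>y. vec k y)"
proof
  show "bij_betw (\<lambda>y. vec k y) (supported {..<k}) (carrier (module_vec TYPE(complex) k))"
  proof (rule bij_betw_byWitness[where f' = "\<lambda>v r. if r < k then v $ r else 0"])
    show "\<forall>y\<in>supported {..<k}. (\<lambda>r. if r < k then vec k y $ r else 0) = y"
      unfolding supported_def by (auto simp: fun_eq_iff)
    show "\<forall>v\<in>carrier (module_vec TYPE(complex) k). vec k (\<lambda>r. if r < k then v $ r else 0) = v"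
      by (auto simp: module_vec_simps)
  qed (auto simp: supported_def module_vec_simps)
qed (auto simp: module_vec_simps)

lemma module_vec_represented:
  assumes "M \<in> carrier_mat k k"
  shows "represented {..<k} (\<lambda>y. vec k y) (\<lambda>v. M *\<^sub>v v) (\<lambda>a i. M $$ (a,i))"
  unfolding represented_def
proof
  fix y :: "nat \<Rightarrow> complex"
  show "M *\<^sub>v vec k y = vec k (\<lambda>a. if a \<in> {..<k} then \<Sum>i<k. M $$ (a,i) * y i else 0)"
    by (rule eq_vecI) (use assms in \<open>auto simp: scalar_prod_def atLeast0LessThan\<close>)
qed

context group
begin

lemma proj_rep_cmodule:
  assumes J: "subgroup J G" and rep: "proj_rep G J k \<beta> \<tau>" and H: "subgroup H G" "H \<subseteq> J"
  shows "cmodule (G\<lparr>carrier := H\<rparr>) (res_cocycle H \<beta>) (module_vec TYPE(complex) k) (\<lambda>x v. \<tau> x *\<^sub>v v)"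
proof -
  interpret vec_space "TYPE(complex)" k .
  note D = proj_repD[OF rep]
  have "unit_vec k 0 \<noteq> (0\<^sub>v k :: complex vec)"
  proof
    assume "unit_vec k 0 = (0\<^sub>v k :: complex vec)"
    then have "unit_vec k 0 $ 0 = (0\<^sub>v k :: complex vec) $ 0" by simp
    then show False using D(1) by simp
  qed
  then have nz: "carrier_vec k \<noteq> {0\<^sub>v k :: complex vec}" using unit_vec_carrier[of k 0] by blast
  have hom: "(\<lambda>v. \<tau> x *\<^sub>v v) \<in> module_hom class_ring (module_vec TYPE(complex) k) (module_vec TYPE(complex) k)" if "x \<in> H" for x
    unfolding module_hom_def
    using D(2)[of x] D(3)[of x] D(4)[of x] subsetD[OF H(2) that]
    by (auto simp: module_vec_simps mult_add_distrib_mat_vec mat_mult_smult_vec intro!: carrier_vecI)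
  have bij: "bij_betw (\<lambda>v. \<tau> x *\<^sub>v v) (carrier_vec k) (carrier_vec k)" if x: "x \<in> H" for x
  proof -
    note xJ = subsetD[OF H(2) x]
    note I = rep_inv[OF J rep xJ]
    show ?thesis
    proof (rule bij_betw_byWitness[where f' = "\<lambda>v. rep_inv G \<beta> \<tau> x *\<^sub>v v"])
      show "\<forall>v\<in>carrier_vec k. rep_inv G \<beta> \<tau> x *\<^sub>v (\<tau> x *\<^sub>v v) = v"
        by (simp add: assoc_mult_mat_vec[OF I(1) D(2)[OF xJ], symmetric] I(2))
      show "\<forall>v\<in>carrier_vec k. \<tau> x *\<^sub>v (rep_inv G \<beta> \<tau> x *\<^sub>v v) = v"
        by (simp add: assoc_mult_mat_vec[OF D(2)[OF xJ] I(1), symmetric] I(3))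
    qed (use D(2)[OF xJ] I(1) in auto)
  qed
  have law: "\<tau> y *\<^sub>v (\<tau> x *\<^sub>v v) = \<beta> (x, y) \<cdot>\<^sub>v (\<tau> (x \<otimes> y) *\<^sub>v v)"
    if "x \<in> H" "y \<in> H" "v \<in> carrier_vec k" for x y v
  proof -
    have xy: "x \<in> J" "y \<in> J" "x \<otimes> y \<in> J" using H that subgroup.m_closed[OF J] by auto
    have "\<tau> y *\<^sub>v (\<tau> x *\<^sub>v v) = \<tau> y * \<tau> x *\<^sub>v v"
      by (rule assoc_mult_mat_vec[OF D(2)[OF xy(2)] D(2)[OF xy(1)] that(3), symmetric])
    also have "\<dots> = \<beta> (x, y) \<cdot>\<^sub>v (\<tau> (x \<otimes> y) *\<^sub>v v)"
      unfolding D(6)[OF xy(1,2)] using D(4)[OF xy(3)] that(3) by (subst smult_mat_mult_vec) auto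
    finally show ?thesis .
  qed
  show ?thesis unfolding cmodule_def
    using vec_vs[of k] fin_dim nz hom bij law by (simp add: module_vec_simps res_cocycle_def)
qed

lemma full_irreducible_cmodule:
  assumes J: "subgroup J G" and rep: "proj_rep G J k \<beta> \<tau>" and H: "subgroup H G" "H \<subseteq> J" and full: "full k \<tau> H"
  shows "irreducible_cmodule (G\<lparr>carrier := H\<rparr>) (res_cocycle H \<beta>) (module_vec TYPE(complex) k) (\<lambda>x v. \<tau> x *\<^sub>v v)"
  unfolding irreducible_cmodule_def
proof (intro conjI allI impI)
  show "cmodule (G\<lparr>carrier := H\<rparr>) (res_cocycle H \<beta>) (module_vec TYPE(complex) k) (\<lambda>x v. \<tau> x *\<^sub>v v)"
    by (rule proj_rep_cmodule[OF J rep H])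
  fix W assume W: "subspace class_ring W (module_vec TYPE(complex) k) \<and>
    (\<forall>x\<in>carrier (G\<lparr>carrier := H\<rparr>). (*\<^sub>v) (\<tau> x) ` W \<subseteq> W)"
  then have "submodule class_ring W (module_vec TYPE(complex) k)" unfolding subspace_def by blast
  then have "vec_subspace k W" unfolding submodule_def vec_subspace_def by (auto simp: module_vec_simps)
  moreover have "irreducible_on k \<tau> H"
    by (rule full_imp_irreducible[OF full]) (use proj_repD(2)[OF rep] H in auto)
  ultimately show "W = {\<zero>\<^bsub>module_vec TYPE(complex) k\<^esub>} \<or> W = carrier (module_vec TYPE(complex) k)"
    using W unfolding irreducible_on_def module_vec_simps by auto
qed

lemma hall_subgroup_index:
  assumes J: "subgroup J G" and fin: "finite (carrier G)" and H: "hall_subgroup \<pi> (G\<lparr>carrier := J\<rparr>) H"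
  shows "subgroup H G" "H \<subseteq> J" "pi_number \<pi> (card H)" "pi_number (primes_compl \<pi>) (card J div card H)"
proof -
  have sub: "subgroup H (G\<lparr>carrier := J\<rparr>)" and c: "pi_number \<pi> (card H)"
    and i: "pi_number (primes_compl \<pi>) (card (rcosets\<^bsub>G\<lparr>carrier := J\<rparr>\<^esub> H))"
    using H unfolding hall_subgroup_def by auto
  show "subgroup H G" by (rule incl_subgroup[OF J sub])
  show "H \<subseteq> J" using subgroup.subset[OF sub] by simp
  show "pi_number \<pi> (card H)" by (rule c)
  have "card (rcosets\<^bsub>G\<lparr>carrier := J\<rparr>\<^esub> H) * card H = card J"
    using group.lagrange[OF subgroup_imp_group[OF J] sub] by (simp add: Coset.order_def)
  moreover have "0 < card H" using c unfolding pi_number_def by simp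
  ultimately have "card J div card H = card (rcosets\<^bsub>G\<lparr>carrier := J\<rparr>\<^esub> H)"
    by (metis nonzero_mult_div_cancel_right neq0_conv)
  then show "pi_number (primes_compl \<pi>) (card J div card H)" using i by simp
qed

text \<open>In suitable coordinates \<open>V\<close> and the induced module have the same matrices.\<close>

lemma induced_tensor_isomorphic:
  fixes V :: "(complex, 'v, 'n) module_scheme"
  assumes fin: "finite (carrier G)" and J: "subgroup J G" and V: "coordinates {..<n} V \<Phi>"
    and rep: "proj_rep G (carrier G) n \<alpha> \<rho>" and full: "full n \<rho> (carrier G)"
    and \<phi>: "\<And>x. x \<in> carrier G \<Longrightarrow> represented {..<n} \<Phi> (\<phi> x) (\<lambda>r s. \<rho> x $$ (r,s))"
    and \<tau>: "\<And>x. x \<in> J \<Longrightarrow> \<tau>1 x \<in> carrier_mat k1 k1" "\<And>x. x \<in> J \<Longrightarrow> \<tau>2 x \<in> carrier_mat k2 k2"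
    and eq: "equivariant J n k1 k2 \<rho> \<tau>1 \<tau>2 D" and count: "n * card J = k1 * k2 * card (carrier G)"
  defines "U \<equiv> tensor (module_vec TYPE(complex) k1) (module_vec TYPE(complex) k2)"
    and "\<psi> \<equiv> tensor_action (module_vec TYPE(complex) k1) (module_vec TYPE(complex) k2) (\<lambda>x v. \<tau>1 x *\<^sub>v v) (\<lambda>x v. \<tau>2 x *\<^sub>v v)"
  shows "cmodule_isomorphic G V \<phi> (induced G \<alpha> J U \<psi>) (induced_action G \<alpha> J U \<psi>)"
proof -
  interpret P: coordinate_pair "{..<k1}" "module_vec TYPE(complex) k1" "\<lambda>y. vec k1 y"
      "{..<k2}" "module_vec TYPE(complex) k2" "\<lambda>y. vec k2 y"
    by (simp add: coordinate_pair_def module_vec_coordinates)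
  let ?R = "{..<k1} \<times> {..<k2}" and ?\<Psi> = "fibre P.product_coord P.pairs"
  interpret induced_data G ?R U ?\<Psi> \<alpha> n \<rho> J \<psi> "\<lambda>h q p. \<tau>1 h $$ (fst q, fst p) * \<tau>2 h $$ (snd q, snd p)"
      "\<lambda>r p. D r (fst p) (snd p)"
  proof (rule induced_data.intro[OF is_group], goal_cases)
    case 1
    show ?case unfolding U_def by (rule P.tensor_coordinates)
  next
    case 2
    show ?case
    proof (rule induced_data_axioms.intro)
      show "finite (carrier G)" "subgroup J G" "proj_rep G (carrier G) n \<alpha> \<rho>" "full n \<rho> (carrier G)" by fact+
      show "represented ?R ?\<Psi> (\<psi> h) (\<lambda>q p. \<tau>1 h $$ (fst q, fst p) * \<tau>2 h $$ (snd q, snd p))" if "h \<in> J" for h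
        unfolding \<psi>_def tensor_action_def
        by (rule P.tensor_represented[OF module_vec_represented[OF \<tau>(1)[OF that]] module_vec_represented[OF \<tau>(2)[OF that]]])
      show "(\<Sum>s<n. \<rho> h $$ (r,s) * D s (fst i) (snd i)) =
          (\<Sum>a\<in>?R. \<tau>1 h $$ (fst a, fst i) * \<tau>2 h $$ (snd a, snd i) * D r (fst a) (snd a))"
        if "h \<in> J" "r < n" "i \<in> ?R" for h r i
      proof -
        have i: "fst i < k1" "snd i < k2" using that(3) by auto
        have "(\<Sum>s<n. \<rho> h $$ (r,s) * D s (fst i) (snd i)) =
            (\<Sum>a<k1. \<Sum>b<k2. \<tau>1 h $$ (a, fst i) * \<tau>2 h $$ (b, snd i) * D r a b)"
          using eq that(1,2) i unfolding equivariant_def by blast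
        then show ?thesis by (simp add: sum.cartesian_product split_def)
      qed
      show "\<exists>r<n. \<exists>i\<in>?R. D r (fst i) (snd i) \<noteq> 0" using eq unfolding equivariant_def by force
      show "n * card J = card ?R * card (carrier G)" using count by simp
    qed
  qed
  show ?thesis
    by (rule cmodule_isomorphic_coordinates[OF V induced_coordinates \<phi> induced_represented])
qed

end

theorem theorem18:
  fixes G :: "('g, 'm) monoid_scheme"
    and \<pi> :: "nat set"
    and c :: "('g \<times> 'g \<Rightarrow> complex) set"
    and \<alpha> :: "'g \<times> 'g \<Rightarrow> complex"
    and V :: "(complex, 'v, 'n) module_scheme"
    and \<phi> :: "'g \<Rightarrow> 'v \<Rightarrow> 'v"
  assumes "\<pi> \<subseteq> {p. Factorial_Ring.prime p}"
    and "group G" and "finite (carrier G)" and "pi_separable \<pi> G"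
    and "c \<in> carrier (H2 G)" and "\<alpha> \<in> c"
    and "irreducible_cmodule G \<alpha> V \<phi>"
  shows "\<exists>J \<beta> \<gamma> (V\<^sub>1 :: (complex, complex vec) module) \<phi>\<^sub>1 (V\<^sub>2 :: (complex, complex vec) module) \<phi>\<^sub>2.
    subgroup J G \<and>
    \<beta> \<in> pi_part \<pi> (H2 G) c \<and> \<gamma> \<in> pi_part (primes_compl \<pi>) (H2 G) c \<and> \<alpha> = \<beta> \<otimes>\<^bsub>Z2 G\<^esub> \<gamma> \<and>
    irreducible_cmodule (G\<lparr>carrier := J\<rparr>) (res_cocycle J \<beta>) V\<^sub>1 \<phi>\<^sub>1 \<and>
    irreducible_cmodule (G\<lparr>carrier := J\<rparr>) (res_cocycle J \<gamma>) V\<^sub>2 \<phi>\<^sub>2 \<and>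
    cmodule_isomorphic G V \<phi>
      (induced G \<alpha> J (tensor V\<^sub>1 V\<^sub>2) (tensor_action V\<^sub>1 V\<^sub>2 \<phi>\<^sub>1 \<phi>\<^sub>2))
      (induced_action G \<alpha> J (tensor V\<^sub>1 V\<^sub>2) (tensor_action V\<^sub>1 V\<^sub>2 \<phi>\<^sub>1 \<phi>\<^sub>2)) \<and>
    (\<forall>H H'. hall_subgroup \<pi> (G\<lparr>carrier := J\<rparr>) H \<and>
            hall_subgroup (primes_compl \<pi>) (G\<lparr>carrier := J\<rparr>) H' \<longrightarrow>
       irreducible_cmodule (G\<lparr>carrier := H\<rparr>) (res_cocycle H \<beta>) V\<^sub>1 \<phi>\<^sub>1 \<and>
       irreducible_cmodule (G\<lparr>carrier := H'\<rparr>) (res_cocycle H' \<gamma>) V\<^sub>2 \<phi>\<^sub>2 \<and>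
       ordinary_cmodule (G\<lparr>carrier := H\<rparr>) (res_cocycle H \<gamma>) V\<^sub>2 \<phi>\<^sub>2 \<and>
       ordinary_cmodule (G\<lparr>carrier := H'\<rparr>) (res_cocycle H' \<beta>) V\<^sub>1 \<phi>\<^sub>1)"
proof -
  interpret group G by fact
  note \<pi> = assms(1) and fin = assms(3)
  obtain \<beta> \<gamma> where Z: "\<beta> \<in> carrier (Z2 G)" "\<gamma> \<in> carrier (Z2 G)" and \<alpha>\<beta>\<gamma>: "\<alpha> = \<beta> \<otimes>\<^bsub>Z2 G\<^esub> \<gamma>"
    and parts: "\<beta> \<in> pi_part \<pi> (H2 G) c" "\<gamma> \<in> pi_part (primes_compl \<pi>) (H2 G) c"
    and tor: "torsion_on \<pi> G (carrier G) \<beta>" "torsion_on (primes_compl \<pi>) G (carrier G) \<gamma>"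
    by (rule cocycle_splitting[OF fin \<pi> assms(5,6)])
  have \<alpha>: "\<alpha> \<in> carrier (Z2 G)" by (rule coclass_eq(1)[OF assms(5,6)])
  obtain n \<rho> \<Phi> where V: "coordinates {..<n} V \<Phi>" and rep: "proj_rep G (carrier G) n \<alpha> \<rho>"
    and irr: "irreducible_on n \<rho> (carrier G)"
    and \<phi>: "\<And>x. x \<in> carrier G \<Longrightarrow> represented {..<n} \<Phi> (\<phi> x) (\<lambda>r s. \<rho> x $$ (r,s))"
  proof (rule cmodule_matrices[OF is_group \<alpha> assms(7)])
    fix n \<rho> \<Phi>
    assume *: "coordinates {..<n} V \<Phi>" "proj_rep G (carrier G) n \<alpha> \<rho>" "irreducible_on n \<rho> (carrier G)"
      "\<And>x. x \<in> carrier G \<Longrightarrow> represented {..<n} \<Phi> (\<phi> x) (\<lambda>r s. \<rho> x $$ (r,s))"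
    show thesis by (rule that[OF *])
  qed
  have full: "full n \<rho> (carrier G)" by (rule irreducible_imp_full[OF subgroup_self fin rep irr])
  have "factorizable \<pi> G (carrier G) {\<one>\<^bsub>G\<^esub>} n \<rho> \<beta> \<gamma>"
  proof (rule factorization[OF fin assms(4) \<pi> subgroup_self _ rep full _ _ tor])
    show "normal_in G {\<one>\<^bsub>G\<^esub>} (carrier G)" unfolding normal_in_def using triv_subgroup by auto
    show "scalar_mat n (\<rho> x)" if "x \<in> {\<one>\<^bsub>G\<^esub>}" for x using proj_repD(7)[OF rep] that unfolding scalar_mat_def by auto
    show "\<alpha> (x,y) = \<beta> (x,y) * \<gamma> (x,y)" if "x \<in> carrier G" "y \<in> carrier G" for x y
      using that unfolding \<alpha>\<beta>\<gamma> Z2_simps by simp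
  qed
  then obtain J k1 k2 \<tau>1 \<tau>2 D where "factors \<pi> G (carrier G) {\<one>\<^bsub>G\<^esub>} n \<rho> \<beta> \<gamma> J k1 k2 \<tau>1 \<tau>2 D"
    unfolding factorizable_def by blast
  then have J: "subgroup J G" and rep1: "proj_rep G J k1 \<beta> \<tau>1" and rep2: "proj_rep G J k2 \<gamma> \<tau>2"
    and full1: "full k1 \<tau>1 J" and full2: "full k2 \<tau>2 J"
    and hall1: "\<And>H. subgroup H G \<Longrightarrow> H \<subseteq> J \<Longrightarrow> pi_number (primes_compl \<pi>) (card J div card H) \<Longrightarrow> full k1 \<tau>1 H"
    and hall2: "\<And>H. subgroup H G \<Longrightarrow> H \<subseteq> J \<Longrightarrow> pi_number \<pi> (card J div card H) \<Longrightarrow> full k2 \<tau>2 H"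
    and count: "n * card J = k1 * k2 * card (carrier G)" and eq: "equivariant J n k1 k2 \<rho> \<tau>1 \<tau>2 D"
    unfolding factors_def by blast+
  let ?V1 = "module_vec TYPE(complex) k1" and ?V2 = "module_vec TYPE(complex) k2"
  let ?\<phi>1 = "\<lambda>x v. \<tau>1 x *\<^sub>v v" and ?\<phi>2 = "\<lambda>x v. \<tau>2 x *\<^sub>v v"
  have hall: "irreducible_cmodule (G\<lparr>carrier := H\<rparr>) (res_cocycle H \<beta>) ?V1 ?\<phi>1 \<and>
       irreducible_cmodule (G\<lparr>carrier := H'\<rparr>) (res_cocycle H' \<gamma>) ?V2 ?\<phi>2 \<and>
       ordinary_cmodule (G\<lparr>carrier := H\<rparr>) (res_cocycle H \<gamma>) ?V2 ?\<phi>2 \<and>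
       ordinary_cmodule (G\<lparr>carrier := H'\<rparr>) (res_cocycle H' \<beta>) ?V1 ?\<phi>1"
    if hH: "hall_subgroup \<pi> (G\<lparr>carrier := J\<rparr>) H" and hH': "hall_subgroup (primes_compl \<pi>) (G\<lparr>carrier := J\<rparr>) H'" for H H'
  proof -
    note H = hall_subgroup_index[OF J fin hH]
    note H' = hall_subgroup_index[OF J fin hH', unfolded primes_compl_compl[OF \<pi>]]
    show ?thesis
    proof (intro conjI)
      show "irreducible_cmodule (G\<lparr>carrier := H\<rparr>) (res_cocycle H \<beta>) ?V1 ?\<phi>1"
        by (rule full_irreducible_cmodule[OF J rep1 H(1,2) hall1[OF H(1,2,4)]])
      show "irreducible_cmodule (G\<lparr>carrier := H'\<rparr>) (res_cocycle H' \<gamma>) ?V2 ?\<phi>2"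
        by (rule full_irreducible_cmodule[OF J rep2 H'(1,2) hall2[OF H'(1,2,4)]])
      show "ordinary_cmodule (G\<lparr>carrier := H\<rparr>) (res_cocycle H \<gamma>) ?V2 ?\<phi>2"
        unfolding ordinary_cmodule_def
        using proj_rep_cmodule[OF J rep2 H(1,2)] res_cocycle_ordinary[OF fin Z(2) tor(2) H(1)] H(3)
        unfolding primes_compl_compl[OF \<pi>] by blast
      show "ordinary_cmodule (G\<lparr>carrier := H'\<rparr>) (res_cocycle H' \<beta>) ?V1 ?\<phi>1"
        unfolding ordinary_cmodule_def
        using proj_rep_cmodule[OF J rep1 H'(1,2)] res_cocycle_ordinary[OF fin Z(1) tor(1) H'(1,3)] by blast
    qed
  qed
  show ?thesis
    by (rule exI[of _ J], rule exI[of _ \<beta>], rule exI[of _ \<gamma>], rule exI[of _ ?V1], rule exI[of _ ?\<phi>1],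
        rule exI[of _ ?V2], rule exI[of _ ?\<phi>2], intro conjI J parts \<alpha>\<beta>\<gamma>
        full_irreducible_cmodule[OF J rep1 J order_refl full1] full_irreducible_cmodule[OF J rep2 J order_refl full2]
        induced_tensor_isomorphic[OF fin J V rep full \<phi> proj_repD(2)[OF rep1] proj_repD(2)[OF rep2] eq count])
      (assumption+, intro allI impI, elim conjE, rule hall)
qed

end
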